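(* Let $\mathscr{T}$ be a hierarchical T-mesh with $\delta-1$ isolated subdivided cells, and let $V^+$ be its number of crossing vertices and $E$ its number of interior l-edges. Then $$\dim \overline{\mathbf{S}}(2,2,1,1,\mathscr{T})=V^+-E+\delta.$$
   Context: A T-mesh is a rectangular grid that allows T-junctions: a region is subdivided by finitely many horizontal and vertical segments into finitely many closed axis-parallel rectangles (the cells) with pairwise disjoint interiors. It is regular if the region $\Omega$ occupied by all its cells is a rectangle; all T-meshes here are regular. Vertices are the grid points (corners of cells); a vertex on $\partial\Omega$ is a boundary vertex, and an interior vertex is a crossing vertex if four edges meet there and a T-vertex if exactly three edges meet there. A T-vertex is horizontal if exactly one of its three edges is horizontal, and vertical if exactly one of them is vertical. Edges are the segments joining adjacent vertices; an edge is interior if it does not lie on $\partial\Omega$. A horizontal (vertical) l-edge is a continuous line segment consisting of horizontal (vertical) interior edges whose two endpoints are boundary vertices or horizontal (vertical) T-vertices, i.e. a longest possible line segment in the mesh. The boundary consists of four boundary l-edges; all other l-edges are interior l-edges. Hierarchical T-mesh: start from a tensor-product mesh (full rectangular grid), the level-$0$ mesh, whose cells have level $0$. The level-$(k+1)$ mesh is obtained from the level-$k$ mesh by choosing some cells of level $k$ and subdividing each into four subcells (which are cells of level $k+1$) by joining the midpoints of opposite edges with two straight segments. A mesh obtained after finitely many levels is a (classical) hierarchical T-mesh. The term "hierarchical T-mesh" refers both to these classical meshes and to their extensions. Extension (associated with the biquadratic $C^{1,1}$ spline space): take a tensor-product mesh $\mathscr{M}$ with $6$ vertical and $6$ horizontal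 lines whose central rectangle is the region occupied by the mesh; all edges of the mesh with an endpoint on its boundary are extended (straight) to reach the boundary of $\mathscr{M}$; the extension consists of $\mathscr{M}$, the mesh, and these extended segments. Isolated subdivided cell: when passing from level $k$ to level $k+1$ in forming the hierarchical T-mesh, a cell of level $k$ that is subdivided while all its horizontally and vertically neighboring cells of level $k$ remain unchanged. (For an extension, the level-$k$ mesh is the extension, with the same $\mathscr{M}$, of the level-$k$ mesh of the original; the neighboring cells outside the original rectangle are included among the neighboring cells, and such a cell counts as changed if it is cut by an extended segment.) $\overline{\mathbf{S}}(2,2,1,1,\mathscr{T})$ is the space of functions $f\in C^{1,1}(\mathbb{R}^2)$ (continuous of order $1$ in the $x$ direction and of order $1$ in the $y$ direction) whose restriction to each cell of $\mathscr{T}$ is a biquadratic polynomial (degree at most $2$ in each of $x$ and $y$) and which vanish identically outside the rectangle occupied by $\mathscr{T}$.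
   Formalization: For non-extended hierarchical T-meshes, the level-0 tensor-product mesh may have only two lines in one direction if it has exactly three in the other; otherwise the formula fails (a single cell has dimension 0, but the formula gives 1). *)

theory Defs
  imports "HOL-Analysis.Analysis" "HOL-Library.Function_Algebras"
begin

section \<open>T-meshes\<close>

text \<open>A mesh is given by its set of cells; the occupied region is \<open>\<Union>T\<close>, and the segments
  of the grid are recovered as the union of the cell boundaries.\<close>

type_synonym mesh = "(real \<times> real) set set"

definition regular_Tmesh :: "mesh \<Rightarrow> bool" where
  "regular_Tmesh T \<longleftrightarrow>
     (\<forall>K\<in>T. interior K \<noteq> {}) \<and> (\<exists>a b. box a b \<noteq> {} \<and> T division_of cbox a b)"

definition skeleton :: "mesh \<Rightarrow> (real \<times> real) set" where
  "skeleton T = (\<Union>K\<in>T. frontier K)"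

definition vertices :: "mesh \<Rightarrow> (real \<times> real) set" where
  "vertices T =
     {v. \<exists>p q. cbox p q \<in> T \<and> fst v \<in> {fst p, fst q} \<and> snd v \<in> {snd p, snd q}}"

text \<open>The edges along which the coordinate \<open>\<pi>\<close> is constant: \<open>\<pi> = snd\<close> gives the horizontal
  edges, \<open>\<pi> = fst\<close> the vertical ones.\<close>

definition axis_edges :: "(real \<times> real \<Rightarrow> real) \<Rightarrow> mesh \<Rightarrow> (real \<times> real) set set" where
  "axis_edges \<pi> T =
     {closed_segment u v | u v.
        u \<in> vertices T \<and> v \<in> vertices T \<and> u \<noteq> v \<and> \<pi> u = \<pi> v \<and>
        closed_segment u v \<subseteq> skeleton T \<and> open_segment u v \<inter> vertices T = {}}"

definition edges :: "mesh \<Rightarrow> (real \<times> real) set set" where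
  "edges T = axis_edges snd T \<union> axis_edges fst T"

definition boundary_vertex :: "mesh \<Rightarrow> real \<times> real \<Rightarrow> bool" where
  "boundary_vertex T v \<longleftrightarrow> v \<in> vertices T \<and> v \<in> frontier (\<Union>T)"

definition interior_vertex :: "mesh \<Rightarrow> real \<times> real \<Rightarrow> bool" where
  "interior_vertex T v \<longleftrightarrow> v \<in> vertices T \<and> v \<in> interior (\<Union>T)"

definition crossing_vertices :: "mesh \<Rightarrow> (real \<times> real) set" where
  "crossing_vertices T = {v. interior_vertex T v \<and> card {e \<in> edges T. v \<in> e} = 4}"

text \<open>\<open>\<pi> = snd\<close>: horizontal T-vertices; \<open>\<pi> = fst\<close>: vertical T-vertices.\<close>

definition axis_T_vertex :: "(real \<times> real \<Rightarrow> real) \<Rightarrow> mesh \<Rightarrow> real \<times> real \<Rightarrow> bool" where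
  "axis_T_vertex \<pi> T v \<longleftrightarrow>
     interior_vertex T v \<and> card {e \<in> edges T. v \<in> e} = 3 \<and>
     card {e \<in> axis_edges \<pi> T. v \<in> e} = 1"

text \<open>\<open>\<pi> = snd\<close>: horizontal interior l-edges; \<open>\<pi> = fst\<close>: vertical interior l-edges. These
  segments are automatically maximal: no segment of horizontal interior edges continues
  beyond a horizontal T-vertex or a boundary vertex.\<close>

definition axis_l_edges :: "(real \<times> real \<Rightarrow> real) \<Rightarrow> mesh \<Rightarrow> (real \<times> real) set set" where
  "axis_l_edges \<pi> T =
     {closed_segment u v | u v.
        u \<noteq> v \<and> \<pi> u = \<pi> v \<and>
        (\<exists>F. F \<subseteq> {e \<in> axis_edges \<pi> T. \<not> e \<subseteq> frontier (\<Union>T)} \<and> closed_segment u v = \<Union>F) \<and>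
        (boundary_vertex T u \<or> axis_T_vertex \<pi> T u) \<and>
        (boundary_vertex T v \<or> axis_T_vertex \<pi> T v)}"

definition interior_l_edges :: "mesh \<Rightarrow> (real \<times> real) set set" where
  "interior_l_edges T = axis_l_edges snd T \<union> axis_l_edges fst T"

section \<open>Hierarchical T-meshes\<close>

definition consecutive :: "real set \<Rightarrow> real \<Rightarrow> real \<Rightarrow> bool" where
  "consecutive X a b \<longleftrightarrow> a \<in> X \<and> b \<in> X \<and> a < b \<and> X \<inter> {a<..<b} = {}"

text \<open>\<open>X\<close> holds the abscissae of the vertical lines, \<open>Y\<close> the ordinates of the horizontal ones.\<close>

definition tensor_mesh :: "real set \<Rightarrow> real set \<Rightarrow> mesh" where
  "tensor_mesh X Y = {cbox (a, c) (b, d) | a b c d. consecutive X a b \<and> consecutive Y c d}"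

definition subcells :: "(real \<times> real) set \<Rightarrow> mesh" where
  "subcells K =
     (\<Union>{tensor_mesh {a, (a + b) / 2, b} {c, (c + d) / 2, d} | a b c d.
          a < b \<and> c < d \<and> K = cbox (a, c) (b, d)})"

text \<open>\<open>S k\<close> is the set of level-\<open>k\<close> cells chosen for subdivision. \<open>level_cells T0 S k\<close>
  are the cells of level \<open>k\<close>, whereas the level-\<open>k\<close> mesh \<open>level_mesh T0 S k\<close> also
  contains the unsubdivided cells of lower level.\<close>

fun level_cells :: "mesh \<Rightarrow> (nat \<Rightarrow> mesh) \<Rightarrow> nat \<Rightarrow> mesh" where
  "level_cells T0 S 0 = T0"
| "level_cells T0 S (Suc k) = (\<Union>K\<in>S k. subcells K)"

fun level_mesh :: "mesh \<Rightarrow> (nat \<Rightarrow> mesh) \<Rightarrow> nat \<Rightarrow> mesh" where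
  "level_mesh T0 S 0 = T0"
| "level_mesh T0 S (Suc k) = (level_mesh T0 S k - S k) \<union> (\<Union>K\<in>S k. subcells K)"

definition refinement :: "real set \<Rightarrow> real set \<Rightarrow> nat \<Rightarrow> (nat \<Rightarrow> mesh) \<Rightarrow> bool" where
  "refinement X Y n S \<longleftrightarrow>
     finite X \<and> finite Y \<and> 2 \<le> card X \<and> 2 \<le> card Y \<and>
     (\<forall>k<n. S k \<subseteq> level_cells (tensor_mesh X Y) S k)"

definition neighbouring :: "(real \<times> real) set \<Rightarrow> (real \<times> real) set \<Rightarrow> bool" where
  "neighbouring K N \<longleftrightarrow> K \<noteq> N \<and> (\<exists>u v. u \<noteq> v \<and> K \<inter> N = closed_segment u v)"

text \<open>The cells in \<open>Q\<close> all of whose neighbours among \<open>A\<close> are still cells of the next mesh \<open>T'\<close>.\<close>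

definition isolated_cells :: "mesh \<Rightarrow> mesh \<Rightarrow> mesh \<Rightarrow> mesh" where
  "isolated_cells Q A T' = {K \<in> Q. \<forall>N\<in>A. neighbouring K N \<longrightarrow> N \<in> T'}"

text \<open>\<open>T\<close> is a classical hierarchical T-mesh, formed from the grid \<open>X\<close>, \<open>Y\<close> with \<open>s\<close> isolated
  subdivided cells. The number \<open>s\<close> belongs to the way in which \<open>T\<close> is formed.\<close>

definition classical_hierarchical_Tmesh :: "real set \<Rightarrow> real set \<Rightarrow> mesh \<Rightarrow> nat \<Rightarrow> bool" where
  "classical_hierarchical_Tmesh X Y T s \<longleftrightarrow>
     (\<exists>n S. let T0 = tensor_mesh X Y in
        refinement X Y n S \<and>
        T = level_mesh T0 S n \<and>
        s = (\<Sum>k<n. card (isolated_cells (S k) (level_cells T0 S k) (level_mesh T0 S (Suc k)))))"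

text \<open>The lines of the outer mesh of an extension, as lists of coordinates; the region
  \<open>R\<close> to be extended is the central rectangle.\<close>

definition outer_grid :: "real list \<Rightarrow> real list \<Rightarrow> (real \<times> real) set \<Rightarrow> bool" where
  "outer_grid xs ys R \<longleftrightarrow>
     length xs = 6 \<and> length ys = 6 \<and> sorted_wrt (<) xs \<and> sorted_wrt (<) ys \<and>
     R = cbox (xs ! 2, ys ! 2) (xs ! 3, ys ! 3)"

text \<open>An edge from \<open>u\<close> to a point \<open>v\<close> of the boundary is prolonged beyond \<open>v\<close> as far as the
  boundary of \<open>R\<close>.\<close>

definition extended_segments :: "mesh \<Rightarrow> (real \<times> real) set \<Rightarrow> (real \<times> real) set" where
  "extended_segments T R =
     {u + t *\<^sub>R (v - u) | u v t.
        closed_segment u v \<in> edges T \<and> v \<in> frontier (\<Union>T) \<and> 1 \<le> t} \<inter> R"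

text \<open>A regular T-mesh is determined by its region and its skeleton, so \<open>T'\<close> is unique.\<close>

definition extension_of :: "real list \<Rightarrow> real list \<Rightarrow> mesh \<Rightarrow> mesh \<Rightarrow> bool" where
  "extension_of xs ys T T' \<longleftrightarrow>
     (let M = tensor_mesh (set xs) (set ys) in
        outer_grid xs ys (\<Union>T) \<and> regular_Tmesh T' \<and> \<Union>T' = \<Union>M \<and>
        skeleton T' = skeleton M \<union> skeleton T \<union> extended_segments T (\<Union>M))"

text \<open>\<open>D k - level_mesh T0 S k\<close> are the cells of the extended level-\<open>k\<close> mesh \<open>D k\<close> outside
  the original rectangle; such a cell is cut by an extended segment of the next mesh if and only
  if it is not a cell of \<open>D (Suc k)\<close>.\<close>

definition extended_hierarchical_Tmesh :: "real set \<Rightarrow> real set \<Rightarrow> mesh \<Rightarrow> nat \<Rightarrow> bool" where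
  "extended_hierarchical_Tmesh X Y T s \<longleftrightarrow>
     (\<exists>n S xs ys D. let T0 = tensor_mesh X Y in
        refinement X Y n S \<and>
        (\<forall>k\<le>n. extension_of xs ys (level_mesh T0 S k) (D k)) \<and>
        T = D n \<and>
        s = (\<Sum>k<n. card (isolated_cells (S k)
               (level_cells T0 S k \<union> (D k - level_mesh T0 S k)) (D (Suc k)))))"

section \<open>Biquadratic splines\<close>

interpretation fun_space: vector_space "\<lambda>c (f :: real \<times> real \<Rightarrow> real) p. c * f p"
  by unfold_locales (auto simp: fun_eq_iff algebra_simps)

definition C11 :: "(real \<times> real \<Rightarrow> real) \<Rightarrow> bool" where
  "C11 f \<longleftrightarrow>
     continuous_on UNIV f \<and>
     (\<exists>fx fy. continuous_on UNIV fx \<and> continuous_on UNIV fy \<and>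
        (\<forall>x y. ((\<lambda>t. f (t, y)) has_real_derivative fx (x, y)) (at x) \<and>
               ((\<lambda>t. f (x, t)) has_real_derivative fy (x, y)) (at y)))"

definition biquadratic_on :: "(real \<times> real) set \<Rightarrow> (real \<times> real \<Rightarrow> real) \<Rightarrow> bool" where
  "biquadratic_on K f \<longleftrightarrow>
     (\<exists>c :: nat \<Rightarrow> nat \<Rightarrow> real. \<forall>(x, y)\<in>K. f (x, y) = (\<Sum>i\<le>2. \<Sum>j\<le>2. c i j * x ^ i * y ^ j))"

definition Sbar :: "mesh \<Rightarrow> (real \<times> real \<Rightarrow> real) set" where
  "Sbar T = {f. C11 f \<and> (\<forall>K\<in>T. biquadratic_on K f) \<and> (\<forall>p. p \<notin> \<Union>T \<longrightarrow> f p = 0)}"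

end

theory Submission
  imports Defs
begin

text \<open>Write \<open>(x - a)\<^sub>+\<close> for \<open>max 0 (x - a)\<close>. A \<open>C\<^sup>1\<close> piecewise
quadratic function of one variable that vanishes far to the left is a combination of the truncated powers
\<open>(x - a)\<^sub>+\<^sup>2\<close> at its knots. Hence every \<open>f\<close> in the spline space is a
combination of the products \<open>(x - a)\<^sub>+\<^sup>2 (y - b)\<^sub>+\<^sup>2\<close> over the points of
the grid spanned by the coordinates of the vertices, with unique coefficients. Two conditions decide which
coefficient families \<open>c\<close> occur: \<open>f\<close> has no jump across points outside the skeleton,
and it vanishes outside the region. Together they say that \<open>c\<close> is supported on the vertices and
that along every l-edge \<open>e\<close>, the four boundary l-edges included, the moments \<open>\<Sum> c p
t\<^sup>j\<close> for \<open>j \<le> 2\<close> vanish, where \<open>p\<close> runs through the vertices on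
\<open>e\<close> and \<open>t\<close> is the coordinate of \<open>p\<close> along \<open>e\<close>
(\<open>Sbar_eq\<close>). So the dimension is \<open>|V| - r\<close>, where \<open>r\<close> is the rank of
these \<open>3 (E + 4)\<close> linear conditions on \<open>c\<close>.

The rank is the number of conditions minus the number of relations among them. A function \<open>k\<close>
whose restriction to every l-edge is a quadratic polynomial of the coordinate along it gives a linear relation
among the conditions: both the horizontal and the vertical moments determine \<open>\<Sum> c p k p\<close>.
The nine monomials \<open>x\<^sup>i y\<^sup>j\<close> with \<open>i, j \<le> 2\<close> are such functions. An
isolated subdivided cell contributes one more: on the cell \<open>[a, b] \<times> [c, d]\<close> the bubble
\<open>(x - a) (x - b) (y - c) (y - d)\<close>, extended by zero. At the moment of subdivision its cross ends
on the boundary of the cell; no later line leaves the cell either, because it would continue into a neighbour,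
and no part of the neighbours, which are not subdivided at that moment, is ever subdivided. These are all
relations, so \<open>r = 3 (E + 4) - 9 - s\<close>; the proof exhibits \<open>r\<close> of the functionals
that can be prescribed freely (\<open>realisable\<close>) and whose vanishing implies the vanishing of all
moments by means of the relations (\<open>determining\<close>). Such a set is constructed level by level
(\<open>functionals\<close>). On the initial grid the moments along all lines of one direction and along all
but three lines of the other one will do. In a refinement step every new l-edge carries vertices that lie on
old lines of the other direction; the coefficients there can be changed without affecting any other new
l-edge. With at least three of them the three moments of the new l-edge can be prescribed. With only two of
them the l-edge is one half of a cross in a single cell, and the value at the centre is forced by the three
moments; the two halves of the cross compete for it precisely if the cell is isolated, which costs one
functional.

It remains to count vertices. At a corner of the region two of the four directions are missing in the
skeleton, at any other vertex that is not a crossing exactly one is missing, and every l-edge lacks a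
continuation at its two ends. So \<open>2 (E + 4) = |V| - |V\<^sup>+| + 4\<close>
(\<open>vertex_count\<close>), and the dimension \<open>|V| - 3 (E + 4) + 9 + s\<close> equals
\<open>|V\<^sup>+| - E + 1 + s\<close>.

For an extension the arms, that is the prolonged segments in the outer mesh, are treated as further cells that
are cut in one direction only; the same induction applies.\<close>

\<comment> \<open>Points and cells are described by their coordinates; quantifiers over them are to stay unsplit.\<close>
declare split_paired_All [simp del] split_paired_Ex [simp del]

section \<open>The common kernel of jointly surjective functionals\<close>

text \<open>Induction on the functionals: one more functional that is independent of the others lowers the dimension of
the common kernel by one, because \<open>g\<close>, on which the others vanish and the new one takes the value
1, complements the new kernel in the old one.\<close>

lemma kernel_basis:
  fixes w :: "'i \<Rightarrow> real \<times> real \<Rightarrow> real"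
  assumes "finite F" and N: "finite N"
    and "\<And>r. \<exists>c. \<forall>i\<in>F. (\<Sum>p\<in>N. c p * w i p) = r i"
  shows "\<exists>B. finite B \<and> \<not> fun_space.dependent B \<and> card B + card F = card N \<and>
     fun_space.span B = {c. (\<forall>p. p \<notin> N \<longrightarrow> c p = 0) \<and> (\<forall>i\<in>F. (\<Sum>p\<in>N. c p * w i p) = 0)}"
  using assms(1,3)
proof (induction F rule: finite_induct)
  case empty
  show ?case using N
  proof (induction N rule: finite_induct)
    case empty
    have "{c :: real \<times> real \<Rightarrow> real. \<forall>p. c p = 0} = {0}" by (auto simp: fun_eq_iff)
    then show ?case by (intro exI[of _ "{}"]) (simp add: fun_space.span_empty fun_space.independent_empty)
  next
    case (insert p N)
    then obtain B where B: "finite B" "\<not> fun_space.dependent B" "card B = card N"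
      "fun_space.span B = {c. (\<forall>p. p \<notin> N \<longrightarrow> c p = 0)}" by auto
    define \<delta> :: "real \<times> real \<Rightarrow> real" where "\<delta> q = (if q = p then 1 else 0)" for q
    have nin: "\<delta> \<notin> fun_space.span B" using insert.hyps
      by (auto simp: B(4) \<delta>_def simp del: split_paired_Ex split_paired_All)
    have ind: "\<not> fun_space.dependent (insert \<delta> B)"
      using fun_space.independent_insertI[OF nin B(2)] .
    have cd: "card (insert \<delta> B) = card (insert p N)"
      proof -
      have "\<delta> \<notin> B" using nin by (rule contrapos_nn) (rule fun_space.span_base)
      then show ?thesis using B(1,3) insert.hyps(1,2) by simp
    qed
    have "fun_space.span (insert \<delta> B) = {c. (\<forall>q. q \<notin> insert p N \<longrightarrow> c q = 0)}"
    proof (intro set_eqI iffI)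
      fix c assume "c \<in> fun_space.span (insert \<delta> B)"
      then obtain k where "c - (\<lambda>q. k * \<delta> q) \<in> fun_space.span B"
        using fun_space.span_breakdown_eq by blast
      then have "\<forall>q. q \<notin> N \<longrightarrow> c q - k * \<delta> q = 0" by (simp add: B(4))
      then have "c q = 0" if "q \<notin> insert p N" for q using that by (auto simp: \<delta>_def split: if_splits)
      then show "c \<in> {c. (\<forall>q. q \<notin> insert p N \<longrightarrow> c q = 0)}" by auto
    next
      fix c assume "c \<in> {c. (\<forall>q. q \<notin> insert p N \<longrightarrow> c q = (0::real))}"
      then have "c - (\<lambda>q. c p * \<delta> q) \<in> fun_space.span B" by (auto simp: B(4) \<delta>_def)
      then show "c \<in> fun_space.span (insert \<delta> B)" using fun_space.span_breakdown_eq by blast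
    qed
    then show ?case using ind cd B(1) by (intro exI[of _ "insert \<delta> B"]) auto
  qed
next
  case (insert i F)
  define V where "V G = {c. (\<forall>p. p \<notin> N \<longrightarrow> c p = 0) \<and> (\<forall>i\<in>G. (\<Sum>p\<in>N. c p * w i p) = 0)}" for G
  have "\<exists>c. \<forall>i\<in>F. (\<Sum>p\<in>N. c p * w i p) = r i" for r using insert.prems[of r] by auto
  then obtain B where B: "finite B" "\<not> fun_space.dependent B" "card B + card F = card N"
      "fun_space.span B = V F" using insert.IH unfolding V_def by auto
  obtain g0 where g0: "\<forall>j\<in>insert i F. (\<Sum>p\<in>N. g0 p * w j p) = (if j = i then 1 else 0)"
    using insert.prems[of "\<lambda>j. if j = i then 1 else 0"] by auto
  define g where "g p = (if p \<in> N then g0 p else 0)" for p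
  have "(\<Sum>p\<in>N. g p * w j p) = (\<Sum>p\<in>N. g0 p * w j p)" for j
    by (rule sum.cong) (auto simp: g_def)
  then have g: "g \<in> V F" "(\<Sum>p\<in>N. g p * w i p) = 1"
    using g0 insert.hyps by (auto simp: V_def g_def)
  have sub: "fun_space.subspace (V (insert i F))"
    unfolding fun_space.subspace_def V_def
    by (auto simp: algebra_simps sum.distrib simp flip: sum_distrib_left)
  obtain B' where B': "B' \<subseteq> V (insert i F)" "\<not> fun_space.dependent B'" "V (insert i F) \<subseteq> fun_space.span B'"
    using fun_space.maximal_independent_subset by blast
  then have sp: "fun_space.span B' = V (insert i F)"
    using fun_space.span_minimal[OF _ sub] by auto
  have gn: "g \<notin> fun_space.span B'" using g by (auto simp: sp V_def)
  have ind: "\<not> fun_space.dependent (insert g B')" using fun_space.independent_insertI[OF gn B'(2)] .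
  have spg: "fun_space.span (insert g B') = V F"
  proof (intro set_eqI iffI)
    fix c assume "c \<in> fun_space.span (insert g B')"
    then obtain k where k: "c - (\<lambda>q. k * g q) \<in> V (insert i F)"
      using fun_space.span_breakdown_eq sp by blast
    have sF: "fun_space.subspace (V F)" by (metis B(4) fun_space.subspace_span)
    have "c - (\<lambda>q. k * g q) \<in> V F" using k by (auto simp: V_def)
    from fun_space.subspace_add[OF sF this fun_space.subspace_scale[OF sF g(1), of k]]
    have "(c - (\<lambda>q. k * g q)) + (\<lambda>q. k * g q) \<in> V F" .
    moreover have "(c - (\<lambda>q. k * g q)) + (\<lambda>q. k * g q) = c" by (auto simp: fun_eq_iff)
    ultimately show "c \<in> V F" by simp
  next
    fix c assume c: "c \<in> V F"
    define k where "k = (\<Sum>p\<in>N. c p * w i p)"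
    have *: "(\<Sum>p\<in>N. (c p - k * g p) * w j p) = (\<Sum>p\<in>N. c p * w j p) - k * (\<Sum>p\<in>N. g p * w j p)" for j
      by (simp add: algebra_simps sum_subtractf sum_distrib_left)
    have "c - (\<lambda>q. k * g q) \<in> V (insert i F)"
      using c g unfolding V_def by (simp add: *) (simp add: k_def)
    then show "c \<in> fun_space.span (insert g B')" using fun_space.span_breakdown_eq sp by blast
  qed
  have sup: "insert g B' \<subseteq> fun_space.span B" "B \<subseteq> fun_space.span (insert g B')"
    using fun_space.span_superset[of "insert g B'"] fun_space.span_superset[of B] spg B(4) by simp_all
  have b1: "finite (insert g B') \<and> card (insert g B') \<le> card B"
    using fun_space.independent_span_bound[OF B(1) ind sup(1)] .
  have b2: "card B \<le> card (insert g B')"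
    using fun_space.independent_span_bound[OF conjunct1[OF b1] B(2) sup(2)] by simp
  have "card (insert g B') = Suc (card B')"
    proof -
    have "g \<notin> B'" using gn by (rule contrapos_nn) (rule fun_space.span_base)
    then show ?thesis using b1 by simp
  qed
  then have "card B' + card (insert i F) = card N" using b1 b2 B(3) insert.hyps by simp
  then show ?case using b1 B' sp unfolding V_def by (intro exI[of _ B']) auto
qed

lemma dim_linear_image:
  assumes lin: "\<And>f g. \<Psi> (f + g) = \<Psi> f + \<Psi> g" "\<And>a f. \<Psi> (\<lambda>p. a * f p) = (\<lambda>p. a * \<Psi> f p)"
    and B: "finite B" "\<not> fun_space.dependent B"
    and inj: "\<And>c. c \<in> fun_space.span B \<Longrightarrow> \<Psi> c = 0 \<Longrightarrow> c = 0"
  shows "(\<exists>B'. finite B' \<and> B' \<subseteq> \<Psi> ` fun_space.span B \<and> \<Psi> ` fun_space.span B \<subseteq> fun_space.span B') \<and>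
     fun_space.dim (\<Psi> ` fun_space.span B) = card B"
proof -
  interpret L: Vector_Spaces.linear "\<lambda>c (f :: real \<times> real \<Rightarrow> real) p. c * f p" "\<lambda>c (f :: real \<times> real \<Rightarrow> real) p. c * f p" \<Psi>
    by unfold_locales (auto simp: lin)
  have io: "inj_on \<Psi> (fun_space.span B)"
    using inj by (simp add: L.inj_on_iff_eq_0 fun_space.subspace_span)
  have ioB: "inj_on \<Psi> B" using io fun_space.span_superset inj_on_subset by blast
  have ind: "\<not> fun_space.dependent (\<Psi> ` B)" using L.dependent_inj_imageD[OF _ io] B by blast
  have sp: "fun_space.span (\<Psi> ` B) = \<Psi> ` fun_space.span B" by (rule L.span_image)
  show ?thesis
    using B ind sp fun_space.span_superset[of "\<Psi> ` B"] card_image[OF ioB] fun_space.dim_span_eq_card_independent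
    by (metis finite_imageI order_refl)
qed

section \<open>Moments along a system of lines\<close>

text \<open>The flag \<open>d\<close> stands for a direction: \<open>True\<close> is horizontal, \<open>False\<close> is
vertical. The coordinate \<open>crd d\<close> varies along lines of direction \<open>d\<close> and \<open>crd
(\<not> d)\<close> is constant on them. Every statement about one direction therefore yields the other one by
instantiation.\<close>

definition crd :: "bool \<Rightarrow> real \<times> real \<Rightarrow> real" where
  "crd d p = (if d then fst p else snd p)"

definition mom :: "(real \<times> real) set \<Rightarrow> bool \<Rightarrow> (real \<times> real) set \<Rightarrow> nat \<Rightarrow> (real \<times> real \<Rightarrow> real) \<Rightarrow> real" where
  "mom P d e j c = (\<Sum>p\<in>P \<inter> e. c p * crd d p ^ j)"

text \<open>An abstraction of the vertices and l-edges of a mesh: finitely many points, and in each direction finitely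
many axis-parallel sets, exactly one of which passes through each point.\<close>

definition line_system :: "(real \<times> real) set \<Rightarrow> (bool \<Rightarrow> (real \<times> real) set set) \<Rightarrow> bool" where
  "line_system P E \<longleftrightarrow> finite P \<and> (\<forall>d. finite (E d)) \<and> (\<forall>d. \<forall>p\<in>P. \<exists>!e. e \<in> E d \<and> p \<in> e) \<and>
     (\<forall>d. \<forall>e\<in>E d. \<forall>p\<in>e. \<forall>q\<in>e. crd (\<not> d) p = crd (\<not> d) q)"

definition quadratic_along :: "bool \<Rightarrow> (real \<times> real) set \<Rightarrow> (real \<times> real \<Rightarrow> real) \<Rightarrow> bool" where
  "quadratic_along d e k \<longleftrightarrow> (\<exists>A. \<forall>p\<in>e. k p = (\<Sum>j\<le>2. A j * crd d p ^ j))"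

text \<open>The coefficients are unique on a set \<open>e\<close> with three points of different coordinates
(\<open>qcoef_eqI\<close>).\<close>

definition qcoef :: "(real \<times> real \<Rightarrow> real) \<Rightarrow> bool \<Rightarrow> (real \<times> real) set \<Rightarrow> nat \<Rightarrow> real" where
  "qcoef k d e = (SOME A. \<forall>p\<in>e. k p = (\<Sum>j\<le>2. A j * crd d p ^ j))"

text \<open>The families \<open>r\<close> of prescribed values for the moments that satisfy the linear relation given by
each \<open>k\<close> in \<open>R\<close>. For the moments of an actual family \<open>c\<close> both sides
equal \<open>\<Sum> c p k p\<close> if \<open>k\<close> is quadratic along the lines
(\<open>moments_satisfy_relations\<close>).\<close>

definition relations :: "(real \<times> real \<Rightarrow> real) set \<Rightarrow> (bool \<Rightarrow> (real \<times> real) set set) \<Rightarrow>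
    (bool \<Rightarrow> (real \<times> real) set \<Rightarrow> nat \<Rightarrow> real) \<Rightarrow> bool" where
  "relations R E r \<longleftrightarrow> (\<forall>k\<in>R.
     (\<Sum>e\<in>E True. \<Sum>j\<le>2. qcoef k True e j * r True e j) =
     (\<Sum>e\<in>E False. \<Sum>j\<le>2. qcoef k False e j * r False e j))"

definition realisable :: "(real \<times> real) set \<Rightarrow> (bool \<times> (real \<times> real) set \<times> nat) set \<Rightarrow> bool" where
  "realisable P F \<longleftrightarrow> (\<forall>r. \<exists>c. (\<forall>p. p \<notin> P \<longrightarrow> c p = 0) \<and> (\<forall>(d, e, j)\<in>F. mom P d e j c = r d e j))"

text \<open>The relations and the vanishing of the values in \<open>F\<close> imply the vanishing of all values. Together
with \<open>realisable\<close> this says, for functions in \<open>R\<close> that are quadratic along the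
lines, that \<open>F\<close> is a basis of the space spanned by the moments; stated for arbitrary families of
values \<open>r\<close>, it passes from one level to the next.\<close>

definition determining where
  "determining R E F \<longleftrightarrow> (\<forall>r. relations R E r \<longrightarrow> (\<forall>(d, e, j)\<in>F. r d e j = 0) \<longrightarrow>
     (\<forall>d. \<forall>e\<in>E d. \<forall>j\<le>2. r d e j = 0))"

definition moment_free :: "(real \<times> real) set \<Rightarrow> (bool \<Rightarrow> (real \<times> real) set set) \<Rightarrow> (real \<times> real \<Rightarrow> real) set" where
  "moment_free P E = {c. (\<forall>p. p \<notin> P \<longrightarrow> c p = 0) \<and> (\<forall>d. \<forall>e\<in>E d. \<forall>j\<le>2. mom P d e j c = 0)}"

lemma qcoef: "quadratic_along d e k \<Longrightarrow> p \<in> e \<Longrightarrow> k p = (\<Sum>j\<le>2. qcoef k d e j * crd d p ^ j)"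
  unfolding quadratic_along_def qcoef_def by (drule someI_ex) blast

lemma sum_atMost_2: "(\<Sum>j\<le>(2::nat). f j) = f 0 + f 1 + f (2::nat)" for f :: "nat \<Rightarrow> 'a::comm_monoid_add"
  by (simp add: eval_nat_numeral)

lemma line_system_sum:
  fixes h :: "real \<times> real \<Rightarrow> real"
  assumes "line_system P E" shows "(\<Sum>p\<in>P. h p) = (\<Sum>e\<in>E d. \<Sum>p\<in>P \<inter> e. h p)"
proof -
  have f: "finite P" "finite (E d)" "\<And>p. p \<in> P \<Longrightarrow> \<exists>!e. e \<in> E d \<and> p \<in> e" using assms by (auto simp: line_system_def)
  have "(\<Sum>e\<in>E d. \<Sum>p\<in>P \<inter> e. h p) = (\<Sum>p\<in>(\<Union>e\<in>E d. P \<inter> e). h p)"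
    using f by (intro sum.UNION_disjoint[symmetric]) blast+
  also have "(\<Union>e\<in>E d. P \<inter> e) = P" using f(3) by blast
  finally show ?thesis by simp
qed

lemma quadratic_three_zeros:
  fixes a b c :: real
  assumes "a + b * x + c * x^2 = 0" "a + b * y + c * y^2 = 0" "a + b * z + c * z^2 = 0"
    and "x \<noteq> y" "y \<noteq> z" "x \<noteq> z"
  shows "a = 0" "b = 0" "c = 0"
proof -
  have "(x - y) * (b + c * (x + y)) = 0" "(x - z) * (b + c * (x + z)) = 0"
    using assms(1-3) by (auto simp: algebra_simps power2_eq_square)
  then have 1: "b + c * (x + y) = 0" "b + c * (x + z) = 0" using assms(4-6) by auto
  then have "c * (y - z) = 0" by argo
  then show "c = 0" using assms by auto
  then show "b = 0" using 1 by auto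
  then show "a = 0" using assms \<open>c = 0\<close> by auto
qed

lemma qcoef_eqI:
  assumes "\<And>p. p \<in> e \<Longrightarrow> k p = (\<Sum>j\<le>2. A j * crd d p ^ j)"
    and inf: "infinite (crd d ` e)" and "j \<le> 2"
  shows "qcoef k d e j = A j"
proof -
  obtain T where T: "T \<subseteq> crd d ` e" "card T = 3" using infinite_arbitrarily_large[OF inf] by blast
  then obtain x y z where xyz: "x \<in> crd d ` e" "y \<in> crd d ` e" "z \<in> crd d ` e" "x \<noteq> y" "y \<noteq> z" "x \<noteq> z"
    unfolding card_3_iff by (metis insertI1 insert_commute subsetD)
  have q: "quadratic_along d e k" unfolding quadratic_along_def using assms(1) by blast
  let ?B = "\<lambda>j. qcoef k d e j - A j"
  have "?B 0 + ?B 1 * x + ?B 2 * x^2 = 0" if xe: "x \<in> crd d ` e" for x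
  proof -
    obtain p where "p \<in> e" "x = crd d p" using xe by blast
    then show ?thesis using qcoef[OF q, of p] assms(1)[of p] by (simp add: sum_atMost_2 algebra_simps)
  qed
  then have "?B 0 = 0" "?B 1 = 0" "?B 2 = 0" using quadratic_three_zeros xyz by metis+
  moreover have "j = 0 \<or> j = 1 \<or> j = 2" using \<open>j \<le> 2\<close> by auto
  ultimately show ?thesis by auto
qed

lemma moments_satisfy_relations:
  assumes sys: "line_system P E" and q: "\<And>k d e. k \<in> R \<Longrightarrow> e \<in> E d \<Longrightarrow> quadratic_along d e k"
  shows "relations R E (\<lambda>d e j. mom P d e j c)"
  unfolding relations_def
proof
  fix k assume k: "k \<in> R"
  have "(\<Sum>e\<in>E d. \<Sum>j\<le>2. qcoef k d e j * mom P d e j c) = (\<Sum>p\<in>P. c p * k p)" for d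
  proof -
    have "(\<Sum>j\<le>2. qcoef k d e j * mom P d e j c) = (\<Sum>p\<in>P \<inter> e. c p * k p)" if "e \<in> E d" for e
    proof -
      have "(\<Sum>j\<le>2. qcoef k d e j * mom P d e j c) = (\<Sum>p\<in>P \<inter> e. \<Sum>j\<le>2. qcoef k d e j * (c p * crd d p ^ j))"
        unfolding mom_def sum_distrib_left by (rule sum.swap)
      also have "\<dots> = (\<Sum>p\<in>P \<inter> e. c p * k p)"
        by (rule sum.cong) (auto simp: qcoef[OF q[OF k that]] sum_distrib_left algebra_simps)
      finally show ?thesis .
    qed
    then have "(\<Sum>e\<in>E d. \<Sum>j\<le>2. qcoef k d e j * mom P d e j c) = (\<Sum>e\<in>E d. \<Sum>p\<in>P \<inter> e. c p * k p)" by simp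
    also have "\<dots> = (\<Sum>p\<in>P. c p * k p)" by (rule line_system_sum[OF sys, symmetric])
    finally show ?thesis .
  qed
  then show "(\<Sum>e\<in>E True. \<Sum>j\<le>2. qcoef k True e j * mom P True e j c) =
     (\<Sum>e\<in>E False. \<Sum>j\<le>2. qcoef k False e j * mom P False e j c)" by simp
qed

text \<open>A determining set of functionals has the same common kernel as the set of all moments.\<close>

lemma moment_free_basis:
  assumes sys: "line_system P E" and q: "\<And>k d e. k \<in> R \<Longrightarrow> e \<in> E d \<Longrightarrow> quadratic_along d e k"
    and F: "finite F" "F \<subseteq> {(d, e, j). e \<in> E d \<and> j \<le> 2}" "realisable P F" "determining R E F"
  shows "\<exists>B. finite B \<and> \<not> fun_space.dependent B \<and> card B + card F = card P \<and>
     fun_space.span B = moment_free P E"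
proof -
  have fP: "finite P" using sys by (auto simp: line_system_def)
  define w where "w = (\<lambda>(d, e, j) p. if p \<in> e then crd d p ^ j else 0)"
  have w: "(\<Sum>p\<in>P. c p * w (d, e, j) p) = mom P d e j c" for c d e j
    unfolding w_def mom_def using fP by (auto simp: sum.inter_restrict intro!: sum.cong)
  have "\<exists>c. \<forall>i\<in>F. (\<Sum>p\<in>P. c p * w i p) = r i" for r
    using F(3)[unfolded realisable_def, rule_format, of "\<lambda>d e j. r (d, e, j)"] by (fastforce simp: w)
  from kernel_basis[OF F(1) fP this]
  obtain B where B: "finite B" "\<not> fun_space.dependent B" "card B + card F = card P"
     "fun_space.span B = {c. (\<forall>p. p \<notin> P \<longrightarrow> c p = 0) \<and> (\<forall>i\<in>F. (\<Sum>p\<in>P. c p * w i p) = 0)}" by auto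
  have "(\<forall>i\<in>F. (\<Sum>p\<in>P. c p * w i p) = 0) \<longleftrightarrow> (\<forall>d. \<forall>e\<in>E d. \<forall>j\<le>2. mom P d e j c = 0)" for c
  proof
    assume "\<forall>i\<in>F. (\<Sum>p\<in>P. c p * w i p) = 0"
    then have "\<forall>(d, e, j)\<in>F. mom P d e j c = 0" by (auto simp flip: w)
    then show "\<forall>d. \<forall>e\<in>E d. \<forall>j\<le>2. mom P d e j c = 0"
      using F(4) moments_satisfy_relations[OF sys q, of R] unfolding determining_def by blast
  qed (use F(2) in \<open>force simp: w\<close>)
  then have "{c. (\<forall>p. p \<notin> P \<longrightarrow> c p = 0) \<and> (\<forall>i\<in>F. (\<Sum>p\<in>P. c p * w i p) = 0)} = moment_free P E"
    unfolding moment_free_def by simp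
  then show ?thesis using B by auto
qed

text \<open>Invertibility of the Vandermonde matrix: three points allow arbitrary moments of order 0, 1 and 2; two points
allow arbitrary moments of order 0 and 1.\<close>

lemma edge_solve:
  fixes t :: "'a \<Rightarrow> real"
  assumes A: "finite A" "inj_on t A" "card A \<ge> 2"
  shows "\<exists>a. \<forall>j\<le>2. (j = 2 \<longrightarrow> card A \<ge> 3) \<longrightarrow> (\<Sum>p\<in>A. a p * t p ^ j) = r j"
proof (cases "card A = 2")
  case True
  then obtain p q where pq: "A = {p, q}" "p \<noteq> q" by (auto simp: card_2_iff)
  then have ne: "t p - t q \<noteq> 0" using A by auto
  define \<beta> where "\<beta> = (r 1 - t q * r 0) / (t p - t q)"
  define a where "a x = (if x = p then \<beta> else r 0 - \<beta>)" for x
  have "\<beta> * (t p - t q) = r 1 - t q * r 0" using ne by (simp add: \<beta>_def)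
  then have "(\<Sum>p\<in>A. a p * t p ^ 0) = r 0" "(\<Sum>p\<in>A. a p * t p ^ 1) = r 1"
    using pq by (auto simp: a_def algebra_simps)
  then have "\<forall>j\<le>2. (j = 2 \<longrightarrow> card A \<ge> 3) \<longrightarrow> (\<Sum>p\<in>A. a p * t p ^ j) = r j"
    using True by (auto simp: le_Suc_eq numeral_2_eq_2)
  then show ?thesis by blast
next
  case False
  then have "3 \<le> card A" using A by auto
  then obtain T where T: "T \<subseteq> A" "card T = 3" by (meson obtain_subset_with_card_n)
  then obtain x y z where xyz: "T = {x, y, z}" "x \<noteq> y" "y \<noteq> z" "x \<noteq> z" by (auto simp: card_3_iff)
  then have ne: "t x - t y \<noteq> 0" "t y - t z \<noteq> 0" "t x - t z \<noteq> 0" using A T by (auto simp: inj_on_def)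
  define \<alpha> where "\<alpha> = (r 2 - (t y + t z) * r 1 + t y * t z * r 0) / ((t x - t y) * (t x - t z))"
  define \<beta> where "\<beta> = (r 1 - t z * r 0 - \<alpha> * (t x - t z)) / (t y - t z)"
  have 1: "\<alpha> * ((t x - t y) * (t x - t z)) = r 2 - (t y + t z) * r 1 + t y * t z * r 0"
    using ne by (simp add: \<alpha>_def)
  have 2: "\<beta> * (t y - t z) = r 1 - t z * r 0 - \<alpha> * (t x - t z)" using ne by (simp add: \<beta>_def)
  define a where "a p = (if p = x then \<alpha> else if p = y then \<beta> else if p = z then r 0 - \<alpha> - \<beta> else 0)" for p
  have s: "(\<Sum>p\<in>A. a p * t p ^ j) = \<alpha> * t x ^ j + \<beta> * t y ^ j + (r 0 - \<alpha> - \<beta>) * t z ^ j" for j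
  proof -
    have "(\<Sum>p\<in>A. a p * t p ^ j) = (\<Sum>p\<in>T. a p * t p ^ j)"
      using A T xyz by (intro sum.mono_neutral_right) (auto simp: a_def)
    then show ?thesis using xyz by (simp add: a_def)
  qed
  have m1: "\<alpha> * t x + \<beta> * t y + (r 0 - \<alpha> - \<beta>) * t z = r 1" using 2 by (simp add: algebra_simps)
  have "\<alpha> * (t x)^2 + \<beta> * (t y)^2 + (r 0 - \<alpha> - \<beta>) * (t z)^2 =
     \<alpha> * ((t x - t y) * (t x - t z)) + (t y + t z) * (\<alpha> * t x + \<beta> * t y + (r 0 - \<alpha> - \<beta>) * t z) - t y * t z * r 0"
    by (simp add: algebra_simps power2_eq_square)
  then have "\<alpha> * (t x)^2 + \<beta> * (t y)^2 + (r 0 - \<alpha> - \<beta>) * (t z)^2 = r 2" using 1 m1 by simp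
  then have "\<forall>j\<le>2. (\<Sum>p\<in>A. a p * t p ^ j) = r j"
    using m1 unfolding s by (auto simp: le_Suc_eq numeral_2_eq_2)
  then show ?thesis by blast
qed

text \<open>With two points besides \<open>z\<close> all three moments determine the value at \<open>z\<close>: apply the
functional to the polynomial \<open>(x - t p) (x - t q)\<close>, where \<open>A = {p, q}\<close>. Conversely,
if \<open>z\<close> carries this value, the correct moments of order 0 and 1 give the correct one of order 2.\<close>

lemma forced_centre:
  fixes t :: "'a \<Rightarrow> real"
  assumes "inj_on t (insert z A)" "z \<notin> A" "card A = 2"
  shows "\<exists>\<alpha>. \<forall>c. c z = \<alpha> \<longrightarrow> (\<forall>j\<le>1. (\<Sum>p\<in>insert z A. c p * t p ^ j) = r j) \<longrightarrow>
     (\<Sum>p\<in>insert z A. c p * t p ^ 2) = r (2::nat)"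
proof -
  obtain p q where pq: "A = {p, q}" "p \<noteq> q" using assms by (auto simp: card_2_iff)
  then have ne: "(t z - t p) * (t z - t q) \<noteq> 0" using assms by (auto simp: inj_on_def)
  have "(\<Sum>x\<in>insert z A. c x * t x ^ 2) = r 2"
    if c: "c z = (r 2 - (t p + t q) * r 1 + t p * t q * r 0) / ((t z - t p) * (t z - t q))"
      and m: "\<forall>j\<le>1. (\<Sum>p\<in>insert z A. c p * t p ^ j) = r j" for c
  proof -
    have s: "(\<Sum>x\<in>insert z A. c x * t x ^ j) = c z * t z ^ j + c p * t p ^ j + c q * t q ^ j" for j
      using pq assms by (auto simp: algebra_simps)
    have 0: "c z + c p + c q = r 0" and 1: "c z * t z + c p * t p + c q * t q = r 1"
      using m[rule_format, of 0] m[rule_format, of 1] unfolding s by auto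
    have "c z * ((t z - t p) * (t z - t q)) = r 2 - (t p + t q) * r 1 + t p * t q * r 0" using c ne by simp
    moreover have "c z * t z ^ 2 + c p * t p ^ 2 + c q * t q ^ 2 = c z * ((t z - t p) * (t z - t q))
       + (t p + t q) * (c z * t z + c p * t p + c q * t q) - t p * t q * (c z + c p + c q)"
      by (simp add: algebra_simps power2_eq_square)
    ultimately show ?thesis unfolding s 0 1 by simp
  qed
  then show ?thesis by blast
qed

section \<open>Adding lines to a system of lines\<close>

text \<open>The points of a new line \<open>e\<close> that lie on an old line of the other direction. Changing a
coefficient there affects no other new line.\<close>

definition on_old where "on_old P' E d e = {p \<in> P' \<inter> e. \<exists>e'\<in>E (\<not> d). p \<in> e'}"

text \<open>What is used of a refinement step: new lines miss the old points and contain at least two points on old lines;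
if they contain only two, there is exactly one further point \<open>z\<close>, the centre of a cross. The
vertical lines in \<open>I\<close> are those whose partner at the centre has only two such points as well. By
\<open>rel\<close>, for each of these a relation in \<open>R\<close> expresses its second moment by its lower
moments and the moments of one horizontal new line.\<close>

locale line_refinement =
  fixes P P' :: "(real \<times> real) set" and E E' :: "bool \<Rightarrow> (real \<times> real) set set" and R I
  assumes sys: "line_system P E" and sys': "line_system P' E'" and PP: "P \<subseteq> P'" and EE: "\<And>d. E d \<subseteq> E' d"
    and new_disj: "\<And>d e. e \<in> E' d - E d \<Longrightarrow> e \<inter> P = {}"
    and two: "\<And>d e. e \<in> E' d - E d \<Longrightarrow> card (on_old P' E d e) \<ge> 2"
    and centre: "\<And>d e. e \<in> E' d - E d \<Longrightarrow> card (on_old P' E d e) = 2 \<Longrightarrow>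
       \<exists>z. P' \<inter> e - on_old P' E d e = {z}"
    and I_def: "I = {e \<in> E' False - E False. card (on_old P' E False e) = 2 \<and>
       (\<exists>h\<in>E' True - E True. card (on_old P' E True h) = 2 \<and> (\<exists>z\<in>P'. z \<in> e \<and> z \<in> h))}"
    and rel: "\<And>e. e \<in> I \<Longrightarrow> \<exists>k\<in>R. \<exists>h\<in>E' True - E True. qcoef k False e 2 \<noteq> 0 \<and>
       (\<forall>e'\<in>E' True - {h}. \<forall>j\<le>2. qcoef k True e' j = 0) \<and>
       (\<forall>e'\<in>E' False - {e}. \<forall>j\<le>2. qcoef k False e' j = 0)"
begin

definition edge_at where "edge_at d p = (THE e. e \<in> E' d \<and> p \<in> e)"

lemma edge_at: assumes "p \<in> P'" shows "edge_at d p \<in> E' d" "p \<in> edge_at d p"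
  unfolding edge_at_def using theI'[of "\<lambda>e. e \<in> E' d \<and> p \<in> e"] sys' assms
  by (auto simp: line_system_def)

lemma edge_at_eq: "p \<in> P' \<Longrightarrow> e \<in> E' d \<Longrightarrow> p \<in> e \<Longrightarrow> edge_at d p = e"
  using sys' edge_at[of p d] unfolding line_system_def by blast

lemma finP': "finite P'" using sys' by (simp add: line_system_def)

lemma on_old_iff:
  assumes "e \<in> E' d" "p \<in> P'" "p \<in> e"
  shows "p \<in> on_old P' E d e \<longleftrightarrow> edge_at (\<not> d) p \<in> E (\<not> d)"
  using assms edge_at[OF assms(2), of "\<not> d"] edge_at_eq[OF assms(2), of _ "\<not> d"] EE[of "\<not> d"]
  unfolding on_old_def by blast

lemma inj_crd: assumes "e \<in> E' d" shows "inj_on (crd d) e"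
proof (rule inj_onI)
  fix p q assume "p \<in> e" "q \<in> e" "crd d p = crd d q"
  moreover have "crd (\<not> d) p = crd (\<not> d) q"
    using calculation(1,2) sys' assms unfolding line_system_def by blast
  ultimately show "p = q" by (cases d) (auto simp: crd_def prod_eq_iff)
qed

text \<open>The functionals that a step adds: all moments of the new lines, apart from the second moment of the lines in
\<open>I\<close>.\<close>

definition new_functionals where
  "new_functionals = {(d, e, j). e \<in> E' d - E d \<and> j \<le> (2::nat)} - {(False, e, 2) | e. e \<in> I}"

text \<open>First the coefficients at points where two new lines meet are fixed: zero, or the forced value if one of the
lines has only two points on old lines, with preference for the horizontal line. Then each new line is
corrected independently at its points on old lines. The preference conflicts with the second line only if that
line is in \<open>I\<close>, and then its second moment is not among the functionals.\<close>

lemma local_solution: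
  "\<exists>c. (\<forall>p. p \<notin> P' \<longrightarrow> c p = 0) \<and> (\<forall>(d, e, j)\<in>new_functionals. mom P' d e j c = r d e j)"
proof -
  define small where "small d e \<longleftrightarrow> card (on_old P' E d e) = 2" for d e
  have "\<exists>\<alpha>. \<forall>c z. z \<in> P' \<inter> e - on_old P' E d e \<longrightarrow> c z = \<alpha> \<longrightarrow>
     (\<forall>j\<le>1. mom P' d e j c = r d e j) \<longrightarrow> mom P' d e 2 c = r d e 2"
    if e: "e \<in> E' d - E d" "small d e" for d e
  proof -
    obtain z where z: "P' \<inter> e - on_old P' E d e = {z}" using centre e unfolding small_def by blast
    then have ins: "P' \<inter> e = insert z (on_old P' E d e)" "z \<notin> on_old P' E d e" unfolding on_old_def by blast+
    have "inj_on (crd d) (insert z (on_old P' E d e))"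
      using inj_crd[of e d] e ins(1) by (metis DiffD1 inf_le2 inj_on_subset)
    from forced_centre[OF this ins(2), of "r d e"] e(2)
    obtain \<alpha> where "\<forall>c. c z = \<alpha> \<longrightarrow> (\<forall>j\<le>1. mom P' d e j c = r d e j) \<longrightarrow> mom P' d e 2 c = r d e 2"
      unfolding small_def mom_def ins(1) by blast
    then show ?thesis unfolding z by blast
  qed
  then have ex: "\<exists>\<alpha>. e \<in> E' d - E d \<longrightarrow> small d e \<longrightarrow> (\<forall>c z. z \<in> P' \<inter> e - on_old P' E d e \<longrightarrow> c z = \<alpha> \<longrightarrow>
     (\<forall>j\<le>1. mom P' d e j c = r d e j) \<longrightarrow> mom P' d e 2 c = r d e 2)" for d e by blast
  define \<alpha> where "\<alpha> d e = (SOME \<alpha>. e \<in> E' d - E d \<longrightarrow> small d e \<longrightarrow> (\<forall>c z. z \<in> P' \<inter> e - on_old P' E d e \<longrightarrow> c z = \<alpha> \<longrightarrow>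
     (\<forall>j\<le>1. mom P' d e j c = r d e j) \<longrightarrow> mom P' d e 2 c = r d e 2))" for d e
  have \<alpha>: "mom P' d e 2 c = r d e 2"
    if "e \<in> E' d - E d" "small d e" "z \<in> P' \<inter> e - on_old P' E d e" "c z = \<alpha> d e"
      "\<forall>j\<le>1. mom P' d e j c = r d e j" for d e c z
    using someI_ex[OF ex[of e d], folded \<alpha>_def] that by blast
  \<comment> \<open>the value at a point where two new lines meet; the horizontal line has priority\<close>
  define c0 where "c0 z = (if small True (edge_at True z) then \<alpha> True (edge_at True z)
     else if small False (edge_at False z) then \<alpha> False (edge_at False z) else 0)" for z
  have exa: "\<exists>a. \<forall>j\<le>2. (j = 2 \<longrightarrow> card (on_old P' E d e) \<ge> 3) \<longrightarrow>
      (\<Sum>p\<in>on_old P' E d e. a p * crd d p ^ j) = r d e j - (\<Sum>p\<in>P' \<inter> e - on_old P' E d e. c0 p * crd d p ^ j)"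
    if e: "e \<in> E' d - E d" for d e
  proof (rule edge_solve)
    show "finite (on_old P' E d e)" using finP' by (simp add: on_old_def)
    show "inj_on (crd d) (on_old P' E d e)"
      by (rule inj_on_subset[OF inj_crd]) (use e in \<open>auto simp: on_old_def\<close>)
    show "2 \<le> card (on_old P' E d e)" using two[OF e] .
  qed
  define a where "a d e = (SOME a. \<forall>j\<le>2. (j = 2 \<longrightarrow> card (on_old P' E d e) \<ge> 3) \<longrightarrow>
      (\<Sum>p\<in>on_old P' E d e. a p * crd d p ^ j) = r d e j - (\<Sum>p\<in>P' \<inter> e - on_old P' E d e. c0 p * crd d p ^ j))" for d e
  have a: "(\<Sum>p\<in>on_old P' E d e. a d e p * crd d p ^ j) = r d e j - (\<Sum>p\<in>P' \<inter> e - on_old P' E d e. c0 p * crd d p ^ j)"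
    if "e \<in> E' d - E d" "j \<le> 2" "j = 2 \<longrightarrow> card (on_old P' E d e) \<ge> 3" for d e j
    using someI_ex[OF exa[OF that(1)], folded a_def] that by blast
  define new where "new d p \<longleftrightarrow> edge_at d p \<notin> E d" for d p
  define c where "c p = (if p \<notin> P' then 0 else if new True p \<and> new False p then c0 p
     else if new True p then a True (edge_at True p) p
     else if new False p then a False (edge_at False p) p else 0)" for p
  have c_old: "c p = a d e p" if "e \<in> E' d - E d" "p \<in> on_old P' E d e" for d e p
  proof -
    have p: "p \<in> P'" "p \<in> e" using that unfolding on_old_def by auto
    then have "edge_at d p = e" "edge_at (\<not> d) p \<in> E (\<not> d)"
      using that on_old_iff edge_at_eq by blast+
    then show ?thesis using that p by (cases d) (auto simp: c_def new_def)
  qed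
  have c_new: "c p = c0 p" if "e \<in> E' d - E d" "p \<in> P' \<inter> e - on_old P' E d e" for d e p
  proof -
    have "edge_at d p = e" "edge_at (\<not> d) p \<notin> E (\<not> d)"
      using that on_old_iff edge_at_eq by blast+
    then show ?thesis using that by (cases d) (auto simp: c_def new_def)
  qed
  have m: "mom P' d e j c = r d e j" if e: "e \<in> E' d - E d" and j: "j \<le> 2" "j = 2 \<longrightarrow> card (on_old P' E d e) \<ge> 3" for d e j
  proof -
    have "mom P' d e j c = (\<Sum>p\<in>P' \<inter> e - on_old P' E d e. c p * crd d p ^ j) + (\<Sum>p\<in>on_old P' E d e. c p * crd d p ^ j)"
      unfolding mom_def using finP' by (intro sum.subset_diff) (auto simp: on_old_def)
    also have "\<dots> = r d e j"
      using c_old[OF e] c_new[OF e] a[OF e j] by simp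
    finally show ?thesis .
  qed
  have "mom P' d e j c = r d e j" if nf: "(d, e, j) \<in> new_functionals" for d e j
  proof -
    have e: "e \<in> E' d - E d" "j \<le> 2" and ni: "\<not> (\<not> d \<and> j = 2 \<and> e \<in> I)" using nf unfolding new_functionals_def by auto
    show ?thesis
    proof (cases "j = 2 \<and> small d e")
      case False
      then show ?thesis using m[OF e] two[OF e(1)] unfolding small_def by auto
    next
      case True
      obtain z where z: "P' \<inter> e - on_old P' E d e = {z}" using centre e True unfolding small_def by blast
      then have zz: "z \<in> P' \<inter> e - on_old P' E d e" by blast
      have zd: "edge_at d z = e" "edge_at (\<not> d) z \<notin> E (\<not> d)" using zz e on_old_iff edge_at_eq by blast+
      have zn: "edge_at (\<not> d) z \<in> E' (\<not> d)" "z \<in> edge_at (\<not> d) z" using edge_at zz by auto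
      have "c z = c0 z" using c_new[OF e(1) zz] .
      also have "\<dots> = \<alpha> d e"
      proof (cases d)
        case True
        then show ?thesis using \<open>j = 2 \<and> small d e\<close> zd by (simp add: c0_def)
      next
        case False
        then have "\<not> small True (edge_at True z)"
          using ni True zd zn e zz unfolding I_def small_def by auto
        then show ?thesis using False True zd by (simp add: c0_def)
      qed
      finally have "mom P' d e 2 c = r d e 2"
        using \<alpha>[OF e(1) conjunct2[OF True] zz, of c] m[OF e(1)] by simp
      then show ?thesis using True by simp
    qed
  qed
  moreover have "c p = 0" if "p \<notin> P'" for p using that by (simp add: c_def)
  ultimately show ?thesis by (intro exI[of _ c]) auto
qed

text \<open>The solution on the new lines disturbs the old moments; the correction supported on the old points leaves the
new moments alone because new lines miss the old points.\<close>

lemma step_realisable: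
  assumes F: "realisable P F" "F \<subseteq> {(d, e, j). e \<in> E d \<and> j \<le> 2}"
  shows "realisable P' (F \<union> new_functionals)"
  unfolding realisable_def
proof
  fix r
  obtain c1 where c1: "\<forall>p. p \<notin> P' \<longrightarrow> c1 p = 0" "\<forall>(d, e, j)\<in>new_functionals. mom P' d e j c1 = r d e j"
    using local_solution by blast
  obtain c2 where c2: "\<forall>p. p \<notin> P \<longrightarrow> c2 p = 0" "\<forall>(d, e, j)\<in>F. mom P d e j c2 = r d e j - mom P' d e j c1"
    using F(1)[unfolded realisable_def, rule_format, of "\<lambda>d e j. r d e j - mom P' d e j c1"] by blast
  have mm: "mom P' d e j c2 = mom P d e j c2" for d e j
    unfolding mom_def using finP' PP c2(1) by (intro sum.mono_neutral_right) auto
  have m0: "mom P d e j c2 = 0" if "(d, e, j) \<in> new_functionals" for d e j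
    using that new_disj[of e d] unfolding mom_def new_functionals_def by (auto simp: Int_commute)
  have add: "mom P' d e j (\<lambda>p. c1 p + c2 p) = mom P' d e j c1 + mom P' d e j c2" for d e j
    by (simp add: mom_def sum.distrib algebra_simps)
  show "\<exists>c. (\<forall>p. p \<notin> P' \<longrightarrow> c p = 0) \<and> (\<forall>(d, e, j)\<in>F \<union> new_functionals. mom P' d e j c = r d e j)"
    using c1 c2 PP mm m0 by (intro exI[of _ "\<lambda>p. c1 p + c2 p"]) (fastforce simp: add)
qed

text \<open>For a line in \<open>I\<close> the relation \<open>rel\<close> recovers the second moment left out of
\<open>new_functionals\<close>. Afterwards all new values vanish, and the relations become relations among the
old values.\<close>

lemma step_determining:
  assumes F: "determining R E F"
  shows "determining R E' (F \<union> new_functionals)"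
  unfolding determining_def
proof (rule allI, rule impI, rule impI)
  fix r assume r: "relations R E' r" "\<forall>(d, e, j)\<in>F \<union> new_functionals. r d e j = 0"
  have fin: "finite (E' d)" "finite (E d)" for d using sys' sys by (auto simp: line_system_def)
  have nz: "r d e j = 0" if e: "e \<in> E' d - E d" and j: "j \<le> 2" for d e j
  proof (cases "\<not> d \<and> j = 2 \<and> e \<in> I")
    case False
    then have "(d, e, j) \<in> new_functionals" using that unfolding new_functionals_def by auto
    then show ?thesis using r(2) by blast
  next
    case True
    then obtain k h where k: "k \<in> R" "h \<in> E' True - E True" "qcoef k False e 2 \<noteq> 0"
       "\<forall>e'\<in>E' True - {h}. \<forall>j\<le>2. qcoef k True e' j = 0" "\<forall>e'\<in>E' False - {e}. \<forall>j\<le>2. qcoef k False e' j = 0"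
      using rel[of e] by blast
    have "r True h j = 0" if "j \<le> 2" for j
      using r(2) that k(2) unfolding new_functionals_def by fastforce
    then have "(\<Sum>j\<le>2. qcoef k True e' j * r True e' j) = 0" if "e' \<in> E' True" for e'
      using that k(4) by (cases "e' = h") (auto intro!: sum.neutral)
    then have "(\<Sum>e'\<in>E' False. \<Sum>j\<le>2. qcoef k False e' j * r False e' j) = 0"
      using r(1) k(1) unfolding relations_def by fastforce
    moreover have "(\<Sum>e'\<in>E' False. \<Sum>j\<le>2. qcoef k False e' j * r False e' j) = (\<Sum>e'\<in>{e}. \<Sum>j\<le>2. qcoef k False e' j * r False e' j)"
      using fin e True k(5) by (intro sum.mono_neutral_right) (auto intro!: sum.neutral)
    moreover have "r False e 0 = 0" "r False e 1 = 0"
      using r(2) e True unfolding new_functionals_def by fastforce+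
    ultimately show ?thesis using True k(3) by (simp add: sum_atMost_2)
  qed
  have "(\<Sum>e\<in>E' d. \<Sum>j\<le>2. qcoef k d e j * r d e j) = (\<Sum>e\<in>E d. \<Sum>j\<le>2. qcoef k d e j * r d e j)" for k d
    using fin EE nz by (intro sum.mono_neutral_right) (auto intro!: sum.neutral)
  then have "relations R E r" using r(1) unfolding relations_def by simp
  then have "\<forall>d. \<forall>e\<in>E d. \<forall>j\<le>2. r d e j = 0" using F r(2) unfolding determining_def by blast
  then show "\<forall>d. \<forall>e\<in>E' d. \<forall>j\<le>2. r d e j = 0" using nz by blast
qed

lemma step_card:
  assumes F: "finite F" "F \<subseteq> {(d, e, j). e \<in> E d \<and> j \<le> 2}"
  shows "finite (F \<union> new_functionals)" "F \<union> new_functionals \<subseteq> {(d, e, j). e \<in> E' d \<and> j \<le> 2}"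
    "int (card (F \<union> new_functionals)) = int (card F) + 3 * (int (card (E' True)) - card (E True))
       + 3 * (int (card (E' False)) - card (E False)) - card I"
proof -
  have fin: "finite (E' d)" "finite (E d)" for d using sys' sys by (auto simp: line_system_def)
  have eq: "{(d, e, j). e \<in> E' d - E d \<and> j \<le> (2::nat)} =
    {True} \<times> (E' True - E True) \<times> {..2} \<union> {False} \<times> (E' False - E False) \<times> {..2}" (is "?N = _")
  proof (intro set_eqI iffI)
    fix x assume "x \<in> ?N"
    then show "x \<in> {True} \<times> (E' True - E True) \<times> {..2} \<union> {False} \<times> (E' False - E False) \<times> {..2}"
      by (cases "fst x") auto
  qed auto
  have fN: "finite ?N" unfolding eq using fin by auto
  have cN: "card ?N = card (E' True - E True) * 3 + card (E' False - E False) * 3"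
    unfolding eq using fin by (subst card_Un_disjoint) (auto simp: card_cartesian_product)
  have cd: "int (card (E' d - E d)) = int (card (E' d)) - card (E d)" for d
    using card_Diff_subset[OF fin(2) EE, of d] card_mono[OF fin(1) EE, of d] by simp
  have D: "{(False, e, 2) | e. e \<in> I} \<subseteq> ?N" unfolding I_def by auto
  have "{(False, e, 2::nat) | e. e \<in> I} = (\<lambda>e. (False, e, 2)) ` I" by auto
  then have cI: "card {(False, e, 2::nat) | e. e \<in> I} = card I" by (simp add: card_image inj_on_def)
  have fD: "finite {(False, e, 2::nat) | e. e \<in> I}" using D fN finite_subset by blast
  have c: "int (card new_functionals) = int (card ?N) - card I"
    unfolding new_functionals_def using card_Diff_subset[OF fD D] card_mono[OF fN D] cI by simp
  have fn: "finite new_functionals" unfolding new_functionals_def using fN by auto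
  show "finite (F \<union> new_functionals)" using F fn by auto
  show "F \<union> new_functionals \<subseteq> {(d, e, j). e \<in> E' d \<and> j \<le> 2}"
    using F EE unfolding new_functionals_def by auto
  have "F \<inter> new_functionals = {}" using F unfolding new_functionals_def by auto
  then show "int (card (F \<union> new_functionals)) = int (card F) + 3 * (int (card (E' True)) - card (E True))
       + 3 * (int (card (E' False)) - card (E False)) - card I"
    using F fn c cN cd[of True] cd[of False] by (simp add: card_Un_disjoint)
qed
end

section \<open>Vertices and l-edges of a skeleton\<close>

definition pt :: "bool \<Rightarrow> real \<Rightarrow> real \<Rightarrow> real \<times> real" where
  "pt d s t = (if d then (s, t) else (t, s))"

lemma crd_pt [simp]: "crd d (pt d s t) = s" "crd (\<not> d) (pt d s t) = t"
  by (auto simp: crd_def pt_def)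

lemma pt_crd [simp]: "pt d (crd d p) (crd (\<not> d) p) = p"
  by (cases p) (auto simp: crd_def pt_def)

lemma point_eqI: "crd d p = crd d q \<Longrightarrow> crd (\<not> d) p = crd (\<not> d) q \<Longrightarrow> p = q"
  by (metis pt_crd)

lemma bool_quantifiers: "(\<forall>d'. P d') \<longleftrightarrow> P d \<and> P (\<not> d)" "(\<exists>d'. P d') \<longleftrightarrow> P d \<or> P (\<not> d)" for P :: "bool \<Rightarrow> bool"
  by (cases d; auto simp: all_bool_eq ex_bool_eq)+

lemma continuous_on_crd [continuous_intros]: "continuous_on S (crd d)"
  by (cases d) (auto simp: crd_def continuous_on_fst continuous_on_snd continuous_on_id)

lemma finite_product_points: "finite X \<Longrightarrow> finite Y \<Longrightarrow> finite {p. crd d p \<in> X \<and> crd (\<not> d) p \<in> Y}"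
  by (rule finite_subset[of _ "(\<lambda>(s, t). pt d s t) ` (X \<times> Y)"]) (auto simp: image_iff, metis pt_crd)

lemma crd_segment: "crd d ` closed_segment v w = closed_segment (crd d v) (crd d w)"
  by (rule closed_segment_linear_image[symmetric]) (cases d; auto simp: crd_def linear_iff)

lemma aligned_segment:
  assumes "crd (\<not> d) v = crd (\<not> d) w"
  shows "closed_segment v w = {p. crd (\<not> d) p = crd (\<not> d) v \<and> crd d p \<in> closed_segment (crd d v) (crd d w)}"
proof (intro set_eqI iffI)
  fix p assume p: "p \<in> closed_segment v w"
  have "crd (\<not> d) p \<in> crd (\<not> d) ` closed_segment v w" "crd d p \<in> crd d ` closed_segment v w" using p by auto
  then show "p \<in> {p. crd (\<not> d) p = crd (\<not> d) v \<and> crd d p \<in> closed_segment (crd d v) (crd d w)}"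
    unfolding crd_segment using assms by simp
next
  fix p assume p: "p \<in> {p. crd (\<not> d) p = crd (\<not> d) v \<and> crd d p \<in> closed_segment (crd d v) (crd d w)}"
  then have "crd d p \<in> crd d ` closed_segment v w" unfolding crd_segment by simp
  then obtain q where q: "q \<in> closed_segment v w" "crd d p = crd d q" by auto
  have "crd (\<not> d) q \<in> crd (\<not> d) ` closed_segment v w" using q by auto
  then have "crd (\<not> d) q = crd (\<not> d) p" unfolding crd_segment using assms p by simp
  then have "q = p" using q point_eqI by metis
  then show "p \<in> closed_segment v w" using q by simp
qed

text \<open>A segment has no isolated points, so finitely many exceptional points do not matter when it is to be contained
in a closed set. This is how segments that are known to lie in a union of lines of both directions are shown
to lie in lines of their own direction.\<close>

lemma segment_subset_closed:
  fixes v w :: "'a::euclidean_space"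
  assumes "v \<noteq> w" "closed C" "finite X" "closed_segment v w \<subseteq> C \<union> X"
  shows "closed_segment v w \<subseteq> C"
proof
  fix p assume p: "p \<in> closed_segment v w"
  have "p islimpt closed_segment v w"
    by (rule connected_imp_perfect[OF connected_segment(1) p]) (metis assms(1) ends_in_segment singletonD)
  then have "p islimpt (X \<union> C)" using assms(4) islimpt_subset by (metis sup_commute)
  then have "p islimpt C" using islimpt_Un_finite[OF assms(3)] by blast
  then show "p \<in> C" using assms(2) closed_limpt by blast
qed

text \<open>All structure of a mesh is read off its skeleton \<open>Sk\<close>, a set of points: \<open>eseg Sk d
v\<close> is the longest segment of direction \<open>d\<close> through \<open>v\<close> inside
\<open>Sk\<close>, vertices are the points where segments of both directions meet, and the segments through
vertices are the l-edges, including those on the boundary of the region.\<close>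

definition eseg :: "(real \<times> real) set \<Rightarrow> bool \<Rightarrow> real \<times> real \<Rightarrow> (real \<times> real) set" where
  "eseg Sk d v = {w. crd (\<not> d) w = crd (\<not> d) v \<and> closed_segment v w \<subseteq> Sk}"

definition dir :: "(real \<times> real) set \<Rightarrow> bool \<Rightarrow> real \<times> real \<Rightarrow> bool" where
  "dir Sk d v \<longleftrightarrow> (\<exists>w\<in>eseg Sk d v. w \<noteq> v)"

definition verts :: "(real \<times> real) set \<Rightarrow> (real \<times> real) set" where
  "verts Sk = {v. \<forall>d. dir Sk d v}"

definition ledges :: "(real \<times> real) set \<Rightarrow> bool \<Rightarrow> (real \<times> real) set set" where
  "ledges Sk d = eseg Sk d ` verts Sk"

lemma aligned_segment_trans:
  assumes "crd (\<not> d) v = crd (\<not> d) w" "crd (\<not> d) u = crd (\<not> d) v"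
  shows "closed_segment v u \<subseteq> closed_segment v w \<union> closed_segment w u"
proof -
  have u: "crd (\<not> d) w = crd (\<not> d) u" using assms by simp
  show ?thesis unfolding aligned_segment[OF assms(1)] aligned_segment[OF assms(2)[symmetric]] aligned_segment[OF u]
    using assms by (auto simp: closed_segment_eq_real_ivl split: if_splits)
qed

lemma eseg_eq: assumes "w \<in> eseg Sk d v" shows "eseg Sk d w = eseg Sk d v"
proof -
  have w: "crd (\<not> d) v = crd (\<not> d) w" "closed_segment v w \<subseteq> Sk" using assms by (auto simp: eseg_def)
  have "closed_segment v u \<subseteq> Sk \<longleftrightarrow> closed_segment w u \<subseteq> Sk" if "crd (\<not> d) u = crd (\<not> d) v" for u
  proof -
    have "closed_segment v u \<subseteq> closed_segment v w \<union> closed_segment w u"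
      using aligned_segment_trans[of d v w u] w that by simp
    moreover have "closed_segment w u \<subseteq> closed_segment w v \<union> closed_segment v u"
      using aligned_segment_trans[of d w v u] w that by simp
    ultimately show ?thesis using w(2) closed_segment_commute[of w v] by blast
  qed
  then show ?thesis unfolding eseg_def using w by auto
qed

lemma dir_eseg: assumes "dir Sk d v" "w \<in> eseg Sk d v" shows "dir Sk d w"
  using assms eseg_eq[OF assms(2)] unfolding dir_def
  by (cases "w = v") (auto simp: eseg_def intro!: bexI[of _ v] simp: closed_segment_commute)

lemma dir_self: assumes "dir Sk d v" shows "v \<in> Sk" "v \<in> eseg Sk d v"
  using assms unfolding dir_def eseg_def by auto

lemma verts_iff: "v \<in> verts Sk \<longleftrightarrow> dir Sk d v \<and> dir Sk (\<not> d) v"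
  by (cases d) (auto simp: verts_def all_bool_eq)

lemma infinite_eseg: assumes "dir Sk d v" shows "infinite (crd d ` eseg Sk d v)"
proof -
  obtain w where w: "w \<in> eseg Sk d v" "w \<noteq> v" using assms by (auto simp: dir_def)
  have c: "crd (\<not> d) v = crd (\<not> d) w" using w by (simp add: eseg_def)
  have "closed_segment v w \<subseteq> eseg Sk d v"
  proof
    fix u assume u: "u \<in> closed_segment v w"
    then have "closed_segment v u \<subseteq> closed_segment v w" by (simp add: subset_closed_segment)
    moreover have "crd (\<not> d) u = crd (\<not> d) v" using u unfolding aligned_segment[OF c] by simp
    ultimately show "u \<in> eseg Sk d v" using w by (auto simp: eseg_def)
  qed
  then have "closed_segment (crd d v) (crd d w) \<subseteq> crd d ` eseg Sk d v" using crd_segment by (metis image_mono)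
  moreover have "crd d v \<noteq> crd d w" using w c point_eqI by metis
  ultimately show ?thesis by (meson finite_closed_segment finite_subset)
qed

lemma eseg_mono: "Sk \<subseteq> Sk' \<Longrightarrow> eseg Sk d v \<subseteq> eseg Sk' d v" by (auto simp: eseg_def)
lemma dir_mono: "Sk \<subseteq> Sk' \<Longrightarrow> dir Sk d v \<Longrightarrow> dir Sk' d v" using eseg_mono unfolding dir_def by blast

lemma ledges_at: assumes "e \<in> ledges Sk d" "p \<in> e" shows "e = eseg Sk d p" "dir Sk d p"
  using assms eseg_eq dir_eseg unfolding ledges_def verts_def by blast+

text \<open>Two segments of the same direction with a common point coincide, because segments are continued as far as the
skeleton goes (\<open>ledges_at\<close>).\<close>

lemma line_system_verts: assumes "finite (verts Sk)" shows "line_system (verts Sk) (ledges Sk)"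
  unfolding line_system_def
proof (intro conjI allI ballI)
  show "finite (ledges Sk d)" for d using assms by (simp add: ledges_def)
  show "\<exists>!e. e \<in> ledges Sk d \<and> p \<in> e" if "p \<in> verts Sk" for d p
    proof -
    have "dir Sk d p" using that by (simp add: verts_def)
    then have "eseg Sk d p \<in> ledges Sk d \<and> p \<in> eseg Sk d p" using that dir_self(2) by (simp add: ledges_def)
    then show ?thesis using ledges_at(1)[of _ Sk d p] by blast
  qed
  show "crd (\<not> d) p = crd (\<not> d) q" if "e \<in> ledges Sk d" "p \<in> e" "q \<in> e" for d e p q
    using that by (auto simp: ledges_def eseg_def)
qed (rule assms)

section \<open>Cells of a grid\<close>

text \<open>A cell is given by its lower left and its upper right corner. The rectangle itself is \<open>cellset
K\<close>.\<close>

type_synonym cell = "(real \<times> real) \<times> (real \<times> real)"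

definition lo :: "bool \<Rightarrow> cell \<Rightarrow> real" where "lo d K = crd d (fst K)"
definition hi :: "bool \<Rightarrow> cell \<Rightarrow> real" where "hi d K = crd d (snd K)"
definition md :: "bool \<Rightarrow> cell \<Rightarrow> real" where "md d K = (lo d K + hi d K) / 2"

definition cellset :: "cell \<Rightarrow> (real \<times> real) set" where "cellset K = {p. \<forall>d. lo d K \<le> crd d p \<and> crd d p \<le> hi d K}"

definition opencell :: "cell \<Rightarrow> (real \<times> real) set" where "opencell K = {p. \<forall>d. lo d K < crd d p \<and> crd d p < hi d K}"

definition gcell :: "(bool \<Rightarrow> real set) \<Rightarrow> cell \<Rightarrow> bool" where
  "gcell G K \<longleftrightarrow> (\<forall>d. consecutive (G d) (lo d K) (hi d K))"

definition mid :: "bool \<Rightarrow> cell \<Rightarrow> (real \<times> real) set" where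
  "mid d K = {x. crd (\<not> d) x = md (\<not> d) K \<and> lo d K \<le> crd d x \<and> crd d x \<le> hi d K}"

text \<open>Cells of the same grid that are adjacent in direction \<open>d\<close>, so that their middle segments of
direction \<open>d\<close> continue each other.\<close>

definition nbr :: "bool \<Rightarrow> cell \<Rightarrow> cell \<Rightarrow> bool" where
  "nbr d K L \<longleftrightarrow> lo (\<not> d) K = lo (\<not> d) L \<and> hi (\<not> d) K = hi (\<not> d) L \<and> (hi d K = lo d L \<or> hi d L = lo d K)"

definition side :: "bool \<Rightarrow> cell \<Rightarrow> (real \<times> real) set" where
  "side d K = {x. crd d x \<in> {lo d K, hi d K} \<and> lo (\<not> d) K \<le> crd (\<not> d) x \<and> crd (\<not> d) x \<le> hi (\<not> d) K}"

text \<open>It vanishes on the boundary of the cell and is quadratic along axis-parallel lines inside it: the source of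
the additional relation of an isolated cell.\<close>

definition bubble :: "cell \<Rightarrow> real \<times> real \<Rightarrow> real" where
  "bubble K p = (if \<forall>d. lo d K \<le> crd d p \<and> crd d p \<le> hi d K
     then (crd True p - lo True K) * (crd True p - hi True K) * ((crd False p - lo False K) * (crd False p - hi False K)) else 0)"

lemma cell_eqI: "(\<And>d. lo d K = lo d L) \<Longrightarrow> (\<And>d. hi d K = hi d L) \<Longrightarrow> K = L"
  unfolding lo_def hi_def by (metis point_eqI prod_eqI)

lemma cell_eqI2: "lo d K = lo d L \<Longrightarrow> hi d K = hi d L \<Longrightarrow> lo (\<not> d) K = lo (\<not> d) L \<Longrightarrow> hi (\<not> d) K = hi (\<not> d) L \<Longrightarrow> K = L"
  unfolding lo_def hi_def by (metis point_eqI prod_eqI)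

lemma cellset_cbox: "cellset (p, q) = cbox p q" "opencell (p, q) = box p q"
  by (cases p; cases q; auto simp: cellset_def opencell_def lo_def hi_def crd_def all_bool_eq mem_box Basis_prod_def inner_prod_def ball_Un)+

lemma cellset_iff: "p \<in> cellset K \<longleftrightarrow> lo d K \<le> crd d p \<and> crd d p \<le> hi d K \<and> lo (\<not> d) K \<le> crd (\<not> d) p \<and> crd (\<not> d) p \<le> hi (\<not> d) K"
  unfolding cellset_def using bool_quantifiers(1)[of _ d] by auto

lemma opencell_iff: "p \<in> opencell K \<longleftrightarrow> lo d K < crd d p \<and> crd d p < hi d K \<and> lo (\<not> d) K < crd (\<not> d) p \<and> crd (\<not> d) p < hi (\<not> d) K"
  unfolding opencell_def using bool_quantifiers(1)[of _ d] by auto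

lemma interior_cellset: "interior (cellset K) = opencell K"
  by (cases K) (simp add: cellset_cbox interior_cbox)

lemma frontier_cellset: "frontier (cellset K) = cellset K - opencell K"
  by (cases K) (simp add: cellset_cbox frontier_cbox)

lemma closed_cellset: "closed (cellset K)" "compact (cellset K)"
  by (cases K; simp add: cellset_cbox closed_cbox)+

lemma opencell_cellset: "opencell K \<subseteq> cellset K" by (auto simp: opencell_def cellset_def less_imp_le)

lemma opencell_nonempty: assumes "opencell K \<noteq> {}" shows "lo d K < hi d K"
  using assms by (auto simp: opencell_def) (meson order.strict_trans)

lemma closure_opencell: assumes "opencell K \<noteq> {}" shows "closure (opencell K) = cellset K"
  using assms by (cases K) (simp add: cellset_cbox closure_box)

lemma cellset_injective: "cellset C = cellset C' \<Longrightarrow> opencell C \<noteq> {} \<Longrightarrow> C = C'"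
  using eq_cbox[of "fst C" "snd C" "fst C'" "snd C'"] opencell_cellset[of C]
  by (cases C; cases C') (auto simp: cellset_cbox)

lemma consecutive_unique:
  assumes "consecutive X a b" "consecutive X a' b'" "a < s" "s < b" "a' \<le> s" "s \<le> b'"
  shows "a' = a" "b' = b"
proof -
  have i: "x \<in> X \<Longrightarrow> \<not> (a < x \<and> x < b)" "x \<in> X \<Longrightarrow> \<not> (a' < x \<and> x < b')" "a \<in> X" "b \<in> X" "a' \<in> X" "b' \<in> X" for x
    using assms(1,2) by (auto simp: consecutive_def)
  show "a' = a" "b' = b" using i(1)[of a'] i(1)[of b'] i(2)[of a] i(2)[of b] i(3-) assms(3-) by linarith+
qed

lemma finite_gcells: assumes "\<And>d. finite (G d)" shows "finite {K. gcell G K}"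
proof (rule finite_subset)
  show "{K. gcell G K} \<subseteq> {p. crd True p \<in> G True \<and> crd (\<not> True) p \<in> G False} \<times> {p. crd True p \<in> G True \<and> crd (\<not> True) p \<in> G False}"
    by (auto simp: gcell_def consecutive_def lo_def hi_def mem_Times_iff)
qed (intro finite_cartesian_product finite_product_points assms)

lemma gcell_less: "gcell G K \<Longrightarrow> lo d K < md d K" "gcell G K \<Longrightarrow> md d K < hi d K" "gcell G K \<Longrightarrow> lo d K < hi d K"
  unfolding gcell_def consecutive_def md_def by (auto simp: field_simps)

lemma gcell_nonempty: "gcell H C \<Longrightarrow> opencell C \<noteq> {}"
proof -
  assume "gcell H C"
  then have "lo d C < hi d C" for d using gcell_less(3) by blast
  then have "pt True (md True C) (md False C) \<in> opencell C"
    by (auto simp: opencell_def all_bool_eq md_def) (simp_all add: pt_def crd_def field_simps)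
  then show ?thesis by blast
qed

lemma gcell_gap: "gcell G K \<Longrightarrow> s \<in> G d \<Longrightarrow> lo d K \<le> s \<Longrightarrow> s \<le> hi d K \<Longrightarrow> s = lo d K \<or> s = hi d K"
proof -
  assume a: "gcell G K" "s \<in> G d" "lo d K \<le> s" "s \<le> hi d K"
  have "consecutive (G d) (lo d K) (hi d K)" using a(1) unfolding gcell_def by blast
  then have "s \<notin> {lo d K<..<hi d K}" using a(2) unfolding consecutive_def by blast
  then show ?thesis using a by auto
qed

lemma md_notin: "gcell G K \<Longrightarrow> md d K \<notin> G d"
  using gcell_gap[of G K "md d K" d] gcell_less[of G K d] by auto

lemma gcell_unique:
  "gcell G K \<Longrightarrow> gcell G L \<Longrightarrow> lo d K < s \<Longrightarrow> s < hi d K \<Longrightarrow> lo d L \<le> s \<Longrightarrow> s \<le> hi d L \<Longrightarrow> lo d L = lo d K \<and> hi d L = hi d K"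
  using consecutive_unique[of "G d" "lo d K" "hi d K" "lo d L" "hi d L" s] unfolding gcell_def by blast

lemma mid_crd: "x \<in> mid d K \<longleftrightarrow> crd (\<not> d) x = md (\<not> d) K \<and> lo d K \<le> crd d x \<and> crd d x \<le> hi d K"
  by (simp add: mid_def)

lemma mid_segment: "gcell G K \<Longrightarrow> p \<in> mid d K \<Longrightarrow> q \<in> mid d K \<Longrightarrow> closed_segment p q \<subseteq> mid d K"
  by (subst aligned_segment[of d]) (auto simp: mid_def closed_segment_eq_real_ivl split: if_splits)

lemma closed_mid: "closed (mid d K)"
proof -
  have "mid d K = {x. crd (\<not> d) x = md (\<not> d) K} \<inter> {x. lo d K \<le> crd d x} \<inter> {x. crd d x \<le> hi d K}" by (auto simp: mid_def)
  then show ?thesis by (auto intro!: closed_Int closed_Collect_le closed_Collect_eq continuous_intros)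
qed

section \<open>A refinement step of a skeleton\<close>

text \<open>One refinement step, seen through skeletons. \<open>A d\<close> consists of the cells cut by their middle
segment of direction \<open>d\<close>. In a classical mesh \<open>A True = A False\<close>; in an extension
the cells crossed by an arm are cut in one direction only, and \<open>lonely\<close> says that a cell whose
cut is not continued into a neighbour is cut in both directions. The grid \<open>G\<close> contains all lines
of the level, in particular those of cells subdivided at this level, and the middle segments are not on these
lines.\<close>

locale skeleton_refinement =
  fixes Sk Sk' :: "(real \<times> real) set" and G :: "bool \<Rightarrow> real set" and A :: "bool \<Rightarrow> cell set"
  assumes finG: "\<And>d. finite (G d)" and closedSk: "closed Sk"
    and lines: "\<And>p. p \<in> Sk \<Longrightarrow> \<exists>d. crd d p \<in> G d"
    and has_vertex: "\<And>d v. dir Sk d v \<Longrightarrow> \<exists>w\<in>eseg Sk d v. w \<in> verts Sk"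
    and cells: "\<And>d K. K \<in> A d \<Longrightarrow> gcell G K"
    and sides: "\<And>d K. K \<in> A d \<Longrightarrow> side d K \<subseteq> Sk"
    and lonely: "\<And>d K. K \<in> A d \<Longrightarrow> (\<And>L. L \<in> A d \<Longrightarrow> \<not> nbr d K L) \<Longrightarrow> K \<in> A (\<not> d)"
    and Sk'_def: "Sk' = Sk \<union> (\<Union>d. \<Union>K\<in>A d. mid d K)"
begin

lemma finA: "finite (A d)"
  by (rule finite_subset[OF _ finite_gcells[of G]]) (use cells finG in auto)

lemma sub: "Sk \<subseteq> Sk'" using Sk'_def by auto
lemma mid_sub: "K \<in> A d \<Longrightarrow> mid d K \<subseteq> Sk'" using Sk'_def by auto

lemma dir_level: assumes "dir Sk d v" shows "crd (\<not> d) v \<in> G (\<not> d)"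
proof (rule ccontr)
  assume n: "crd (\<not> d) v \<notin> G (\<not> d)"
  obtain w where w: "w \<noteq> v" "crd (\<not> d) v = crd (\<not> d) w" "closed_segment v w \<subseteq> Sk"
    using assms by (auto simp: dir_def eseg_def)
  have "closed_segment v w \<subseteq> {} \<union> {p. crd d p \<in> G d \<and> crd (\<not> d) p \<in> {crd (\<not> d) v}}"
  proof
    fix p assume p: "p \<in> closed_segment v w"
    then have "crd (\<not> d) p = crd (\<not> d) v" using aligned_segment[OF w(2)] by auto
    moreover obtain d' where "crd d' p \<in> G d'" using lines p w by blast
    ultimately show "p \<in> {} \<union> {p. crd d p \<in> G d \<and> crd (\<not> d) p \<in> {crd (\<not> d) v}}"
      using n by (cases "d' = d") auto
  qed
  moreover have "finite {p. crd d p \<in> G d \<and> crd (\<not> d) p \<in> {crd (\<not> d) v}}"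
    by (rule finite_product_points) (auto simp: finG)
  ultimately have "closed_segment v w \<subseteq> {}" using segment_subset_closed[OF w(1)[symmetric] closed_empty] by blast
  then show False by auto
qed

lemma verts_grid: "v \<in> verts Sk \<Longrightarrow> crd d v \<in> G d"
  using dir_level[of "\<not> d" v] unfolding verts_def by auto

text \<open>Middle segments of direction \<open>d\<close> are off the lines of \<open>G\<close>, and those of the other
direction meet a line of \<open>G\<close> in finitely many points.\<close>

lemma old_level:
  assumes "crd (\<not> d) v \<in> G (\<not> d)" "w \<in> eseg Sk' d v" "w \<noteq> v"
  shows "w \<in> eseg Sk d v"
proof -
  have w: "crd (\<not> d) v = crd (\<not> d) w" "closed_segment v w \<subseteq> Sk'" using assms by (auto simp: eseg_def)
  have "closed_segment v w \<subseteq> Sk \<union> {p. crd d p \<in> md d ` A (\<not> d) \<and> crd (\<not> d) p \<in> {crd (\<not> d) v}}"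
  proof
    fix p assume p: "p \<in> closed_segment v w"
    then have pc: "crd (\<not> d) p = crd (\<not> d) v" using aligned_segment[OF w(1)] by auto
    have "p \<in> Sk \<or> (\<exists>d'. \<exists>K\<in>A d'. p \<in> mid d' K)" using p w unfolding Sk'_def by blast
    then show "p \<in> Sk \<union> {p. crd d p \<in> md d ` A (\<not> d) \<and> crd (\<not> d) p \<in> {crd (\<not> d) v}}"
    proof
      assume "\<exists>d'. \<exists>K\<in>A d'. p \<in> mid d' K"
      then obtain d' K where K: "K \<in> A d'" "p \<in> mid d' K" by blast
      have "d' \<noteq> d"
      proof
        assume "d' = d"
        then show False using K pc assms(1) md_notin[OF cells[OF K(1)], of "\<not> d"] by (simp add: mid_crd)
      qed
      then have "d' = (\<not> d)" by auto
      then show ?thesis using K pc by (auto simp: mid_crd)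
    qed auto
  qed
  moreover have "finite {p. crd d p \<in> md d ` A (\<not> d) \<and> crd (\<not> d) p \<in> {crd (\<not> d) v}}"
    by (rule finite_product_points) (auto simp: finA)
  ultimately have "closed_segment v w \<subseteq> Sk" using segment_subset_closed[OF assms(3)[symmetric] closedSk] by blast
  then show ?thesis using w by (auto simp: eseg_def)
qed

text \<open>The same argument off the lines of \<open>G\<close>: a line there meets the old skeleton and the middle
segments of the other direction in finitely many points.\<close>

lemma new_level: assumes "crd (\<not> d) v \<notin> G (\<not> d)" "w \<in> eseg Sk' d v" "w \<noteq> v"
  shows "closed_segment v w \<subseteq> (\<Union>K\<in>A d. mid d K)"
proof -
  have w: "crd (\<not> d) v = crd (\<not> d) w" "closed_segment v w \<subseteq> Sk'" using assms by (auto simp: eseg_def)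
  have "closed_segment v w \<subseteq> (\<Union>K\<in>A d. mid d K) \<union> {p. crd d p \<in> G d \<union> md d ` A (\<not> d) \<and> crd (\<not> d) p \<in> {crd (\<not> d) v}}"
  proof
    fix p assume p: "p \<in> closed_segment v w"
    then have pc: "crd (\<not> d) p = crd (\<not> d) v" using aligned_segment[OF w(1)] by auto
    have "p \<in> Sk \<or> (\<exists>d'. \<exists>K\<in>A d'. p \<in> mid d' K)" using p w unfolding Sk'_def by blast
    then show "p \<in> (\<Union>K\<in>A d. mid d K) \<union> {p. crd d p \<in> G d \<union> md d ` A (\<not> d) \<and> crd (\<not> d) p \<in> {crd (\<not> d) v}}"
    proof
      assume "p \<in> Sk"
      then obtain d' where "crd d' p \<in> G d'" using lines by blast
      then show ?thesis using pc assms(1) by (cases "d' = d") auto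
    next
      assume "\<exists>d'. \<exists>K\<in>A d'. p \<in> mid d' K"
      then obtain d' K where K: "K \<in> A d'" "p \<in> mid d' K" by blast
      then show ?thesis using pc by (cases "d' = d") (auto simp: mid_crd)
    qed
  qed
  moreover have "finite {p. crd d p \<in> G d \<union> md d ` A (\<not> d) \<and> crd (\<not> d) p \<in> {crd (\<not> d) v}}"
    by (rule finite_product_points) (auto simp: finG finA)
  moreover have "closed (\<Union>K\<in>A d. mid d K)" by (intro closed_UN finA ballI closed_mid)
  ultimately show ?thesis using segment_subset_closed[OF assms(3)[symmetric]] by blast
qed

lemma mid_dir: assumes "K \<in> A d" "p \<in> mid d K" shows "mid d K \<subseteq> eseg Sk' d p" "dir Sk' d p"
proof -
  show 1: "mid d K \<subseteq> eseg Sk' d p"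
    using mid_segment[OF cells[OF assms(1)] assms(2)] mid_sub[OF assms(1)] assms(2)
    by (fastforce simp: eseg_def mid_crd)
  have "pt d (lo d K) (md (\<not> d) K) \<in> mid d K" "pt d (hi d K) (md (\<not> d) K) \<in> mid d K"
    using gcell_less[OF cells[OF assms(1)]] by (auto simp: mid_crd less_imp_le)
  moreover have "pt d (lo d K) (md (\<not> d) K) \<noteq> pt d (hi d K) (md (\<not> d) K)"
    using gcell_less(3)[OF cells[OF assms(1)], of d] crd_pt(1) by (metis less_irrefl)
  ultimately show "dir Sk' d p" using 1 unfolding dir_def by (metis subsetD)
qed

text \<open>Hence a new segment is old or consists of middle segments, and old segments are not prolonged
(\<open>eseg_old\<close>): the old l-edges remain l-edges.\<close>

lemma dir': "dir Sk' d v \<longleftrightarrow> dir Sk d v \<or> (\<exists>K\<in>A d. v \<in> mid d K)"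
proof
  assume "dir Sk' d v"
  then obtain w where w: "w \<in> eseg Sk' d v" "w \<noteq> v" by (auto simp: dir_def)
  show "dir Sk d v \<or> (\<exists>K\<in>A d. v \<in> mid d K)"
    using old_level[OF _ w] new_level[OF _ w] w unfolding dir_def by blast
qed (use mid_dir dir_mono[OF sub] in blast)

lemma verts_sub: "verts Sk \<subseteq> verts Sk'" using dir_mono[OF sub] by (auto simp: verts_def)

lemma eseg_old: assumes "dir Sk d v" shows "eseg Sk' d v = eseg Sk d v"
  using old_level[OF dir_level[OF assms]] eseg_mono[OF sub] dir_self(2)[OF assms] by blast

lemma ledges_sub: "ledges Sk d \<subseteq> ledges Sk' d"
  using eseg_old verts_sub unfolding ledges_def verts_def by blast

lemma new_ledge: assumes "e \<in> ledges Sk' d - ledges Sk d" "p \<in> e"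
  shows "crd (\<not> d) p \<notin> G (\<not> d)" "\<exists>K\<in>A d. p \<in> mid d K \<and> mid d K \<subseteq> e"
proof -
  have e: "e = eseg Sk' d p" "dir Sk' d p" using assms ledges_at by blast+
  show 1: "crd (\<not> d) p \<notin> G (\<not> d)"
  proof
    assume "crd (\<not> d) p \<in> G (\<not> d)"
    then have dp: "dir Sk d p" using old_level e(2) unfolding dir_def by blast
    then obtain w where w: "w \<in> eseg Sk d p" "w \<in> verts Sk" using has_vertex by blast
    then have "eseg Sk d w = e" using eseg_eq eseg_old[OF dp] e(1) by auto
    then show False using w assms by (auto simp: ledges_def)
  qed
  obtain w where w: "w \<in> eseg Sk' d p" "w \<noteq> p" using e(2) by (auto simp: dir_def)
  then obtain K where "K \<in> A d" "p \<in> mid d K" using new_level[OF 1 w] by auto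
  then show "\<exists>K\<in>A d. p \<in> mid d K \<and> mid d K \<subseteq> e" using mid_dir e by blast
qed

abbreviation "old_on d e \<equiv> on_old (verts Sk') (ledges Sk) d e"

text \<open>The ends of each middle segment lie on sides of its cell, hence on old segments of the other direction; these
are the only points of a new l-edge with a coordinate in \<open>G d\<close>.\<close>

lemma old_on: assumes "e \<in> ledges Sk' d - ledges Sk d" shows "old_on d e = {p \<in> e. crd d p \<in> G d}"
proof (intro set_eqI iffI)
  fix p assume "p \<in> old_on d e"
  then obtain e' where "p \<in> e" "e' \<in> ledges Sk (\<not> d)" "p \<in> e'" unfolding on_old_def by blast
  then show "p \<in> {p \<in> e. crd d p \<in> G d}" using ledges_at(2) dir_level[of "\<not> d" p] by auto
next
  fix p assume "p \<in> {p \<in> e. crd d p \<in> G d}"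
  then have p: "p \<in> e" "crd d p \<in> G d" by auto
  obtain K where K: "K \<in> A d" "p \<in> mid d K" using new_ledge(2)[OF assms p(1)] by blast
  have g: "gcell G K" using cells K by blast
  have s: "crd d p \<in> {lo d K, hi d K}" using gcell_gap[OF g p(2)] K(2) by (auto simp: mid_crd)
  define q where "q = pt d (crd d p) (lo (\<not> d) K)"
  have q: "crd d q = crd d p" "crd (\<not> d) q = lo (\<not> d) K" by (auto simp: q_def)
  have m: "crd (\<not> d) p = md (\<not> d) K" using K by (simp add: mid_crd)
  have "q \<noteq> p" using q m gcell_less[OF g, of "\<not> d"] by auto
  moreover have "closed_segment p q \<subseteq> side d K"
    using aligned_segment[of "\<not> d" p q] q m gcell_less[OF g, of "\<not> d"] s
    by (auto simp: side_def closed_segment_eq_real_ivl)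
  ultimately have dp: "dir Sk (\<not> d) p"
    unfolding dir_def using sides[OF K(1)] q by (intro bexI[of _ q]) (auto simp: eseg_def)
  then obtain w where w: "w \<in> eseg Sk (\<not> d) p" "w \<in> verts Sk" using has_vertex by blast
  have pe: "p \<in> eseg Sk (\<not> d) w" using eseg_eq[OF w(1)] dir_self(2)[OF dp] by simp
  have "dir Sk' d p" "dir Sk' (\<not> d) p" using dp dir_mono[OF sub] mid_dir K by blast+
  then have "p \<in> verts Sk'" using verts_iff by blast
  then show "p \<in> old_on d e" unfolding on_old_def ledges_def using p pe w by auto
qed

text \<open>The segment of the other direction through \<open>p\<close> is off the grid, hence also made of middle
segments; the two middle segments through \<open>p\<close> belong to the same cell.\<close>

lemma new_on:
  assumes e: "e \<in> ledges Sk' d - ledges Sk d" and p: "p \<in> verts Sk'" "p \<in> e" "p \<notin> old_on d e"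
  shows "\<exists>K\<in>A d. K \<in> A (\<not> d) \<and> crd d p = md d K \<and> crd (\<not> d) p = md (\<not> d) K \<and> mid d K \<subseteq> e"
proof -
  obtain K where K: "K \<in> A d" "p \<in> mid d K" "mid d K \<subseteq> e" using new_ledge(2)[OF e p(2)] by blast
  have nG: "crd d p \<notin> G d" using p old_on[OF e] by auto
  have "dir Sk' (\<not> d) p" using p by (auto simp: verts_def)
  moreover have "\<not> dir Sk (\<not> d) p" using nG dir_level[of "\<not> d" p] by auto
  ultimately obtain L where L: "L \<in> A (\<not> d)" "p \<in> mid (\<not> d) L" using dir' by blast
  have g: "gcell G K" "gcell G L" using cells K L by auto
  have present: "lo d K \<in> G d" "hi d K \<in> G d" using g by (auto simp: gcell_def consecutive_def)
  have l: "lo d K < crd d p" "crd d p < hi d K"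
    using K(2) nG present by (auto simp: mid_crd order.strict_iff_order)
  have "crd d p = md d L" "lo (\<not> d) L \<le> crd (\<not> d) p" "crd (\<not> d) p \<le> hi (\<not> d) L" "crd (\<not> d) p = md (\<not> d) K"
    using K L by (auto simp: mid_crd)
  moreover from this have "L = K"
    using gcell_unique[OF g l] gcell_less[OF g(2), of d]
      gcell_unique[OF g, of "\<not> d" "crd (\<not> d) p"] gcell_less[OF g(1), of "\<not> d"]
    by (intro cell_eqI2[of d]) auto
  ultimately show ?thesis using K L by auto
qed

definition left_end where "left_end d K = pt d (lo d K) (md (\<not> d) K)"
definition right_end where "right_end d K = pt d (hi d K) (md (\<not> d) K)"

lemma ends:
  assumes "K \<in> A d"
  shows "left_end d K \<in> mid d K" "right_end d K \<in> mid d K" "crd d (left_end d K) \<in> G d" "crd d (right_end d K) \<in> G d"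
   "left_end d K \<noteq> right_end d K"
proof -
  have g: "gcell G K" using cells assms by blast
  show "left_end d K \<in> mid d K" "right_end d K \<in> mid d K" "crd d (left_end d K) \<in> G d" "crd d (right_end d K) \<in> G d"
    using less_imp_le[OF gcell_less(3)[OF g, of d]] g by (auto simp: mid_crd left_end_def right_end_def gcell_def consecutive_def)
  show "left_end d K \<noteq> right_end d K" using gcell_less(3)[OF g, of d] crd_pt(1) unfolding left_end_def right_end_def by (metis less_irrefl)
qed

lemma ends_old_on:
  assumes e: "e \<in> ledges Sk' d - ledges Sk d" and K: "K \<in> A d" "mid d K \<subseteq> e"
  shows "{left_end d K, right_end d K} \<subseteq> old_on d e"
  using ends[OF K(1)] K(2) old_on[OF e] by auto

lemma finV': "finite (verts Sk')"
proof (rule finite_subset)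
  show "verts Sk' \<subseteq> {p. crd True p \<in> G True \<union> md True ` A False \<and> crd (\<not> True) p \<in> G False \<union> md False ` A True}"
    using dir'[of False] dir'[of True] dir_level[of True] dir_level[of False] by (auto simp: verts_def mid_crd) blast+
qed (rule finite_product_points; auto simp: finG finA)

lemma finV: "finite (verts Sk)" using finV' verts_sub finite_subset by blast

lemma fin_old_on: "finite (old_on d e)" using finV' by (simp add: on_old_def)

lemma ledge_nonempty:
  assumes "e \<in> ledges Sk' d - ledges Sk d" obtains K where "K \<in> A d" "mid d K \<subseteq> e"
proof -
  obtain v where "e = eseg Sk' d v" "dir Sk' d v" using assms by (auto simp: ledges_def verts_def)
  then have "v \<in> e" using dir_self by auto
  then show ?thesis using new_ledge(2)[OF assms] that by blast
qed

lemma two_old: assumes e: "e \<in> ledges Sk' d - ledges Sk d" shows "2 \<le> card (old_on d e)"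
proof -
  obtain K where K: "K \<in> A d" "mid d K \<subseteq> e" using ledge_nonempty[OF e] .
  have "card {left_end d K, right_end d K} = 2" using ends(5)[OF K(1)] by simp
  then show ?thesis using card_mono[OF fin_old_on ends_old_on[OF e K]] by simp
qed

lemma small_eq:
  assumes e: "e \<in> ledges Sk' d - ledges Sk d" and K: "K \<in> A d" "mid d K \<subseteq> e" and c: "card (old_on d e) = 2"
  shows "old_on d e = {left_end d K, right_end d K}"
  using card_subset_eq[OF fin_old_on ends_old_on[OF e K]] c ends(5)[OF K(1)] by simp

text \<open>Each cell along a new l-edge contributes both ends of its middle segment. With only two such points, the
l-edge consists of one cell; this cell has no neighbour that is cut in the same direction
(\<open>small_lonely\<close>), so that it is cut in both directions and its centre is the only other vertex
(\<open>small_centre\<close>).\<close>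

lemma small_unique: assumes e: "e \<in> ledges Sk' d - ledges Sk d" and c: "card (old_on d e) = 2"
  and K: "K \<in> A d" "mid d K \<subseteq> e" and L: "L \<in> A d" "mid d L \<subseteq> e"
  shows "L = K"
proof -
  have "{left_end d K, right_end d K} = {left_end d L, right_end d L}" using small_eq[OF e K c] small_eq[OF e L c] by simp
  then have "crd d ` {left_end d K, right_end d K} = crd d ` {left_end d L, right_end d L}" by simp
  then have s: "{lo d K, hi d K} = {lo d L, hi d L}" by (simp add: left_end_def right_end_def)
  have g: "gcell G K" "gcell G L" using cells K L by auto
  have 1: "lo d L = lo d K" "hi d L = hi d K" using s gcell_less(3)[OF g(1), of d] gcell_less(3)[OF g(2), of d]
    by (auto simp: doubleton_eq_iff)
  have "left_end d K \<in> e" "left_end d L \<in> e" using ends(1) K L by blast+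
  then have "crd (\<not> d) (left_end d K) = crd (\<not> d) (left_end d L)" using e by (auto simp: ledges_def eseg_def)
  then have m: "md (\<not> d) K = md (\<not> d) L" by (simp add: left_end_def)
  show ?thesis using 1 gcell_unique[OF g, of "\<not> d" "md (\<not> d) K"] gcell_less[OF g(1), of "\<not> d"] gcell_less[OF g(2), of "\<not> d"] m
    by (intro cell_eqI2[of d]) auto
qed

lemma small_lonely: assumes e: "e \<in> ledges Sk' d - ledges Sk d" and c: "card (old_on d e) = 2"
  and K: "K \<in> A d" "mid d K \<subseteq> e" and L: "L \<in> A d"
  shows "\<not> nbr d K L"
proof
  assume n: "nbr d K L"
  then have m: "md (\<not> d) K = md (\<not> d) L" unfolding nbr_def md_def by simp
  have g: "lo d L < hi d L" "lo d K < hi d K" using gcell_less(3)[OF cells] L K by blast+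
  have "right_end d K = left_end d L \<or> right_end d L = left_end d K" using n m unfolding nbr_def right_end_def left_end_def by auto
  then obtain x where x: "x \<in> mid d K" "x \<in> mid d L" using ends[OF K(1)] ends[OF L] by metis
  have "e = eseg Sk' d x" using ledges_at(1) e x K by blast
  then have "mid d L \<subseteq> e" using mid_dir(1)[OF L x(2)] by simp
  then have "L = K" using small_unique[OF e c K L] by simp
  then show False using n g unfolding nbr_def by auto
qed

lemma small_centre: assumes e: "e \<in> ledges Sk' d - ledges Sk d" and c: "card (old_on d e) = 2"
  shows "\<exists>z. verts Sk' \<inter> e - old_on d e = {z}"
proof -
  obtain K where K: "K \<in> A d" "mid d K \<subseteq> e" using ledge_nonempty[OF e] .
  have KA: "K \<in> A (\<not> d)" using lonely[OF K(1)] small_lonely[OF e c K] by blast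
  have g: "gcell G K" using cells K by auto
  define z where "z = pt d (md d K) (md (\<not> d) K)"
  have zm: "z \<in> mid d K" "z \<in> mid (\<not> d) K" using gcell_less[OF g] by (auto simp: z_def mid_crd less_imp_le)
  then have "dir Sk' d z" "dir Sk' (\<not> d) z" using mid_dir K KA by blast+
  then have zv: "z \<in> verts Sk'" using verts_iff by blast
  have zo: "z \<notin> old_on d e" using old_on[OF e] md_notin[OF g] by (simp add: z_def)
  have "p = z" if p: "p \<in> verts Sk' \<inter> e - old_on d e" for p
  proof -
    obtain L where L: "L \<in> A d" "crd d p = md d L" "crd (\<not> d) p = md (\<not> d) L" "mid d L \<subseteq> e"
      using new_on[OF e] p by blast
    then have "L = K" using small_unique[OF e c K] by blast
    then show ?thesis using L by (intro point_eqI[of d]) (auto simp: z_def)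
  qed
  then have "verts Sk' \<inter> e - old_on d e = {z}" using zv zo zm K by blast
  then show ?thesis by blast
qed

text \<open>Beyond an end of the middle segment the skeleton would have to follow the middle segment of a cell that begins
at this end, hence of a neighbour.\<close>

lemma isolated_edge:
  assumes K: "K \<in> A d" and n: "\<And>L. L \<in> A d \<Longrightarrow> \<not> nbr d K L" and p: "p \<in> mid d K"
  shows "eseg Sk' d p = mid d K"
proof
  show "mid d K \<subseteq> eseg Sk' d p" using mid_dir[OF K p] by blast
  show "eseg Sk' d p \<subseteq> mid d K"
  proof (rule ccontr)
    assume "\<not> eseg Sk' d p \<subseteq> mid d K"
    then obtain w where w: "w \<in> eseg Sk' d p" "w \<notin> mid d K" by auto
    have g: "gcell G K" using cells K by auto
    have pl: "crd (\<not> d) p = md (\<not> d) K" using p by (simp add: mid_crd)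
    have nG: "crd (\<not> d) p \<notin> G (\<not> d)" using md_notin[OF g] pl by simp
    have wp: "w \<noteq> p" using w p by auto
    have cov: "closed_segment p w \<subseteq> (\<Union>L\<in>A d. mid d L)" using new_level[OF nG w(1) wp] .
    have al: "crd (\<not> d) p = crd (\<not> d) w" using w by (simp add: eseg_def)
    have "crd d w > hi d K \<or> crd d w < lo d K" using w al pl by (auto simp: mid_crd)
    then show False
    proof
      assume h: "crd d w > hi d K"
      \<comment> \<open>a point beyond the cell, but before the next line of the grid\<close>
      let ?S = "insert (crd d w) {s \<in> G d. s > hi d K}"
      define m where "m = Min ?S"
      have fS: "finite ?S" using finG by auto
      have m: "m > hi d K" "m \<le> crd d w" "\<And>s. s \<in> G d \<Longrightarrow> s > hi d K \<Longrightarrow> m \<le> s"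
        using h fS unfolding m_def by (auto simp: Min_gr_iff)
      define s where "s = (hi d K + m) / 2"
      have s: "hi d K < s" "s < m" using m by (auto simp: s_def)
      have "pt d s (crd (\<not> d) p) \<in> closed_segment p w"
        using s m p unfolding aligned_segment[OF al] by (auto simp: closed_segment_eq_real_ivl mid_crd)
      then obtain L where L: "L \<in> A d" "pt d s (crd (\<not> d) p) \<in> mid d L" using cov by blast
      have gL: "gcell G L" using cells L by auto
      have LL: "lo d L \<le> s" "s \<le> hi d L" "md (\<not> d) L = md (\<not> d) K" using L pl by (auto simp: mid_crd)
      have "lo d L \<in> G d" "hi d K \<in> G d" using g gL by (auto simp: gcell_def consecutive_def)
      then have "lo d L = hi d K"
        using m(3)[of "lo d L"] s LL gcell_gap[OF gL, of "hi d K" d] by force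
      moreover have "lo (\<not> d) L = lo (\<not> d) K \<and> hi (\<not> d) L = hi (\<not> d) K"
        using gcell_unique[OF g gL, of "\<not> d" "md (\<not> d) K"] gcell_less[OF g, of "\<not> d"] gcell_less[OF gL, of "\<not> d"] LL by auto
      ultimately have "nbr d K L" by (auto simp: nbr_def)
      then show False using n L by blast
    next
      assume h: "crd d w < lo d K"
      let ?S = "insert (crd d w) {s \<in> G d. s < lo d K}"
      define m where "m = Max ?S"
      have fS: "finite ?S" using finG by auto
      have m: "m < lo d K" "m \<ge> crd d w" "\<And>s. s \<in> G d \<Longrightarrow> s < lo d K \<Longrightarrow> s \<le> m"
        using h fS unfolding m_def by (auto simp: Max_less_iff)
      define s where "s = (lo d K + m) / 2"
      have s: "s < lo d K" "m < s" using m by (auto simp: s_def)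
      have "pt d s (crd (\<not> d) p) \<in> closed_segment p w"
        using s m p unfolding aligned_segment[OF al] by (auto simp: closed_segment_eq_real_ivl mid_crd)
      then obtain L where L: "L \<in> A d" "pt d s (crd (\<not> d) p) \<in> mid d L" using cov by blast
      have gL: "gcell G L" using cells L by auto
      have LL: "lo d L \<le> s" "s \<le> hi d L" "md (\<not> d) L = md (\<not> d) K" using L pl by (auto simp: mid_crd)
      have "hi d L \<in> G d" "lo d K \<in> G d" using g gL by (auto simp: gcell_def consecutive_def)
      then have "hi d L = lo d K"
        using m(3)[of "hi d L"] s LL gcell_gap[OF gL, of "lo d K" d] by force
      moreover have "lo (\<not> d) L = lo (\<not> d) K \<and> hi (\<not> d) L = hi (\<not> d) K"
        using gcell_unique[OF g gL, of "\<not> d" "md (\<not> d) K"] gcell_less[OF g, of "\<not> d"] gcell_less[OF gL, of "\<not> d"] LL by auto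
      ultimately have "nbr d K L" by (auto simp: nbr_def)
      then show False using n L by blast
    qed
  qed
qed

definition isolated where "isolated = {K \<in> A True \<inter> A False. \<forall>d. \<forall>L\<in>A d. \<not> nbr d K L}"

lemma isolated_inside:
  assumes K: "K \<in> isolated" and e: "e \<in> ledges Sk' d" and p: "p \<in> e" "p \<in> opencell K"
  shows "e = mid d K"
proof -
  have KA: "K \<in> A d" and n: "\<And>L. L \<in> A d \<Longrightarrow> \<not> nbr d K L" using K by (cases d; auto simp: isolated_def)+
  have g: "gcell G K" using cells KA by auto
  have pG: "crd d' p \<notin> G d'" for d' using gcell_gap[OF g, of "crd d' p" d'] p(2) unfolding opencell_def by (auto simp: less_imp_le) (metis less_irrefl)+
  have "e \<notin> ledges Sk d" using dir_level ledges_at(2) p(1) pG by blast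
  then have e': "e \<in> ledges Sk' d - ledges Sk d" using e by auto
  obtain L where L: "L \<in> A d" "p \<in> mid d L" using new_ledge(2)[OF e' p(1)] by blast
  have gL: "gcell G L" using cells L by auto
  have ins: "lo d' K < crd d' p" "crd d' p < hi d' K" for d' using p(2) by (auto simp: opencell_def)
  have inL: "lo d L \<le> crd d p" "crd d p \<le> hi d L" "lo (\<not> d) L \<le> crd (\<not> d) p" "crd (\<not> d) p \<le> hi (\<not> d) L"
    using L(2) gcell_less[OF gL, of "\<not> d"] by (auto simp: mid_crd)
  have "L = K" using gcell_unique[OF g gL ins[of d] inL(1,2)] gcell_unique[OF g gL ins[of "\<not> d"] inL(3,4)]
    by (intro cell_eqI2[of d]) auto
  then have "p \<in> mid d K" using L by simp
  then show ?thesis using isolated_edge[OF KA n] ledges_at(1)[OF e p(1)] by simp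
qed

lemma isolated_mid: assumes K: "K \<in> isolated"
  shows "mid d K \<in> ledges Sk' d - ledges Sk d" "card (old_on d (mid d K)) = 2"
    "pt d (md d K) (md (\<not> d) K) \<in> verts Sk'"
proof -
  have KA: "K \<in> A d" and n: "\<And>L. L \<in> A d \<Longrightarrow> \<not> nbr d K L" and KA': "K \<in> A (\<not> d)" using K by (cases d; auto simp: isolated_def)+
  have g: "gcell G K" using cells KA by auto
  define z where "z = pt d (md d K) (md (\<not> d) K)"
  have zm: "z \<in> mid d K" "z \<in> mid (\<not> d) K" using gcell_less[OF g] by (auto simp: z_def mid_crd less_imp_le)
  then have "dir Sk' d z" "dir Sk' (\<not> d) z" using mid_dir KA KA' by blast+
  then show zv: "pt d (md d K) (md (\<not> d) K) \<in> verts Sk'" unfolding z_def[symmetric] using verts_iff by blast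
  have "mid d K = eseg Sk' d z" using isolated_edge[OF KA n zm(1)] by simp
  then have 1: "mid d K \<in> ledges Sk' d" using zv unfolding ledges_def z_def by blast
  moreover have "mid d K \<notin> ledges Sk d"
  proof
    assume "mid d K \<in> ledges Sk d"
    then have "crd (\<not> d) z \<in> G (\<not> d)" using ledges_at(2)[OF _ zm(1)] dir_level by blast
    then show False using md_notin[OF g] by (simp add: z_def)
  qed
  ultimately show e: "mid d K \<in> ledges Sk' d - ledges Sk d" by blast
  have "old_on d (mid d K) = {left_end d K, right_end d K}"
  proof
    show "old_on d (mid d K) \<subseteq> {left_end d K, right_end d K}"
      unfolding old_on[OF e] using gcell_gap[OF g, of _ d]
      by (auto simp: mid_crd left_end_def right_end_def intro!: point_eqI[of d]) (metis crd_pt(1) crd_pt(2) point_eqI)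
  qed (rule ends_old_on[OF e KA order_refl])
  then show "card (old_on d (mid d K)) = 2" using ends(5)[OF KA] by simp
qed

text \<open>The set \<open>I\<close> of the abstract step: vertical halves of crosses whose horizontal half has only two
points on old lines, too. By \<open>dropped_eq\<close> these are the vertical halves of the crosses in
isolated cells.\<close>

definition dropped where "dropped = {e \<in> ledges Sk' False - ledges Sk False. card (old_on False e) = 2 \<and>
       (\<exists>h\<in>ledges Sk' True - ledges Sk True. card (old_on True h) = 2 \<and> (\<exists>z\<in>verts Sk'. z \<in> e \<and> z \<in> h))}"

lemma dropped_eq: "dropped = mid False ` isolated"
proof (intro set_eqI iffI)
  fix e assume "e \<in> dropped"
  then obtain h z where e: "e \<in> ledges Sk' False - ledges Sk False" "card (old_on False e) = 2"
    and h: "h \<in> ledges Sk' True - ledges Sk True" "card (old_on True h) = 2" "z \<in> verts Sk'" "z \<in> e" "z \<in> h"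
    unfolding dropped_def by blast
  obtain K where K: "K \<in> A False" "z \<in> mid False K" "mid False K \<subseteq> e" using new_ledge(2)[OF e(1) h(4)] by blast
  obtain L where L: "L \<in> A True" "z \<in> mid True L" "mid True L \<subseteq> h" using new_ledge(2)[OF h(1) h(5)] by blast
  have g: "gcell G K" "gcell G L" using cells K L by auto
  have "L = K"
  proof (rule cell_eqI2[of True])
    show "lo True L = lo True K" "hi True L = hi True K"
      using gcell_unique[OF g, of True "crd True z"] K(2) L(2) gcell_less[OF g(1), of True] by (auto simp: mid_crd)
    show "lo (\<not> True) L = lo (\<not> True) K" "hi (\<not> True) L = hi (\<not> True) K"
      using gcell_unique[OF g(2,1), of False "crd False z"] K(2) L(2) gcell_less[OF g(2), of False] by (auto simp: mid_crd)
  qed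
  then have "K \<in> isolated" using K L small_lonely[OF e K(1,3)] small_lonely[OF h(1,2) L(1,3)]
    unfolding isolated_def by (auto, metis (full_types))
  moreover have "e = mid False K"
    using isolated_edge[OF K(1) small_lonely[OF e K(1,3)] K(2)] ledges_at(1) e h(4) by blast
  ultimately show "e \<in> mid False ` isolated" by blast
next
  fix e assume "e \<in> mid False ` isolated"
  then obtain K where K: "K \<in> isolated" "e = mid False K" by blast
  have "gcell G K" using K(1) cells unfolding isolated_def by blast
  then have "pt True (md True K) (md (\<not> True) K) \<in> mid False K \<inter> mid True K"
    using gcell_less[of G K True] gcell_less[of G K False] by (auto simp: mid_crd crd_def pt_def)
  then show "e \<in> dropped" unfolding dropped_def using isolated_mid[OF K(1)] K(2) by blast
qed

lemma card_dropped: "card dropped = card isolated"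
proof -
  have "inj_on (mid False) isolated"
  proof (rule inj_onI)
    fix K L assume KL: "K \<in> isolated" "L \<in> isolated" "mid False K = mid False L"
    then have K: "K \<in> A False" and L: "L \<in> A False" by (auto simp: isolated_def)
    have "mid False K \<subseteq> mid False L" using KL by simp
    then show "K = L" using small_unique[OF isolated_mid(1,2)[OF KL(2)] L order_refl K] by simp
  qed
  then show ?thesis unfolding dropped_eq by (rule card_image)
qed

text \<open>Apart from the two halves of the cross no l-edge of the new skeleton enters the interior of an isolated cell
(\<open>isolated_inside\<close>), and outside the interior the bubble vanishes.\<close>

lemma bubble_qcoef_zero:
  assumes K: "K \<in> isolated" and e: "e \<in> ledges Sk' d" "e \<noteq> mid d K" and j: "j \<le> 2"
  shows "qcoef (bubble K) d e j = 0"
proof -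
  have z: "bubble K p = 0" if "p \<in> e" for p
  proof -
    have "p \<notin> opencell K" using isolated_inside[OF K e(1) that] e(2) by blast
    then obtain d' where "crd d' p \<le> lo d' K \<or> hi d' K \<le> crd d' p" by (auto simp: opencell_def not_less)
    then have "(crd d' p - lo d' K) * (crd d' p - hi d' K) = 0"
      if "\<forall>d. lo d K \<le> crd d p \<and> crd d p \<le> hi d K"
      using that by (metis diff_self mult_eq_0_iff order_antisym)
    then show ?thesis by (cases d') (auto simp: bubble_def)
  qed
  obtain v where "e = eseg Sk' d v" "dir Sk' d v" using e by (auto simp: ledges_def verts_def)
  then show ?thesis using z infinite_eseg by (intro qcoef_eqI[where A = "\<lambda>_. 0", OF _ _ j]) auto
qed

lemma bubble_qcoef: assumes K: "K \<in> isolated" shows "qcoef (bubble K) False (mid False K) 2 \<noteq> 0"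
proof -
  have g: "gcell G K" using K cells unfolding isolated_def by blast
  let ?q = "(md True K - lo True K) * (md True K - hi True K)"
  let ?A = "\<lambda>j::nat. ?q * (if j = 0 then lo False K * hi False K else if j = 1 then - (lo False K + hi False K) else 1)"
  have "bubble K p = (\<Sum>j\<le>2. ?A j * crd False p ^ j)" if p: "p \<in> mid False K" for p
  proof -
    have "\<forall>d. lo d K \<le> crd d p \<and> crd d p \<le> hi d K"
      using p gcell_less[OF g, of True] by (auto simp: mid_crd all_bool_eq)
    moreover have "crd True p = md True K" using p by (simp add: mid_crd)
    ultimately show ?thesis by (simp add: bubble_def sum_atMost_2 algebra_simps power2_eq_square)
  qed
  moreover have "infinite (crd False ` mid False K)"
    using isolated_mid(1)[OF K, of False] infinite_eseg by (auto simp: ledges_def verts_def)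
  ultimately have "qcoef (bubble K) False (mid False K) 2 = ?A 2" by (intro qcoef_eqI) auto
  then show ?thesis using gcell_less[OF g, of True] by auto
qed

lemma line_refinement:
  assumes R: "\<And>K. K \<in> isolated \<Longrightarrow> bubble K \<in> R"
  shows "line_refinement (verts Sk) (verts Sk') (ledges Sk) (ledges Sk') R dropped"
proof
  show "line_system (verts Sk) (ledges Sk)" "line_system (verts Sk') (ledges Sk')"
    using line_system_verts finV finV' by auto
  show "verts Sk \<subseteq> verts Sk'" by (rule verts_sub)
  show "ledges Sk d \<subseteq> ledges Sk' d" for d by (rule ledges_sub)
  show "e \<inter> verts Sk = {}" if "e \<in> ledges Sk' d - ledges Sk d" for d e
    using new_ledge(1)[OF that] verts_grid by blast
  show "2 \<le> card (old_on d e)" if "e \<in> ledges Sk' d - ledges Sk d" for d e using two_old[OF that] .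
  show "\<exists>z. verts Sk' \<inter> e - old_on d e = {z}" if "e \<in> ledges Sk' d - ledges Sk d" "card (old_on d e) = 2" for d e
    using small_centre[OF that] .
  show "dropped = {e \<in> ledges Sk' False - ledges Sk False. card (old_on False e) = 2 \<and>
       (\<exists>h\<in>ledges Sk' True - ledges Sk True. card (old_on True h) = 2 \<and> (\<exists>z\<in>verts Sk'. z \<in> e \<and> z \<in> h))}"
    by (rule dropped_def)
  fix e assume "e \<in> dropped"
  then obtain K where K: "K \<in> isolated" "e = mid False K" unfolding dropped_eq by blast
  show "\<exists>k\<in>R. \<exists>h\<in>ledges Sk' True - ledges Sk True. qcoef k False e 2 \<noteq> 0 \<and>
       (\<forall>e'\<in>ledges Sk' True - {h}. \<forall>j\<le>2. qcoef k True e' j = 0) \<and>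
       (\<forall>e'\<in>ledges Sk' False - {e}. \<forall>j\<le>2. qcoef k False e' j = 0)"
    using R[OF K(1)] isolated_mid(1)[OF K(1), of True] bubble_qcoef[OF K(1)] bubble_qcoef_zero[OF K(1)] K(2)
    by (intro bexI[of _ "bubble K"] bexI[of _ "mid True K"]) auto
qed

end

section \<open>Tensor-product grids\<close>

definition grid_skeleton :: "(bool \<Rightarrow> real set) \<Rightarrow> (real \<times> real) set" where
  "grid_skeleton G = {p. (\<forall>d. Min (G d) \<le> crd d p \<and> crd d p \<le> Max (G d)) \<and> (\<exists>d. crd d p \<in> G d)}"

definition grid_line :: "(bool \<Rightarrow> real set) \<Rightarrow> bool \<Rightarrow> real \<Rightarrow> (real \<times> real) set" where
  "grid_line G d t = {p. crd (\<not> d) p = t \<and> Min (G d) \<le> crd d p \<and> crd d p \<le> Max (G d)}"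

locale grid =
  fixes G :: "bool \<Rightarrow> real set"
  assumes fin: "\<And>d. finite (G d)" and card2: "\<And>d. card (G d) \<ge> 2"
begin

lemma ne: "G d \<noteq> {}" using card2[of d] by auto

lemma minmax: "Min (G d) \<in> G d" "Max (G d) \<in> G d" "Min (G d) < Max (G d)" "s \<in> G d \<Longrightarrow> Min (G d) \<le> s" "s \<in> G d \<Longrightarrow> s \<le> Max (G d)"
proof -
  show 1: "Min (G d) \<in> G d" "Max (G d) \<in> G d" "s \<in> G d \<Longrightarrow> Min (G d) \<le> s" "s \<in> G d \<Longrightarrow> s \<le> Max (G d)"
    using fin ne by auto
  have "\<not> (\<exists>x. G d = {x})" using card2[of d] by auto
  then have "Min (G d) \<noteq> Max (G d)" using fin[of d] ne[of d]
    by (metis Max_ge Min_le order_antisym is_singletonI' is_singleton_def order_trans)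
  then show "Min (G d) < Max (G d)" using fin[of d] ne[of d] by (simp add: Min_le order.not_eq_order_implies_strict)
qed

lemma in_skeleton: "p \<in> grid_skeleton G \<longleftrightarrow> (\<forall>d. Min (G d) \<le> crd d p \<and> crd d p \<le> Max (G d)) \<and> (\<exists>d. crd d p \<in> G d)"
  by (simp add: grid_skeleton_def)

lemma eseg_line: assumes p: "p \<in> grid_skeleton G" "crd (\<not> d) p \<in> G (\<not> d)"
  shows "eseg (grid_skeleton G) d p = grid_line G d (crd (\<not> d) p)"
proof (intro set_eqI iffI)
  fix w assume w: "w \<in> eseg (grid_skeleton G) d p"
  then have "w \<in> grid_skeleton G" by (auto simp: eseg_def)
  then show "w \<in> grid_line G d (crd (\<not> d) p)" using w by (auto simp: grid_line_def eseg_def in_skeleton)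
next
  fix w assume w: "w \<in> grid_line G d (crd (\<not> d) p)"
  then have al: "crd (\<not> d) p = crd (\<not> d) w" by (simp add: grid_line_def)
  have "closed_segment p w \<subseteq> grid_skeleton G"
    unfolding aligned_segment[OF al] using w p minmax(4,5)
    by (auto simp: in_skeleton bool_quantifiers(1)[of _ d] bool_quantifiers(2)[of _ d] grid_line_def closed_segment_eq_real_ivl split: if_splits)
  then show "w \<in> eseg (grid_skeleton G) d p" using al by (simp add: eseg_def)
qed

lemma dir_grid: "dir (grid_skeleton G) d p \<longleftrightarrow> p \<in> grid_skeleton G \<and> crd (\<not> d) p \<in> G (\<not> d)"
proof
  assume "dir (grid_skeleton G) d p"
  then obtain w where w: "w \<noteq> p" "crd (\<not> d) p = crd (\<not> d) w" "closed_segment p w \<subseteq> grid_skeleton G"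
    by (auto simp: dir_def eseg_def)
  have "crd (\<not> d) p \<in> G (\<not> d)"
  proof (rule ccontr)
    assume n: "crd (\<not> d) p \<notin> G (\<not> d)"
    have "closed_segment p w \<subseteq> {} \<union> {q. crd d q \<in> G d \<and> crd (\<not> d) q \<in> {crd (\<not> d) p}}"
      using w(3) n unfolding aligned_segment[OF w(2)] by (auto simp: subset_iff in_skeleton bool_quantifiers(2)[of _ d])
    moreover have "finite {q. crd d q \<in> G d \<and> crd (\<not> d) q \<in> {crd (\<not> d) p}}"
      by (rule finite_product_points) (auto simp: fin)
    ultimately have "closed_segment p w \<subseteq> {}" using segment_subset_closed[OF w(1)[symmetric] closed_empty] by blast
    then show False by auto
  qed
  then show "p \<in> grid_skeleton G \<and> crd (\<not> d) p \<in> G (\<not> d)" using w by auto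
next
  assume p: "p \<in> grid_skeleton G \<and> crd (\<not> d) p \<in> G (\<not> d)"
  define q where "q = pt d (if crd d p = Min (G d) then Max (G d) else Min (G d)) (crd (\<not> d) p)"
  have "q \<in> grid_line G d (crd (\<not> d) p)" "crd d q \<noteq> crd d p"
    using minmax(3)[of d] by (auto simp: q_def grid_line_def)
  then show "dir (grid_skeleton G) d p" using eseg_line[of p d] p unfolding dir_def by (metis)
qed

lemma verts_grid: "verts (grid_skeleton G) = {p. \<forall>d. crd d p \<in> G d}"
  using minmax(4,5) by (auto simp: verts_def dir_grid in_skeleton all_bool_eq)

lemma grid_line_vertex: "t \<in> G (\<not> d) \<Longrightarrow> pt d (Min (G d)) t \<in> verts (grid_skeleton G)"
  unfolding verts_grid using minmax(1) by (simp add: bool_quantifiers(1)[of _ d])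

lemma ledges_grid: "ledges (grid_skeleton G) d = grid_line G d ` G (\<not> d)"
proof -
  have "eseg (grid_skeleton G) d p = grid_line G d (crd (\<not> d) p)" "crd (\<not> d) p \<in> G (\<not> d)" if "p \<in> verts (grid_skeleton G)" for p
    using that eseg_line[of p d] dir_grid[of d p] by (auto simp: verts_def)
  moreover have "t \<in> (\<lambda>p. crd (\<not> d) p) ` verts (grid_skeleton G)" if "t \<in> G (\<not> d)" for t
    using grid_line_vertex[OF that] by (metis crd_pt(2) image_eqI)
  ultimately show ?thesis unfolding ledges_def by (auto simp: image_iff) metis+
qed

lemma inj_grid_line: "inj_on (grid_line G d) X"
proof (rule inj_onI)
  fix x y assume "grid_line G d x = grid_line G d y"
  moreover have "pt d (Min (G d)) x \<in> grid_line G d x" using minmax(3)[of d] by (simp add: grid_line_def)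
  ultimately show "x = y" by (simp add: grid_line_def)
qed

lemma card_ledges_grid: "card (ledges (grid_skeleton G) d) = card (G (\<not> d))"
  unfolding ledges_grid by (rule card_image[OF inj_grid_line])

lemma finite_verts_grid: "finite (verts (grid_skeleton G))"
proof -
  have "{p. \<forall>d. crd d p \<in> G d} = {p. crd True p \<in> G True \<and> crd (\<not> True) p \<in> G False}" by (auto simp: all_bool_eq)
  then show ?thesis unfolding verts_grid using finite_product_points[OF fin fin, of True] by simp
qed

lemma infinite_grid_line: assumes "t \<in> G (\<not> d)" shows "infinite (crd d ` grid_line G d t)"
proof -
  have v: "pt d (Min (G d)) t \<in> verts (grid_skeleton G)" using grid_line_vertex[OF assms] .
  then have "dir (grid_skeleton G) d (pt d (Min (G d)) t)" by (simp add: verts_def)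
  then show ?thesis using infinite_eseg[of "grid_skeleton G" d "pt d (Min (G d)) t"] eseg_line[of "pt d (Min (G d)) t" d] dir_grid by simp
qed

lemma mom_grid: assumes t: "t \<in> G (\<not> d)"
  shows "mom (verts (grid_skeleton G)) d (grid_line G d t) j c = (\<Sum>s\<in>G d. c (pt d s t) * s ^ j)"
proof -
  have "verts (grid_skeleton G) \<inter> grid_line G d t = (\<lambda>s. pt d s t) ` G d"
  proof (intro set_eqI iffI)
    fix p assume "p \<in> verts (grid_skeleton G) \<inter> grid_line G d t"
    then have "p = pt d (crd d p) t" "crd d p \<in> G d" by (auto simp: verts_grid grid_line_def)
    then show "p \<in> (\<lambda>s. pt d s t) ` G d" by blast
  qed (use t minmax(4,5) in \<open>auto simp: verts_grid bool_quantifiers(1)[of _ d] grid_line_def\<close>)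
  moreover have "inj_on (\<lambda>s. pt d s t) (G d)" by (rule inj_onI) (metis crd_pt(1))
  ultimately show ?thesis unfolding mom_def by (simp add: sum.reindex)
qed

end

lemma vandermonde_3:
  fixes u :: "real \<Rightarrow> real"
  assumes "card T = 3" "\<And>j. j \<le> 2 \<Longrightarrow> (\<Sum>s\<in>T. s ^ j * u s) = 0" "x \<in> T"
  shows "u x = 0"
proof -
  obtain y z where T: "T = {x, y, z}" "x \<noteq> y" "x \<noteq> z" "y \<noteq> z"
    using assms(1,3) unfolding card_3_iff by auto
  have "u x + u y + u z = 0" "x * u x + y * u y + z * u z = 0" "x^2 * u x + y^2 * u y + z^2 * u z = 0"
    using assms(2)[of 0] assms(2)[of 1] assms(2)[of 2] T by (auto simp: algebra_simps)
  moreover have "(x - y) * (x - z) * u x = (x^2 * u x + y^2 * u y + z^2 * u z) - (y + z) * (x * u x + y * u y + z * u z)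
     + y * z * (u x + u y + u z)" by (simp add: algebra_simps power2_eq_square)
  ultimately show ?thesis using T by auto
qed

lemma edge_solve_real:
  assumes "finite (A :: real set)" "card A \<ge> 3"
  shows "\<exists>a. \<forall>j\<le>2. (\<Sum>s\<in>A. a s * s ^ j) = r j"
  using edge_solve[of A "\<lambda>s. s" r] assms by auto

lemma relationsD: "relations R E r \<Longrightarrow> k \<in> R \<Longrightarrow>
   (\<Sum>e\<in>E d. \<Sum>j\<le>2. qcoef k d e j * r d e j) = (\<Sum>e\<in>E (\<not> d). \<Sum>j\<le>2. qcoef k (\<not> d) e j * r (\<not> d) e j)"
  unfolding relations_def by (cases d) auto

text \<open>\<open>T\<close> consists of three lines of direction \<open>\<not> d\<close>, given by their coordinates in
\<open>G d\<close>. The functionals are all moments of all lines of direction \<open>d\<close>, and those of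
direction \<open>\<not> d\<close> except the nine moments of the lines in \<open>T\<close>.

Prescribing them: outside \<open>T\<close> solve along the lines of direction \<open>\<not> d\<close>, then
correct along each line of direction \<open>d\<close> at its three points on the lines in \<open>T\<close>.
The first part needs three points on lines of direction \<open>\<not> d\<close>, unless \<open>T\<close>
contains all of them.

Recovering the other nine: the relations of the monomials give, for each order \<open>i\<close>, a homogeneous
Vandermonde system for the moments of order \<open>i\<close> on the three lines.\<close>

lemma (in grid) base_functionals:
  assumes c3: "card (G d) \<ge> 3" "card (G (\<not> d)) \<ge> 3 \<or> card (G d) = 3"
    and R: "\<And>i j. i \<le> 2 \<Longrightarrow> j \<le> 2 \<Longrightarrow> (\<lambda>p. crd d p ^ j * crd (\<not> d) p ^ i) \<in> R"
  shows "\<exists>F. finite F \<and> F \<subseteq> {(d, e, j). e \<in> ledges (grid_skeleton G) d \<and> j \<le> 2} \<and>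
     int (card F) = 3 * (int (card (ledges (grid_skeleton G) True)) + card (ledges (grid_skeleton G) False)) - 9 \<and>
     realisable (verts (grid_skeleton G)) F \<and> determining R (ledges (grid_skeleton G)) F"
proof -
  obtain T where T: "T \<subseteq> G d" "card T = 3" using c3(1) obtain_subset_with_card_n by metis
  then have finT: "finite T" using fin finite_subset by blast
  let ?L = "grid_line G"
  define F where "F = {d} \<times> ?L d ` G (\<not> d) \<times> {..2::nat} \<union> {\<not> d} \<times> ?L (\<not> d) ` (G d - T) \<times> {..2}"
  have "finite F" unfolding F_def using fin by auto
  moreover have "F \<subseteq> {(d, e, j). e \<in> ledges (grid_skeleton G) d \<and> j \<le> 2}"
    unfolding F_def ledges_grid by auto
  moreover have "int (card F) = 3 * (int (card (ledges (grid_skeleton G) True)) + card (ledges (grid_skeleton G) False)) - 9"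
  proof -
    have "card F = card (G (\<not> d)) * 3 + card (G d - T) * 3"
      unfolding F_def using fin by (subst card_Un_disjoint) (auto simp: card_cartesian_product card_image inj_grid_line)
    moreover have "card (G d - T) = card (G d) - 3" using T finT by (simp add: card_Diff_subset)
    ultimately show ?thesis using c3(1) by (cases d) (auto simp: card_ledges_grid)
  qed
  moreover have "realisable (verts (grid_skeleton G)) F"
    unfolding realisable_def
  proof
    fix r :: "bool \<Rightarrow> (real \<times> real) set \<Rightarrow> nat \<Rightarrow> real"
    have "\<exists>a. s \<in> G d - T \<longrightarrow> (\<forall>j\<le>2. (\<Sum>t\<in>G (\<not> d). a t * t ^ j) = r (\<not> d) (?L (\<not> d) s) j)" for s
    proof (cases "s \<in> G d - T")
      case True
      then have "card (G d) \<noteq> 3" using T fin by (metis DiffE card_subset_eq)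
      then have "card (G (\<not> d)) \<ge> 3" using c3 by auto
      from edge_solve_real[OF fin this] show ?thesis by blast
    qed auto
    then obtain a where a: "\<And>s j. s \<in> G d - T \<Longrightarrow> j \<le> 2 \<Longrightarrow> (\<Sum>t\<in>G (\<not> d). a s t * t ^ j) = r (\<not> d) (?L (\<not> d) s) j"
      by metis
    have "\<exists>b. \<forall>j\<le>2. (\<Sum>s\<in>T. b s * s ^ j) = r d (?L d t) j - (\<Sum>s\<in>G d - T. a s t * s ^ j)" for t
      using edge_solve_real[OF finT, of "\<lambda>j. r d (?L d t) j - (\<Sum>s\<in>G d - T. a s t * s ^ j)"] T by simp
    then obtain b where b: "\<And>t j. j \<le> 2 \<Longrightarrow> (\<Sum>s\<in>T. b t s * s ^ j) = r d (?L d t) j - (\<Sum>s\<in>G d - T. a s t * s ^ j)"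
      by metis
    define c where "c p = (if p \<in> verts (grid_skeleton G) then if crd d p \<in> T then b (crd (\<not> d) p) (crd d p) else a (crd d p) (crd (\<not> d) p) else 0)" for p
    have cp: "c (pt d s t) = (if s \<in> T then b t s else a s t)" if "s \<in> G d" "t \<in> G (\<not> d)" for s t
      using that by (simp add: c_def verts_grid bool_quantifiers(1)[of _ d])
    have pp: "pt (\<not> d) t s = pt d s t" for s t by (simp add: pt_def)
    have "mom (verts (grid_skeleton G)) d (?L d t) j c = r d (?L d t) j" if "t \<in> G (\<not> d)" "j \<le> 2" for t j
    proof -
      have "mom (verts (grid_skeleton G)) d (?L d t) j c = (\<Sum>s\<in>G d - T. c (pt d s t) * s ^ j) + (\<Sum>s\<in>T. c (pt d s t) * s ^ j)"
        unfolding mom_grid[OF that(1)] using sum.subset_diff[OF T(1) fin] .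
      also have "(\<Sum>s\<in>T. c (pt d s t) * s ^ j) = (\<Sum>s\<in>T. b t s * s ^ j)"
        using T cp that by (intro sum.cong) auto
      also have "(\<Sum>s\<in>G d - T. c (pt d s t) * s ^ j) = (\<Sum>s\<in>G d - T. a s t * s ^ j)"
        using T cp that by (intro sum.cong) auto
      finally show ?thesis using b[OF that(2)] by simp
    qed
    moreover have "mom (verts (grid_skeleton G)) (\<not> d) (?L (\<not> d) s) j c = r (\<not> d) (?L (\<not> d) s) j" if "s \<in> G d - T" "j \<le> 2" for s j
    proof -
      have s: "s \<in> G (\<not> \<not> d)" using that by simp
      show ?thesis
        unfolding mom_grid[OF s] pp a[OF that, symmetric] using that cp by (intro sum.cong) auto
    qed
    moreover have "c p = 0" if "p \<notin> verts (grid_skeleton G)" for p using that by (simp add: c_def)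
    ultimately show "\<exists>c. (\<forall>p. p \<notin> verts (grid_skeleton G) \<longrightarrow> c p = 0) \<and>
         (\<forall>(d, e, j)\<in>F. mom (verts (grid_skeleton G)) d e j c = r d e j)"
      unfolding F_def by (intro exI[of _ c]) auto
  qed
  moreover have "determining R (ledges (grid_skeleton G)) F"
    unfolding determining_def
  proof (rule allI, rule impI, rule impI)
    fix r :: "bool \<Rightarrow> (real \<times> real) set \<Rightarrow> nat \<Rightarrow> real"
    assume rel: "relations R (ledges (grid_skeleton G)) r" and r0: "\<forall>(d, e, j)\<in>F. r d e j = 0"
    have rd: "r d (?L d t) j = 0" if "t \<in> G (\<not> d)" "j \<le> 2" for t j
      using bspec[OF r0, of "(d, ?L d t, j)"] that unfolding F_def by simp
    have rn: "r (\<not> d) (?L (\<not> d) s) j = 0" if "s \<in> G d - T" "j \<le> 2" for s j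
      using bspec[OF r0, of "(\<not> d, ?L (\<not> d) s, j)"] that unfolding F_def by simp
    have rT: "r (\<not> d) (?L (\<not> d) s) i = 0" if s: "s \<in> T" and i: "i \<le> 2" for s i
    proof (rule vandermonde_3[OF T(2) _ s])
      fix j :: nat assume j: "j \<le> 2"
      let ?k = "\<lambda>p. crd d p ^ j * crd (\<not> d) p ^ i"
      have "(\<Sum>e\<in>ledges (grid_skeleton G) d. \<Sum>j'\<le>2. qcoef ?k d e j' * r d e j') = 0"
        using rd by (auto simp: ledges_grid intro!: sum.neutral)
      then have "0 = (\<Sum>e\<in>ledges (grid_skeleton G) (\<not> d). \<Sum>j'\<le>2. qcoef ?k (\<not> d) e j' * r (\<not> d) e j')"
        using relationsD[OF rel R[OF i j], of d] by simp
      also have "\<dots> = (\<Sum>s\<in>G d. \<Sum>j'\<le>2. qcoef ?k (\<not> d) (?L (\<not> d) s) j' * r (\<not> d) (?L (\<not> d) s) j')"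
        unfolding ledges_grid by (simp add: sum.reindex inj_grid_line)
      also have "\<dots> = (\<Sum>s\<in>T. \<Sum>j'\<le>2. qcoef ?k (\<not> d) (?L (\<not> d) s) j' * r (\<not> d) (?L (\<not> d) s) j')"
        using T fin rn by (intro sum.mono_neutral_right) (auto intro!: sum.neutral)
      also have "\<dots> = (\<Sum>s\<in>T. s ^ j * r (\<not> d) (?L (\<not> d) s) i)"
      proof (rule sum.cong[OF refl])
        fix s assume "s \<in> T"
        then have sG: "s \<in> G (\<not> \<not> d)" using T by auto
        have q: "qcoef ?k (\<not> d) (?L (\<not> d) s) j' = (if j' = i then s ^ j else 0)" if "j' \<le> 2" for j'
        proof (rule qcoef_eqI[OF _ infinite_grid_line[OF sG] that, of ?k "\<lambda>j'. if j' = i then s ^ j else 0"])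
          fix p assume "p \<in> ?L (\<not> d) s"
          then have "crd d p = s" by (simp add: grid_line_def)
          then have "?k p = (\<Sum>j'\<le>2. if j' = i then s ^ j * crd (\<not> d) p ^ j' else 0)" using i by (simp add: sum.delta)
          also have "\<dots> = (\<Sum>j'\<le>2. (if j' = i then s ^ j else 0) * crd (\<not> d) p ^ j')" by (rule sum.cong) auto
          finally show "?k p = (\<Sum>j'\<le>2. (if j' = i then s ^ j else 0) * crd (\<not> d) p ^ j')" .
        qed
        have "(\<Sum>j'\<le>2. qcoef ?k (\<not> d) (?L (\<not> d) s) j' * r (\<not> d) (?L (\<not> d) s) j') =
           (\<Sum>j'\<le>2. if j' = i then s ^ j * r (\<not> d) (?L (\<not> d) s) j' else 0)"
          using q by (intro sum.cong) auto
        then show "(\<Sum>j'\<le>2. qcoef ?k (\<not> d) (?L (\<not> d) s) j' * r (\<not> d) (?L (\<not> d) s) j') = s ^ j * r (\<not> d) (?L (\<not> d) s) i"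
          using i by (simp add: sum.delta)
      qed
      finally show "(\<Sum>s\<in>T. s ^ j * r (\<not> d) (?L (\<not> d) s) i) = 0" by simp
    qed
    show "\<forall>d. \<forall>e\<in>ledges (grid_skeleton G) d. \<forall>j\<le>2. r d e j = 0"
      unfolding bool_quantifiers(1)[of _ d] ledges_grid using rd rn rT by (auto, blast)
  qed
  ultimately show ?thesis by blast
qed

lemma mid_cellset: assumes "gcell G K" shows "mid d K \<subseteq> cellset K"
proof
  fix p assume p: "p \<in> mid d K"
  have "lo (\<not> d) K \<le> crd (\<not> d) p \<and> crd (\<not> d) p \<le> hi (\<not> d) K" "lo d K \<le> crd d p \<and> crd d p \<le> hi d K"
    using p gcell_less[OF assms, of "\<not> d"] by (auto simp: mid_crd)
  then show "p \<in> cellset K" unfolding cellset_def by (cases d) (auto simp: all_bool_eq)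
qed

section \<open>Sequences of refinement steps\<close>

text \<open>On a line that stays in the cell one factor of the bubble is constant and the other one quadratic; on a line
that avoids the interior it is zero.\<close>

lemma quadratic_along_bubble:
  assumes "\<And>p q. p \<in> e \<Longrightarrow> q \<in> e \<Longrightarrow> crd (\<not> d) p = crd (\<not> d) q"
    and "e \<subseteq> cellset K \<or> (\<forall>p\<in>e. \<exists>d. \<not> (lo d K < crd d p \<and> crd d p < hi d K))"
  shows "quadratic_along d e (bubble K)"
  using assms(2)
proof
  assume e: "e \<subseteq> cellset K"
  show ?thesis
  proof (cases "e = {}")
    case False
    then obtain q where q: "q \<in> e" by auto
    define c where "c = (crd (\<not> d) q - lo (\<not> d) K) * (crd (\<not> d) q - hi (\<not> d) K)"
    define C where "C j = c * (if j = 0 then lo d K * hi d K else if j = 1 then - (lo d K + hi d K) else 1)" for j :: nat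
    have "bubble K p = (\<Sum>j\<le>2. C j * crd d p ^ j)" if p: "p \<in> e" for p
    proof -
      have "\<forall>d. lo d K \<le> crd d p \<and> crd d p \<le> hi d K" using p e by (auto simp: cellset_def)
      then have "bubble K p = (crd True p - lo True K) * (crd True p - hi True K) * ((crd False p - lo False K) * (crd False p - hi False K))"
        by (simp add: bubble_def)
      then have "bubble K p = (crd d p - lo d K) * (crd d p - hi d K) * ((crd (\<not> d) p - lo (\<not> d) K) * (crd (\<not> d) p - hi (\<not> d) K))"
        by (cases d) (simp_all add: mult.commute)
      then have "bubble K p = (crd d p - lo d K) * (crd d p - hi d K) * c" using assms(1)[OF p q] by (simp add: c_def)
      moreover have "(x - a) * (x - b) * c = (\<Sum>j\<le>2. (c * (if j = 0 then a * b else if j = 1 then - (a + b) else 1)) * x ^ j)"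
        for x a b :: real by (simp add: sum_atMost_2 algebra_simps power2_eq_square)
      ultimately show ?thesis by (simp add: C_def)
    qed
    then show ?thesis unfolding quadratic_along_def by (intro exI[of _ C] ballI)
  qed (auto simp: quadratic_along_def)
next
  assume e: "\<forall>p\<in>e. \<exists>d. \<not> (lo d K < crd d p \<and> crd d p < hi d K)"
  have "bubble K p = 0" if "p \<in> e" for p
  proof -
    obtain d' where d': "crd d' p \<le> lo d' K \<or> hi d' K \<le> crd d' p" using bspec[OF e \<open>p \<in> e\<close>] by (auto simp: not_less)
    then have "(crd d' p - lo d' K) * (crd d' p - hi d' K) = 0"
      if "\<forall>d. lo d K \<le> crd d p \<and> crd d p \<le> hi d K"
      using that by (metis diff_self mult_eq_0_iff order_antisym)
    then show ?thesis by (cases d') (auto simp: bubble_def)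
  qed
  then show ?thesis unfolding quadratic_along_def by (intro exI[of _ "\<lambda>_. 0"]) auto
qed

lemma consecutive_same_end:
  "consecutive X a b \<Longrightarrow> consecutive X a' b \<Longrightarrow> a = a'" "consecutive X a b \<Longrightarrow> consecutive X a b' \<Longrightarrow> b = b'"
proof -
  have gap: "\<not> (a < x \<and> x < b)" if "consecutive X a b" "x \<in> X" for a b x
    using that by (auto simp: consecutive_def)
  show "a = a'" if "consecutive X a b" "consecutive X a' b"
    using that gap[OF that(1), of a'] gap[OF that(2), of a] by (auto simp: consecutive_def)
  show "b = b'" if "consecutive X a b" "consecutive X a b'"
    using that gap[OF that(1), of b'] gap[OF that(2), of b] by (auto simp: consecutive_def)
qed

text \<open>By \<open>nested\<close> every cell cut at some level is part of a cell cut at the previous level, in the same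
direction. The bounds \<open>base3\<close> on the number of lines are the ones of
\<open>base_functionals\<close>.\<close>

locale skeleton_sequence =
  fixes n :: nat and Sk :: "nat \<Rightarrow> (real \<times> real) set" and G :: "nat \<Rightarrow> bool \<Rightarrow> real set" and A :: "nat \<Rightarrow> bool \<Rightarrow> cell set"
    and G0 :: "bool \<Rightarrow> real set" and d0 :: bool
  assumes steps: "\<And>k. k < n \<Longrightarrow> skeleton_refinement (Sk k) (Sk (Suc k)) (G k) (A k)"
    and nested: "\<And>k d L. Suc k < n \<Longrightarrow> L \<in> A (Suc k) d \<Longrightarrow> \<exists>N\<in>A k d. cellset L \<subseteq> cellset N"
    and base: "grid G0" "Sk 0 = grid_skeleton G0"
    and base3: "card (G0 d0) \<ge> 3" "card (G0 (\<not> d0)) \<ge> 3 \<or> card (G0 d0) = 3"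
begin

abbreviation "isolated k \<equiv> skeleton_refinement.isolated (A k)"

lemma nested':
  assumes "k < m" "m < n" "L \<in> A m d"
  shows "\<exists>N\<in>A k d. cellset L \<subseteq> cellset N"
  using assms
proof (induction m arbitrary: L)
  case (Suc m)
  obtain N where N: "N \<in> A m d" "cellset L \<subseteq> cellset N" using nested Suc by blast
  show ?case
  proof (cases "k = m")
    case False
    then show ?thesis using Suc N by (metis Suc_lessD less_SucE subset_trans)
  qed (use N in auto)
qed simp

text \<open>To leave an isolated cell, an l-edge that enters its interior would have to continue into a middle segment of
a cell outside \<open>K\<close>. By nesting, that cell is part of a cell cut at level \<open>k\<close>, which
would be a neighbour of \<open>K\<close>.\<close>

lemma isolated_persists:
  assumes k: "k < n" and K: "K \<in> isolated k" and m: "k < m" "m \<le> n" and e: "e \<in> ledges (Sk m) d"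
    and p: "p \<in> e" "\<forall>d. lo d K < crd d p \<and> crd d p < hi d K"
  shows "e \<subseteq> cellset K"
  using m e p
proof (induction m arbitrary: e p)
  case (Suc m)
  interpret k: skeleton_refinement "Sk k" "Sk (Suc k)" "G k" "A k" using steps k by blast
  interpret m: skeleton_refinement "Sk m" "Sk (Suc m)" "G m" "A m" using steps Suc.prems by simp
  have KA: "K \<in> A k d" and n: "\<And>L. L \<in> A k d \<Longrightarrow> \<not> nbr d K L" using K by (cases d; auto simp: k.isolated_def)+
  have gK: "gcell (G k) K" using k.cells KA by auto
  show ?case
  proof (cases "k = m")
    case True
    then have "e = mid d K" using k.isolated_inside[OF K _ Suc.prems(4)] Suc.prems by (simp add: opencell_def)
    then show ?thesis using mid_cellset[OF gK] by simp
  next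
    case False
    then have km: "k < m" "m < n" using Suc.prems by auto
    show ?thesis
    proof (cases "e \<in> ledges (Sk m) d")
      case True
      then show ?thesis using Suc.IH[OF km(1) _ True Suc.prems(4,5)] km by simp
    next
      case enew: False
      then have e: "e \<in> ledges (Sk (Suc m)) d - ledges (Sk m) d" using Suc.prems by auto
      show ?thesis
      proof (rule ccontr)
        assume "\<not> e \<subseteq> cellset K"
        then obtain w where w: "w \<in> e" "w \<notin> cellset K" by auto
        have ee: "e = eseg (Sk (Suc m)) d p" using ledges_at(1) e Suc.prems(4) by blast
        then have al: "crd (\<not> d) p = crd (\<not> d) w" using w by (simp add: eseg_def)
        have pin: "lo d' K < crd d' p" "crd d' p < hi d' K" for d' using Suc.prems(5) by auto
        have "w \<noteq> p" using w pin by (auto simp: cellset_def less_imp_le)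
        then have cov: "closed_segment p w \<subseteq> (\<Union>L\<in>A m d. mid d L)"
          using m.new_level[OF m.new_ledge(1)[OF e Suc.prems(4)]] w ee by blast
        have wd: "crd d w < lo d K \<or> hi d K < crd d w"
        proof (rule ccontr)
          assume "\<not> ?thesis"
          then have "w \<in> cellset K" using al pin[of "\<not> d"] unfolding cellset_def
            by (cases d) (auto simp: all_bool_eq)
          then show False using w by simp
        qed
        define \<beta> where "\<beta> = (if hi d K < crd d w then hi d K else lo d K)"
        define q where "q = pt d \<beta> (crd (\<not> d) p)"
        have \<beta>: "\<beta> = lo d K \<or> \<beta> = hi d K" by (auto simp: \<beta>_def)
        have qw: "q \<noteq> w" using wd by (auto simp: q_def \<beta>_def)
        have alq: "crd (\<not> d) q = crd (\<not> d) w" using al by (simp add: q_def)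
        have seg: "closed_segment q w \<subseteq> closed_segment p w"
          unfolding aligned_segment[OF alq] aligned_segment[OF al] using wd pin[of d] al
          by (auto simp: q_def \<beta>_def closed_segment_eq_real_ivl split: if_splits)
        \<comment> \<open>beyond the side of the cell the segment is covered by cuts in cells outside it\<close>
        let ?C = "\<Union>L\<in>{L \<in> A m d. \<not> cellset L \<subseteq> cellset K}. mid d L"
        have sub: "closed_segment q w \<subseteq> ?C \<union> {q}"
        proof
          fix x assume x: "x \<in> closed_segment q w"
          show "x \<in> ?C \<union> {q}"
          proof (cases "x = q")
            case False
            then have "crd d x \<noteq> \<beta>" using x unfolding aligned_segment[OF alq]
              by (metis (mono_tags, lifting) mem_Collect_eq point_eqI crd_pt(1) q_def)
            then have "crd d x < lo d K \<or> hi d K < crd d x" using x wd pin[of d] unfolding aligned_segment[OF alq]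
              by (auto simp: q_def \<beta>_def closed_segment_eq_real_ivl split: if_splits)
            then have xK: "x \<notin> cellset K" by (auto simp: cellset_def) (metis less_le_not_le)+
            obtain L where L: "L \<in> A m d" "x \<in> mid d L" using cov seg x by blast
            then have "x \<in> cellset L" using mid_cellset m.cells by blast
            then show ?thesis using L xK by blast
          qed simp
        qed
        have "closed ?C" using m.finA by (intro closed_UN ballI closed_mid) auto
        from segment_subset_closed[OF qw this _ sub] have "closed_segment q w \<subseteq> ?C" by simp
        moreover have "q \<in> closed_segment q w" by simp
        ultimately have "q \<in> ?C" by blast
        then obtain L where L: "L \<in> A m d" "\<not> cellset L \<subseteq> cellset K" "q \<in> mid d L" by blast
        obtain N where N: "N \<in> A k d" "cellset L \<subseteq> cellset N" using nested'[OF km L(1)] by blast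
        have gN: "gcell (G k) N" using k.cells N by auto
        have "q \<in> cellset N" using L(1,3) mid_cellset m.cells N(2) by blast
        then have qN: "lo d N \<le> \<beta>" "\<beta> \<le> hi d N" "lo (\<not> d) N \<le> crd (\<not> d) p" "crd (\<not> d) p \<le> hi (\<not> d) N"
          unfolding cellset_def q_def using crd_pt by (metis (mono_tags, lifting) mem_Collect_eq)+
        have NK: "lo (\<not> d) N = lo (\<not> d) K" "hi (\<not> d) N = hi (\<not> d) K"
          using gcell_unique[OF gK gN pin[of "\<not> d"] qN(3,4)] by auto
        have "\<beta> \<in> G k d" using \<beta> gK by (auto simp: gcell_def consecutive_def)
        then have bN: "\<beta> = lo d N \<or> \<beta> = hi d N" using gcell_gap[OF gN _ qN(1,2)] by blast
        have cK: "consecutive (G k d) (lo d K) (hi d K)" "consecutive (G k d) (lo d N) (hi d N)"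
          using gK gN by (auto simp: gcell_def)
        have "N \<noteq> K" using L(2) N(2) by auto
        then have "\<not> (lo d N = lo d K \<and> hi d N = hi d K)" using NK cell_eqI2 by metis
        then have "hi d K = lo d N \<or> hi d N = lo d K"
          using bN \<beta> consecutive_same_end[of "G k d"] cK by metis
        then have "nbr d K N" using NK by (auto simp: nbr_def)
        then show False using n N by blast
      qed
    qed
  qed
qed simp

text \<open>The relations at every level are those of the functions that are quadratic along the l-edges of the last
level: among them are the bubbles of all levels.\<close>

definition R where "R = {k. \<forall>d. \<forall>e\<in>ledges (Sk n) d. quadratic_along d e k}"

lemma monomial_R: "(\<lambda>p. crd d p ^ j * crd (\<not> d) p ^ i) \<in> R" if "i \<le> 2" "j \<le> 2"
proof -
  have "quadratic_along d' e (\<lambda>p. crd d' p ^ j * crd (\<not> d') p ^ i)" if e: "e \<in> ledges (Sk n) d'" and j: "j \<le> 2" for d' e i j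
  proof -
    obtain v where v: "e = eseg (Sk n) d' v" using e by (auto simp: ledges_def)
    have "crd d' p ^ j * crd (\<not> d') p ^ i = (\<Sum>j'\<le>2. (if j' = j then crd (\<not> d') v ^ i else 0) * crd d' p ^ j')" if "p \<in> e" for p
    proof -
      have "crd (\<not> d') p = crd (\<not> d') v" using that v by (simp add: eseg_def)
      moreover have "(\<Sum>j'\<le>2. (if j' = j then crd (\<not> d') v ^ i else 0) * crd d' p ^ j') = (\<Sum>j'\<le>2. if j' = j then crd (\<not> d') v ^ i * crd d' p ^ j' else 0)"
        by (rule sum.cong) auto
      ultimately show ?thesis using j by (simp add: sum.delta)
    qed
    then show ?thesis unfolding quadratic_along_def by (intro exI[of _ "\<lambda>j'. if j' = j then crd (\<not> d') v ^ i else 0"] ballI)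
  qed
  from this[of _ d j i] this[of _ "\<not> d" i j] that
  show ?thesis unfolding R_def by (cases d) (auto simp: all_bool_eq mult.commute)
qed

lemma bubble_R: assumes "k < n" "K \<in> isolated k" shows "bubble K \<in> R"
  unfolding R_def
proof (intro CollectI allI ballI)
  fix d e assume e: "e \<in> ledges (Sk n) d"
  show "quadratic_along d e (bubble K)"
  proof (rule quadratic_along_bubble)
    show "crd (\<not> d) p = crd (\<not> d) q" if "p \<in> e" "q \<in> e" for p q using e that by (auto simp: ledges_def eseg_def)
    show "e \<subseteq> cellset K \<or> (\<forall>p\<in>e. \<exists>d. \<not> (lo d K < crd d p \<and> crd d p < hi d K))"
      using isolated_persists[OF assms assms(1) order_refl e] by blast
  qed
qed

lemma functionals: "k \<le> n \<Longrightarrow> \<exists>F. finite F \<and> F \<subseteq> {(d, e, j). e \<in> ledges (Sk k) d \<and> j \<le> 2} \<and>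
     int (card F) = 3 * (int (card (ledges (Sk k) True)) + card (ledges (Sk k) False)) - 9 - (\<Sum>i<k. card (isolated i)) \<and>
     realisable (verts (Sk k)) F \<and> determining R (ledges (Sk k)) F"
proof (induction k)
  case 0
  show ?case using grid.base_functionals[OF base(1) base3 monomial_R] base(2) by simp
next
  case (Suc k)
  then obtain F where F: "finite F" "F \<subseteq> {(d, e, j). e \<in> ledges (Sk k) d \<and> j \<le> 2}"
     "int (card F) = 3 * (int (card (ledges (Sk k) True)) + card (ledges (Sk k) False)) - 9 - (\<Sum>i<k. card (isolated i))"
     "realisable (verts (Sk k)) F" "determining R (ledges (Sk k)) F" by auto
  have k: "k < n" using Suc by simp
  interpret S: skeleton_refinement "Sk k" "Sk (Suc k)" "G k" "A k" using steps k by blast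
  interpret L: line_refinement "verts (Sk k)" "verts (Sk (Suc k))" "ledges (Sk k)" "ledges (Sk (Suc k))" R S.dropped
    using S.line_refinement bubble_R[OF k] by blast
  show ?case
    using L.step_card[OF F(1,2)] L.step_realisable[OF F(4,2)] L.step_determining[OF F(5)] F(3) S.card_dropped
    by (intro exI[of _ "F \<union> L.new_functionals"]) auto
qed

lemma finite_verts: "finite (verts (Sk n))"
proof (cases n)
  case 0 then show ?thesis using grid.finite_verts_grid[OF base(1)] base(2) by simp
next
  case (Suc m)
  then show ?thesis using skeleton_refinement.finV'[OF steps[of m]] by simp
qed

theorem moment_free_dim:
  "\<exists>B. finite B \<and> \<not> fun_space.dependent B \<and> fun_space.span B = moment_free (verts (Sk n)) (ledges (Sk n)) \<and>
    int (card B) = int (card (verts (Sk n))) - 3 * (int (card (ledges (Sk n) True)) + card (ledges (Sk n) False)) + 9 + (\<Sum>i<n. card (isolated i))"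
proof -
  obtain F where F: "finite F" "F \<subseteq> {(d, e, j). e \<in> ledges (Sk n) d \<and> j \<le> 2}"
     "int (card F) = 3 * (int (card (ledges (Sk n) True)) + card (ledges (Sk n) False)) - 9 - (\<Sum>i<n. card (isolated i))"
     "realisable (verts (Sk n)) F" "determining R (ledges (Sk n)) F" using functionals[of n] by auto
  have q: "quadratic_along d e k" if "k \<in> R" "e \<in> ledges (Sk n) d" for k d e using that by (auto simp: R_def)
  from moment_free_basis[OF line_system_verts[OF finite_verts] q F(1,2,4,5)]
  obtain B where B: "finite B" "\<not> fun_space.dependent B" "card B + card F = card (verts (Sk n))"
     "fun_space.span B = moment_free (verts (Sk n)) (ledges (Sk n))" by blast
  then show ?thesis using F(3) by (intro exI[of _ B]) auto
qed

end

section \<open>Rays and germs\<close>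

text \<open>The behaviour of a mesh near a point \<open>v\<close> is described by rays: \<open>ev\<close> says that a
property holds on a ray for all small positive parameters. Since cells are given by finitely many linear
inequalities, membership in them is \<open>decided\<close>: it holds, or fails, for all small parameters. No
small parameter has to be chosen by hand.\<close>

definition ray :: "bool \<Rightarrow> real \<Rightarrow> real \<Rightarrow> real \<times> real \<Rightarrow> real \<Rightarrow> real \<times> real" where
  "ray d \<alpha> \<beta> v \<tau> = pt d (crd d v + \<alpha> * \<tau>) (crd (\<not> d) v + \<beta> * \<tau>)"

lemma crd_ray [simp]: "crd d (ray d \<alpha> \<beta> v \<tau>) = crd d v + \<alpha> * \<tau>" "crd (\<not> d) (ray d \<alpha> \<beta> v \<tau>) = crd (\<not> d) v + \<beta> * \<tau>"
  by (simp_all add: ray_def)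

abbreviation ev :: "(real \<Rightarrow> bool) \<Rightarrow> bool" where "ev P \<equiv> eventually P (at_right 0)"

definition decided :: "(real \<Rightarrow> bool) \<Rightarrow> bool" where "decided P \<longleftrightarrow> ev P \<or> ev (\<lambda>\<tau>. \<not> P \<tau>)"

lemma decided_not: "decided P \<Longrightarrow> decided (\<lambda>\<tau>. \<not> P \<tau>)" unfolding decided_def by auto

lemma decided_conj: "decided P \<Longrightarrow> decided Q \<Longrightarrow> decided (\<lambda>\<tau>. P \<tau> \<and> Q \<tau>)"
  unfolding decided_def using eventually_conj[of P "at_right 0" Q]
    eventually_mono[of "\<lambda>\<tau>. \<not> P \<tau>" "at_right 0" "\<lambda>\<tau>. \<not> (P \<tau> \<and> Q \<tau>)"]
    eventually_mono[of "\<lambda>\<tau>. \<not> Q \<tau>" "at_right 0" "\<lambda>\<tau>. \<not> (P \<tau> \<and> Q \<tau>)"] by blast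

lemma decided_Ball: "finite X \<Longrightarrow> (\<And>x. x \<in> X \<Longrightarrow> decided (P x)) \<Longrightarrow> decided (\<lambda>\<tau>. \<forall>x\<in>X. P x \<tau>)"
proof (induction X rule: finite_induct)
  case (insert x X)
  then show ?case using decided_conj[of "P x" "\<lambda>\<tau>. \<forall>x\<in>X. P x \<tau>"] by simp
qed (simp add: decided_def)

lemma decided_Bex: "finite X \<Longrightarrow> (\<And>x. x \<in> X \<Longrightarrow> decided (P x)) \<Longrightarrow> decided (\<lambda>\<tau>. \<exists>x\<in>X. P x \<tau>)"
  using decided_not[OF decided_Ball[of X "\<lambda>x \<tau>. \<not> P x \<tau>"]] decided_not by simp

lemma ev_pos: "ev (\<lambda>\<tau>. \<tau> > 0)" by (simp add: eventually_at_right_less)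

lemma linear_tendsto: "((\<lambda>\<tau>. x + \<alpha> * \<tau>) \<longlongrightarrow> x) (at_right (0::real))" for x :: real
  by (auto intro!: tendsto_eq_intros)

lemma ev_less: "x < c \<Longrightarrow> ev (\<lambda>\<tau>. x + \<alpha> * \<tau> < c)" "c < x \<Longrightarrow> ev (\<lambda>\<tau>. c < x + \<alpha> * \<tau>)"
  using order_tendstoD[OF linear_tendsto[of x \<alpha>]] by auto

lemma decided_le: "decided (\<lambda>\<tau>. x + \<alpha> * \<tau> \<le> c)"
proof -
  consider "x < c" | "c < x" | "x = c" "\<alpha> \<le> 0" | "x = c" "\<alpha> > 0" by linarith
  then show ?thesis
  proof cases
    case 1
    then show ?thesis unfolding decided_def using ev_less(1)[OF 1, of \<alpha>] by (auto elim: eventually_mono)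
  next
    case 2
    then show ?thesis unfolding decided_def using ev_less(2)[OF 2, of \<alpha>] by (simp add: not_le)
  next
    case 3
    then have "ev (\<lambda>\<tau>. x + \<alpha> * \<tau> \<le> c)"
      by (intro eventually_mono[OF ev_pos]) (simp add: mult_nonpos_nonneg)
    then show ?thesis by (simp add: decided_def)
  next
    case 4
    then have "ev (\<lambda>\<tau>. \<not> x + \<alpha> * \<tau> \<le> c)" by (intro eventually_mono[OF ev_pos]) (simp add: not_le)
    then show ?thesis by (simp add: decided_def)
  qed
qed

lemma decided_ge: "decided (\<lambda>\<tau>. c \<le> x + \<alpha> * \<tau>)"
  using decided_le[of "- x" "- \<alpha>" "- c"] by (simp add: algebra_simps)

lemma decided_less: "decided (\<lambda>\<tau>. x + \<alpha> * \<tau> < c)" "decided (\<lambda>\<tau>. c < x + \<alpha> * \<tau>)"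
  using decided_not[OF decided_ge[of c x \<alpha>]] decided_not[OF decided_le[of x \<alpha> c]] by (simp_all add: not_le)

lemma decided_cell: "decided (\<lambda>\<tau>. ray d \<alpha> \<beta> v \<tau> \<in> cellset K)" "decided (\<lambda>\<tau>. ray d \<alpha> \<beta> v \<tau> \<in> opencell K)"
  unfolding cellset_iff[of _ _ d] opencell_iff[of _ _ d] crd_ray
  by (intro decided_conj decided_le decided_ge decided_less)+

lemma ev_nontrivial: "ev P \<Longrightarrow> ev Q \<Longrightarrow> (\<And>\<tau>. P \<tau> \<Longrightarrow> Q \<tau> \<Longrightarrow> \<tau> > 0 \<Longrightarrow> R) \<Longrightarrow> R"
  using eventually_happens[OF eventually_conj[OF eventually_conj[of P _ Q] ev_pos]] by auto

lemma ray_opencell_cellset: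
  assumes "ev (\<lambda>\<tau>. ray d \<alpha> \<beta> v \<tau> \<in> opencell K)"
  shows "v \<in> cellset K"
proof -
  have e: "ev (\<lambda>\<tau>. lo d K \<le> crd d v + \<alpha> * \<tau>)" "ev (\<lambda>\<tau>. crd d v + \<alpha> * \<tau> \<le> hi d K)"
    "ev (\<lambda>\<tau>. lo (\<not> d) K \<le> crd (\<not> d) v + \<beta> * \<tau>)" "ev (\<lambda>\<tau>. crd (\<not> d) v + \<beta> * \<tau> \<le> hi (\<not> d) K)"
    by (rule eventually_mono[OF assms]; auto simp: opencell_iff[of _ _ d])+
  show ?thesis unfolding cellset_iff[of _ _ d]
    using tendsto_lowerbound[OF linear_tendsto e(1)] tendsto_lowerbound[OF linear_tendsto e(3)]
      tendsto_upperbound[OF linear_tendsto e(2)] tendsto_upperbound[OF linear_tendsto e(4)] by simp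
qed

text \<open>The skeleton starts from \<open>v\<close> along direction \<open>d\<close>, forwards for \<open>\<sigma> =
1\<close> and backwards for \<open>\<sigma> = - 1\<close>.\<close>

definition germ :: "(real \<times> real) set \<Rightarrow> bool \<Rightarrow> real \<Rightarrow> real \<times> real \<Rightarrow> bool" where
  "germ Sk d \<sigma> v \<longleftrightarrow> ev (\<lambda>\<tau>. ray d \<sigma> 0 v \<tau> \<in> Sk)"

lemma germ_eseg: assumes "v \<in> Sk" "germ Sk d \<sigma> v"
  shows "\<exists>\<delta>>0. ray d \<sigma> 0 v \<delta> \<in> eseg Sk d v"
proof -
  obtain b where b: "b > 0" "\<And>\<tau>. 0 < \<tau> \<Longrightarrow> \<tau> < b \<Longrightarrow> ray d \<sigma> 0 v \<tau> \<in> Sk"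
    using assms(2) unfolding germ_def eventually_at_right_field by auto
  have al: "crd (\<not> d) v = crd (\<not> d) (ray d \<sigma> 0 v (b / 2))" by simp
  have "p \<in> Sk" if p: "p \<in> closed_segment v (ray d \<sigma> 0 v (b / 2))" for p
  proof -
    obtain u where u: "0 \<le> u" "u \<le> 1" "p = (1 - u) *\<^sub>R v + u *\<^sub>R ray d \<sigma> 0 v (b / 2)" using p by (auto simp: in_segment)
    have "p = ray d \<sigma> 0 v (u * (b / 2))"
      unfolding u(3) ray_def by (cases d) (auto simp: crd_def pt_def prod_eq_iff algebra_simps)
    moreover have "u * (b / 2) < b" using u b(1) by (smt (verit) field_sum_of_halves mult_left_le_one_le)
    moreover have "ray d \<sigma> 0 v 0 = v" by (simp add: ray_def)
    ultimately show ?thesis using b(2)[of "u * (b / 2)"] b(1) u assms(1) by (cases "u = 0") auto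
  qed
  then show ?thesis using b(1) by (intro exI[of _ "b / 2"]) (auto simp: eseg_def)
qed

lemma eseg_germ:
  assumes "w \<in> eseg Sk d v" "\<sigma> * (crd d w - crd d v) > 0" "\<bar>\<sigma>\<bar> = 1"
  shows "germ Sk d \<sigma> v"
proof -
  have al: "crd (\<not> d) v = crd (\<not> d) w" and s: "closed_segment v w \<subseteq> Sk" using assms by (auto simp: eseg_def)
  have "crd d w \<noteq> crd d v" using assms(2) by auto
  then have "ev (\<lambda>\<tau>. \<tau> < \<bar>crd d w - crd d v\<bar>)" using ev_less(1)[of 0 "\<bar>crd d w - crd d v\<bar>" 1] assms by auto
  then have "ev (\<lambda>\<tau>. \<tau> < \<bar>crd d w - crd d v\<bar> \<and> \<tau> > 0)" using ev_pos eventually_conj by blast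
  then show ?thesis unfolding germ_def
  proof (rule eventually_mono)
    fix \<tau> assume t: "\<tau> < \<bar>crd d w - crd d v\<bar> \<and> \<tau> > 0"
    have "\<sigma> = 1 \<or> \<sigma> = -1" using assms(3) by auto
    then have "ray d \<sigma> 0 v \<tau> \<in> closed_segment v w"
      using t assms(2) unfolding aligned_segment[OF al] by (auto simp: closed_segment_eq_real_ivl)
    then show "ray d \<sigma> 0 v \<tau> \<in> Sk" using s by auto
  qed
qed

abbreviation signs :: "real set" where "signs \<equiv> {1, -1}"

lemma dir_germ:
  assumes "v \<in> Sk"
  shows "dir Sk d v \<longleftrightarrow> (\<exists>\<sigma>\<in>signs. germ Sk d \<sigma> v)"
proof
  assume "dir Sk d v"
  then obtain w where w: "w \<in> eseg Sk d v" "w \<noteq> v" by (auto simp: dir_def)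
  then have "crd d w \<noteq> crd d v" using point_eqI[of d w v] by (auto simp: eseg_def)
  then have "1 * (crd d w - crd d v) > 0 \<or> (-1) * (crd d w - crd d v) > 0" by auto
  then show "\<exists>\<sigma>\<in>signs. germ Sk d \<sigma> v" using eseg_germ[OF w(1)] by (metis abs_minus_cancel abs_one insertI1 insertI2)
next
  assume "\<exists>\<sigma>\<in>signs. germ Sk d \<sigma> v"
  then obtain \<sigma> where s: "\<sigma> \<in> signs" "germ Sk d \<sigma> v" by blast
  then obtain \<delta> where "\<delta> > 0" "ray d \<sigma> 0 v \<delta> \<in> eseg Sk d v" using germ_eseg assms by blast
  moreover have "crd d (ray d \<sigma> 0 v \<delta>) \<noteq> crd d v" using s \<open>\<delta> > 0\<close> by auto
  ultimately show "dir Sk d v" unfolding dir_def by metis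
qed

lemma eseg_interval:
  assumes c: "compact Sk" and v: "v \<in> Sk"
  obtains l r where "l \<le> crd d v" "crd d v \<le> r" "eseg Sk d v = {p. crd (\<not> d) p = crd (\<not> d) v \<and> l \<le> crd d p \<and> crd d p \<le> r}"
proof -
  define S where "S = crd d ` (Sk \<inter> {p. crd (\<not> d) p = crd (\<not> d) v})"
  have "closed {p. crd (\<not> d) p = crd (\<not> d) v}" by (intro closed_Collect_eq continuous_intros)
  then have cS: "compact S" unfolding S_def by (intro compact_continuous_image continuous_intros compact_Int_closed c)
  have vS: "crd d v \<in> S" using v by (auto simp: S_def)
  have Siff: "s \<in> S \<longleftrightarrow> pt d s (crd (\<not> d) v) \<in> Sk" for s
  proof
    assume "s \<in> S"
    then obtain p where "p \<in> Sk" "crd (\<not> d) p = crd (\<not> d) v" "s = crd d p" by (auto simp: S_def)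
    then show "pt d s (crd (\<not> d) v) \<in> Sk" using pt_crd[of d p] by simp
  next
    assume "pt d s (crd (\<not> d) v) \<in> Sk"
    then show "s \<in> S" unfolding S_def by (intro image_eqI[of _ _ "pt d s (crd (\<not> d) v)"]) auto
  qed
  let ?C = "connected_component_set S (crd d v)"
  have "closed ?C" using closed_connected_component compact_imp_closed cS by blast
  then have "compact ?C" using cS connected_component_subset compact_Int_closed by (metis Int_absorb1)
  then have "connected ?C \<and> compact ?C" by simp
  then obtain l r where lr: "?C = {l..r}" unfolding connected_compact_interval_1 by (auto simp: cbox_interval)
  have vC: "crd d v \<in> ?C" using vS by simp
  have e: "w \<in> eseg Sk d v \<longleftrightarrow> crd (\<not> d) w = crd (\<not> d) v \<and> crd d w \<in> ?C" for w
  proof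
    assume "w \<in> eseg Sk d v"
    then have al: "crd (\<not> d) v = crd (\<not> d) w" and s: "closed_segment v w \<subseteq> Sk" by (auto simp: eseg_def)
    have "closed_segment (crd d v) (crd d w) \<subseteq> S"
      unfolding crd_segment[symmetric] S_def using s aligned_segment[OF al] by auto
    then have "closed_segment (crd d v) (crd d w) \<subseteq> ?C"
      by (intro connected_component_maximal) auto
    then show "crd (\<not> d) w = crd (\<not> d) v \<and> crd d w \<in> ?C" using al by auto
  next
    assume w: "crd (\<not> d) w = crd (\<not> d) v \<and> crd d w \<in> ?C"
    have "closed_segment (crd d v) (crd d w) \<subseteq> ?C"
      using w vC unfolding lr by (intro closed_segment_subset) auto
    then have "closed_segment (crd d v) (crd d w) \<subseteq> S" using connected_component_subset by blast
    then have "p \<in> Sk" if "p \<in> closed_segment v w" for p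
      using that w Siff[of "crd d p"] pt_crd[of d p] by (auto simp: aligned_segment[of d v w] subset_iff)
    then show "w \<in> eseg Sk d v" using w by (auto simp: eseg_def)
  qed
  have "eseg Sk d v = {p. crd (\<not> d) p = crd (\<not> d) v \<and> l \<le> crd d p \<and> crd d p \<le> r}"
    by (intro set_eqI) (simp add: e lr)
  then show ?thesis using that[of l r] vC unfolding lr by simp
qed

lemma eseg_ends:
  assumes c: "compact Sk" and v: "v \<in> Sk"
  obtains l r where "l \<le> crd d v" "crd d v \<le> r" "eseg Sk d v = {p. crd (\<not> d) p = crd (\<not> d) v \<and> l \<le> crd d p \<and> crd d p \<le> r}"
    "\<forall>p\<in>eseg Sk d v. (germ Sk d 1 p \<longleftrightarrow> crd d p < r) \<and> (germ Sk d (-1) p \<longleftrightarrow> l < crd d p)"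
proof -
  obtain l r where lr: "l \<le> crd d v" "crd d v \<le> r" "eseg Sk d v = {p. crd (\<not> d) p = crd (\<not> d) v \<and> l \<le> crd d p \<and> crd d p \<le> r}"
    using eseg_interval[OF c v] .
  have pS: "p \<in> Sk" if "p \<in> eseg Sk d v" for p using that by (auto simp: eseg_def)
  have 1: "germ Sk d 1 p \<longleftrightarrow> crd d p < r" if p: "p \<in> eseg Sk d v" for p
  proof
    assume "germ Sk d 1 p"
    then obtain \<delta> where "\<delta> > 0" "ray d 1 0 p \<delta> \<in> eseg Sk d v" using germ_eseg[OF pS[OF p]] eseg_eq[OF p] by metis
    then show "crd d p < r" unfolding lr(3) by auto
  next
    assume "crd d p < r"
    moreover have "pt d r (crd (\<not> d) v) \<in> eseg Sk d p" unfolding eseg_eq[OF p] lr(3) using lr by auto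
    ultimately show "germ Sk d 1 p" by (intro eseg_germ[of "pt d r (crd (\<not> d) v)"]) auto
  qed
  have 2: "germ Sk d (-1) p \<longleftrightarrow> l < crd d p" if p: "p \<in> eseg Sk d v" for p
  proof
    assume "germ Sk d (-1) p"
    then obtain \<delta> where "\<delta> > 0" "ray d (-1) 0 p \<delta> \<in> eseg Sk d v" using germ_eseg[OF pS[OF p]] eseg_eq[OF p] by metis
    then show "l < crd d p" unfolding lr(3) by auto
  next
    assume "l < crd d p"
    moreover have "pt d l (crd (\<not> d) v) \<in> eseg Sk d p" unfolding eseg_eq[OF p] lr(3) using lr by auto
    ultimately show "germ Sk d (-1) p" by (intro eseg_germ[of "pt d l (crd (\<not> d) v)"]) auto
  qed
  show ?thesis using that[OF lr] 1 2 by blast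
qed

section \<open>Regular meshes\<close>

text \<open>A regular mesh with region \<open>cellset B\<close>, independent of the way in which it is constructed.\<close>

locale regular_mesh =
  fixes T :: mesh and B :: cell
  assumes nonempty: "\<And>K. K \<in> T \<Longrightarrow> interior K \<noteq> {}" and B: "opencell B \<noteq> {}"
    and division: "T division_of cellset B"
begin

abbreviation "Sk \<equiv> skeleton T"

lemma finT: "finite T" using division by (rule division_ofD)

lemma cellE:
  assumes "K \<in> T" obtains C where "K = cellset C" "opencell C \<noteq> {}" "cellset C \<subseteq> cellset B"
proof -
  obtain p q where "K = cbox p q" using division_ofD(4)[OF division assms] by auto
  then have "K = cellset (p, q)" by (simp add: cellset_cbox)
  then show ?thesis using that[of "(p, q)"] nonempty[OF assms] interior_cellset division_ofD(2)[OF division assms] by metis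
qed

lemma region: "\<Union>T = cellset B" using division_ofD(6)[OF division] .

lemma compact_Sk: "compact Sk"
  unfolding skeleton_def
proof (intro compact_UN finT)
  fix K assume "K \<in> T"
  then obtain C where "K = cellset C" using cellE by metis
  then show "compact (frontier K)" using compact_frontier[OF closed_cellset(2)[of C]] by simp
qed

lemma Sk_region: "Sk \<subseteq> cellset B"
proof
  fix p assume "p \<in> Sk"
  then obtain K where K: "K \<in> T" "p \<in> frontier K" by (auto simp: skeleton_def)
  obtain C where C: "K = cellset C" "opencell C \<noteq> {}" "cellset C \<subseteq> cellset B" using cellE[OF K(1)] .
  then show "p \<in> cellset B" using K(2) unfolding C(1) frontier_cellset by auto
qed

lemma opencell_Sk: assumes "cellset C \<in> T" shows "opencell C \<inter> Sk = {}"
proof (rule ccontr)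
  assume "\<not> ?thesis"
  then obtain p K where p: "p \<in> opencell C" "K \<in> T" "p \<in> frontier K" by (auto simp: skeleton_def)
  obtain C' where C': "K = cellset C'" "opencell C' \<noteq> {}" using cellE[OF p(2)] by metis
  have pf: "p \<in> cellset C'" "p \<notin> opencell C'" using p(3) unfolding C'(1) frontier_cellset by auto
  have "cellset C \<noteq> K" using pf p(1) interior_cellset C'(1) by metis
  then have "opencell C \<inter> opencell C' = {}"
    using division_ofD(5)[OF division assms p(2)] C' interior_cellset by metis
  then have "opencell C \<inter> closure (opencell C') = {}"
    using open_Int_closure_eq_empty[of "opencell C"] interior_cellset open_interior by metis
  then show False using p(1) pf(1) closure_opencell[OF C'(2)] by auto
qed

lemma frontier_Sk: "frontier (cellset B) \<subseteq> Sk"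
proof
  fix p assume p: "p \<in> frontier (cellset B)"
  then have "p \<in> cellset B" "p \<notin> opencell B" unfolding frontier_cellset by auto
  then obtain K where K: "K \<in> T" "p \<in> K" using region by auto
  obtain C where C: "K = cellset C" "cellset C \<subseteq> cellset B" using cellE[OF K(1)] by metis
  have "opencell C \<subseteq> opencell B" using C(2) interior_mono interior_cellset by metis
  then have "p \<in> frontier K" using \<open>p \<notin> opencell B\<close> K C frontier_cellset by auto
  then show "p \<in> Sk" using K by (auto simp: skeleton_def)
qed

lemma not_Sk:
  assumes "p \<in> cellset B" "p \<notin> Sk"
  shows "\<exists>C. cellset C \<in> T \<and> p \<in> opencell C"
proof -
  obtain K where K: "K \<in> T" "p \<in> K" using region assms by auto
  obtain C where C: "K = cellset C" using cellE[OF K(1)] by metis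
  then show ?thesis using assms(2) K frontier_cellset[of C] by (auto simp: skeleton_def)
qed

lemma decided_Sk: "decided (\<lambda>\<tau>. ray d \<alpha> \<beta> v \<tau> \<in> Sk)"
proof -
  have "decided (\<lambda>\<tau>. \<exists>K\<in>T. ray d \<alpha> \<beta> v \<tau> \<in> frontier K)"
  proof (rule decided_Bex[OF finT])
    fix K assume "K \<in> T"
    then obtain C where C: "K = cellset C" using cellE by metis
    show "decided (\<lambda>\<tau>. ray d \<alpha> \<beta> v \<tau> \<in> frontier K)"
      unfolding C frontier_cellset Diff_iff by (intro decided_conj decided_not decided_cell)
  qed
  then show ?thesis by (simp add: skeleton_def)
qed

text \<open>A ray that leaves \<open>v\<close> inside the region and off the skeleton stays in one open cell for small
parameters: there are finitely many cells, and membership is decided for each of them.\<close>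

lemma ray_cell:
  assumes "ev (\<lambda>\<tau>. ray d \<alpha> \<beta> v \<tau> \<in> cellset B)" "ev (\<lambda>\<tau>. ray d \<alpha> \<beta> v \<tau> \<notin> Sk)"
  obtains C where "cellset C \<in> T" "ev (\<lambda>\<tau>. ray d \<alpha> \<beta> v \<tau> \<in> opencell C)" "opencell C \<noteq> {}" "cellset C \<subseteq> cellset B"
proof -
  have e: "ev (\<lambda>\<tau>. \<exists>K\<in>T. ray d \<alpha> \<beta> v \<tau> \<in> interior K)"
    using eventually_conj[OF assms]
  proof (rule eventually_mono)
    fix \<tau> assume "ray d \<alpha> \<beta> v \<tau> \<in> cellset B \<and> ray d \<alpha> \<beta> v \<tau> \<notin> Sk"
    then show "\<exists>K\<in>T. ray d \<alpha> \<beta> v \<tau> \<in> interior K" using not_Sk interior_cellset by metis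
  qed
  have "\<exists>K\<in>T. ev (\<lambda>\<tau>. ray d \<alpha> \<beta> v \<tau> \<in> interior K)"
  proof (rule ccontr)
    assume n: "\<not> ?thesis"
    have "ev (\<lambda>\<tau>. ray d \<alpha> \<beta> v \<tau> \<notin> interior K)" if K: "K \<in> T" for K
    proof -
      obtain C where C: "K = cellset C" using cellE K by metis
      have "\<not> ev (\<lambda>\<tau>. ray d \<alpha> \<beta> v \<tau> \<in> interior K)" using n K by blast
      then show ?thesis using decided_cell(2)[of d \<alpha> \<beta> v C] unfolding C interior_cellset decided_def by blast
    qed
    then have "ev (\<lambda>\<tau>. \<forall>K\<in>T. ray d \<alpha> \<beta> v \<tau> \<notin> interior K)" using finT by (simp add: eventually_ball_finite)
    then show False using ev_nontrivial[OF e, of _ False] by blast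
  qed
  then obtain K where K: "K \<in> T" "ev (\<lambda>\<tau>. ray d \<alpha> \<beta> v \<tau> \<in> interior K)" by blast
  obtain C where C: "K = cellset C" "opencell C \<noteq> {}" "cellset C \<subseteq> cellset B" using cellE[OF K(1)] .
  then show ?thesis using that[of C] K interior_cellset by metis
qed

lemma germ_dichotomy: "\<not> germ Sk d \<sigma> v \<Longrightarrow> ev (\<lambda>\<tau>. ray d \<sigma> 0 v \<tau> \<notin> Sk)"
  using decided_Sk[of d \<sigma> 0 v] unfolding germ_def decided_def by auto

lemma cell_side_Sk:
  assumes "cellset C \<in> T" "crd d p \<in> {lo d C, hi d C}" "lo (\<not> d) C \<le> crd (\<not> d) p" "crd (\<not> d) p \<le> hi (\<not> d) C" "opencell C \<noteq> {}"
  shows "p \<in> Sk"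
proof -
  have "p \<in> cellset C - opencell C" using assms opencell_nonempty[OF assms(5), of d] by (auto simp: cellset_iff[of _ _ d] opencell_iff[of _ _ d])
  then show ?thesis using assms(1) frontier_cellset[of C] by (auto simp: skeleton_def)
qed

text \<open>If the region continues beyond \<open>v\<close> in some direction, but the skeleton does not, then
\<open>v\<close> lies in the interior of a side of the cell in that direction; so it starts in both
perpendicular directions. This excludes vertices with two missing directions in the interior of the region.\<close>

lemma missing_germ:
  assumes v: "v \<in> Sk" and \<sigma>: "\<sigma> \<in> signs" "\<not> germ Sk d \<sigma> v" and r: "ev (\<lambda>\<tau>. ray d \<sigma> 0 v \<tau> \<in> cellset B)"
    and \<rho>: "\<rho> \<in> signs"
  shows "germ Sk (\<not> d) \<rho> v"
proof -
  obtain C where C: "cellset C \<in> T" "ev (\<lambda>\<tau>. ray d \<sigma> 0 v \<tau> \<in> opencell C)" "opencell C \<noteq> {}"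
    using ray_cell[OF r germ_dichotomy[OF \<sigma>(2)]] by metis
  have "v \<in> cellset C" using ray_opencell_cellset[OF C(2)] .
  moreover have "v \<notin> opencell C" using opencell_Sk[OF C(1)] v by auto
  moreover obtain \<tau> where "ray d \<sigma> 0 v \<tau> \<in> opencell C" using eventually_happens[OF C(2)] by auto
  then have t: "lo (\<not> d) C < crd (\<not> d) v" "crd (\<not> d) v < hi (\<not> d) C" by (auto simp: opencell_iff[of _ _ d])
  ultimately have s: "crd d v \<in> {lo d C, hi d C}" by (auto simp: cellset_iff[of _ _ d] opencell_iff[of _ _ d])
  have "ev (\<lambda>\<tau>. lo (\<not> d) C < crd (\<not> d) v + \<rho> * \<tau> \<and> crd (\<not> d) v + \<rho> * \<tau> < hi (\<not> d) C)"
    using ev_less(1)[OF t(2), of \<rho>] ev_less(2)[OF t(1), of \<rho>] by (simp add: eventually_conj)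
  then show ?thesis unfolding germ_def
  proof (rule eventually_mono)
    fix \<tau> assume a: "lo (\<not> d) C < crd (\<not> d) v + \<rho> * \<tau> \<and> crd (\<not> d) v + \<rho> * \<tau> < hi (\<not> d) C"
    have "crd d (ray (\<not> d) \<rho> 0 v \<tau>) = crd d v" "crd (\<not> d) (ray (\<not> d) \<rho> 0 v \<tau>) = crd (\<not> d) v + \<rho> * \<tau>"
      using crd_ray[of "\<not> d" \<rho> 0 v \<tau>] by simp_all
    then show "ray (\<not> d) \<rho> 0 v \<tau> \<in> Sk" using a s by (intro cell_side_Sk[OF C(1), of d] C(3)) auto
  qed
qed

lemma loB: "lo d B < hi d B" using opencell_nonempty[OF B] .

lemma ray_inside:
  assumes "v \<in> cellset B" "\<sigma> \<in> signs" "\<sigma> = 1 \<Longrightarrow> crd d v < hi d B" "\<sigma> = -1 \<Longrightarrow> lo d B < crd d v"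
  shows "ev (\<lambda>\<tau>. ray d \<sigma> 0 v \<tau> \<in> cellset B)"
proof (cases "\<sigma> = 1")
  case True
  have "ev (\<lambda>\<tau>. crd d v + 1 * \<tau> < hi d B \<and> \<tau> > 0)" using ev_less(1)[OF assms(3)[OF True], of 1] ev_pos eventually_conj by blast
  then show ?thesis unfolding True by (rule eventually_mono) (use assms(1) in \<open>auto simp: cellset_iff[of _ _ d]\<close>)
next
  case False
  then have s: "\<sigma> = -1" using assms by auto
  have "ev (\<lambda>\<tau>. lo d B < crd d v + (-1) * \<tau> \<and> \<tau> > 0)" using ev_less(2)[OF assms(4)[OF s], of "-1"] ev_pos eventually_conj by blast
  then show ?thesis unfolding s by (rule eventually_mono) (use assms(1) in \<open>auto simp: cellset_iff[of _ _ d]\<close>)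
qed

lemma germ_inside:
  assumes "germ Sk d \<sigma> v" "\<sigma> \<in> signs"
  shows "\<sigma> = 1 \<Longrightarrow> crd d v < hi d B" "\<sigma> = -1 \<Longrightarrow> lo d B < crd d v"
proof -
  obtain \<tau> where "ray d \<sigma> 0 v \<tau> \<in> Sk" "\<tau> > 0"
    using assms(1) unfolding germ_def by (rule ev_nontrivial[OF _ ev_pos])
  then have "ray d \<sigma> 0 v \<tau> \<in> cellset B" "\<tau> > 0" using Sk_region by auto
  then show "\<sigma> = 1 \<Longrightarrow> crd d v < hi d B" "\<sigma> = -1 \<Longrightarrow> lo d B < crd d v" by (auto simp: cellset_iff[of _ _ d])
qed

lemma boundary_germ: assumes "v \<in> cellset B" "crd d v \<in> {lo d B, hi d B}" shows "dir Sk (\<not> d) v"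
proof -
  define w where "w = pt d (crd d v) (if crd (\<not> d) v = lo (\<not> d) B then hi (\<not> d) B else lo (\<not> d) B)"
  have al: "crd (\<not> \<not> d) v = crd (\<not> \<not> d) w" by (simp add: w_def)
  have "crd (\<not> d) w \<noteq> crd (\<not> d) v" using loB[of "\<not> d"] by (simp add: w_def)
  moreover have "closed_segment v w \<subseteq> frontier (cellset B)"
    unfolding frontier_cellset aligned_segment[OF al] using assms
    by (auto simp: cellset_iff[of _ _ d] opencell_iff[of _ _ d] w_def closed_segment_eq_real_ivl split: if_splits)
  ultimately show ?thesis using frontier_Sk al unfolding dir_def eseg_def by (intro bexI[of _ w]) auto
qed

text \<open>If the region continues beyond \<open>v\<close>, the perpendicular germs exist by \<open>missing_germ\<close>;
otherwise \<open>v\<close> is on a perpendicular side of the region.\<close>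

lemma end_vertex:
  assumes v: "v \<in> Sk" and w: "\<sigma> \<in> signs" "\<not> germ Sk d \<sigma> v" "dir Sk d v"
  shows "v \<in> verts Sk"
proof (cases "ev (\<lambda>\<tau>. ray d \<sigma> 0 v \<tau> \<in> cellset B)")
  case True
  have "germ Sk (\<not> d) 1 v" using missing_germ[OF v w(1,2) True, of 1] by simp
  then have "dir Sk (\<not> d) v" using dir_germ[OF v] by auto
  then show ?thesis using w verts_iff by blast
next
  case False
  have vB: "v \<in> cellset B" using Sk_region v by auto
  have "crd d v \<in> {lo d B, hi d B}"
  proof (rule ccontr)
    assume "\<not> ?thesis"
    then have "lo d B < crd d v" "crd d v < hi d B" using vB by (auto simp: cellset_iff[of _ _ d])
    then show False using False ray_inside[OF vB w(1), of d] by blast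
  qed
  then show ?thesis using boundary_germ[OF vB] w(3) verts_iff by blast
qed

lemma has_vertex: assumes "dir Sk d v" shows "\<exists>w\<in>eseg Sk d v. w \<in> verts Sk"
proof -
  have v: "v \<in> Sk" using dir_self assms by blast
  obtain l r where lr: "l \<le> crd d v" "crd d v \<le> r" "eseg Sk d v = {p. crd (\<not> d) p = crd (\<not> d) v \<and> l \<le> crd d p \<and> crd d p \<le> r}"
    "\<forall>p\<in>eseg Sk d v. (germ Sk d 1 p \<longleftrightarrow> crd d p < r) \<and> (germ Sk d (-1) p \<longleftrightarrow> l < crd d p)"
    by (rule eseg_ends[OF compact_Sk v, where d = d])
  define w where "w = pt d r (crd (\<not> d) v)"
  have w: "w \<in> eseg Sk d v" unfolding lr(3) w_def using lr by auto
  have "\<not> germ Sk d 1 w" using lr(4) w by (simp add: w_def)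
  moreover have "w \<in> Sk" using w by (auto simp: eseg_def)
  moreover have "dir Sk d w" using dir_eseg[OF assms w] .
  ultimately show ?thesis using end_vertex w by blast
qed

lemma coordinates_Sk: "p \<in> Sk \<Longrightarrow> \<exists>d. \<exists>C. cellset C \<in> T \<and> opencell C \<noteq> {} \<and> crd d p \<in> {lo d C, hi d C}"
proof -
  assume "p \<in> Sk"
  then obtain K where K: "K \<in> T" "p \<in> frontier K" by (auto simp: skeleton_def)
  obtain C where C: "K = cellset C" "opencell C \<noteq> {}" using cellE[OF K(1)] by metis
  then have "p \<in> cellset C - opencell C" using K frontier_cellset by auto
  then have a: "\<forall>d. lo d C \<le> crd d p \<and> crd d p \<le> hi d C" "\<not> (\<forall>d. lo d C < crd d p \<and> crd d p < hi d C)"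
    unfolding cellset_def opencell_def by blast+
  then obtain d where "\<not> (lo d C < crd d p \<and> crd d p < hi d C)" by blast
  then have "crd d p \<in> {lo d C, hi d C}" using a(1) by (metis insertCI order_le_imp_less_or_eq)
  then show ?thesis using K C by (intro exI[of _ d] exI[of _ C]) auto
qed

lemma corner_vertices: "vertices T = {v. \<exists>C. cellset C \<in> T \<and> (\<forall>d. crd d v \<in> {lo d C, hi d C})}"
  unfolding vertices_def by (auto simp: crd_def lo_def hi_def all_bool_eq cellset_cbox)
    (metis cellset_cbox(1) fst_conv snd_conv prod.collapse)+

lemma finite_cells: "finite {C. cellset C \<in> T}"
proof -
  have "inj_on cellset {C. cellset C \<in> T}"
    using cellset_injective nonempty interior_cellset by (intro inj_onI) (metis mem_Collect_eq)
  moreover have "cellset ` {C. cellset C \<in> T} \<subseteq> T" by auto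
  ultimately show ?thesis using finT by (meson inj_on_finite)
qed

lemma finite_corner_coords: "finite (\<Union>C\<in>{C. cellset C \<in> T}. {lo d C, hi d C})"
  using finite_cells by auto

text \<open>A diagonal ray between two perpendicular germs runs in an open cell, which both germs avoid; so their origin
is a corner of this cell. Conversely, two sides meet at each corner of a cell.\<close>

lemma vertices_verts: "vertices T = verts Sk"
proof (intro set_eqI iffI)
  fix v assume "v \<in> vertices T"
  then obtain C where C: "cellset C \<in> T" "\<And>d. crd d v \<in> {lo d C, hi d C}" unfolding corner_vertices by blast
  have ne: "opencell C \<noteq> {}" using nonempty[OF C(1)] interior_cellset by metis
  have "dir Sk d v" for d
  proof -
    define w where "w = pt d (if crd d v = lo d C then hi d C else lo d C) (crd (\<not> d) v)"
    have al: "crd (\<not> d) v = crd (\<not> d) w" by (simp add: w_def)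
    have wn: "crd d w \<noteq> crd d v" using opencell_nonempty[OF ne, of d] by (simp add: w_def)
    have "p \<in> Sk" if "p \<in> closed_segment v w" for p
    proof (rule cell_side_Sk[OF C(1), of "\<not> d"])
      show "crd (\<not> d) p \<in> {lo (\<not> d) C, hi (\<not> d) C}" using that C(2)[of "\<not> d"] unfolding aligned_segment[OF al] by simp
      show "lo (\<not> \<not> d) C \<le> crd (\<not> \<not> d) p" "crd (\<not> \<not> d) p \<le> hi (\<not> \<not> d) C"
        using that C(2)[of d] opencell_nonempty[OF ne, of d] unfolding aligned_segment[OF al]
        by (auto simp: w_def closed_segment_eq_real_ivl split: if_splits)
    qed (rule ne)
    then show ?thesis using wn al unfolding dir_def eseg_def by (intro bexI[of _ w]) auto
  qed
  then show "v \<in> verts Sk" by (simp add: verts_def)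
next
  fix v assume v: "v \<in> verts Sk"
  have vS: "v \<in> Sk" using v dir_self by (auto simp: verts_def)
  have "\<exists>\<sigma>\<in>signs. germ Sk True \<sigma> v" "\<exists>\<rho>\<in>signs. germ Sk False \<rho> v" using v dir_germ[OF vS] by (auto simp: verts_def)
  then obtain \<sigma> \<rho> where g: "\<sigma> \<in> signs" "germ Sk True \<sigma> v" "\<rho> \<in> signs" "germ Sk False \<rho> v" by blast
  have eT: "ev (\<lambda>\<tau>. ray True \<sigma> 0 v \<tau> \<in> Sk)" and eF: "ev (\<lambda>\<tau>. ray False \<rho> 0 v \<tau> \<in> Sk)"
    using g by (auto simp: germ_def)
  have rel: "crd True (ray False \<rho> 0 v \<tau>) = crd True v" "crd False (ray False \<rho> 0 v \<tau>) = crd False v + \<rho> * \<tau>"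
     "crd True (ray True \<sigma> \<rho>' v \<tau>) = crd True v + \<sigma> * \<tau>" "crd False (ray True \<sigma> \<rho>' v \<tau>) = crd False v + \<rho>' * \<tau>" for \<tau> \<rho>'
    by (simp_all add: ray_def pt_def crd_def)
  have r1: "ev (\<lambda>\<tau>. ray True \<sigma> \<rho> v \<tau> \<in> cellset B)"
    using eventually_conj[OF eT eF]
  proof (rule eventually_mono)
    fix \<tau> assume "ray True \<sigma> 0 v \<tau> \<in> Sk \<and> ray False \<rho> 0 v \<tau> \<in> Sk"
    then have "ray True \<sigma> 0 v \<tau> \<in> cellset B" "ray False \<rho> 0 v \<tau> \<in> cellset B" using Sk_region by auto
    then show "ray True \<sigma> \<rho> v \<tau> \<in> cellset B" by (auto simp: cellset_iff[of _ _ True] rel)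
  qed
  \<comment> \<open>near v, but not on its lines, both coordinates avoid the finitely many coordinates of corners\<close>
  have r2: "ev (\<lambda>\<tau>. ray True \<sigma> \<rho> v \<tau> \<notin> Sk)"
  proof -
    have "ev (\<lambda>\<tau>. crd d v + \<alpha> * \<tau> \<notin> (\<Union>C\<in>{C. cellset C \<in> T}. {lo d C, hi d C}))" if "\<alpha> \<in> signs" for d \<alpha>
    proof -
      have "ev (\<lambda>\<tau>. crd d v + \<alpha> * \<tau> \<noteq> c)" for c
      proof (cases "crd d v = c")
        case True then show ?thesis using that by (intro eventually_mono[OF ev_pos]) auto
      next
        case False
        then consider "crd d v < c" | "c < crd d v" by linarith
        then show ?thesis
          using eventually_mono[OF ev_less(1), of "crd d v" c \<alpha>] eventually_mono[OF ev_less(2), of c "crd d v" \<alpha>]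
          by cases auto
      qed
      then have "ev (\<lambda>\<tau>. \<forall>c\<in>(\<Union>C\<in>{C. cellset C \<in> T}. {lo d C, hi d C}). crd d v + \<alpha> * \<tau> \<noteq> c)"
        using finite_corner_coords by (intro eventually_ball_finite) auto
      then show ?thesis by (rule eventually_mono) auto
    qed
    from eventually_conj[OF this[OF g(1), of True] this[OF g(3), of False]] show ?thesis
    proof (rule eventually_mono)
      fix \<tau> assume a: "crd True v + \<sigma> * \<tau> \<notin> (\<Union>C\<in>{C. cellset C \<in> T}. {lo True C, hi True C}) \<and>
          crd False v + \<rho> * \<tau> \<notin> (\<Union>C\<in>{C. cellset C \<in> T}. {lo False C, hi False C})"
      show "ray True \<sigma> \<rho> v \<tau> \<notin> Sk"
      proof
        assume "ray True \<sigma> \<rho> v \<tau> \<in> Sk"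
        then obtain d C where "cellset C \<in> T" "crd d (ray True \<sigma> \<rho> v \<tau>) \<in> {lo d C, hi d C}" using coordinates_Sk by blast
        then show False using a by (cases d) (auto simp: rel)
      qed
    qed
  qed
  obtain C where C: "cellset C \<in> T" "ev (\<lambda>\<tau>. ray True \<sigma> \<rho> v \<tau> \<in> opencell C)" "opencell C \<noteq> {}"
    using ray_cell[OF r1 r2] by metis
  have vC: "v \<in> cellset C" using ray_opencell_cellset[OF C(2)] .
  have "crd False v \<in> {lo False C, hi False C}"
  proof -
    obtain \<tau> where "ray True \<sigma> \<rho> v \<tau> \<in> opencell C" "ray True \<sigma> 0 v \<tau> \<in> Sk" using ev_nontrivial[OF C(2) eT] by blast
    moreover have "ray True \<sigma> 0 v \<tau> \<notin> opencell C" using opencell_Sk[OF C(1)] calculation by blast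
    ultimately have "ray True \<sigma> 0 v \<tau> \<notin> opencell C" "lo True C < crd True v + \<sigma> * \<tau>" "crd True v + \<sigma> * \<tau> < hi True C"
      using opencell_Sk[OF C(1)] by (auto simp: opencell_iff[of _ _ True] rel)
    then show ?thesis using vC by (auto simp: opencell_iff[of _ _ True] cellset_iff[of _ _ True] rel)
  qed
  moreover have "crd True v \<in> {lo True C, hi True C}"
  proof -
    obtain \<tau> where "ray True \<sigma> \<rho> v \<tau> \<in> opencell C" "ray False \<rho> 0 v \<tau> \<in> Sk" using ev_nontrivial[OF C(2) eF] by blast
    moreover have "ray False \<rho> 0 v \<tau> \<notin> opencell C" using opencell_Sk[OF C(1)] calculation by blast
    ultimately have "ray False \<rho> 0 v \<tau> \<notin> opencell C" "lo False C < crd False v + \<rho> * \<tau>" "crd False v + \<rho> * \<tau> < hi False C"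
      using opencell_Sk[OF C(1)] by (auto simp: opencell_iff[of _ _ True] rel)
    then show ?thesis using vC by (auto simp: opencell_iff[of _ _ True] cellset_iff[of _ _ True] rel)
  qed
  ultimately show "v \<in> vertices T" unfolding corner_vertices using C(1) by (auto simp: all_bool_eq)
qed

lemma finite_verts: "finite (verts Sk)"
proof -
  have "vertices T \<subseteq> {p. crd True p \<in> (\<Union>C\<in>{C. cellset C \<in> T}. {lo True C, hi True C}) \<and> crd (\<not> True) p \<in> (\<Union>C\<in>{C. cellset C \<in> T}. {lo False C, hi False C})}"
    unfolding corner_vertices by (auto simp: all_bool_eq)
  then show ?thesis unfolding vertices_verts[symmetric]
    by (rule finite_subset) (intro finite_product_points finite_corner_coords)
qed

end

section \<open>Counting vertices and l-edges\<close>

lemma crd_fun: "fst = crd True" "snd = crd False" by (auto simp: crd_def fun_eq_iff)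

context regular_mesh begin

abbreviation "aedges d \<equiv> axis_edges (crd (\<not> d)) T"

lemma edges_aedges: "edges T = aedges True \<union> aedges False"
  unfolding edges_def crd_fun by simp

lemma aedges_iff: "e \<in> aedges d \<longleftrightarrow> (\<exists>u v. e = closed_segment u v \<and> u \<in> verts Sk \<and> v \<in> verts Sk \<and> u \<noteq> v \<and>
   v \<in> eseg Sk d u \<and> open_segment u v \<inter> verts Sk = {})"
  unfolding axis_edges_def vertices_verts eseg_def mem_Collect_eq by (blast intro: sym)

text \<open>\<open>w\<close> is the next vertex from \<open>v\<close> in the direction of \<open>\<sigma>\<close>. Edges
at \<open>v\<close> correspond to next vertices, hence to germs (\<open>edges_at\<close>).\<close>

definition adj :: "bool \<Rightarrow> real \<Rightarrow> real \<times> real \<Rightarrow> real \<times> real \<Rightarrow> bool" where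
  "adj d \<sigma> v w \<longleftrightarrow> w \<in> verts Sk \<and> w \<in> eseg Sk d v \<and> \<sigma> * (crd d w - crd d v) > 0 \<and> open_segment v w \<inter> verts Sk = {}"

lemma open_segment_eseg: assumes "w \<in> eseg Sk d v" "p \<in> open_segment v w"
  shows "p \<in> eseg Sk d v" "\<bar>crd d p - crd d v\<bar> < \<bar>crd d w - crd d v\<bar>" "(crd d p - crd d v) * (crd d w - crd d v) > 0"
proof -
  have al: "crd (\<not> d) v = crd (\<not> d) w" and s: "closed_segment v w \<subseteq> Sk" using assms by (auto simp: eseg_def)
  have p: "p \<in> closed_segment v w" "p \<noteq> v" "p \<noteq> w" using assms(2) by (auto simp: open_segment_def)
  then have pl: "crd (\<not> d) p = crd (\<not> d) v" "crd d p \<in> closed_segment (crd d v) (crd d w)" using aligned_segment[OF al] by auto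
  have "closed_segment v p \<subseteq> closed_segment v w" using p by (simp add: subset_closed_segment)
  then show "p \<in> eseg Sk d v" using s pl by (auto simp: eseg_def)
  have "crd d p \<noteq> crd d v" "crd d p \<noteq> crd d w" using p pl al point_eqI[of d] by metis+
  then show "\<bar>crd d p - crd d v\<bar> < \<bar>crd d w - crd d v\<bar>" "(crd d p - crd d v) * (crd d w - crd d v) > 0"
    using pl(2) by (auto simp: closed_segment_eq_real_ivl mult_pos_pos mult_neg_neg split: if_splits)
qed

lemma in_open_segmentI:
  assumes "w \<in> eseg Sk d v" "p \<in> eseg Sk d v" "\<sigma> * (crd d p - crd d v) > 0" "\<sigma> * (crd d p - crd d v) < \<sigma> * (crd d w - crd d v)" "\<sigma> \<in> signs"
  shows "p \<in> open_segment v w"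
proof -
  have al: "crd (\<not> d) v = crd (\<not> d) w" "crd (\<not> d) p = crd (\<not> d) v" using assms by (auto simp: eseg_def)
  have "p \<in> closed_segment v w" unfolding aligned_segment[OF al(1)] using al assms(3-5) by (auto simp: closed_segment_eq_real_ivl)
  moreover have "p \<noteq> v" "p \<noteq> w" using assms(3,4) by auto
  ultimately show ?thesis by (simp add: open_segment_def)
qed

lemma vS: "v \<in> verts Sk \<Longrightarrow> v \<in> Sk" using dir_self by (auto simp: verts_def)

lemma segment_end: assumes v: "v \<in> Sk" "dir Sk d v" and \<sigma>: "\<sigma> \<in> signs"
  obtains w where "w \<in> verts Sk" "w \<in> eseg Sk d v" "\<not> germ Sk d \<sigma> w"
    "\<forall>p\<in>eseg Sk d v. \<sigma> * crd d p \<le> \<sigma> * crd d w \<and> (germ Sk d \<sigma> p \<longleftrightarrow> p \<noteq> w)"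
proof -
  obtain l r where lr: "l \<le> crd d v" "crd d v \<le> r" "eseg Sk d v = {p. crd (\<not> d) p = crd (\<not> d) v \<and> l \<le> crd d p \<and> crd d p \<le> r}"
    "\<forall>p\<in>eseg Sk d v. (germ Sk d 1 p \<longleftrightarrow> crd d p < r) \<and> (germ Sk d (-1) p \<longleftrightarrow> l < crd d p)"
    by (rule eseg_ends[OF compact_Sk v(1), where d = d])
  define w where "w = pt d (if \<sigma> = 1 then r else l) (crd (\<not> d) v)"
  have w: "w \<in> eseg Sk d v" unfolding lr(3) w_def using lr by auto
  have g: "germ Sk d \<sigma> p \<longleftrightarrow> crd d p \<noteq> crd d w" if "p \<in> eseg Sk d v" for p
    using lr(3,4) that \<sigma> by (auto simp: w_def)
  then have ng: "\<not> germ Sk d \<sigma> w" using w by auto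
  have wS: "w \<in> Sk" using w by (auto simp: eseg_def)
  have "w \<in> verts Sk" using end_vertex[OF wS \<sigma> ng dir_eseg[OF v(2) w]] .
  moreover have "\<sigma> * crd d p \<le> \<sigma> * crd d w" if "p \<in> eseg Sk d v" for p
    using that \<sigma> unfolding lr(3) w_def by auto
  moreover have "germ Sk d \<sigma> p \<longleftrightarrow> p \<noteq> w" if "p \<in> eseg Sk d v" for p
    using g[OF that] that w point_eqI[of d p w] by (auto simp: eseg_def)
  ultimately show ?thesis using that w ng by blast
qed

lemma adj_exists:
  assumes v: "v \<in> verts Sk" and \<sigma>: "\<sigma> \<in> signs" "germ Sk d \<sigma> v"
  shows "\<exists>w. adj d \<sigma> v w"
proof -
  have vd: "dir Sk d v" using v by (simp add: verts_def)
  let ?W = "{w \<in> verts Sk. w \<in> eseg Sk d v \<and> \<sigma> * (crd d w - crd d v) > 0}"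
  obtain e where e: "e \<in> verts Sk" "e \<in> eseg Sk d v" "\<not> germ Sk d \<sigma> e"
    "\<forall>p\<in>eseg Sk d v. \<sigma> * crd d p \<le> \<sigma> * crd d e \<and> (germ Sk d \<sigma> p \<longleftrightarrow> p \<noteq> e)"
    using segment_end[OF vS[OF v] vd \<sigma>(1)] .
  have "\<sigma> * crd d v \<le> \<sigma> * crd d e" using e(4) dir_self(2)[OF vd] by blast
  moreover have "v \<noteq> e" using e(3) \<sigma>(2) by auto
  then have "crd d v \<noteq> crd d e" using e(2) point_eqI[of d v e] by (auto simp: eseg_def)
  ultimately have "\<sigma> * (crd d e - crd d v) > 0" using \<sigma>(1) by (auto simp: algebra_simps)
  then have ne: "?W \<noteq> {}" "finite ?W" using e finite_verts by auto
  define w where "w = arg_min_on (\<lambda>w. \<sigma> * (crd d w - crd d v)) ?W"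
  have w: "w \<in> ?W" "\<And>x. x \<in> ?W \<Longrightarrow> \<sigma> * (crd d w - crd d v) \<le> \<sigma> * (crd d x - crd d v)"
    using arg_min_if_finite[OF ne(2,1), of "\<lambda>w. \<sigma> * (crd d w - crd d v)"] unfolding w_def by (blast, metis (no_types, lifting) linorder_not_less)
  have "p \<notin> verts Sk" if p: "p \<in> open_segment v w" for p
  proof
    assume pv: "p \<in> verts Sk"
    note o = open_segment_eseg[OF _ p, of d]
    have "\<sigma> * (crd d p - crd d v) > 0" "\<sigma> * (crd d p - crd d v) < \<sigma> * (crd d w - crd d v)"
      using o(2,3) w(1) \<sigma>(1) by (auto simp: zero_less_mult_iff abs_if split: if_splits)
    then show False using w(2)[of p] pv o(1) w(1) by auto
  qed
  then show ?thesis using w(1) unfolding adj_def by blast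
qed

lemma adj_unique: assumes "adj d \<sigma> v w" "adj d \<sigma> v w'" "\<sigma> \<in> signs" shows "w = w'"
proof (rule ccontr)
  assume "w \<noteq> w'"
  have e: "w \<in> eseg Sk d v" "w' \<in> eseg Sk d v" using assms by (auto simp: adj_def)
  then have "crd d w \<noteq> crd d w'" using \<open>w \<noteq> w'\<close> point_eqI[of d w w'] by (auto simp: eseg_def)
  then have "\<sigma> * (crd d w - crd d v) < \<sigma> * (crd d w' - crd d v) \<or> \<sigma> * (crd d w' - crd d v) < \<sigma> * (crd d w - crd d v)"
    using assms(3) by auto
  then have "w \<in> open_segment v w' \<or> w' \<in> open_segment v w"
    using in_open_segmentI[OF e(2,1)] in_open_segmentI[OF e] assms by (auto simp: adj_def)
  then show False using assms by (auto simp: adj_def)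
qed

lemma adj_edge: assumes "v \<in> verts Sk" "adj d \<sigma> v w" shows "closed_segment v w \<in> aedges d"
  using assms unfolding aedges_iff adj_def by (intro exI[of _ v] exI[of _ w]) auto

lemma edge_adj: assumes v: "v \<in> verts Sk" and e: "e \<in> aedges d" "v \<in> e"
  obtains \<sigma> w where "\<sigma> \<in> signs" "germ Sk d \<sigma> v" "adj d \<sigma> v w" "e = closed_segment v w"
proof -
  obtain u w where uw: "e = closed_segment u w" "u \<in> verts Sk" "w \<in> verts Sk" "u \<noteq> w"
   "w \<in> eseg Sk d u" "open_segment u w \<inter> verts Sk = {}" using e(1) unfolding aedges_iff by blast
  have "v = u \<or> v = w" using uw v e(2) by (auto simp: open_segment_def)
  then obtain w' where w': "e = closed_segment v w'" "w' \<in> verts Sk" "v \<noteq> w'" "w' \<in> eseg Sk d v" "open_segment v w' \<inter> verts Sk = {}"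
  proof
    assume "v = u" then show ?thesis using that uw by blast
  next
    assume vw: "v = w"
    have "u \<in> eseg Sk d w" using uw(5) by (auto simp: eseg_def closed_segment_commute)
    then show ?thesis using that[of u] uw vw by (simp add: closed_segment_commute open_segment_commute)
  qed
  have ne: "crd d w' \<noteq> crd d v" using w' point_eqI[of d v w'] by (auto simp: eseg_def)
  define \<sigma> where "\<sigma> = (if crd d w' > crd d v then 1 else - 1 :: real)"
  have s: "\<sigma> \<in> signs" "\<sigma> * (crd d w' - crd d v) > 0" "\<bar>\<sigma>\<bar> = 1" using ne by (auto simp: \<sigma>_def)
  then show ?thesis using that[of \<sigma> w'] eseg_germ[OF w'(4) s(2,3)] w' by (auto simp: adj_def)
qed

definition present where "present d v = {\<sigma> \<in> signs. germ Sk d \<sigma> v}"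
definition missing where "missing d v = {\<sigma> \<in> signs. \<not> germ Sk d \<sigma> v}"

lemma finite_present_missing [simp]: "finite (present d v)" "finite (missing d v)" by (auto simp: present_def missing_def)

lemma card_present_missing: "card (present d v) + card (missing d v) = 2"
proof -
  have "present d v \<union> missing d v = signs" "present d v \<inter> missing d v = {}" by (auto simp: present_def missing_def)
  then show ?thesis by (metis card_Un_disjoint card_2_iff finite_present_missing one_neq_neg_one)
qed

lemma edges_at: assumes v: "v \<in> verts Sk"
  shows "finite {e \<in> aedges d. v \<in> e}" "card {e \<in> aedges d. v \<in> e} = card (present d v)"
proof -
  define f where "f \<sigma> = closed_segment v (SOME w. adj d \<sigma> v w)" for \<sigma>
  have f: "adj d \<sigma> v (SOME w. adj d \<sigma> v w)" if "\<sigma> \<in> present d v" for \<sigma>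
    using someI_ex[OF adj_exists[OF v, of \<sigma> d]] that by (simp add: present_def)
  have im: "f ` present d v = {e \<in> aedges d. v \<in> e}"
  proof (intro set_eqI iffI)
    fix e assume "e \<in> f ` present d v"
    then show "e \<in> {e \<in> aedges d. v \<in> e}" using adj_edge[OF v f] by (auto simp: f_def)
  next
    fix e assume "e \<in> {e \<in> aedges d. v \<in> e}"
    then obtain \<sigma> w where w: "\<sigma> \<in> signs" "germ Sk d \<sigma> v" "adj d \<sigma> v w" "e = closed_segment v w"
      using edge_adj[OF v, of e d] by blast
    then have g: "\<sigma> \<in> present d v" by (simp add: present_def)
    have "w = (SOME w. adj d \<sigma> v w)" using adj_unique[OF w(3) f[OF g] w(1)] .
    then show "e \<in> f ` present d v" using w g by (auto simp: f_def)
  qed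
  have inj: "inj_on f (present d v)"
  proof (rule inj_onI)
    fix \<sigma> \<sigma>' assume g: "\<sigma> \<in> present d v" "\<sigma>' \<in> present d v" "f \<sigma> = f \<sigma>'"
    obtain w w' where w: "adj d \<sigma> v w" "adj d \<sigma>' v w'" "closed_segment v w = closed_segment v w'"
      using f[OF g(1)] f[OF g(2)] g(3) unfolding f_def by blast
    then have "{v, w} = {v, w'}" by (simp add: closed_segment_eq)
    then have "w = w'" by (auto simp: doubleton_eq_iff)
    then show "\<sigma> = \<sigma>'" using w g by (auto simp: adj_def present_def)
  qed
  show "finite {e \<in> aedges d. v \<in> e}" using im by (metis finite_imageI finite_present_missing(1))
  show "card {e \<in> aedges d. v \<in> e} = card (present d v)" using card_image[OF inj] im by simp
qed

lemma aedges_disjoint: "aedges True \<inter> aedges False = {}"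
proof (rule ccontr)
  assume "\<not> ?thesis"
  then obtain e where e: "e \<in> aedges True" "e \<in> aedges False" by auto
  obtain u v where u: "e = closed_segment u v" "u \<noteq> v" "v \<in> eseg Sk True u" using e(1) unfolding aedges_iff by blast
  obtain u' v' where u': "e = closed_segment u' v'" "v' \<in> eseg Sk False u'" using e(2) unfolding aedges_iff by blast
  have "crd True u' = crd True v'" "crd False u = crd False v" using u u' by (auto simp: eseg_def)
  moreover have "{u, v} = {u', v'}" using u u' by (metis closed_segment_eq)
  ultimately have "crd True u = crd True v" by (auto simp: doubleton_eq_iff)
  then show False using u(2) \<open>crd False u = crd False v\<close> point_eqI[of True u v] by simp
qed

lemma degree:
  assumes v: "v \<in> verts Sk"
  shows "card {e \<in> edges T. v \<in> e} = card (present d v) + card (present (\<not> d) v)"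
proof -
  have "{e \<in> edges T. v \<in> e} = {e \<in> aedges True. v \<in> e} \<union> {e \<in> aedges False. v \<in> e}" using edges_aedges by auto
  moreover have "{e \<in> aedges True. v \<in> e} \<inter> {e \<in> aedges False. v \<in> e} = {}" using aedges_disjoint by auto
  ultimately have "card {e \<in> edges T. v \<in> e} = card (present True v) + card (present False v)"
    using edges_at[OF v, of True] edges_at[OF v, of False] by (simp add: card_Un_disjoint)
  then show ?thesis by (cases d) auto
qed

lemma card_missing_le_1: assumes "v \<in> verts Sk" shows "card (missing d v) \<le> 1"
proof -
  have "dir Sk d v" using assms by (simp add: verts_def)
  then have "present d v \<noteq> {}" using dir_germ[OF vS[OF assms]] by (auto simp: present_def)
  then have "card (present d v) \<ge> 1" by (simp add: Suc_leI card_gt_0_iff)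
  then show ?thesis using card_present_missing[of d v] by simp
qed

lemma both_missing:
  assumes v: "v \<in> verts Sk" and m: "missing d v \<noteq> {}" "missing (\<not> d) v \<noteq> {}"
  shows "crd d v \<in> {lo d B, hi d B}"
proof (rule ccontr)
  assume n: "\<not> ?thesis"
  have vB: "v \<in> cellset B" using vS[OF v] Sk_region by auto
  obtain \<sigma> where \<sigma>: "\<sigma> \<in> signs" "\<not> germ Sk d \<sigma> v" using m by (auto simp: missing_def)
  have "ev (\<lambda>\<tau>. ray d \<sigma> 0 v \<tau> \<in> cellset B)" using ray_inside[OF vB \<sigma>(1), of d] n vB by (auto simp: cellset_iff[of _ _ d])
  then have "germ Sk (\<not> d) \<rho> v" if "\<rho> \<in> signs" for \<rho> using missing_germ[OF vS[OF v] \<sigma>] that by blast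
  then show False using m(2) by (auto simp: missing_def)
qed

lemma boundary_missing: assumes "crd d v \<in> {lo d B, hi d B}" shows "missing d v \<noteq> {}"
proof
  assume "missing d v = {}"
  then have "germ Sk d 1 v" "germ Sk d (-1) v" by (auto simp: missing_def)
  then have "crd d v < hi d B" "lo d B < crd d v" using germ_inside by auto
  then show False using assms by auto
qed

definition corners where "corners = {v. \<forall>d. crd d v \<in> {lo d B, hi d B}}"

lemma card_corners: "card corners = 4" "finite corners"
proof -
  have e: "corners = (\<lambda>(s, t). pt True s t) ` ({lo True B, hi True B} \<times> {lo False B, hi False B})"
    by (auto simp: corners_def all_bool_eq pt_def crd_def image_iff)
  have "inj_on (\<lambda>(s, t). pt True s t) X" for X by (auto simp: inj_on_def pt_def)
  from card_image[OF this] have "card corners = card ({lo True B, hi True B} \<times> {lo False B, hi False B})" unfolding e .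
  then show "card corners = 4" unfolding card_cartesian_product using loB[of True] loB[of False] by simp
  show "finite corners" unfolding e by auto
qed

lemma corners_verts: "corners \<subseteq> verts Sk"
proof
  fix v assume v: "v \<in> corners"
  then have vB: "v \<in> cellset B" using loB by (auto simp: corners_def cellset_def less_imp_le) (metis less_imp_le order_refl)+
  have "dir Sk d v" for d using boundary_germ[OF vB, of "\<not> d"] v by (auto simp: corners_def)
  then show "v \<in> verts Sk" by (simp add: verts_def)
qed

lemma interior_region: "interior (\<Union>T) = opencell B" "frontier (\<Union>T) = cellset B - opencell B"
  using region interior_cellset frontier_cellset by auto

lemma crossing: "crossing_vertices T = {v \<in> verts Sk. \<forall>d. missing d v = {}}"
proof (intro set_eqI iffI)
  fix v assume "v \<in> crossing_vertices T"
  then have v: "v \<in> verts Sk" "card {e \<in> edges T. v \<in> e} = 4"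
    by (auto simp: crossing_vertices_def interior_vertex_def vertices_verts)
  have "missing d v = {}" for d using degree[OF v(1), of d] card_present_missing[of d v] card_present_missing[of "\<not> d" v] v(2) card_missing_le_1[OF v(1), of d] card_0_eq[OF finite_present_missing(2), of d v] by linarith
  then show "v \<in> {v \<in> verts Sk. \<forall>d. missing d v = {}}" using v by auto
next
  fix v assume "v \<in> {v \<in> verts Sk. \<forall>d. missing d v = {}}"
  then have v: "v \<in> verts Sk" "\<And>d. missing d v = {}" by auto
  have "crd d v \<notin> {lo d B, hi d B}" for d using boundary_missing v(2) by blast
  moreover have "v \<in> cellset B" using vS[OF v(1)] Sk_region by auto
  ultimately have "v \<in> opencell B" unfolding opencell_def cellset_def by (auto simp: order.strict_iff_order) metis+
  moreover have "card {e \<in> edges T. v \<in> e} = 4" using degree[OF v(1), of True] card_present_missing[of True v] card_present_missing[of False v] v(2) by simp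
  ultimately show "v \<in> crossing_vertices T" using v(1) by (simp add: crossing_vertices_def interior_vertex_def vertices_verts interior_region)
qed

text \<open>A crossing has no missing direction, a corner of the region has two, and any other vertex one.\<close>

lemma missing_total: "(\<Sum>v\<in>verts Sk. card (missing True v) + card (missing False v)) + card (crossing_vertices T) = card (verts Sk) + 4"
proof -
  let ?X = "crossing_vertices T" and ?m = "\<lambda>v. card (missing True v) + card (missing False v)"
  have m: "?m v = (if v \<in> ?X then 0 else if v \<in> corners then 2 else 1)" if v: "v \<in> verts Sk" for v
  proof -
    have c: "v \<in> corners" if "missing True v \<noteq> {}" "missing False v \<noteq> {}"
      using both_missing[OF v, of True] both_missing[OF v, of False] that by (auto simp: corners_def all_bool_eq)
    have n: "missing True v \<noteq> {} \<and> missing False v \<noteq> {}" if "v \<in> corners" using that boundary_missing by (auto simp: corners_def)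
    have 1: "card (missing d v) = (if missing d v = {} then 0 else 1)" for d
      using card_missing_le_1[OF v, of d] by (auto simp: le_Suc_eq)
    have x: "v \<in> ?X \<longleftrightarrow> missing True v = {} \<and> missing False v = {}" using v unfolding crossing by (auto simp: all_bool_eq)
    show ?thesis unfolding 1[of True] 1[of False] x using c n by auto
  qed
  have d: "?X \<inter> corners = {}" using boundary_missing unfolding crossing corners_def by fastforce
  have X: "?X \<subseteq> verts Sk" unfolding crossing by auto
  have "(\<Sum>v\<in>verts Sk. ?m v) = (\<Sum>v\<in>verts Sk - ?X. ?m v)"
    using m X finite_verts by (intro sum.mono_neutral_right) auto
  also have "\<dots> = (\<Sum>v\<in>(verts Sk - ?X) - corners. ?m v) + (\<Sum>v\<in>corners. ?m v)"
    using finite_verts corners_verts d by (intro sum.subset_diff) auto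
  also have "(\<Sum>v\<in>corners. ?m v) = (\<Sum>v\<in>corners. 2)"
  proof (rule sum.cong[OF refl])
    fix v assume "v \<in> corners"
    then have "v \<in> verts Sk" "v \<notin> ?X" "v \<in> corners" using corners_verts d by blast+
    then show "?m v = 2" using m[of v] by simp
  qed
  also have "(\<Sum>v\<in>(verts Sk - ?X) - corners. ?m v) = (\<Sum>v\<in>(verts Sk - ?X) - corners. 1)" using m by (intro sum.cong) auto
  also have "\<dots> = card (verts Sk - ?X) - 4"
  proof -
    have "corners \<subseteq> verts Sk - ?X" using corners_verts d by blast
    then show ?thesis using card_corners by (simp add: card_Diff_subset)
  qed
  finally have s: "(\<Sum>v\<in>verts Sk. ?m v) = card (verts Sk - ?X) - 4 + 8" using card_corners by simp
  have "card corners \<le> card (verts Sk - ?X)" using finite_verts corners_verts d by (intro card_mono) auto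
  moreover have "card (verts Sk - ?X) + card ?X = card (verts Sk)"
    using X finite_verts finite_subset[OF X finite_verts] card_mono[OF finite_verts X] by (simp add: card_Diff_subset)
  ultimately show ?thesis using s card_corners by simp
qed

text \<open>Each l-edge has exactly two ends, and the direction missing at a vertex along direction \<open>d\<close>
points out of the l-edge through this vertex.\<close>

lemma missing_ledges: "(\<Sum>v\<in>verts Sk. card (missing d v)) = 2 * card (ledges Sk d)"
proof -
  have "(\<Sum>v\<in>verts Sk. card (missing d v)) = card (SIGMA v:verts Sk. missing d v)"
    using finite_verts by (simp add: card_SigmaI)
  also have "\<dots> = card (ledges Sk d \<times> signs)"
  proof (rule bij_betw_same_card[of "\<lambda>(v, \<sigma>). (eseg Sk d v, \<sigma>)"], unfold bij_betw_def, rule conjI)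
    have in1: "v = v'" if v: "v \<in> verts Sk" "v' \<in> verts Sk" "\<sigma> \<in> missing d v" "\<sigma> \<in> missing d v'" "eseg Sk d v = eseg Sk d v'" for v v' \<sigma>
    proof -
      have \<sigma>: "\<sigma> \<in> signs" and vd: "dir Sk d v" "dir Sk d v'" using v by (auto simp: missing_def verts_def)
      obtain w where w: "w \<in> verts Sk" "w \<in> eseg Sk d v" "\<not> germ Sk d \<sigma> w"
        "\<forall>p\<in>eseg Sk d v. \<sigma> * crd d p \<le> \<sigma> * crd d w \<and> (germ Sk d \<sigma> p \<longleftrightarrow> p \<noteq> w)"
        using segment_end[OF vS[OF v(1)] vd(1) \<sigma>] .
      have "v \<in> eseg Sk d v" "v' \<in> eseg Sk d v" using dir_self(2) vd v(5) by blast+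
      then show ?thesis using bspec[OF w(4), of v] bspec[OF w(4), of v'] v(3,4) by (simp add: missing_def)
    qed
    then show "inj_on (\<lambda>(v, \<sigma>). (eseg Sk d v, \<sigma>)) (SIGMA v:verts Sk. missing d v)" by (auto simp: inj_on_def)
    show "(\<lambda>(v, \<sigma>). (eseg Sk d v, \<sigma>)) ` (SIGMA v:verts Sk. missing d v) = ledges Sk d \<times> signs"
    proof (intro set_eqI iffI)
      fix x assume "x \<in> (\<lambda>(v, \<sigma>). (eseg Sk d v, \<sigma>)) ` (SIGMA v:verts Sk. missing d v)"
      then show "x \<in> ledges Sk d \<times> signs" by (auto simp: ledges_def missing_def)
    next
      fix x assume "x \<in> ledges Sk d \<times> signs"
      then obtain v \<sigma> where x: "x = (eseg Sk d v, \<sigma>)" "v \<in> verts Sk" "\<sigma> \<in> signs" by (auto simp: ledges_def)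
      have vd: "dir Sk d v" using x by (simp add: verts_def)
      obtain w where w: "w \<in> verts Sk" "w \<in> eseg Sk d v" "\<not> germ Sk d \<sigma> w"
        using segment_end[OF vS[OF x(2)] vd x(3)] by metis
      then have "(w, \<sigma>) \<in> (SIGMA v:verts Sk. missing d v)" "x = (eseg Sk d w, \<sigma>)" using x eseg_eq[OF w(2)] by (auto simp: missing_def)
      then show "x \<in> (\<lambda>(v, \<sigma>). (eseg Sk d v, \<sigma>)) ` (SIGMA v:verts Sk. missing d v)" by force
    qed
  qed
  finally show ?thesis by (simp add: card_cartesian_product)
qed

lemma vertex_count: "2 * (card (ledges Sk True) + card (ledges Sk False)) + card (crossing_vertices T) = card (verts Sk) + 4"
  using missing_total missing_ledges[of True] missing_ledges[of False] by (simp add: sum.distrib)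

text \<open>The l-edges of direction \<open>d\<close> that are not on the boundary; the other two of this direction are
sides of the region. They are the l-edges composed of interior edges (\<open>inner_ledge_is_l_edge\<close>,
\<open>l_edge_is_inner_ledge\<close>).\<close>

definition inner_ledges where "inner_ledges d = {e \<in> ledges Sk d. \<exists>v\<in>e. lo (\<not> d) B < crd (\<not> d) v \<and> crd (\<not> d) v < hi (\<not> d) B}"
definition bside where "bside d \<beta> = {p \<in> cellset B. crd (\<not> d) p = \<beta>}"

lemma bside:
  assumes "v \<in> Sk" "crd (\<not> d) v \<in> {lo (\<not> d) B, hi (\<not> d) B}"
  shows "eseg Sk d v = bside d (crd (\<not> d) v)"
proof (intro set_eqI iffI)
  fix w assume "w \<in> eseg Sk d v"
  then have "w \<in> Sk" "crd (\<not> d) w = crd (\<not> d) v" by (auto simp: eseg_def)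
  then show "w \<in> bside d (crd (\<not> d) v)" using Sk_region by (auto simp: bside_def)
next
  fix w assume w: "w \<in> bside d (crd (\<not> d) v)"
  then have al: "crd (\<not> d) v = crd (\<not> d) w" by (simp add: bside_def)
  have vB: "v \<in> cellset B" using assms Sk_region by auto
  have "closed_segment v w \<subseteq> frontier (cellset B)"
    unfolding frontier_cellset aligned_segment[OF al] using assms(2) w vB
    by (auto simp: cellset_iff[of _ _ d] opencell_iff[of _ _ d] bside_def closed_segment_eq_real_ivl split: if_splits)
  then show "w \<in> eseg Sk d v" using al frontier_Sk by (auto simp: eseg_def)
qed

lemma corner_exists: "s \<in> {lo d B, hi d B} \<Longrightarrow> t \<in> {lo (\<not> d) B, hi (\<not> d) B} \<Longrightarrow> pt d s t \<in> corners"
  unfolding corners_def using bool_quantifiers(1)[of _ d] by auto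

lemma ledges_inner: "ledges Sk d = insert (bside d (lo (\<not> d) B)) (insert (bside d (hi (\<not> d) B)) (inner_ledges d))"
proof (intro set_eqI iffI)
  fix e assume e: "e \<in> ledges Sk d"
  then obtain v where v: "v \<in> verts Sk" "e = eseg Sk d v" by (auto simp: ledges_def)
  have "v \<in> e" using v dir_self(2) by (auto simp: verts_def)
  moreover have "v \<in> cellset B" using vS[OF v(1)] Sk_region by auto
  then have "crd (\<not> d) v \<in> {lo (\<not> d) B, hi (\<not> d) B} \<or> lo (\<not> d) B < crd (\<not> d) v \<and> crd (\<not> d) v < hi (\<not> d) B"
    by (auto simp: cellset_iff[of _ _ d])
  ultimately show "e \<in> insert (bside d (lo (\<not> d) B)) (insert (bside d (hi (\<not> d) B)) (inner_ledges d))"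
    using e bside[OF vS[OF v(1)], of d] v(2) by (auto simp: inner_ledges_def)
next
  fix e assume "e \<in> insert (bside d (lo (\<not> d) B)) (insert (bside d (hi (\<not> d) B)) (inner_ledges d))"
  moreover have "bside d t \<in> ledges Sk d" if "t \<in> {lo (\<not> d) B, hi (\<not> d) B}" for t
  proof -
    have c: "pt d (lo d B) t \<in> verts Sk" using corner_exists[of "lo d B" d t] that corners_verts by auto
    have "eseg Sk d (pt d (lo d B) t) = bside d t" using bside[OF vS[OF c], of d] that by simp
    then show ?thesis using c by (auto simp: ledges_def)
  qed
  ultimately show "e \<in> ledges Sk d" by (auto simp: inner_ledges_def)
qed

lemma card_ledges_inner: "card (ledges Sk d) = card (inner_ledges d) + 2" "finite (inner_ledges d)"
proof -
  show f: "finite (inner_ledges d)" using finite_verts by (auto simp: inner_ledges_def ledges_def)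
  have p: "pt d (lo d B) (lo (\<not> d) B) \<in> bside d (lo (\<not> d) B)"
    using loB[of d] loB[of "\<not> d"] by (auto simp: bside_def cellset_iff[of _ _ d])
  have "bside d (lo (\<not> d) B) \<noteq> bside d (hi (\<not> d) B)" using p loB[of "\<not> d"] by (auto simp: bside_def)
  moreover have "bside d t \<notin> inner_ledges d" if "t \<in> {lo (\<not> d) B, hi (\<not> d) B}" for t using that by (auto simp: inner_ledges_def bside_def)
  ultimately show "card (ledges Sk d) = card (inner_ledges d) + 2" unfolding ledges_inner using f by simp
qed

lemma inner_ledges_disjoint: "inner_ledges True \<inter> inner_ledges False = {}"
proof (rule ccontr)
  assume "\<not> ?thesis"
  then obtain e where e: "e \<in> ledges Sk True" "e \<in> ledges Sk False" by (auto simp: inner_ledges_def)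
  obtain v where v: "v \<in> verts Sk" "e = eseg Sk True v" using e(1) by (auto simp: ledges_def)
  have "dir Sk True v" using v by (simp add: verts_def)
  then obtain w where w: "w \<in> e" "w \<noteq> v" "v \<in> e" using dir_self(2) v unfolding dir_def by blast
  have "crd False w = crd False v" using w(1) v by (auto simp: eseg_def)
  moreover have "crd True w = crd True v" using e(2) w(1,3) by (auto simp: ledges_def eseg_def)
  ultimately show False using w(2) point_eqI[of True w v] by simp
qed

lemma aedge_level:
  assumes "f \<in> aedges d" "p \<in> f" "lo (\<not> d) B < crd (\<not> d) p" "crd (\<not> d) p < hi (\<not> d) B"
  shows "\<not> f \<subseteq> frontier (\<Union>T)"
proof -
  obtain u v where f: "f = closed_segment u v" "u \<noteq> v" "v \<in> eseg Sk d u" using assms(1) unfolding aedges_iff by blast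
  have al: "crd (\<not> d) u = crd (\<not> d) v" using f by (simp add: eseg_def)
  have ne: "crd d u \<noteq> crd d v" using f(2) al point_eqI by metis
  define m where "m = pt d ((crd d u + crd d v) / 2) (crd (\<not> d) u)"
  have mf: "m \<in> f" unfolding f(1) aligned_segment[OF al] m_def by (auto simp: closed_segment_eq_real_ivl)
  have uv: "u \<in> cellset B" "v \<in> cellset B" using f(3) Sk_region by (auto simp: eseg_def)
  have "crd (\<not> d) u = crd (\<not> d) p" using assms(2) unfolding f(1) aligned_segment[OF al] by simp
  then have "m \<in> opencell B" using uv ne assms(3,4) unfolding m_def cellset_iff[of _ _ d] opencell_iff[of _ _ d] crd_pt by (auto simp: field_simps)
  then show ?thesis using mf interior_region by auto
qed

text \<open>An end of the segment is a vertex with one germ missing along it; so it is a T-vertex if it lies in the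
interior of the region, and the number of edges along the segment is one.\<close>

lemma inner_ledge_is_l_edge:
  assumes e: "e \<in> inner_ledges d"
  shows "e \<in> axis_l_edges (crd (\<not> d)) T"
proof -
  obtain v where v: "v \<in> verts Sk" "e = eseg Sk d v" using e by (auto simp: inner_ledges_def ledges_def)
  have vd: "dir Sk d v" and ve: "v \<in> e" using v dir_self(2) by (auto simp: verts_def)
  have lev: "crd (\<not> d) p = crd (\<not> d) v" if "p \<in> e" for p using that v by (simp add: eseg_def)
  have vl: "lo (\<not> d) B < crd (\<not> d) v" "crd (\<not> d) v < hi (\<not> d) B" using e lev by (auto simp: inner_ledges_def)
  have rsg: "1 \<in> signs" by simp
  obtain r where r0: "r \<in> verts Sk" "r \<in> eseg Sk d v" "\<not> germ Sk d 1 r"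
    "\<forall>p\<in>eseg Sk d v. 1 * crd d p \<le> 1 * crd d r \<and> (germ Sk d 1 p \<longleftrightarrow> p \<noteq> r)"
    using segment_end[OF vS[OF v(1)] vd rsg] .
  have r: "r \<in> verts Sk" "r \<in> e" "\<not> germ Sk d 1 r" "crd d p \<le> crd d r" "germ Sk d 1 p \<longleftrightarrow> p \<noteq> r" if "p \<in> e" for p
    using r0 that v(2) by auto
  have lsg: "(-1) \<in> signs" by simp
  obtain l where l0: "l \<in> verts Sk" "l \<in> eseg Sk d v" "\<not> germ Sk d (-1) l"
    "\<forall>p\<in>eseg Sk d v. (-1) * crd d p \<le> (-1) * crd d l \<and> (germ Sk d (-1) p \<longleftrightarrow> p \<noteq> l)"
    using segment_end[OF vS[OF v(1)] vd lsg] .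
  have l: "l \<in> verts Sk" "l \<in> e" "\<not> germ Sk d (-1) l" "crd d l \<le> crd d p" "germ Sk d (-1) p \<longleftrightarrow> p \<noteq> l" if "p \<in> e" for p
    using l0 that v(2) by auto
  have eq: "eseg Sk d p = e" if "p \<in> e" for p using eseg_eq that v(2) by blast
  have al: "crd (\<not> d) l = crd (\<not> d) r" using lev l(2)[OF ve] r(2)[OF ve] by simp
  have seg: "e = closed_segment l r"
  proof
    show "e \<subseteq> closed_segment l r" unfolding aligned_segment[OF al] using lev l(2)[OF ve] l(4) r(4) by (fastforce simp: closed_segment_eq_real_ivl)
    show "closed_segment l r \<subseteq> e"
    proof
      fix p assume p: "p \<in> closed_segment l r"
      have "closed_segment l r \<subseteq> Sk" using r(2)[OF ve] eq[OF l(2)[OF ve]] by (auto simp: eseg_def)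
      moreover have "closed_segment l p \<subseteq> closed_segment l r" using p by (simp add: subset_closed_segment)
      moreover have "crd (\<not> d) p = crd (\<not> d) l" using p unfolding aligned_segment[OF al] by simp
      ultimately have "p \<in> eseg Sk d l" by (auto simp: eseg_def)
      then show "p \<in> e" using eq[OF l(2)[OF ve]] by simp
    qed
  qed
  have ne: "l \<noteq> r"
  proof
    assume "l = r"
    then have "e = {v}" using seg ve by auto
    then show False using vd v(2) by (auto simp: dir_def)
  qed
  let ?F = "{f \<in> aedges d. f \<subseteq> e}"
  have cov: "e \<subseteq> \<Union>?F"
  proof
    fix p assume p: "p \<in> e"
    have seg_sub: "closed_segment u w \<subseteq> e" if "u \<in> e" "w \<in> e" for u w
      using that unfolding seg by (meson closed_segment_subset convex_closed_segment)
    show "p \<in> \<Union>?F"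
    proof (cases "p = r")
      case True
      then have "germ Sk d (-1) p" using l(5)[OF p] True ne by auto
      then obtain w where w: "adj d (-1) p w" using adj_exists[of p "-1" d] r(1)[OF ve] True by auto
      then have "w \<in> e" using eq[OF p] by (simp add: adj_def)
      then have "closed_segment p w \<in> ?F" using adj_edge[OF _ w] r(1)[OF ve] True seg_sub p by auto
      then show ?thesis by (meson UnionI ends_in_segment(1))
    next
      case False
      let ?W = "{u \<in> verts Sk. u \<in> e \<and> crd d u \<le> crd d p}"
      have "l \<in> ?W" using l(1,2)[OF ve] l(4)[OF p] by simp
      then have W: "finite ?W" "?W \<noteq> {}" using finite_verts by auto
      define u where "u = arg_min_on (\<lambda>u. - crd d u) ?W"
      have u: "u \<in> ?W" "\<And>x. x \<in> ?W \<Longrightarrow> crd d x \<le> crd d u"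
        using arg_min_if_finite[OF W, of "\<lambda>u. - crd d u"] unfolding u_def by (blast, metis (no_types, lifting) linorder_not_less neg_le_iff_le)
      have "u \<noteq> r"
      proof
        assume "u = r"
        then have "crd d p = crd d r" using u(1) r(4)[OF p] by auto
        then show False using False point_eqI[of d p r] lev[OF p] lev[OF r(2)[OF ve]] by simp
      qed
      then have "germ Sk d 1 u" using r(5)[of u] u(1) by simp
      then obtain w where w: "adj d 1 u w" using adj_exists[of u 1 d] u(1) by auto
      then have we: "w \<in> e" "w \<in> verts Sk" "crd d w > crd d u" using eq[of u] u(1) by (auto simp: adj_def)
      then have "\<not> crd d w \<le> crd d p" using u(2)[of w] by auto
      then have "p \<in> closed_segment u w"
        using u(1) lev[OF p] lev[OF we(1)] lev[of u] by (subst aligned_segment[of d]) (auto simp: closed_segment_eq_real_ivl)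
      moreover have "closed_segment u w \<in> ?F" using adj_edge[OF _ w] u(1) seg_sub we by auto
      ultimately show ?thesis by blast
    qed
  qed
  have F: "?F \<subseteq> {f \<in> aedges d. \<not> f \<subseteq> frontier (\<Union>T)}"
  proof
    fix f assume f: "f \<in> ?F"
    then obtain p where "p \<in> f" unfolding aedges_iff by auto
    then show "f \<in> {f \<in> aedges d. \<not> f \<subseteq> frontier (\<Union>T)}" using f aedge_level[of f d p] lev[of p] vl by auto
  qed
  have ends: "boundary_vertex T w \<or> axis_T_vertex (crd (\<not> d)) T w" if w: "w \<in> verts Sk" "w \<in> e" "\<sigma> \<in> signs" "\<not> germ Sk d \<sigma> w" for w \<sigma>
  proof (cases "w \<in> opencell B")
    case True
    have wB: "w \<in> cellset B" using True opencell_cellset by blast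
    have "ev (\<lambda>\<tau>. ray d \<sigma> 0 w \<tau> \<in> cellset B)" using True by (intro ray_inside[OF wB w(3)]) (auto simp: opencell_iff[of _ _ d])
    then have "germ Sk (\<not> d) \<rho> w" if "\<rho> \<in> signs" for \<rho> using missing_germ[OF vS[OF w(1)] w(3,4)] that by blast
    then have "missing (\<not> d) w = {}" by (auto simp: missing_def)
    then have 2: "card (present (\<not> d) w) = 2" using card_present_missing[of "\<not> d" w] by simp
    have "missing d w \<noteq> {}" using w(3,4) by (auto simp: missing_def)
    then have "card (missing d w) \<noteq> 0" by simp
  have 1: "card (present d w) = 1" using \<open>card (missing d w) \<noteq> 0\<close> card_present_missing[of d w] card_missing_le_1[OF w(1), of d] by linarith
    show ?thesis using 1 2 degree[OF w(1), of d] edges_at(2)[OF w(1), of d] w(1) True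
      by (simp add: axis_T_vertex_def interior_vertex_def interior_region vertices_verts)
  next
    case False
    then show ?thesis using w(1) vS[OF w(1)] Sk_region by (auto simp: boundary_vertex_def interior_region vertices_verts)
  qed
  have "e = \<Union>?F" using cov by auto
  then show ?thesis
    unfolding axis_l_edges_def using ne al seg F ends[OF l(1)[OF ve] l(2)[OF ve] _ l(3)[OF ve]] ends[OF r(1)[OF ve] r(2)[OF ve] _ r(3)[OF ve]]
    by (intro CollectI exI[of _ l] exI[of _ r] conjI exI[of _ ?F]) auto
qed

text \<open>At the ends \<open>u\<close> and \<open>v\<close> the skeleton is not continued: on the boundary it would
leave the region, and a T-vertex has only one edge along the segment. So \<open>u\<close> and \<open>v\<close>
are the ends of the longest segment.\<close>

lemma l_edge_is_inner_ledge:
  assumes e: "e \<in> axis_l_edges (crd (\<not> d)) T"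
  shows "e \<in> inner_ledges d"
proof -
  obtain u v F where uv: "e = closed_segment u v" "u \<noteq> v" "crd (\<not> d) u = crd (\<not> d) v"
     "F \<subseteq> {f \<in> aedges d. \<not> f \<subseteq> frontier (\<Union>T)}" "e = \<Union>F"
     "boundary_vertex T u \<or> axis_T_vertex (crd (\<not> d)) T u" "boundary_vertex T v \<or> axis_T_vertex (crd (\<not> d)) T v"
    using e unfolding axis_l_edges_def by blast
  have V: "u \<in> verts Sk" "v \<in> verts Sk" using uv(6,7) by (auto simp: boundary_vertex_def axis_T_vertex_def interior_vertex_def vertices_verts)
  have eS: "e \<subseteq> Sk" unfolding uv(5) using uv(4) by (auto simp: aedges_iff eseg_def subset_iff)
  have "u \<in> e" using uv(1) by simp
  then obtain f where f: "f \<in> aedges d" "\<not> f \<subseteq> frontier (\<Union>T)" "f \<subseteq> e" "f \<in> F" using uv(4,5) by blast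
  obtain q where q: "q \<in> f" "q \<notin> frontier (\<Union>T)" using f by blast
  have "q \<in> opencell B" using q f(3) eS Sk_region interior_region by auto
  moreover have "crd (\<not> d) q = crd (\<not> d) u" using q f(3) unfolding uv(1) aligned_segment[OF uv(3)] by auto
  ultimately have lev: "lo (\<not> d) B < crd (\<not> d) u" "crd (\<not> d) u < hi (\<not> d) B" by (auto simp: opencell_iff[of _ _ d])
  have ne: "crd d u \<noteq> crd d v" using uv(2,3) point_eqI by metis
  have no: "\<not> germ Sk d (- \<sigma>) w" if w: "boundary_vertex T w \<or> axis_T_vertex (crd (\<not> d)) T w" "w' \<in> eseg Sk d w" "\<sigma> * (crd d w' - crd d w) > 0"
      "\<sigma> \<in> signs" "crd (\<not> d) w = crd (\<not> d) u" for w w' \<sigma>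
  proof
    assume g: "germ Sk d (- \<sigma>) w"
    have g2: "germ Sk d \<sigma> w" using eseg_germ[OF w(2,3)] w(4) by auto
    have all: "germ Sk d \<rho> w" if "\<rho> \<in> signs" for \<rho> using g g2 w(4) that by auto
    have missing: "missing d w = {}" using all by (auto simp: missing_def)
    show False using w(1)
    proof
      assume "boundary_vertex T w"
      then have "w \<in> cellset B" "w \<notin> opencell B" using interior_region by (auto simp: boundary_vertex_def)
      then have "crd d w \<in> {lo d B, hi d B}" using lev w(5) by (auto simp: cellset_iff[of _ _ d] opencell_iff[of _ _ d])
      then show False using boundary_missing missing by blast
    next
      assume a: "axis_T_vertex (crd (\<not> d)) T w"
      then have "w \<in> verts Sk" by (auto simp: axis_T_vertex_def interior_vertex_def vertices_verts)
      then have "card (present d w) = 1" using a edges_at(2)[of w d] by (simp add: axis_T_vertex_def)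
      then show False using card_present_missing[of d w] missing by simp
    qed
  qed
  define \<sigma> where "\<sigma> = (if crd d u < crd d v then 1 else - 1 :: real)"
  have s: "\<sigma> \<in> signs" "\<sigma> * (crd d v - crd d u) > 0" "- \<sigma> \<in> signs" "(- \<sigma>) * (crd d u - crd d v) > 0" using ne by (auto simp: \<sigma>_def)
  have vu: "v \<in> eseg Sk d u" "u \<in> eseg Sk d v" using uv(1,3) eS by (auto simp: eseg_def closed_segment_commute)
  have nu: "\<not> germ Sk d (- \<sigma>) u" using no[OF uv(6) vu(1) s(2,1)] by simp
  have nv: "\<not> germ Sk d \<sigma> v" using no[OF uv(7) vu(2) s(4,3)] uv(3) by simp
  have ud: "dir Sk d u" using V by (simp add: verts_def)
  obtain w1 where w1': "\<forall>p\<in>eseg Sk d u. \<sigma> * crd d p \<le> \<sigma> * crd d w1 \<and> (germ Sk d \<sigma> p \<longleftrightarrow> p \<noteq> w1)"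
    by (rule segment_end[OF vS[OF V(1)] ud s(1)])
  have w1: "\<sigma> * crd d p \<le> \<sigma> * crd d w1" "germ Sk d \<sigma> p \<longleftrightarrow> p \<noteq> w1" if "p \<in> eseg Sk d u" for p using w1' that by auto
  have w1v: "w1 = v" using w1(2)[OF vu(1)] nv by simp
  obtain w2 where w2': "\<forall>p\<in>eseg Sk d u. - \<sigma> * crd d p \<le> - \<sigma> * crd d w2 \<and> (germ Sk d (- \<sigma>) p \<longleftrightarrow> p \<noteq> w2)"
    by (rule segment_end[OF vS[OF V(1)] ud s(3)])
  have w2: "- \<sigma> * crd d p \<le> - \<sigma> * crd d w2" "germ Sk d (- \<sigma>) p \<longleftrightarrow> p \<noteq> w2" if "p \<in> eseg Sk d u" for p using w2' that by auto
  have w2u: "w2 = u" using w2(2)[OF dir_self(2)[OF ud]] nu by simp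
  have "eseg Sk d u = e"
  proof
    show "eseg Sk d u \<subseteq> e"
    proof
      fix p assume p: "p \<in> eseg Sk d u"
      have "\<sigma> * crd d p \<le> \<sigma> * crd d v" "- \<sigma> * crd d p \<le> - \<sigma> * crd d u" using w1(1)[OF p] w2(1)[OF p] w1v w2u by auto
      then have "crd d p \<in> closed_segment (crd d u) (crd d v)" using s by (auto simp: closed_segment_eq_real_ivl)
      then show "p \<in> e" using p unfolding uv(1) aligned_segment[OF uv(3)] by (simp add: eseg_def)
    qed
    show "e \<subseteq> eseg Sk d u"
    proof
      fix p assume p: "p \<in> e"
      then have "closed_segment u p \<subseteq> e" unfolding uv(1) by (simp add: subset_closed_segment)
      moreover have "crd (\<not> d) p = crd (\<not> d) u" using p unfolding uv(1) aligned_segment[OF uv(3)] by simp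
      ultimately show "p \<in> eseg Sk d u" using eS by (auto simp: eseg_def)
    qed
  qed
  then have "e \<in> ledges Sk d" using V by (auto simp: ledges_def)
  then show ?thesis using lev \<open>u \<in> e\<close> by (auto simp: inner_ledges_def)
qed

lemma l_edge_count: "card (interior_l_edges T) + 4 = card (ledges Sk True) + card (ledges Sk False)"
proof -
  have "axis_l_edges (crd (\<not> d)) T = inner_ledges d" for d using inner_ledge_is_l_edge l_edge_is_inner_ledge by blast
  from this[of True] this[of False] have "interior_l_edges T = inner_ledges True \<union> inner_ledges False" unfolding interior_l_edges_def crd_fun by simp
  then have "card (interior_l_edges T) = card (inner_ledges True) + card (inner_ledges False)"
    using card_ledges_inner(2) inner_ledges_disjoint by (simp add: card_Un_disjoint)
  then show ?thesis using card_ledges_inner(1)[of True] card_ledges_inner(1)[of False] by simp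
qed

end

section \<open>Quadratic splines of one variable\<close>

definition quadratic :: "(real \<Rightarrow> real) \<Rightarrow> bool" where
  "quadratic \<psi> \<longleftrightarrow> (\<exists>\<alpha> \<beta> \<gamma>. \<forall>x. \<psi> x = \<alpha> + \<beta> * x + \<gamma> * x ^ 2)"

lemma quadraticE:
  assumes "quadratic \<psi>" obtains \<alpha> \<beta> \<gamma> where "\<psi> = (\<lambda>x. \<alpha> + \<beta> * x + \<gamma> * x ^ 2)"
  using assms unfolding quadratic_def by (metis ext)

lemma quadraticI: "quadratic (\<lambda>x. \<alpha> + \<beta> * x + \<gamma> * x ^ 2)" unfolding quadratic_def by blast

lemma quadratic_zero: "quadratic (\<lambda>x. 0)" using quadraticI[of 0 0 0] by simp

lemma quadratic_square: "quadratic (\<lambda>x. (x - a) ^ 2)"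
  using quadraticI[of "a ^ 2" "- 2 * a" 1] by (simp add: power2_eq_square algebra_simps)

lemma quadratic_add:
  assumes "quadratic \<phi>" "quadratic \<psi>"
  shows "quadratic (\<lambda>x. \<phi> x + \<psi> x)"
proof -
  obtain a b c where 1: "\<phi> = (\<lambda>x. a + b * x + c * x ^ 2)" using quadraticE[OF assms(1)] .
  obtain a' b' c' where 2: "\<psi> = (\<lambda>x. a' + b' * x + c' * x ^ 2)" using quadraticE[OF assms(2)] .
  have "(\<lambda>x. \<phi> x + \<psi> x) = (\<lambda>x. (a + a') + (b + b') * x + (c + c') * x ^ 2)"
    unfolding 1 2 by (auto simp: algebra_simps)
  then show ?thesis using quadraticI by metis
qed

lemma quadratic_scale: assumes "quadratic \<phi>" shows "quadratic (\<lambda>x. k * \<phi> x)"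
proof -
  obtain a b c where 1: "\<phi> = (\<lambda>x. a + b * x + c * x ^ 2)" using quadraticE[OF assms(1)] .
  have "(\<lambda>x. k * \<phi> x) = (\<lambda>x. k * a + (k * b) * x + (k * c) * x ^ 2)"
    unfolding 1 by (auto simp: algebra_simps)
  then show ?thesis using quadraticI by metis
qed

lemma quadratic_sum: "finite A \<Longrightarrow> (\<And>a. a \<in> A \<Longrightarrow> quadratic (\<phi> a)) \<Longrightarrow> quadratic (\<lambda>x. \<Sum>a\<in>A. \<phi> a x)"
  by (induction A rule: finite_induct) (auto intro: quadratic_zero quadratic_add)

lemma quadratic_eq:
  assumes "quadratic \<phi>" "quadratic \<psi>" "infinite S" "\<And>x. x \<in> S \<Longrightarrow> \<phi> x = \<psi> x"
  shows "\<phi> = \<psi>"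
proof -
  obtain a b c where 1: "\<phi> = (\<lambda>x. a + b * x + c * x ^ 2)" using quadraticE[OF assms(1)] .
  obtain a' b' c' where 2: "\<psi> = (\<lambda>x. a' + b' * x + c' * x ^ 2)" using quadraticE[OF assms(2)] .
  obtain X where X: "X \<subseteq> S" "card X = 3" using infinite_arbitrarily_large[OF assms(3)] by blast
  then obtain x y z where xyz: "x \<in> S" "y \<in> S" "z \<in> S" "x \<noteq> y" "y \<noteq> z" "x \<noteq> z" by (auto simp: card_3_iff)
  have e: "(a - a') + (b - b') * x + (c - c') * x ^ 2 = 0" if "x \<in> S" for x
    using assms(4)[OF that] unfolding 1 2 by (simp add: algebra_simps)
  have "a - a' = 0" "b - b' = 0" "c - c' = 0"
    using quadratic_three_zeros[OF e[OF xyz(1)] e[OF xyz(2)] e[OF xyz(3)] xyz(4-6)] by auto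
  then show ?thesis unfolding 1 2 by auto
qed

text \<open>The truncated power \<open>(x - a)\<^sub>+\<^sup>2\<close>.\<close>

definition tpow :: "real \<Rightarrow> real \<Rightarrow> real" where "tpow x a = (max 0 (x - a)) ^ 2"

lemma tpow_right: "a \<le> x \<Longrightarrow> tpow x a = (x - a) ^ 2" by (simp add: tpow_def)
lemma tpow_left: "x \<le> a \<Longrightarrow> tpow x a = 0" by (simp add: tpow_def)

lemma tpow_deriv: "((\<lambda>x. tpow x a) has_real_derivative 2 * max 0 (x - a)) (at x)"
proof -
  consider "x < a" | "x > a" | "x = a" by linarith
  then show ?thesis
  proof cases
    case 1
    have e: "eventually (\<lambda>y. tpow y a = 0) (nhds x)"
      using eventually_nhds_in_open[of "{..<a}" x] 1 by (auto elim!: eventually_mono simp: tpow_left)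
    have "((\<lambda>x. 0) has_real_derivative 0) (at x)" by simp
    then show ?thesis using 1 DERIV_cong_ev[OF refl e refl, of 0] by simp
  next
    case 2
    have e: "eventually (\<lambda>y. tpow y a = (y - a)^2) (nhds x)"
      using eventually_nhds_in_open[of "{a<..}" x] 2 by (auto elim!: eventually_mono simp: tpow_right)
    have "((\<lambda>y. (y - a)^2) has_real_derivative 2 * (x - a)) (at x)" by (auto intro!: derivative_eq_intros)
    then show ?thesis using 2 DERIV_cong_ev[OF refl e refl, of "2 * (x - a)"] by simp
  next
    case 3
    have "((\<lambda>h. (tpow (a + h) a - tpow a a) / h) \<longlongrightarrow> 0) (at 0)"
    proof (rule tendsto_rabs_zero_cancel, rule real_tendsto_sandwich[of "\<lambda>_. 0" _ _ "\<lambda>h. \<bar>h\<bar>"])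
      have "\<bar>(tpow (a + h) a - tpow a a) / h\<bar> \<le> \<bar>h\<bar>" for h :: real
        by (cases "h \<ge> 0") (auto simp: tpow_def power2_eq_square)
      then show "eventually (\<lambda>h. \<bar>(tpow (a + h) a - tpow a a) / h\<bar> \<le> \<bar>h\<bar>) (at 0)" by simp
    qed (auto intro!: tendsto_eq_intros)
    then show ?thesis using 3 by (simp add: DERIV_def)
  qed
qed

definition quad_on :: "(real \<Rightarrow> real) \<Rightarrow> real set \<Rightarrow> bool" where
  "quad_on \<phi> S \<longleftrightarrow> (\<exists>\<psi>. quadratic \<psi> \<and> (\<forall>x\<in>S. \<phi> x = \<psi> x))"

text \<open>Differentiable functions that are quadratic between consecutive points of \<open>X\<close> and vanish to the
left of all of them.\<close>

definition spline :: "real set \<Rightarrow> (real \<Rightarrow> real) \<Rightarrow> bool" where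
  "spline X \<phi> \<longleftrightarrow> (\<forall>x. \<exists>D. (\<phi> has_real_derivative D) (at x)) \<and>
     (\<forall>a b. a < b \<longrightarrow> {a<..<b} \<inter> X = {} \<longrightarrow> quad_on \<phi> {a..b}) \<and> (\<forall>x. (\<forall>a\<in>X. x \<le> a) \<longrightarrow> \<phi> x = 0)"

lemma quad_on_add: "quad_on \<phi> S \<Longrightarrow> quad_on \<psi> S \<Longrightarrow> quad_on (\<lambda>x. \<phi> x + \<psi> x) S"
  unfolding quad_on_def by (metis (no_types, lifting) quadratic_add)

lemma quad_on_scale: "quad_on \<phi> S \<Longrightarrow> quad_on (\<lambda>x. k * \<phi> x) S"
  unfolding quad_on_def by (metis (no_types, lifting) quadratic_scale)

lemma quad_on_sub: "quad_on \<phi> S \<Longrightarrow> S' \<subseteq> S \<Longrightarrow> quad_on \<phi> S'" unfolding quad_on_def by blast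

lemma spline_sum:
  assumes "finite A" "\<And>a. a \<in> A \<Longrightarrow> spline X (\<phi> a)"
  shows "spline X (\<lambda>x. \<Sum>a\<in>A. k a * \<phi> a x)"
  using assms
proof (induction A rule: finite_induct)
  case empty
  have "quad_on (\<lambda>x. 0) S" for S unfolding quad_on_def using quadratic_zero by blast
  then show ?case unfolding spline_def by (auto intro!: exI[of _ 0])
next
  case (insert a A)
  then have s: "spline X (\<phi> a)" "spline X (\<lambda>x. \<Sum>a\<in>A. k a * \<phi> a x)" by auto
  have "\<exists>D. ((\<lambda>x. k a * \<phi> a x + (\<Sum>a\<in>A. k a * \<phi> a x)) has_real_derivative D) (at x)" for x
  proof -
    obtain D1 where "(\<phi> a has_real_derivative D1) (at x)" using s(1) unfolding spline_def by blast
    moreover obtain D2 where "((\<lambda>x. \<Sum>a\<in>A. k a * \<phi> a x) has_real_derivative D2) (at x)" using s(2) unfolding spline_def by blast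
    ultimately have "((\<lambda>x. k a * \<phi> a x + (\<Sum>a\<in>A. k a * \<phi> a x)) has_real_derivative (k a * D1 + D2)) (at x)"
      by (intro DERIV_add DERIV_cmult)
    then show ?thesis by blast
  qed
  then show ?case using s insert.hyps unfolding spline_def by (simp add: quad_on_add quad_on_scale)
qed

lemma quadratic_deriv:
  assumes "\<phi> = (\<lambda>x. a + b * x + c * x ^ 2)"
  shows "(\<phi> has_real_derivative b + 2 * c * x) (at x within S)"
  unfolding assms by (auto intro!: derivative_eq_intros)

text \<open>Induction on the largest knot \<open>m\<close>: value and derivative of the polynomials to its left and to its
right agree at \<open>m\<close>, so they differ by a multiple of \<open>(x - m)\<^sup>2\<close>. Subtracting
this multiple of the truncated power removes the knot.\<close>

lemma truncated_power_expansion: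
  assumes "finite X" "spline X \<phi>"
  shows "\<exists>c. \<forall>x. \<phi> x = (\<Sum>a\<in>X. c a * tpow x a)"
  using assms
proof (induction X arbitrary: \<phi> rule: finite_linorder_max_induct)
  case empty
  then show ?case unfolding spline_def by simp
next
  case (insert m X)
  have sp: "\<And>x. \<exists>D. (\<phi> has_real_derivative D) (at x)"
    "\<And>a b. a < b \<Longrightarrow> {a<..<b} \<inter> insert m X = {} \<Longrightarrow> quad_on \<phi> {a..b}" "\<And>x. (\<forall>a\<in>insert m X. x \<le> a) \<Longrightarrow> \<phi> x = 0"
    using insert.prems unfolding spline_def by blast+
  \<comment> \<open>without a knot to the left any point to the left of m serves\<close>
  define l where "l = (if X = {} then m - 1 else Max X)"
  have l: "l < m" "{l<..<m} \<inter> insert m X = {}"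
    using insert.hyps Max_ge[OF insert.hyps(1)] by (auto simp: l_def) (metis Max_ge insert.hyps(1) linorder_not_less)
  obtain L where L: "quadratic L" "\<And>x. x \<in> {l..m} \<Longrightarrow> \<phi> x = L x" using sp(2)[OF l] unfolding quad_on_def by blast
  have right: "{m<..<b} \<inter> insert m X = {}" for b using insert.hyps by force
  obtain R where R: "quadratic R" "\<And>x. x \<in> {m..m+1} \<Longrightarrow> \<phi> x = R x"
    using sp(2)[of m "m + 1"] right unfolding quad_on_def by auto
  have R': "\<phi> x = R x" if "m \<le> x" for x
  proof -
    define b where "b = max x (m + 1)"
    obtain Q where Q: "quadratic Q" "\<And>x. x \<in> {m..b} \<Longrightarrow> \<phi> x = Q x"
    proof -
      have "m < b" by (simp add: b_def)
      from sp(2)[OF this right] show ?thesis unfolding quad_on_def using that by blast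
    qed
    have "R = Q"
    proof (rule quadratic_eq[OF R(1) Q(1), of "{m..m+1}"])
      fix y assume y: "y \<in> {m..m+1}"
      then have "y \<in> {m..b}" unfolding b_def by auto
      then show "R y = Q y" using R(2)[OF y] Q(2) by simp
    qed simp
    then show ?thesis using Q(2)[of x] that by (simp add: b_def)
  qed
  obtain a b c where Lf: "L = (\<lambda>x. a + b * x + c * x ^ 2)" using quadraticE[OF L(1)] .
  obtain a' b' c' where Rf: "R = (\<lambda>x. a' + b' * x + c' * x ^ 2)" using quadraticE[OF R(1)] .
  obtain D where D: "(\<phi> has_real_derivative D) (at m)" using sp(1) by blast
  have "(L has_real_derivative D) (at m within {l..m})"
    by (rule has_field_derivative_transform_within[OF has_field_derivative_at_within[OF D], of 1]) (use l L in auto)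
  moreover have "at m within {l..m} \<noteq> bot" using l(1) by (simp add: at_within_Icc_at_left)
  ultimately have DL: "D = b + 2 * c * m" using quadratic_deriv[OF Lf] has_field_derivative_unique by blast
  have "(R has_real_derivative D) (at m within {m..m+1})"
    by (rule has_field_derivative_transform_within[OF has_field_derivative_at_within[OF D], of 1]) (use R in auto)
  moreover have "at m within {m..m+1} \<noteq> bot" by (simp add: at_within_Icc_at_right)
  ultimately have DR: "D = b' + 2 * c' * m" using quadratic_deriv[OF Rf] has_field_derivative_unique by blast
  have LR: "L m = R m" using L(2)[of m] R(2)[of m] l by simp
  define \<kappa> where "\<kappa> = c' - c"
  have jump: "R x = L x + \<kappa> * (x - m) ^ 2" for x
  proof -
    have eb: "b' - b = - 2 * \<kappa> * m" using DL DR by (simp add: \<kappa>_def algebra_simps)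
    have "a' - a = - (b' - b) * m - \<kappa> * m ^ 2" using LR unfolding Lf Rf \<kappa>_def by (simp add: algebra_simps)
    then have ea: "a' - a = \<kappa> * m ^ 2" unfolding eb by (simp add: power2_eq_square)
    have "R x = L x + ((a' - a) + (b' - b) * x + \<kappa> * x ^ 2)" unfolding Lf Rf \<kappa>_def by (simp add: algebra_simps)
    also have "\<dots> = L x + \<kappa> * (x - m) ^ 2" unfolding ea eb by (simp add: algebra_simps power2_eq_square)
    finally show ?thesis .
  qed
  define \<phi>' where "\<phi>' x = \<phi> x + (- \<kappa>) * tpow x m" for x
  have after: "\<phi>' x = L x" if "m \<le> x" for x unfolding \<phi>'_def R'[OF that] jump tpow_right[OF that] by simp
  have tpq: "quad_on (\<lambda>x. (- \<kappa>) * tpow x m) {u..w}" if "m \<notin> {u<..<w}" "u < w" for u w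
  proof (rule quad_on_scale)
    have "w \<le> m \<or> m \<le> u" using that by auto
    then show "quad_on (\<lambda>x. tpow x m) {u..w}"
    proof
      assume "w \<le> m"
      then show ?thesis unfolding quad_on_def using quadratic_zero by (intro exI[of _ "\<lambda>_. 0"]) (auto simp: tpow_left)
    next
      assume "m \<le> u"
      then show ?thesis unfolding quad_on_def using quadratic_square[of m] by (intro exI[of _ "\<lambda>x. (x - m)^2"]) (auto simp: tpow_right)
    qed
  qed
  have "spline X \<phi>'"
    unfolding spline_def
  proof (intro conjI allI impI)
    fix x
    obtain D where "(\<phi> has_real_derivative D) (at x)" using sp(1) by blast
    then have "(\<phi>' has_real_derivative (D + (- \<kappa>) * (2 * max 0 (x - m)))) (at x)"
      unfolding \<phi>'_def by (intro DERIV_add DERIV_cmult tpow_deriv)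
    then show "\<exists>D. (\<phi>' has_real_derivative D) (at x)" by blast
  next
    fix u w :: real assume uw: "u < w" "{u<..<w} \<inter> X = {}"
    show "quad_on \<phi>' {u..w}"
    proof (cases "m \<in> {u<..<w}")
      case False
      then show ?thesis unfolding \<phi>'_def using sp(2)[of u w] uw tpq[OF False uw(1)] by (intro quad_on_add) auto
    next
      case True
      have "{u<..<m} \<inter> insert m X = {}"
      proof -
        have "{u<..<m} \<subseteq> {u<..<w} - {m}" using True by auto
        then show ?thesis using uw(2) by blast
      qed
      then have "quad_on \<phi> {u..m}" using sp(2)[of u m] True by simp
      then obtain Q where Q: "quadratic Q" "\<And>x. x \<in> {u..m} \<Longrightarrow> \<phi> x = Q x" unfolding quad_on_def by blast
      have "Q = L" by (rule quadratic_eq[OF Q(1) L(1), of "{max u l..m}"]) (use Q(2) L(2) True l in \<open>auto simp: max_def split: if_splits\<close>)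
      then have "\<phi>' x = L x" if "x \<in> {u..w}" for x
        using after[of x] Q(2)[of x] that by (cases "m \<le> x") (auto simp: \<phi>'_def tpow_left)
      then show ?thesis unfolding quad_on_def using L(1) by blast
    qed
  next
    fix x assume x: "\<forall>a\<in>X. x \<le> a"
    show "\<phi>' x = 0"
    proof (cases "x \<le> m")
      case True
      then show ?thesis using x sp(3)[of x] by (simp add: \<phi>'_def tpow_left)
    next
      case False
      then have "X = {}" using x insert.hyps by force
      then have "L = (\<lambda>x. 0)" using L(2) sp(3) l by (intro quadratic_eq[OF L(1) quadratic_zero, of "{l..m}"]) auto
      then show ?thesis using after[of x] False by simp
    qed
  qed
  then obtain k where k: "\<And>x. \<phi>' x = (\<Sum>a\<in>X. k a * tpow x a)" using insert.IH by blast
  have "m \<notin> X" using insert.hyps by auto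
  then have "(\<Sum>a\<in>X. (k(m := \<kappa>)) a * tpow x a) = (\<Sum>a\<in>X. k a * tpow x a)" for x by (intro sum.cong) auto
  then have "\<phi> x = (\<Sum>a\<in>insert m X. (k(m := \<kappa>)) a * tpow x a)" for x
    using k[of x] \<open>m \<notin> X\<close> insert.hyps by (simp add: \<phi>'_def)
  then show ?case by blast
qed

text \<open>A truncated power does not affect values to the left of its knot. So the coefficients can be computed from
left to right, each from the earlier ones and one more value, taken to the right of its knot. For the last
knot this value is taken at \<open>M\<close>.\<close>

lemma coefficient_functionals:
  assumes "finite X"
  shows "\<forall>M. (\<forall>a\<in>X. a < M) \<longrightarrow> (\<exists>\<Xi> \<gamma>. finite \<Xi> \<and> \<Xi> \<subseteq> {..M} \<and>
     (\<forall>c. \<forall>a\<in>X. c a = (\<Sum>\<xi>\<in>\<Xi>. \<gamma> a \<xi> * (\<Sum>b\<in>X. c b * tpow \<xi> b))))"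
  using assms
proof (induction X rule: finite_linorder_max_induct)
  case empty
  then show ?case by auto
next
  case (insert m X)
  show ?case
  proof (intro allI impI)
    fix M assume M: "\<forall>a\<in>insert m X. a < M"
    then have mM: "m < M" by simp
    obtain \<Xi> \<gamma> where I0: "finite \<Xi> \<and> \<Xi> \<subseteq> {..m} \<and>
      (\<forall>c. \<forall>a\<in>X. c a = (\<Sum>\<xi>\<in>\<Xi>. \<gamma> a \<xi> * (\<Sum>b\<in>X. c b * tpow \<xi> b)))"
      using insert.IH[THEN spec, THEN mp, OF insert.hyps(2)] by (elim exE)
    have I: "finite \<Xi>" "\<Xi> \<subseteq> {..m}" using I0 by auto
    have I3: "c a = (\<Sum>\<xi>\<in>\<Xi>. \<gamma> a \<xi> * (\<Sum>b\<in>X. c b * tpow \<xi> b))" if "a \<in> X" for c a using I0 that by blast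
    have mX: "m \<notin> X" and MX: "M \<notin> \<Xi>" using insert.hyps I(2) mM by auto
    define S where "S c \<xi> = (\<Sum>b\<in>insert m X. c b * tpow \<xi> b)" for c :: "real \<Rightarrow> real" and \<xi>
    have S: "S c \<xi> = (\<Sum>b\<in>X. c b * tpow \<xi> b)" if "\<xi> \<in> \<Xi>" for c \<xi>
      using I(2) that mX insert.hyps by (auto simp: S_def tpow_left)
    have tM: "tpow M m \<noteq> 0" using mM by (simp add: tpow_def)
    define \<gamma>' where "\<gamma>' a \<xi> = (if a = m then if \<xi> = M then 1 / tpow M m else - (\<Sum>b\<in>X. \<gamma> b \<xi> * tpow M b) / tpow M m
       else if \<xi> = M then 0 else \<gamma> a \<xi>)" for a \<xi>
    have IS: "c a = (\<Sum>\<xi>\<in>\<Xi>. \<gamma> a \<xi> * S c \<xi>)" if "a \<in> X" for c a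
      using I3[OF that, of c] S by simp
    have "c a = (\<Sum>\<xi>\<in>insert M \<Xi>. \<gamma>' a \<xi> * S c \<xi>)" if a: "a \<in> insert m X" for c a
    proof (cases "a = m")
      case False
      then have "(\<Sum>\<xi>\<in>insert M \<Xi>. \<gamma>' a \<xi> * S c \<xi>) = (\<Sum>\<xi>\<in>\<Xi>. \<gamma>' a \<xi> * S c \<xi>)" using I(1) MX by (simp add: \<gamma>'_def)
      also have "\<dots> = (\<Sum>\<xi>\<in>\<Xi>. \<gamma> a \<xi> * S c \<xi>)" using False MX by (intro sum.cong) (auto simp: \<gamma>'_def)
      finally show ?thesis using IS[of a c] a False by simp
    next
      case True
      have "S c M = c m * tpow M m + (\<Sum>b\<in>X. c b * tpow M b)" using mX insert.hyps by (simp add: S_def)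
      also have "(\<Sum>b\<in>X. c b * tpow M b) = (\<Sum>b\<in>X. (\<Sum>\<xi>\<in>\<Xi>. \<gamma> b \<xi> * S c \<xi>) * tpow M b)"
        by (rule sum.cong[OF refl]) (simp add: IS[symmetric])
      also have "\<dots> = (\<Sum>b\<in>X. \<Sum>\<xi>\<in>\<Xi>. (\<gamma> b \<xi> * tpow M b) * S c \<xi>)"
        by (simp add: sum_distrib_right sum_distrib_left mult_ac)
      also have "\<dots> = (\<Sum>\<xi>\<in>\<Xi>. (\<Sum>b\<in>X. \<gamma> b \<xi> * tpow M b) * S c \<xi>)"
        by (subst sum.swap) (simp add: sum_distrib_right)
      finally have e: "c m * tpow M m = S c M - (\<Sum>\<xi>\<in>\<Xi>. (\<Sum>b\<in>X. \<gamma> b \<xi> * tpow M b) * S c \<xi>)" by simp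
      have "(\<Sum>\<xi>\<in>insert M \<Xi>. \<gamma>' m \<xi> * S c \<xi>) = 1 / tpow M m * S c M + (\<Sum>\<xi>\<in>\<Xi>. \<gamma>' m \<xi> * S c \<xi>)"
        using I(1) MX by (simp add: \<gamma>'_def)
      also have "(\<Sum>\<xi>\<in>\<Xi>. \<gamma>' m \<xi> * S c \<xi>) = (\<Sum>\<xi>\<in>\<Xi>. (- 1 / tpow M m) * ((\<Sum>b\<in>X. \<gamma> b \<xi> * tpow M b) * S c \<xi>))"
        using MX by (intro sum.cong) (auto simp: \<gamma>'_def)
      also have "\<dots> = (- 1 / tpow M m) * (\<Sum>\<xi>\<in>\<Xi>. (\<Sum>b\<in>X. \<gamma> b \<xi> * tpow M b) * S c \<xi>)" by (simp add: sum_distrib_left)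
      finally have "(\<Sum>\<xi>\<in>insert M \<Xi>. \<gamma>' m \<xi> * S c \<xi>) = (S c M - (\<Sum>\<xi>\<in>\<Xi>. (\<Sum>b\<in>X. \<gamma> b \<xi> * tpow M b) * S c \<xi>)) / tpow M m"
        by (simp add: diff_divide_distrib)
      also have "\<dots> = c m" unfolding e[symmetric] using tM by simp
      finally show ?thesis using True by simp
    qed
    then show "\<exists>\<Xi> \<gamma>. finite \<Xi> \<and> \<Xi> \<subseteq> {..M} \<and> (\<forall>c. \<forall>a\<in>insert m X. c a = (\<Sum>\<xi>\<in>\<Xi>. \<gamma> a \<xi> * (\<Sum>b\<in>insert m X. c b * tpow \<xi> b)))"
      using I mM unfolding S_def by (intro exI[of _ "insert M \<Xi>"] exI[of _ \<gamma>']) auto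
  qed
qed

text \<open>Expand in \<open>x\<close> for fixed \<open>y\<close>. By the previous lemma, the coefficients are
combinations of sections \<open>g \<xi>\<close> with \<open>\<xi>\<close> from a finite set, hence splines in
\<open>y\<close>, and can be expanded in turn.\<close>

lemma tensor_expansion:
  assumes X: "finite X" and Y: "finite Y"
    and x: "\<And>y. spline X (\<lambda>x. g x y)" and y: "\<And>x. spline Y (\<lambda>y. g x y)"
  shows "\<exists>c. \<forall>x y. g x y = (\<Sum>a\<in>X. \<Sum>b\<in>Y. c a b * tpow x a * tpow y b)"
proof -
  obtain M where M: "\<forall>a\<in>X. a < M" using X by (metis Max_ge gt_ex le_less_trans)
  obtain \<Xi> \<gamma> where I0: "finite \<Xi> \<and> \<Xi> \<subseteq> {..M} \<and>
      (\<forall>c. \<forall>a\<in>X. c a = (\<Sum>\<xi>\<in>\<Xi>. \<gamma> a \<xi> * (\<Sum>b\<in>X. c b * tpow \<xi> b)))"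
    using coefficient_functionals[OF X, THEN spec, THEN mp, OF M] by (elim exE)
  have I: "finite \<Xi>" using I0 by auto
  have I2: "c a = (\<Sum>\<xi>\<in>\<Xi>. \<gamma> a \<xi> * (\<Sum>b\<in>X. c b * tpow \<xi> b))" if "a \<in> X" for c a using I0 that by blast
  define C where "C a y = (\<Sum>\<xi>\<in>\<Xi>. \<gamma> a \<xi> * g \<xi> y)" for a y
  have g: "g x y = (\<Sum>a\<in>X. C a y * tpow x a)" for x y
  proof -
    obtain k where k: "\<And>x. g x y = (\<Sum>a\<in>X. k a * tpow x a)" using truncated_power_expansion[OF X x[of y]] by blast
    have "k a = C a y" if "a \<in> X" for a using I2[OF that, of k] unfolding C_def k .
    then show ?thesis using k[of x] by simp
  qed
  have "spline Y (C a)" for a unfolding C_def using spline_sum[OF I, of Y g "\<gamma> a"] y by simp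
  then have "\<exists>k. \<forall>y. C a y = (\<Sum>b\<in>Y. k b * tpow y b)" for a using truncated_power_expansion[OF Y] by blast
  then obtain k where k: "\<And>a y. C a y = (\<Sum>b\<in>Y. k a b * tpow y b)" by metis
  have "g x y = (\<Sum>a\<in>X. \<Sum>b\<in>Y. k a b * tpow x a * tpow y b)" for x y
    unfolding g k by (simp add: sum_distrib_right sum_distrib_left mult_ac)
  then show ?thesis by blast
qed

lemma quad_near: fixes u \<beta> :: real assumes "finite X" "u < \<beta>" obtains u' where "u \<le> u'" "u' < \<beta>" "{u'..<\<beta>} \<inter> X = {}"
proof -
  define u' where "u' = Max (insert u ((\<lambda>x. (x + \<beta>) / 2) ` {x \<in> X. x < \<beta>}))"
  have f: "finite (insert u ((\<lambda>x. (x + \<beta>) / 2) ` {x \<in> X. x < \<beta>}))" using assms by auto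
  have 1: "u \<le> u'" unfolding u'_def using f by simp
  have 2: "u' < \<beta>" unfolding u'_def using f assms(2) by (subst Max_less_iff) auto
  have "x < u'" if "x \<in> X" "x < \<beta>" for x
  proof -
    have "(x + \<beta>) / 2 \<le> u'" unfolding u'_def using f that by (intro Max_ge) auto
    then show ?thesis using that by simp
  qed
  then show ?thesis using that[OF 1 2] by force
qed

lemma partial_quadratic:
  assumes "finite X" "\<And>a. a \<in> X \<Longrightarrow> a \<le> u \<or> w \<le> a" "x \<in> {u..w}"
  shows "(\<Sum>a\<in>X. k a * tpow x a) = (\<Sum>a\<in>{a \<in> X. a \<le> u}. k a * (x - a) ^ 2)"
proof -
  have "(\<Sum>a\<in>X. k a * tpow x a) = (\<Sum>a\<in>{a \<in> X. a \<le> u}. k a * tpow x a)"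
    using assms by (intro sum.mono_neutral_right) (force simp: tpow_left)+
  also have "\<dots> = (\<Sum>a\<in>{a \<in> X. a \<le> u}. k a * (x - a) ^ 2)" using assms(3) by (intro sum.cong) (auto simp: tpow_right)
  finally show ?thesis .
qed

lemma quadratic_partial: "finite X \<Longrightarrow> quadratic (\<lambda>x. \<Sum>a\<in>{a \<in> X. P a}. k a * (x - a) ^ 2)"
  by (intro quadratic_sum quadratic_scale quadratic_square) auto

text \<open>Near each end of the interval the sum is a single polynomial; which powers contribute is decided by the
position of the knots relative to that end.\<close>

lemma vanish_partial:
  assumes X: "finite X" and uw: "u < w" and z: "\<And>x. x \<in> {u<..<w} \<Longrightarrow> (\<Sum>a\<in>X. k a * tpow x a) = \<psi> x" "quadratic \<psi>"
  shows "\<And>x. (\<Sum>a\<in>{a \<in> X. a < w}. k a * (x - a) ^ 2) = \<psi> x" "\<And>x. (\<Sum>a\<in>{a \<in> X. a \<le> u}. k a * (x - a) ^ 2) = \<psi> x"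
proof -
  obtain u' where u': "u \<le> u'" "u' < w" "{u'..<w} \<inter> X = {}" using quad_near[OF X uw] .
  have gap: "a \<le> u'" if "a \<in> X" "a < w" for a
  proof (rule ccontr)
    assume "\<not> a \<le> u'"
    then have "a \<in> {u'..<w} \<inter> X" using that by simp
    then show False using u'(3) by blast
  qed
  have e1: "(\<lambda>x. \<Sum>a\<in>{a \<in> X. a \<le> u'}. k a * (x - a) ^ 2) = \<psi>"
  proof (rule quadratic_eq[OF quadratic_partial[OF X] z(2), of "{u'<..<w}"])
    fix x assume x: "x \<in> {u'<..<w}"
    have "(\<Sum>a\<in>X. k a * tpow x a) = (\<Sum>a\<in>{a \<in> X. a \<le> u'}. k a * (x - a) ^ 2)"
      using gap x by (intro partial_quadratic[OF X, where w = w]) (auto simp: not_le[symmetric])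
    then show "(\<Sum>a\<in>{a \<in> X. a \<le> u'}. k a * (x - a) ^ 2) = \<psi> x" using z(1)[of x] u' x by simp
  qed (use u' in simp)
  have "{a \<in> X. a \<le> u'} = {a \<in> X. a < w}" using u' gap by force
  then show "(\<Sum>a\<in>{a \<in> X. a < w}. k a * (x - a) ^ 2) = \<psi> x" for x using fun_cong[OF e1, of x] by simp
  obtain v' where v': "- w \<le> v'" "v' < - u" "{v'..<- u} \<inter> uminus ` X = {}" using quad_near[of "uminus ` X" "- w" "- u"] X uw by auto
  define w' where "w' = - v'"
  have w': "w' \<le> w" "u < w'" using v' by (auto simp: w'_def)
  have wX: "a \<le> u \<or> w' \<le> a" if "a \<in> X" for a
  proof -
    have "- a \<notin> {v'..<- u}" using v'(3) that by blast
    then show ?thesis by (auto simp: w'_def)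
  qed
  have e2: "(\<lambda>x. \<Sum>a\<in>{a \<in> X. a \<le> u}. k a * (x - a) ^ 2) = \<psi>"
  proof (rule quadratic_eq[OF quadratic_partial[OF X] z(2), of "{u<..<w'}"])
    fix x assume x: "x \<in> {u<..<w'}"
    have "(\<Sum>a\<in>X. k a * tpow x a) = (\<Sum>a\<in>{a \<in> X. a \<le> u}. k a * (x - a) ^ 2)"
      using wX x by (intro partial_quadratic[OF X, where w = w']) auto
    then show "(\<Sum>a\<in>{a \<in> X. a \<le> u}. k a * (x - a) ^ 2) = \<psi> x" using z(1)[of x] w' x by simp
  qed (use w' in simp)
  show "(\<Sum>a\<in>{a \<in> X. a \<le> u}. k a * (x - a) ^ 2) = \<psi> x" for x using fun_cong[OF e2, of x] by simp
qed

text \<open>The partial sums over the knots below \<open>\<beta>\<close> and up to \<open>\<beta>\<close> are the same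
polynomial; they differ by \<open>k \<beta> (x - \<beta>)\<^sup>2\<close>.\<close>

lemma no_jump:
  assumes X: "finite X" "\<beta> \<in> X" and uw: "u < \<beta>" "\<beta> < w" and \<psi>: "quadratic \<psi>"
    and l: "\<And>x. x \<in> {u<..<\<beta>} \<Longrightarrow> (\<Sum>a\<in>X. k a * tpow x a) = \<psi> x" and r: "\<And>x. x \<in> {\<beta><..<w} \<Longrightarrow> (\<Sum>a\<in>X. k a * tpow x a) = \<psi> x"
  shows "k \<beta> = 0"
proof -
  have 1: "(\<Sum>a\<in>{a \<in> X. a < \<beta>}. k a * (x - a) ^ 2) = \<psi> x" for x
    using vanish_partial(1)[OF X(1) uw(1) l \<psi>] .
  have 2: "(\<Sum>a\<in>{a \<in> X. a \<le> \<beta>}. k a * (x - a) ^ 2) = \<psi> x" for x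
    using vanish_partial(2)[OF X(1) uw(2) r \<psi>] .
  have "{a \<in> X. a \<le> \<beta>} = insert \<beta> {a \<in> X. a < \<beta>}" using X(2) by auto
  then have "(\<Sum>a\<in>{a \<in> X. a \<le> \<beta>}. k a * (x - a) ^ 2) = k \<beta> * (x - \<beta>) ^ 2 + (\<Sum>a\<in>{a \<in> X. a < \<beta>}. k a * (x - a) ^ 2)" for x
    using X(1) by simp
  then have "k \<beta> * (x - \<beta>) ^ 2 = 0" for x using 1 2 by simp
  from this[of "\<beta> + 1"] show ?thesis by simp
qed

section \<open>Splines and moment-free coefficient families\<close>

definition Psi :: "(real \<times> real) set \<Rightarrow> (real \<times> real \<Rightarrow> real) \<Rightarrow> real \<times> real \<Rightarrow> real" where
  "Psi P c q = (\<Sum>p\<in>P. c p * (tpow (crd True q) (crd True p) * tpow (crd False q) (crd False p)))"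

lemma Psi_d: "Psi P c q = (\<Sum>p\<in>P. c p * (tpow (crd d q) (crd d p) * tpow (crd (\<not> d) q) (crd (\<not> d) p)))"
  unfolding Psi_def by (cases d) (simp_all add: mult.commute)

lemma Psi_linear: "Psi P (c + c') = Psi P c + Psi P c'" "Psi P (\<lambda>p. a * c p) = (\<lambda>q. a * Psi P c q)"
  by (auto simp: Psi_def fun_eq_iff sum.distrib sum_distrib_left algebra_simps)

lemma moment_free_square:
  assumes "c \<in> moment_free P E" "e \<in> E d"
  shows "(\<Sum>p\<in>P \<inter> e. c p * (s - crd d p) ^ 2) = 0"
proof -
  have m: "mom P d e j c = 0" if "j \<le> 2" for j using assms that by (auto simp: moment_free_def)
  have "(\<Sum>p\<in>P \<inter> e. c p * (s - crd d p) ^ 2) = s ^ 2 * mom P d e 0 c - 2 * s * mom P d e 1 c + mom P d e 2 c"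
    unfolding mom_def by (simp add: sum_distrib_left sum.distrib[symmetric] sum_subtractf[symmetric] power2_eq_square algebra_simps)
  then show ?thesis using m by simp
qed

lemma biquadratic_add:
  assumes "biquadratic_on K f" "biquadratic_on K g"
  shows "biquadratic_on K (\<lambda>q. f q + g q)"
proof -
  obtain c c' where "\<And>x y. (x, y) \<in> K \<Longrightarrow> f (x, y) = (\<Sum>i\<le>2. \<Sum>j\<le>2. c i j * x ^ i * y ^ j)"
    "\<And>x y. (x, y) \<in> K \<Longrightarrow> g (x, y) = (\<Sum>i\<le>2. \<Sum>j\<le>2. c' i j * x ^ i * y ^ j)"
    using assms unfolding biquadratic_on_def by blast
  then show ?thesis unfolding biquadratic_on_def
    by (intro exI[of _ "\<lambda>i j. c i j + c' i j"]) (auto simp: sum.distrib[symmetric] algebra_simps)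
qed

lemma biquadratic_cong:
  assumes "\<And>q. q \<in> K \<Longrightarrow> f q = g q" "biquadratic_on K g"
  shows "biquadratic_on K f"
proof -
  obtain c where c: "\<forall>(x, y)\<in>K. g (x, y) = (\<Sum>i\<le>2. \<Sum>j\<le>2. c i j * x ^ i * y ^ j)"
    using assms(2) unfolding biquadratic_on_def by blast
  then have "\<forall>(x, y)\<in>K. f (x, y) = (\<Sum>i\<le>2. \<Sum>j\<le>2. c i j * x ^ i * y ^ j)" using assms(1) by auto
  then show ?thesis unfolding biquadratic_on_def by (intro exI[of _ c])
qed

lemma biquadratic_term: "biquadratic_on K (\<lambda>q. c * ((crd True q - a) ^ 2 * (crd False q - b) ^ 2))"
proof -
  define k where "k i a = (if i = 0 then a ^ 2 else if i = 1 then - 2 * a else 1)" for i :: nat and a :: real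
  have s: "(x - a) ^ 2 = (\<Sum>i\<le>2. k i a * x ^ i)" for x a by (simp add: k_def sum_atMost_2 power2_eq_square algebra_simps)
  have "c * ((x - a) ^ 2 * (y - b) ^ 2) = (\<Sum>i\<le>2. \<Sum>j\<le>2. (c * k i a * k j b) * x ^ i * y ^ j)" for x y
    unfolding s by (simp add: sum_atMost_2 algebra_simps)
  then show ?thesis unfolding biquadratic_on_def by (intro exI[of _ "\<lambda>i j. c * k i a * k j b"]) (auto simp: crd_def)
qed

lemma biquadratic_sum: "finite A \<Longrightarrow> biquadratic_on K (\<lambda>q. \<Sum>p\<in>A. c p * ((crd True q - a p) ^ 2 * (crd False q - b p) ^ 2))"
proof (induction A rule: finite_induct)
  case empty
  show ?case unfolding biquadratic_on_def by (intro exI[of _ "\<lambda>_ _. 0"]) auto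
next
  case (insert x A)
  then show ?case using biquadratic_add[OF biquadratic_term[of K "c x" "a x" "b x"] insert.IH] by simp
qed

lemma biquadratic_line:
  assumes "biquadratic_on K f"
  shows "quad_on (\<lambda>s. f (pt d s t)) {s. pt d s t \<in> K}"
proof -
  obtain c where c: "\<And>x y. (x, y) \<in> K \<Longrightarrow> f (x, y) = (\<Sum>i\<le>2. \<Sum>j\<le>2. c i j * x ^ i * y ^ j)"
    using assms unfolding biquadratic_on_def by blast
  define k where "k i = (if d then (\<Sum>j\<le>2. c i j * t ^ j) else (\<Sum>j\<le>2. c j i * t ^ j))" for i
  have "f (pt d s t) = k 0 + k 1 * s + k 2 * s ^ 2" if "pt d s t \<in> K" for s
    using c[of "fst (pt d s t)" "snd (pt d s t)"] that
    by (cases d) (simp_all add: pt_def k_def sum_atMost_2 algebra_simps)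
  then show ?thesis unfolding quad_on_def using quadraticI by (intro exI[of _ "\<lambda>s. k 0 + k 1 * s + k 2 * s ^ 2"]) auto
qed

lemma continuous_tpow: "continuous_on S (\<lambda>q. tpow (crd d q) a)"
  unfolding tpow_def by (intro continuous_intros continuous_on_max)

lemma C11_Psi: "C11 (Psi P c)"
proof -
  define g where "g d q = (\<Sum>p\<in>P. c p * ((2 * max 0 (crd d q - crd d p)) * tpow (crd (\<not> d) q) (crd (\<not> d) p)))" for d q
  have cg: "continuous_on UNIV (g d)" for d unfolding g_def
    by (intro continuous_on_sum continuous_on_mult continuous_intros continuous_tpow continuous_on_max)
  have c: "continuous_on UNIV (Psi P c)" unfolding Psi_def
    by (intro continuous_on_sum continuous_on_mult continuous_intros continuous_tpow)
  have dg: "((\<lambda>s. Psi P c (pt d s t)) has_real_derivative g d (pt d s t)) (at s)" for d s t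
    unfolding Psi_d[of _ _ _ d] g_def crd_pt
    by (intro DERIV_sum DERIV_cmult DERIV_cmult_right tpow_deriv)
  show ?thesis unfolding C11_def
    using c cg[of True] cg[of False] dg[of True] dg[of False]
    by (intro conjI exI[of _ "g True"] exI[of _ "g False"]) (auto simp: pt_def)
qed

context regular_mesh begin

abbreviation "P \<equiv> verts Sk"
abbreviation "Z \<equiv> moment_free P (ledges Sk)"

lemma system: "line_system P (ledges Sk)" using line_system_verts finite_verts by blast

lemma P_region: "p \<in> P \<Longrightarrow> p \<in> cellset B" using vS[of p] Sk_region by blast

lemma ledge_level: "e \<in> ledges Sk d \<Longrightarrow> p \<in> e \<Longrightarrow> q \<in> e \<Longrightarrow> crd (\<not> d) p = crd (\<not> d) q"
  by (auto simp: ledges_def eseg_def)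

text \<open>Beyond an l-edge in its own direction all truncated powers along it are full squares, so the contribution of
its vertices is a combination of vanishing moments.\<close>

lemma edge_block_zero:
  assumes c: "c \<in> Z" and e: "e \<in> ledges Sk d" and s: "\<And>p. p \<in> P \<inter> e \<Longrightarrow> crd d p \<le> crd d q"
  shows "(\<Sum>p\<in>P \<inter> e. c p * (tpow (crd d q) (crd d p) * tpow (crd (\<not> d) q) (crd (\<not> d) p))) = 0"
proof (cases "P \<inter> e = {}")
  case False
  then obtain p0 where p0: "p0 \<in> P \<inter> e" by auto
  have "(\<Sum>p\<in>P \<inter> e. c p * (tpow (crd d q) (crd d p) * tpow (crd (\<not> d) q) (crd (\<not> d) p))) =
     (\<Sum>p\<in>P \<inter> e. (c p * (crd d q - crd d p) ^ 2) * tpow (crd (\<not> d) q) (crd (\<not> d) p0))"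
  proof (rule sum.cong[OF refl])
    fix p assume p: "p \<in> P \<inter> e"
    have lv: "crd (\<not> d) p = crd (\<not> d) p0" using ledge_level[OF e] p p0 by blast
    show "c p * (tpow (crd d q) (crd d p) * tpow (crd (\<not> d) q) (crd (\<not> d) p)) =
      (c p * (crd d q - crd d p) ^ 2) * tpow (crd (\<not> d) q) (crd (\<not> d) p0)"
      unfolding tpow_right[OF s[OF p]] lv by simp
  qed
  also have "\<dots> = (\<Sum>p\<in>P \<inter> e. c p * (crd d q - crd d p) ^ 2) * tpow (crd (\<not> d) q) (crd (\<not> d) p0)"
    by (simp add: sum_distrib_right)
  finally show ?thesis using moment_free_square[OF c e] by simp
qed (simp add: sum.neutral)

lemma Psi_outside: assumes c: "c \<in> Z" and q: "q \<notin> cellset B" shows "Psi P c q = 0"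
proof -
  obtain d where d: "crd d q < lo d B \<or> hi d B < crd d q" using q by (auto simp: cellset_def not_le)
  then show ?thesis
  proof
    assume "crd d q < lo d B"
    then have "tpow (crd d q) (crd d p) = 0" if "p \<in> P" for p
      using P_region[OF that] by (intro tpow_left) (auto simp: cellset_iff[of _ _ d])
    then show ?thesis unfolding Psi_d[of _ _ _ d] by (intro sum.neutral) auto
  next
    assume h: "hi d B < crd d q"
    have "crd d p \<le> crd d q" if "p \<in> P" for p using P_region[OF that] h by (auto simp: cellset_iff[of _ _ d])
    then show ?thesis unfolding Psi_d[of _ _ _ d] line_system_sum[OF system, of _ d]
      using edge_block_zero[OF c] by (intro sum.neutral) auto
  qed
qed

text \<open>Otherwise the l-edge would pass through the open cell, which contains no point of the skeleton.\<close>

lemma one_sided: assumes C: "cellset C \<in> T" and e: "e \<in> ledges Sk d" and p: "p \<in> e" "q \<in> e"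
  and l: "lo (\<not> d) C < crd (\<not> d) p" "crd (\<not> d) p < hi (\<not> d) C" and pl: "crd d p \<le> lo d C"
  shows "crd d q \<le> lo d C"
proof (rule ccontr)
  assume n: "\<not> crd d q \<le> lo d C"
  have ne: "opencell C \<noteq> {}" using nonempty[OF C] interior_cellset by metis
  have qe: "q \<in> eseg Sk d p" using ledges_at(1)[OF e p(1)] p(2) by simp
  then have al: "crd (\<not> d) p = crd (\<not> d) q" and s: "closed_segment p q \<subseteq> Sk" by (auto simp: eseg_def)
  define t where "t = (lo d C + min (hi d C) (crd d q)) / 2"
  have t: "lo d C < t" "t < hi d C" "t < crd d q" using n opencell_nonempty[OF ne, of d] by (auto simp: t_def min_def)
  have "pt d t (crd (\<not> d) p) \<in> closed_segment p q" unfolding aligned_segment[OF al] using t pl by (auto simp: closed_segment_eq_real_ivl)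
  moreover have "pt d t (crd (\<not> d) p) \<in> opencell C" using t l by (simp add: opencell_iff[of _ _ d])
  ultimately show False using s opencell_Sk[OF C] by blast
qed

lemma cell_strip_zero:
  assumes c: "c \<in> Z" and C: "cellset C \<in> T" and q: "q \<in> cellset C"
  shows "(\<Sum>p\<in>{p \<in> P. crd d p \<le> lo d C \<and> lo (\<not> d) C < crd (\<not> d) p \<and> crd (\<not> d) p < hi (\<not> d) C}.
      c p * (tpow (crd d q) (crd d p) * tpow (crd (\<not> d) q) (crd (\<not> d) p))) = 0"
proof -
  let ?h = "\<lambda>p. c p * (tpow (crd d q) (crd d p) * tpow (crd (\<not> d) q) (crd (\<not> d) p))"
  let ?S = "{p \<in> P. crd d p \<le> lo d C \<and> lo (\<not> d) C < crd (\<not> d) p \<and> crd (\<not> d) p < hi (\<not> d) C}"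
  have "(\<Sum>p\<in>?S. ?h p) = (\<Sum>p\<in>P. if p \<in> ?S then ?h p else 0)"
    using finite_verts by (subst sum.inter_filter[symmetric]) auto
  also have "\<dots> = (\<Sum>e\<in>ledges Sk d. \<Sum>p\<in>P \<inter> e. if p \<in> ?S then ?h p else 0)" by (rule line_system_sum[OF system])
  also have "\<dots> = 0"
  proof (rule sum.neutral, rule ballI)
    fix e assume e: "e \<in> ledges Sk d"
    show "(\<Sum>p\<in>P \<inter> e. if p \<in> ?S then ?h p else 0) = 0"
    proof (cases "\<exists>p\<in>P \<inter> e. p \<in> ?S")
      case False
      then show ?thesis by (intro sum.neutral) auto
    next
      case True
      then obtain p where p: "p \<in> e" "crd d p \<le> lo d C" "lo (\<not> d) C < crd (\<not> d) p" "crd (\<not> d) p < hi (\<not> d) C" by auto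
      have all: "crd d p' \<le> lo d C" "lo (\<not> d) C < crd (\<not> d) p'" "crd (\<not> d) p' < hi (\<not> d) C" if "p' \<in> e" for p'
        using one_sided[OF C e p(1) that p(3,4,2)] ledge_level[OF e p(1) that] p by auto
      have "(\<Sum>p\<in>P \<inter> e. if p \<in> ?S then ?h p else 0) = (\<Sum>p\<in>P \<inter> e. ?h p)"
        using all by (intro sum.cong) auto
      also have "\<dots> = 0" using all(1) q by (intro edge_block_zero[OF c e]) (force simp: cellset_iff[of _ _ d])
      finally show ?thesis .
    qed
  qed
  finally show ?thesis .
qed

text \<open>On a cell, vertices to the right of it or above it do not contribute. Those to its lower left contribute
polynomials. The remaining ones are in the two strips to the left of the cell and below it; they are grouped
along the l-edges that end before the cell, and each group contributes zero.\<close>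

lemma Psi_biquadratic: assumes c: "c \<in> Z" and K: "K \<in> T" shows "biquadratic_on K (Psi P c)"
proof -
  obtain C where C: "K = cellset C" using cellE[OF K] by metis
  have CT: "cellset C \<in> T" using K C by simp
  let ?P0 = "{p \<in> P. crd True p \<le> lo True C \<and> crd False p \<le> lo False C}"
  let ?S = "\<lambda>d. {p \<in> P. crd d p \<le> lo d C \<and> lo (\<not> d) C < crd (\<not> d) p \<and> crd (\<not> d) p < hi (\<not> d) C}"
  have eq: "Psi P c q = (\<Sum>p\<in>?P0. c p * ((crd True q - crd True p) ^ 2 * (crd False q - crd False p) ^ 2))" if q: "q \<in> cellset C" for q
  proof -
    let ?h = "\<lambda>p. c p * (tpow (crd True q) (crd True p) * tpow (crd False q) (crd False p))"
    have qc: "lo d C \<le> crd d q" "crd d q \<le> hi d C" for d using q by (auto simp: cellset_def)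
    have "Psi P c q = (\<Sum>p\<in>?P0 \<union> ?S True \<union> ?S False. ?h p)"
      unfolding Psi_def
    proof (rule sum.mono_neutral_right[OF finite_verts])
      show "\<forall>p\<in>P - (?P0 \<union> ?S True \<union> ?S False). ?h p = 0"
      proof
        fix p assume p: "p \<in> P - (?P0 \<union> ?S True \<union> ?S False)"
        have "p \<notin> opencell C" using p vS opencell_Sk[OF CT] by blast
        then have "hi True C \<le> crd True p \<or> hi False C \<le> crd False p"
          using p by (auto simp: opencell_iff[of _ _ True])
        then have "tpow (crd True q) (crd True p) = 0 \<or> tpow (crd False q) (crd False p) = 0"
          using qc(2)[of True] qc(2)[of False] by (auto intro: tpow_left)
        then show "?h p = 0" by auto
      qed
    qed auto
    also have "\<dots> = (\<Sum>p\<in>?P0. ?h p) + (\<Sum>p\<in>?S True. ?h p) + (\<Sum>p\<in>?S False. ?h p)"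
      using finite_verts by (subst sum.union_disjoint; (subst sum.union_disjoint)?) auto
    also have "(\<Sum>p\<in>?S True. ?h p) = 0" using cell_strip_zero[OF c CT q, of True] by simp
    also have "(\<Sum>p\<in>?S False. ?h p) = 0" using cell_strip_zero[OF c CT q, of False] by (simp add: mult.commute)
    also have "(\<Sum>p\<in>?P0. ?h p) = (\<Sum>p\<in>?P0. c p * ((crd True q - crd True p) ^ 2 * (crd False q - crd False p) ^ 2))"
      using qc(1)[of True] qc(1)[of False] by (intro sum.cong) (auto simp: tpow_right)
    finally show ?thesis by simp
  qed
  have "biquadratic_on K (\<lambda>q. \<Sum>p\<in>?P0. c p * ((crd True q - crd True p) ^ 2 * (crd False q - crd False p) ^ 2))"
    using finite_verts by (intro biquadratic_sum) auto
  then show ?thesis by (rule biquadratic_cong[rotated]) (rule eq, simp add: C)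
qed

lemma Psi_Sbar: assumes "c \<in> Z" shows "Psi P c \<in> Sbar T"
  using C11_Psi Psi_biquadratic[OF assms] Psi_outside[OF assms] region by (simp add: Sbar_def)

abbreviation "X d \<equiv> crd d ` P"

lemma cell_coords: assumes "cellset C \<in> T" shows "lo d C \<in> X d" "hi d C \<in> X d"
proof -
  have "fst C \<in> vertices T" "snd C \<in> vertices T" using assms unfolding corner_vertices by (auto simp: lo_def hi_def)
  then show "lo d C \<in> X d" "hi d C \<in> X d" using vertices_verts by (auto simp: lo_def hi_def)
qed

lemma region_coords: "lo d B \<in> X d" "hi d B \<in> X d"
proof -
  have "fst B \<in> corners" "snd B \<in> corners" by (auto simp: corners_def lo_def hi_def)
  then show "lo d B \<in> X d" "hi d B \<in> X d" using corners_verts by (auto simp: lo_def hi_def)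
qed

lemma finX: "finite (X d)" using finite_verts by auto

lemma Sbar_boundary: assumes f: "f \<in> Sbar T" and q: "q \<notin> opencell B" shows "f q = 0"
proof -
  have "continuous_on UNIV f" using f by (simp add: Sbar_def C11_def)
  then have "closed {q. f q = 0}" by (intro closed_Collect_eq continuous_on_const)
  moreover have "- cellset B \<subseteq> {q. f q = 0}" using f region by (auto simp: Sbar_def)
  ultimately have "closure (- cellset B) \<subseteq> {q. f q = 0}" by (rule closure_minimal[rotated])
  then show ?thesis using q by (auto simp: closure_complement interior_cellset)
qed

text \<open>The knots of a section of \<open>f\<close> are coordinates of vertices, since sides of cells have such
coordinates. To the left of the region, \<open>f\<close> is zero.\<close>

lemma Sbar_spline: assumes f: "f \<in> Sbar T" shows "spline (X d) (\<lambda>s. f (pt d s t))"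
  unfolding spline_def
proof (intro conjI allI impI)
  fix s
  have "C11 f" using f by (simp add: Sbar_def)
  then obtain fx fy where D: "\<And>x y. ((\<lambda>t. f (t, y)) has_real_derivative fx (x, y)) (at x)"
    "\<And>x y. ((\<lambda>t. f (x, t)) has_real_derivative fy (x, y)) (at y)" unfolding C11_def by blast
  show "\<exists>D. ((\<lambda>s. f (pt d s t)) has_real_derivative D) (at s)"
    using D(1)[of t s] D(2)[of t s] by (cases d) (auto simp: pt_def)
next
  fix a b :: real assume ab: "a < b" "{a<..<b} \<inter> X d = {}"
  let ?m = "(a + b) / 2"
  have m: "a < ?m" "?m < b" using ab by auto
  have gap: "c \<le> a \<or> b \<le> c" if "c \<in> X d" for c using ab(2) that by force
  show "quad_on (\<lambda>s. f (pt d s t)) {a..b}"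
  proof (cases "pt d ?m t \<in> cellset B")
    case True
    then obtain K where K: "K \<in> T" "pt d ?m t \<in> K" using region by blast
    obtain C where C: "K = cellset C" using cellE[OF K(1)] by metis
    then have CT: "cellset C \<in> T" using K by simp
    have mc: "lo d C \<le> ?m" "?m \<le> hi d C" "lo (\<not> d) C \<le> t" "t \<le> hi (\<not> d) C" using K(2) unfolding C cellset_iff[of _ _ d] by auto
    have "lo d C \<le> a" "b \<le> hi d C" using gap[OF cell_coords(1)[OF CT]] gap[OF cell_coords(2)[OF CT]] mc(1,2) m by linarith+
    then have "{a..b} \<subseteq> {s. pt d s t \<in> K}" using mc unfolding C cellset_iff[of _ _ d] by auto
    moreover have "biquadratic_on K f" using f K by (simp add: Sbar_def)
    ultimately show ?thesis using biquadratic_line quad_on_sub by blast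
  next
    case False
    have "f (pt d s t) = 0" if s: "s \<in> {a..b}" for s
    proof (rule Sbar_boundary[OF f])
      have "t < lo (\<not> d) B \<or> hi (\<not> d) B < t \<or> ?m < lo d B \<or> hi d B < ?m" using False unfolding cellset_iff[of _ _ d] by auto
      then have "t < lo (\<not> d) B \<or> hi (\<not> d) B < t \<or> b \<le> lo d B \<or> hi d B \<le> a"
        using gap[OF region_coords(1)] gap[OF region_coords(2)] m by linarith
      then show "pt d s t \<notin> opencell B" using s by (auto simp: opencell_iff[of _ _ d])
    qed
    then show ?thesis unfolding quad_on_def using quadratic_zero by (intro exI[of _ "\<lambda>_. 0"]) auto
  qed
next
  fix s assume "\<forall>a\<in>X d. s \<le> a"
  then have "s \<le> lo d B" using region_coords by blast
  then show "f (pt d s t) = 0" by (intro Sbar_boundary[OF f]) (auto simp: opencell_iff[of _ _ d])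
qed

text \<open>The grid spanned by the coordinates of all vertices. The products of truncated powers at its points span a
space that contains the spline space of the mesh.\<close>

definition Q where "Q = {p. crd True p \<in> X True \<and> crd False p \<in> X False}"

lemma Q_d: "p \<in> Q \<longleftrightarrow> crd d p \<in> X d \<and> crd (\<not> d) p \<in> X (\<not> d)" unfolding Q_def by (cases d) auto

lemma finQ: "finite Q"
  using finite_product_points[OF finX[of True] finX[of False], of True] unfolding Q_def by simp

lemma P_Q: "P \<subseteq> Q" by (auto simp: Q_def)

lemma sum_Q: "(\<Sum>p\<in>Q. h p) = (\<Sum>b\<in>X (\<not> d). \<Sum>a\<in>X d. h (pt d a b))" for h :: "real \<times> real \<Rightarrow> real"
proof -
  have "(\<Sum>b\<in>X (\<not> d). \<Sum>a\<in>X d. h (pt d a b)) = (\<Sum>(b, a)\<in>X (\<not> d) \<times> X d. h (pt d a b))"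
    using finX by (intro sum.cartesian_product)
  also have "\<dots> = (\<Sum>p\<in>Q. h p)"
    by (rule sum.reindex_bij_witness[of _ "\<lambda>p. (crd (\<not> d) p, crd d p)" "\<lambda>(b, a). pt d a b"]) (auto simp: Q_d[of _ d])
  finally show ?thesis by simp
qed

lemma Psi_Q: "Psi Q c (pt d s t) = (\<Sum>b\<in>X (\<not> d). (\<Sum>a\<in>X d. c (pt d a b) * tpow s a) * tpow t b)"
  unfolding Psi_d[of _ _ _ d] sum_Q[of _ d] by (simp add: sum_distrib_right sum_distrib_left mult_ac)

lemma Sbar_Psi_Q: assumes f: "f \<in> Sbar T" shows "\<exists>c. f = Psi Q c"
proof -
  obtain k where k: "\<And>x y. f (pt True x y) = (\<Sum>a\<in>X True. \<Sum>b\<in>X False. k a b * tpow x a * tpow y b)"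
    using tensor_expansion[OF finX finX, of True "\<lambda>x y. f (pt True x y)" False] Sbar_spline[OF f, of True] Sbar_spline[OF f, of False]
    by (auto simp: pt_def)
  have "f q = Psi Q (\<lambda>p. k (crd True p) (crd False p)) q" for q
  proof -
    have "f q = (\<Sum>a\<in>X True. \<Sum>b\<in>X False. k a b * tpow (crd True q) a * tpow (crd False q) b)"
      using k[of "crd True q" "crd False q"] pt_crd[of True q] by simp
    also have "\<dots> = Psi Q (\<lambda>p. k (crd True p) (crd False p)) q"
      unfolding Psi_def sum_Q[of _ True] using crd_pt[of True] by (subst sum.swap) (simp add: mult_ac)
    finally show ?thesis .
  qed
  then show ?thesis by blast
qed

text \<open>Across a point off the skeleton the function is locally a polynomial in the perpendicular direction, so by
\<open>no_jump\<close> the coefficient of \<open>(t - b)\<^sub>+\<^sup>2\<close> vanishes there. This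
coefficient is the spline of one variable formed by the row at level \<open>b\<close>.\<close>

lemma row_zero:
  assumes f: "f \<in> Sbar T" "f = Psi Q c" and b: "b \<in> X (\<not> d)" and p: "pt d s b \<notin> Sk"
  shows "(\<Sum>a\<in>X d. c (pt d a b) * tpow s a) = 0"
proof -
  have "\<exists>u w \<psi>. u < b \<and> b < w \<and> quadratic \<psi> \<and> (\<forall>t\<in>{u<..<w}. f (pt d s t) = \<psi> t)"
  proof (cases "pt d s b \<in> cellset B")
    case True
    obtain C where C: "cellset C \<in> T" "pt d s b \<in> opencell C" using not_Sk[OF True p] by blast
    then have l: "lo d C < s" "s < hi d C" "lo (\<not> d) C < b" "b < hi (\<not> d) C" by (auto simp: opencell_iff[of _ _ d])
    have "biquadratic_on (cellset C) f" using f C by (simp add: Sbar_def)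
    from biquadratic_line[OF this, of "\<not> d" s] obtain \<psi> where "quadratic \<psi>" "\<And>t. pt (\<not> d) t s \<in> cellset C \<Longrightarrow> f (pt (\<not> d) t s) = \<psi> t"
      unfolding quad_on_def by blast
    moreover have "pt (\<not> d) t s = pt d s t" for t by (simp add: pt_def)
    ultimately show ?thesis using l by (intro exI[of _ "lo (\<not> d) C"] exI[of _ "hi (\<not> d) C"] exI[of _ \<psi>]) (auto simp: cellset_iff[of _ _ d])
  next
    case False
    have "isCont (\<lambda>t. pt d s t) b" unfolding pt_def by (cases d) auto
    then have "((\<lambda>t. pt d s t) \<longlongrightarrow> pt d s b) (at b)" by (simp add: isCont_def)
    moreover have "open (- cellset B)" using closed_cellset by (simp add: open_Compl)
    ultimately have "eventually (\<lambda>t. pt d s t \<in> - cellset B) (at b)" using topological_tendstoD False by blast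
    then obtain \<epsilon> where e: "\<epsilon> > 0" "\<And>t. t \<noteq> b \<Longrightarrow> dist t b < \<epsilon> \<Longrightarrow> pt d s t \<notin> cellset B"
      unfolding eventually_at by auto
    have "f (pt d s t) = 0" if "t \<in> {b - \<epsilon><..<b + \<epsilon>}" for t
      using e(2)[of t] that False f(1) region by (cases "t = b") (auto simp: Sbar_def dist_real_def)
    then show ?thesis using e(1) quadratic_zero by (intro exI[of _ "b - \<epsilon>"] exI[of _ "b + \<epsilon>"] exI[of _ "\<lambda>_. 0"]) auto
  qed
  then obtain u w \<psi> where u: "u < b" "b < w" "quadratic \<psi>" "\<And>t. t \<in> {u<..<w} \<Longrightarrow> f (pt d s t) = \<psi> t" by blast
  show ?thesis
    by (rule no_jump[OF finX b u(1,2,3), of "\<lambda>b. \<Sum>a\<in>X d. c (pt d a b) * tpow s a"])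
      (use u f(2) Psi_Q[of c d s] in auto)
qed

lemma not_germ_gap: assumes "\<not> germ Sk d \<sigma> v" "\<sigma> \<in> signs"
  obtains \<epsilon> where "\<epsilon> > 0" "\<And>\<tau>. 0 < \<tau> \<Longrightarrow> \<tau> < \<epsilon> \<Longrightarrow> pt d (crd d v + \<sigma> * \<tau>) (crd (\<not> d) v) \<notin> Sk"
  using germ_dichotomy[OF assms(1)] that unfolding eventually_at_right_field ray_def by auto

lemma not_vert_germ:
  assumes "p \<notin> P"
  shows "\<exists>d. \<forall>\<sigma>\<in>signs. \<not> germ Sk d \<sigma> p"
proof (cases "p \<in> Sk")
  case True
  then show ?thesis using assms dir_germ[OF True] by (auto simp: verts_def)
next
  case False
  have "\<not> germ Sk True \<sigma> p" for \<sigma>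
  proof
    assume g: "germ Sk True \<sigma> p"
    have "((\<lambda>\<tau>. ray True \<sigma> 0 p \<tau>) \<longlongrightarrow> p) (at_right 0)"
    proof -
      have "((\<lambda>\<tau>. (crd True p + \<sigma> * \<tau>, crd False p + 0 * \<tau>)) \<longlongrightarrow> (crd True p, crd False p)) (at_right 0)"
        by (intro tendsto_Pair linear_tendsto)
      then show ?thesis by (simp add: ray_def pt_def crd_def)
    qed
    moreover have "open (- Sk)" using compact_imp_closed[OF compact_Sk] by (simp add: open_Compl)
    ultimately have "ev (\<lambda>\<tau>. ray True \<sigma> 0 p \<tau> \<in> - Sk)" using topological_tendstoD False by blast
    then show False using ev_nontrivial[OF g[unfolded germ_def], of _ False] by auto
  qed
  then show ?thesis by blast
qed

text \<open>At a point that is not a vertex, one direction has no germ at all; so the row spline vanishes on both sides of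
the point and has no knot there.\<close>

lemma coefficient_support:
  assumes f: "f \<in> Sbar T" "f = Psi Q c" and p: "p \<in> Q" "p \<notin> P"
  shows "c p = 0"
proof -
  obtain d where d: "\<not> germ Sk d 1 p" "\<not> germ Sk d (-1) p" using not_vert_germ[OF p(2)] by auto
  have pq: "crd d p \<in> X d" "crd (\<not> d) p \<in> X (\<not> d)" using p(1) Q_d[of p d] by auto
  obtain \<epsilon> where e: "\<epsilon> > 0" "\<And>\<tau>. 0 < \<tau> \<Longrightarrow> \<tau> < \<epsilon> \<Longrightarrow> pt d (crd d p + 1 * \<tau>) (crd (\<not> d) p) \<notin> Sk"
    using not_germ_gap[OF d(1)] by auto
  obtain \<epsilon>' where e': "\<epsilon>' > 0" "\<And>\<tau>. 0 < \<tau> \<Longrightarrow> \<tau> < \<epsilon>' \<Longrightarrow> pt d (crd d p + (-1) * \<tau>) (crd (\<not> d) p) \<notin> Sk"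
    using not_germ_gap[OF d(2)] by auto
  have "c (pt d (crd d p) (crd (\<not> d) p)) = 0"
  proof (rule no_jump[OF finX pq(1) _ _ quadratic_zero, of "crd d p - \<epsilon>'" "crd d p + \<epsilon>" "\<lambda>a. c (pt d a (crd (\<not> d) p))"])
    show "crd d p - \<epsilon>' < crd d p" "crd d p < crd d p + \<epsilon>" using e e' by auto
    show "(\<Sum>a\<in>X d. c (pt d a (crd (\<not> d) p)) * tpow x a) = 0" if "x \<in> {crd d p - \<epsilon>'<..<crd d p}" for x
      using row_zero[OF f pq(2), of x] e'(2)[of "crd d p - x"] that by auto
    show "(\<Sum>a\<in>X d. c (pt d a (crd (\<not> d) p)) * tpow x a) = 0" if "x \<in> {crd d p<..<crd d p + \<epsilon>}" for x
      using row_zero[OF f pq(2), of x] e(2)[of "x - crd d p"] that by auto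
  qed
  then show ?thesis by simp
qed

text \<open>Just before the left end and just after the right end of an l-edge the row spline vanishes. Subtracting, the
truncated powers of the l-edge sum to the zero polynomial \<open>\<Sum> c p (x - t)\<^sup>2\<close>, whose
coefficients are multiples of the moments.\<close>

lemma coefficient_moments:
  assumes f: "f \<in> Sbar T" "f = Psi Q c" and e: "e \<in> ledges Sk d" and j: "j \<le> 2"
  shows "mom P d e j c = 0"
proof -
  obtain v where v: "v \<in> P" "e = eseg Sk d v" using e by (auto simp: ledges_def)
  obtain l r where lr: "l \<le> crd d v" "crd d v \<le> r" "eseg Sk d v = {p. crd (\<not> d) p = crd (\<not> d) v \<and> l \<le> crd d p \<and> crd d p \<le> r}"
    "\<forall>p\<in>eseg Sk d v. (germ Sk d 1 p \<longleftrightarrow> crd d p < r) \<and> (germ Sk d (-1) p \<longleftrightarrow> l < crd d p)"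
    by (rule eseg_ends[OF compact_Sk vS[OF v(1)], where d = d])
  define b where "b = crd (\<not> d) v"
  have bX: "b \<in> X (\<not> d)" using v by (auto simp: b_def)
  have ends: "pt d l b \<in> eseg Sk d v" "pt d r b \<in> eseg Sk d v" unfolding lr(3) using lr by (auto simp: b_def)
  then have ng: "\<not> germ Sk d (-1) (pt d l b)" "\<not> germ Sk d 1 (pt d r b)" using lr(4) by auto
  obtain \<epsilon> where e1: "\<epsilon> > 0" "\<And>\<tau>. 0 < \<tau> \<Longrightarrow> \<tau> < \<epsilon> \<Longrightarrow> pt d (r + 1 * \<tau>) b \<notin> Sk"
    using not_germ_gap[OF ng(2)] by auto
  obtain \<epsilon>' where e2: "\<epsilon>' > 0" "\<And>\<tau>. 0 < \<tau> \<Longrightarrow> \<tau> < \<epsilon>' \<Longrightarrow> pt d (l + (-1) * \<tau>) b \<notin> Sk"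
    using not_germ_gap[OF ng(1)] by auto
  let ?k = "\<lambda>a. c (pt d a b)"
  have 1: "(\<Sum>a\<in>{a \<in> X d. a < l}. ?k a * (x - a) ^ 2) = 0" for x
  proof (rule vanish_partial(1)[OF finX[of d], where u = "l - \<epsilon>'" and w = l and k = ?k and \<psi> = "\<lambda>_. 0", OF _ _ quadratic_zero])
    show "(\<Sum>a\<in>X d. ?k a * tpow x a) = 0" if "x \<in> {l - \<epsilon>'<..<l}" for x
      using row_zero[OF f bX, of x] e2(2)[of "l - x"] that by auto
  qed (use e2 in simp)
  have 2: "(\<Sum>a\<in>{a \<in> X d. a \<le> r}. ?k a * (x - a) ^ 2) = 0" for x
  proof (rule vanish_partial(2)[OF finX[of d], where u = r and w = "r + \<epsilon>" and k = ?k and \<psi> = "\<lambda>_. 0", OF _ _ quadratic_zero])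
    show "(\<Sum>a\<in>X d. ?k a * tpow x a) = 0" if "x \<in> {r<..<r + \<epsilon>}" for x
      using row_zero[OF f bX, of x] e1(2)[of "x - r"] that by auto
  qed (use e1 in simp)
  let ?Xe = "{a \<in> X d. l \<le> a \<and> a \<le> r}"
  have 3: "(\<Sum>a\<in>?Xe. ?k a * (x - a) ^ 2) = 0" for x
  proof -
    have "{a \<in> X d. a \<le> r} = {a \<in> X d. a < l} \<union> ?Xe" using lr by auto
    then have "(\<Sum>a\<in>{a \<in> X d. a \<le> r}. ?k a * (x - a) ^ 2) = (\<Sum>a\<in>{a \<in> X d. a < l}. ?k a * (x - a) ^ 2) + (\<Sum>a\<in>?Xe. ?k a * (x - a) ^ 2)"
      using finX by (simp only:) (subst sum.union_disjoint; auto)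
    then show ?thesis using 1 2 by simp
  qed
  have "(\<Sum>a\<in>?Xe. ?k a * (x - a) ^ 2) = (\<Sum>a\<in>?Xe. ?k a * a ^ 2) + (- 2 * (\<Sum>a\<in>?Xe. ?k a * a ^ 1)) * x + (\<Sum>a\<in>?Xe. ?k a * a ^ 0) * x ^ 2" for x
    by (simp add: sum_distrib_left sum_distrib_right sum.distrib[symmetric] sum_subtractf[symmetric] power2_eq_square algebra_simps)
  then have q: "(\<Sum>a\<in>?Xe. ?k a * a ^ 2) + (- 2 * (\<Sum>a\<in>?Xe. ?k a * a ^ 1)) * x + (\<Sum>a\<in>?Xe. ?k a * a ^ 0) * x ^ 2 = 0" for x
    using 3 by metis
  have "(\<Sum>a\<in>?Xe. ?k a * a ^ 2) = 0" "- 2 * (\<Sum>a\<in>?Xe. ?k a * a ^ 1) = 0" "(\<Sum>a\<in>?Xe. ?k a * a ^ 0) = 0"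
    using quadratic_three_zeros[OF q[of 0] q[of 1] q[of 2]] by auto
  moreover have "j = 0 \<or> j = 1 \<or> j = 2" using j by auto
  ultimately have m: "(\<Sum>a\<in>?Xe. ?k a * a ^ j) = 0" by auto
  have "mom P d e j c = (\<Sum>p\<in>Q \<inter> e. c p * crd d p ^ j)"
    unfolding mom_def using finQ P_Q coefficient_support[OF f] by (intro sum.mono_neutral_left) auto
  also have "\<dots> = (\<Sum>a\<in>?Xe. ?k a * a ^ j)"
    by (rule sum.reindex_bij_witness[of _ "\<lambda>a. pt d a b" "crd d"])
      (use bX in \<open>auto simp: v(2) lr(3) Q_d[of _ d] b_def\<close>, (metis pt_crd)+)
  finally show ?thesis using m by simp
qed

lemma Sbar_eq: "Sbar T = Psi P ` Z"
proof
  show "Psi P ` Z \<subseteq> Sbar T" using Psi_Sbar by blast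
  show "Sbar T \<subseteq> Psi P ` Z"
  proof
    fix f assume f: "f \<in> Sbar T"
    obtain c where c: "f = Psi Q c" using Sbar_Psi_Q[OF f] by blast
    define c' where "c' p = (if p \<in> P then c p else 0)" for p
    have "mom P d e j c' = mom P d e j c" for d e j unfolding mom_def by (intro sum.cong) (auto simp: c'_def)
    then have "c' \<in> Z" using coefficient_moments[OF f c] by (auto simp: moment_free_def c'_def)
    moreover have "f q = Psi P c' q" for q
    proof -
      have "Psi Q c q = (\<Sum>p\<in>P. c p * (tpow (crd True q) (crd True p) * tpow (crd False q) (crd False p)))"
        unfolding Psi_def using finQ P_Q coefficient_support[OF f c] by (intro sum.mono_neutral_right) auto
      also have "\<dots> = Psi P c' q" unfolding Psi_def by (intro sum.cong) (auto simp: c'_def)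
      finally show ?thesis using c by simp
    qed
    then have "f = Psi P c'" by blast
    ultimately show "f \<in> Psi P ` Z" by blast
  qed
qed

lemma Psi_injective: assumes c: "c \<in> Z" and z: "Psi P c = 0" shows "c = 0"
proof -
  have supp: "c p = 0" if "p \<notin> P" for p using c that by (simp add: moment_free_def)
  have "Psi Q c q = Psi P c q" for q
    unfolding Psi_def using finQ P_Q supp by (intro sum.mono_neutral_right) auto
  then have zQ: "Psi Q c q = 0" for q using z by simp
  have "c p = 0" if p: "p \<in> Q" for p
  proof -
    have pq: "crd True p \<in> X True" "crd (\<not> True) p \<in> X (\<not> True)" using p Q_d[of p True] by auto
    have row: "(\<Sum>a\<in>X True. c (pt True a (crd (\<not> True) p)) * tpow s a) = 0" for s
      by (rule no_jump[OF finX pq(2) _ _ quadratic_zero, of "crd (\<not> True) p - 1" "crd (\<not> True) p + 1" "\<lambda>b. \<Sum>a\<in>X True. c (pt True a b) * tpow s a"])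
        (use zQ Psi_Q[of c True s] in auto)
    have "c (pt True (crd True p) (crd (\<not> True) p)) = 0"
      by (rule no_jump[OF finX pq(1) _ _ quadratic_zero, of "crd True p - 1" "crd True p + 1" "\<lambda>a. c (pt True a (crd (\<not> True) p))"]) (use row in auto)
    then show ?thesis using pt_crd[of True p] by simp
  qed
  then have "c p = 0" for p using supp P_Q by blast
  then show ?thesis by auto
qed

lemma Sbar_dim:
  assumes B: "finite B'" "\<not> fun_space.dependent B'" "fun_space.span B' = Z"
  shows "(\<exists>B. finite B \<and> B \<subseteq> Sbar T \<and> Sbar T \<subseteq> fun_space.span B) \<and> fun_space.dim (Sbar T) = card B'"
  using dim_linear_image[of "Psi P", OF Psi_linear B(1,2)] Psi_injective unfolding B(3) Sbar_eq by blast

end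

section \<open>Tensor-product meshes\<close>

text \<open>A pair of coordinate sets as a family indexed by directions.\<close>

definition axes :: "real set \<Rightarrow> real set \<Rightarrow> bool \<Rightarrow> real set" where "axes X Y d = (if d then X else Y)"

lemma tensor_mesh_gcell: "tensor_mesh X Y = cellset ` {K. gcell (axes X Y) K}"
proof (intro set_eqI iffI)
  fix K assume "K \<in> tensor_mesh X Y"
  then obtain a b c d where K: "K = cbox (a, c) (b, d)" "consecutive X a b" "consecutive Y c d" by (auto simp: tensor_mesh_def)
  then show "K \<in> cellset ` {K. gcell (axes X Y) K}"
    by (intro image_eqI[of _ _ "((a, c), (b, d))"]) (auto simp: cellset_cbox gcell_def all_bool_eq axes_def lo_def hi_def crd_def)
next
  fix K assume "K \<in> cellset ` {K. gcell (axes X Y) K}"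
  then obtain a b c d where "K = cellset ((a, c), (b, d))" "gcell (axes X Y) ((a, c), (b, d))" by (metis (no_types, lifting) imageE mem_Collect_eq surj_pair)
  then show "K \<in> tensor_mesh X Y" unfolding tensor_mesh_def
    by (auto simp: cellset_cbox gcell_def all_bool_eq axes_def lo_def hi_def crd_def)
qed

lemma next_gap:
  assumes "finite X" "b \<in> X" "x \<in> X" "b < x"
  shows "\<exists>c. consecutive X b c \<and> c \<le> (x :: real)"
proof -
  define c where "c = Min {x \<in> X. b < x}"
  have f: "finite {x \<in> X. b < x}" "{x \<in> X. b < x} \<noteq> {}" using assms by auto
  have "c \<in> {x \<in> X. b < x}" unfolding c_def using Min_in[OF f] .
  moreover have le: "c \<le> y" if "y \<in> X" "b < y" for y unfolding c_def using f that by (intro Min_le) auto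
  then have "X \<inter> {b<..<c} = {}" by force
  ultimately show ?thesis using assms le by (auto simp: consecutive_def)
qed

lemma previous_gap:
  assumes "finite X" "b \<in> X" "x \<in> X" "x < b"
  shows "\<exists>c. consecutive X c b \<and> (x :: real) \<le> c"
proof -
  define c where "c = Max {x \<in> X. x < b}"
  have f: "finite {x \<in> X. x < b}" "{x \<in> X. x < b} \<noteq> {}" using assms by auto
  have "c \<in> {x \<in> X. x < b}" unfolding c_def using Max_in[OF f] .
  moreover have le: "y \<le> c" if "y \<in> X" "y < b" for y unfolding c_def using f that by (intro Max_ge) auto
  then have "X \<inter> {c<..<b} = {}" by force
  ultimately show ?thesis using assms le by (auto simp: consecutive_def)
qed

lemma gap_exists: assumes X: "finite X" "x \<in> X" "y \<in> X" "x \<le> s" "s \<le> y" "x < (y :: real)"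
  shows "\<exists>a b. consecutive X a b \<and> a \<le> s \<and> s \<le> b"
proof (cases "s = y")
  case True
  then show ?thesis using previous_gap[OF X(1,3,2,6)] by (auto simp: consecutive_def intro: less_imp_le)
next
  case False
  define a where "a = Max {x \<in> X. x \<le> s}"
  have f: "finite {x \<in> X. x \<le> s}" "{x \<in> X. x \<le> s} \<noteq> {}" using X by auto
  have a: "a \<in> X" "a \<le> s" using Max_in[OF f] by (auto simp: a_def)
  have le: "z \<le> a" if "z \<in> X" "z \<le> s" for z unfolding a_def using f that by (intro Max_ge) auto
  obtain b where b: "consecutive X a b" using next_gap[OF X(1) a(1) X(3)] a(2) X(5) False by auto
  then have "b \<in> X" "a < b" by (auto simp: consecutive_def)
  then have "s \<le> b" using le[of b] by force
  then show ?thesis using b a by blast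
qed

context grid begin

definition gbox :: cell where "gbox = (pt True (Min (G True)) (Min (G False)), pt True (Max (G True)) (Max (G False)))"

lemma gbox: "lo d gbox = Min (G d)" "hi d gbox = Max (G d)"
  by (cases d; simp add: gbox_def lo_def hi_def crd_def pt_def)+

lemma gbox_nonempty: "opencell gbox \<noteq> {}"
proof -
  have "pt True (md True gbox) (md False gbox) \<in> opencell gbox"
    using minmax(3)[of True] minmax(3)[of False] by (simp add: opencell_iff[of _ _ True] gbox md_def) (simp add: pt_def crd_def)
  then show ?thesis by blast
qed

lemma gcell_region: "gcell G K \<Longrightarrow> cellset K \<subseteq> cellset gbox"
proof
  fix p assume K: "gcell G K" "p \<in> cellset K"
  have "Min (G d) \<le> lo d K" "hi d K \<le> Max (G d)" for d
    using K(1) minmax(4,5) by (auto simp: gcell_def consecutive_def)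
  then show "p \<in> cellset gbox" using K(2) unfolding cellset_def gbox mem_Collect_eq by (meson order_trans)
qed

lemma gcell_cover: assumes "p \<in> cellset gbox" shows "\<exists>K. gcell G K \<and> p \<in> cellset K"
proof -
  have "\<exists>a b. consecutive (G d) a b \<and> a \<le> crd d p \<and> crd d p \<le> b" for d
    using assms minmax(3)[where d = d] by (intro gap_exists[OF fin minmax(1,2)]) (auto simp: cellset_def gbox)
  then obtain a b where ab: "\<And>d. consecutive (G d) (a d) (b d) \<and> a d \<le> crd d p \<and> crd d p \<le> b d" by metis
  define K :: cell where "K = (pt True (a True) (a False), pt True (b True) (b False))"
  have "lo d K = a d" "hi d K = b d" for d by (cases d; simp add: K_def lo_def hi_def crd_def pt_def)+
  then show ?thesis using ab by (intro exI[of _ K]) (auto simp: gcell_def cellset_def)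
qed

lemma grid_regular: "regular_mesh (cellset ` {K. gcell G K}) gbox"
proof
  show "interior K \<noteq> {}" if "K \<in> cellset ` {K. gcell G K}" for K using that gcell_nonempty interior_cellset by auto
  show "opencell gbox \<noteq> {}" by (rule gbox_nonempty)
  show "cellset ` {K. gcell G K} division_of cellset gbox"
  proof (rule division_ofI)
    show "finite (cellset ` {K. gcell G K})" using finite_gcells[OF fin] by simp
    show "K \<subseteq> cellset gbox" if "K \<in> cellset ` {K. gcell G K}" for K using that gcell_region by blast
    show "K \<noteq> {}" if "K \<in> cellset ` {K. gcell G K}" for K using that gcell_nonempty opencell_cellset by fastforce
    show "\<exists>a b. K = cbox a b" if "K \<in> cellset ` {K. gcell G K}" for K using that by (metis cellset_cbox(1) imageE prod.collapse)
    show "interior K \<inter> interior L = {}" if KL: "K \<in> cellset ` {K. gcell G K}" "L \<in> cellset ` {K. gcell G K}" "K \<noteq> L" for K L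
    proof (rule ccontr)
      assume na: "\<not> ?thesis"
      obtain C C' where C: "K = cellset C" "L = cellset C'" "gcell G C" "gcell G C'" using KL by blast
      obtain p where p: "p \<in> opencell C" "p \<in> opencell C'" using na unfolding C interior_cellset by auto
      have "lo d C' = lo d C \<and> hi d C' = hi d C" for d
        using gcell_unique[OF C(3,4), of d "crd d p"] p by (auto simp: opencell_def less_imp_le)
      then have "C' = C" by (intro cell_eqI) auto
      then show False using KL(3) C by simp
    qed
    show "\<Union> (cellset ` {K. gcell G K}) = cellset gbox" using gcell_cover gcell_region by blast
  qed
qed

lemma grid_skel: "skeleton (cellset ` {K. gcell G K}) = grid_skeleton G"
proof (intro set_eqI iffI)
  fix p assume "p \<in> skeleton (cellset ` {K. gcell G K})"
  then obtain K where K: "gcell G K" "p \<in> cellset K" "p \<notin> opencell K" by (auto simp: skeleton_def frontier_cellset)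
  obtain d where d: "\<not> (lo d K < crd d p \<and> crd d p < hi d K)" using K(3) by (auto simp: opencell_def)
  moreover have "lo d K \<le> crd d p" "crd d p \<le> hi d K" using K(2) by (auto simp: cellset_def)
  ultimately have "crd d p \<in> {lo d K, hi d K}" by auto
  then have "crd d p \<in> G d" using K(1) by (auto simp: gcell_def consecutive_def)
  then show "p \<in> grid_skeleton G" using gcell_region[OF K(1)] K(2) by (auto simp: in_skeleton cellset_def gbox)
next
  fix p assume "p \<in> grid_skeleton G"
  then have p: "p \<in> cellset gbox" "\<exists>d. crd d p \<in> G d" by (auto simp: in_skeleton cellset_def gbox)
  then obtain d where d: "crd d p \<in> G d" by blast
  obtain K where K: "gcell G K" "p \<in> cellset K" using gcell_cover[OF p(1)] by blast
  have "crd d p = lo d K \<or> crd d p = hi d K" using gcell_gap[OF K(1) d] K(2) by (auto simp: cellset_def)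
  then have "p \<notin> opencell K" unfolding opencell_def by (metis (mono_tags, lifting) less_irrefl mem_Collect_eq)
  then show "p \<in> skeleton (cellset ` {K. gcell G K})" using K by (auto simp: skeleton_def frontier_cellset)
qed

end

section \<open>Subdivision of cells\<close>

definition halves :: "cell \<Rightarrow> bool \<Rightarrow> real set" where "halves C d = {lo d C, md d C, hi d C}"

lemma open_less: "opencell C \<noteq> {} \<Longrightarrow> lo d C < md d C" "opencell C \<noteq> {} \<Longrightarrow> md d C < hi d C"
  using opencell_nonempty[of C d] by (auto simp: md_def)

lemma subcells_gcell:
  assumes "opencell C \<noteq> {}"
  shows "subcells (cellset C) = cellset ` {K. gcell (halves C) K}"
proof -
  obtain a b c d where C: "C = ((a, c), (b, d))" by (metis surj_pair)
  have l: "a < b" "c < d" using opencell_nonempty[OF assms, of True] opencell_nonempty[OF assms, of False] by (auto simp: C lo_def hi_def crd_def)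
  have u: "a' = a \<and> b' = b \<and> c' = c \<and> d' = d" if "cellset C = cbox (a', c') (b', d')" for a' b' c' d'
    using cellset_injective[of C "((a', c'), (b', d'))"] assms that by (simp add: cellset_cbox C)
  have "{tensor_mesh {a, (a + b) / 2, b} {c, (c + d) / 2, d} | a b c d. a < b \<and> c < d \<and> cellset C = cbox (a, c) (b, d)}
     = {tensor_mesh {a, (a + b) / 2, b} {c, (c + d) / 2, d}}"
    using u l by (auto simp: cellset_cbox C)
  then have "subcells (cellset C) = tensor_mesh {a, (a + b) / 2, b} {c, (c + d) / 2, d}" by (simp add: subcells_def)
  moreover have "axes {a, (a + b) / 2, b} {c, (c + d) / 2, d} = halves C"
    by (auto simp: axes_def halves_def C lo_def hi_def md_def crd_def fun_eq_iff)
  ultimately show ?thesis using tensor_mesh_gcell by metis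
qed

lemma halves_grid:
  assumes "opencell C \<noteq> {}"
  shows "grid (halves C)" "Min (halves C d) = lo d C" "Max (halves C d) = hi d C"
proof -
  have l: "lo d C < md d C" "md d C < hi d C" for d using open_less[OF assms] by auto
  show "grid (halves C)"
  proof
    show "2 \<le> card (halves C d)" for d
    proof -
      have "card {lo d C, hi d C} \<le> card (halves C d)" by (rule card_mono) (auto simp: halves_def)
      then show ?thesis using l[of d] by simp
    qed
  qed (simp add: halves_def)
  show "Min (halves C d) = lo d C" "Max (halves C d) = hi d C" using l[of d] by (auto simp: halves_def min_def max_def)
qed

lemma subcells_regular: assumes "opencell C \<noteq> {}" shows "regular_mesh (subcells (cellset C)) C"
proof -
  interpret grid "halves C" using halves_grid(1)[OF assms] .
  have "gbox = C" by (rule cell_eqI) (simp_all add: gbox halves_grid[OF assms])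
  then show ?thesis using grid_regular subcells_gcell[OF assms] by simp
qed

lemma subcells_skeleton:
  assumes "opencell C \<noteq> {}"
  shows "skeleton (subcells (cellset C)) = frontier (cellset C) \<union> (\<Union>d. mid d C)"
proof -
  interpret grid "halves C" using halves_grid(1)[OF assms] .
  have l: "lo d C < md d C" "md d C < hi d C" for d using open_less[OF assms] by auto
  have g: "skeleton (subcells (cellset C)) = grid_skeleton (halves C)" using grid_skel subcells_gcell[OF assms] by simp
  show ?thesis unfolding g
  proof (intro set_eqI iffI)
    fix p assume "p \<in> grid_skeleton (halves C)"
    then have p: "p \<in> cellset C" "\<exists>d. crd d p \<in> halves C d" by (auto simp: in_skeleton cellset_def halves_grid[OF assms])
    then obtain d where "crd d p \<in> {lo d C, md d C, hi d C}" by (auto simp: halves_def)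
    moreover have "p \<in> mid (\<not> d) C" if "crd d p = md d C" using that p(1) by (auto simp: mid_crd cellset_iff[of _ _ d])
    moreover have "p \<notin> opencell C" if "crd d p = lo d C \<or> crd d p = hi d C" using that by (auto simp: opencell_iff[of _ _ d])
    ultimately show "p \<in> frontier (cellset C) \<union> (\<Union>d. mid d C)" using p(1) frontier_cellset[of C] by blast
  next
    fix p assume "p \<in> frontier (cellset C) \<union> (\<Union>d. mid d C)"
    then show "p \<in> grid_skeleton (halves C)"
    proof
      assume "p \<in> frontier (cellset C)"
      then have p: "p \<in> cellset C" "p \<notin> opencell C" by (auto simp: frontier_cellset)
      then obtain d where "\<not> (lo d C < crd d p \<and> crd d p < hi d C)" by (auto simp: opencell_def)
      then have "crd d p \<in> halves C d" using p(1) by (auto simp: halves_def cellset_iff[of _ _ d])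
      then show ?thesis using p(1) by (auto simp: in_skeleton cellset_def halves_grid[OF assms])
    next
      assume "p \<in> (\<Union>d. mid d C)"
      then obtain d where d: "p \<in> mid d C" by blast
      then have "p \<in> cellset C" using l[of "\<not> d"] by (auto simp: mid_crd cellset_iff[of _ _ d])
      moreover have "crd (\<not> d) p \<in> halves C (\<not> d)" using d by (simp add: halves_def mid_crd)
      ultimately show ?thesis by (auto simp: in_skeleton cellset_def halves_grid[OF assms])
    qed
  qed
qed

text \<open>The refined grid contains the lines of all possible subdivisions of a level; so the cells of level
\<open>k\<close> are cells of the grid refined \<open>k\<close> times, wherever they are.\<close>

definition refine :: "real set \<Rightarrow> real set" where "refine X = X \<union> {(a + b) / 2 | a b. consecutive X a b}"

lemma refine_sub: "X \<subseteq> refine X" by (auto simp: refine_def)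

lemma finite_refine: assumes "finite X" shows "finite (refine X)"
proof -
  have "finite {(a + b) / 2 | a b. a \<in> X \<and> b \<in> X}" using assms by (intro finite_image_set2) auto
  moreover have "{(a + b) / 2 | a b. consecutive X a b} \<subseteq> {(a + b) / 2 | a b. a \<in> X \<and> b \<in> X}" by (auto simp: consecutive_def)
  ultimately have "finite {(a + b) / 2 | a b. consecutive X a b}" by (rule finite_subset[rotated])
  then show ?thesis using assms by (simp add: refine_def)
qed

lemma refine_gap: assumes "consecutive X l h" shows "refine X \<inter> {l<..<h} = {(l + h) / 2}"
proof -
  have "z = (l + h) / 2" if z: "z \<in> refine X" "l < z" "z < h" for z
  proof -
    have "z \<notin> X" using assms z by (auto simp: consecutive_def)
    then obtain a b where ab: "consecutive X a b" "z = (a + b) / 2" using z(1) unfolding refine_def by blast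
    then have "a \<le> z" "z \<le> b" by (auto simp: consecutive_def)
    from consecutive_unique[OF assms ab(1) z(2,3) this] show ?thesis using ab(2) by simp
  qed
  moreover have "(l + h) / 2 \<in> refine X" using assms by (auto simp: refine_def)
  moreover have "l < (l + h) / 2" "(l + h) / 2 < h" using assms by (auto simp: consecutive_def)
  ultimately show ?thesis by auto
qed

lemma refine_consecutive:
  assumes X: "consecutive X l h" and H: "consecutive {l, (l + h) / 2, h} a b"
  shows "consecutive (refine X) a b"
proof -
  have lh: "l < h" "l \<in> X" "h \<in> X" using X by (auto simp: consecutive_def)
  have ab: "a \<in> {l, (l + h) / 2, h}" "b \<in> {l, (l + h) / 2, h}" "a < b" "\<not> (a < (l + h) / 2 \<and> (l + h) / 2 < b)"
    using H by (auto simp: consecutive_def)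
  have in_r: "{l, (l + h) / 2, h} \<subseteq> refine X" using refine_gap[OF X] lh refine_sub by auto
  have "l \<le> a" "b \<le> h" using ab(1,2) lh by (auto simp: field_simps)
  then have "refine X \<inter> {a<..<b} \<subseteq> {(l + h) / 2}" using refine_gap[OF X] by force
  then have "refine X \<inter> {a<..<b} = {}" using ab(4) by force
  moreover have "a \<in> refine X" "b \<in> refine X" using ab(1,2) in_r by blast+
  ultimately show ?thesis using ab(3) unfolding consecutive_def by blast
qed

lemma subcell_gcell: assumes "gcell G C" "gcell (halves C) K" shows "gcell (\<lambda>d. refine (G d)) K"
  using assms refine_consecutive unfolding gcell_def halves_def md_def by blast

text \<open>The subcells of a cell tile it, and their boundaries consist of the boundary of the cell and its two middle
segments (\<open>subcells_skeleton\<close>).\<close>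

lemma refine_regular:
  assumes T: "regular_mesh T B" and S: "S \<subseteq> T"
  shows "regular_mesh ((T - S) \<union> (\<Union>K\<in>S. subcells K)) B"
    "skeleton ((T - S) \<union> (\<Union>K\<in>S. subcells K)) = skeleton T \<union> (\<Union>d. \<Union>C\<in>{C. cellset C \<in> S \<and> opencell C \<noteq> {}}. mid d C)"
proof -
  interpret regular_mesh T B by (rule T)
  have SE: "\<exists>C. K = cellset C \<and> opencell C \<noteq> {}" if "K \<in> S" for K using cellE[of K] that S by (metis subsetD)
  have sub: "regular_mesh (subcells K) C" if "K = cellset C" "opencell C \<noteq> {}" for K C using that subcells_regular by blast
  let ?T = "(T - S) \<union> (\<Union>K\<in>S. subcells K)"
  have parent: "\<exists>K\<in>T. L \<subseteq> K \<and> (L = K \<and> K \<notin> S \<or> L \<in> subcells K \<and> K \<in> S)" if L: "L \<in> ?T" for L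
  proof (cases "L \<in> T - S")
    case True then show ?thesis by auto
  next
    case False
    then obtain K where K: "K \<in> S" "L \<in> subcells K" using L by auto
    obtain C where C: "K = cellset C" "opencell C \<noteq> {}" using SE[OF K(1)] by blast
    have "L \<subseteq> K" using division_ofD(2)[OF regular_mesh.division[OF sub[OF C]] K(2)] C by simp
    then show ?thesis using K S by auto
  qed
  have props: "interior L \<noteq> {} \<and> L \<noteq> {} \<and> (\<exists>a b. L = cbox a b)" if L: "L \<in> ?T" for L
  proof (cases "L \<in> T - S")
    case True
    then show ?thesis using nonempty[of L] division_ofD(3,4)[OF division, of L] by blast
  next
    case False
    then obtain K where K: "K \<in> S" "L \<in> subcells K" using L by auto
    obtain C where C: "K = cellset C" "opencell C \<noteq> {}" using SE[OF K(1)] by blast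
    show ?thesis using regular_mesh.nonempty[OF sub[OF C] K(2)] division_ofD(3,4)[OF regular_mesh.division[OF sub[OF C]] K(2)] by blast
  qed
  show "regular_mesh ?T B"
  proof
    show "interior K \<noteq> {}" if "K \<in> ?T" for K using props[OF that] by blast
    show "opencell B \<noteq> {}" by (rule B)
    show "?T division_of cellset B"
    proof (rule division_ofI)
      have "finite (subcells K)" if "K \<in> S" for K
        using SE[OF that] sub regular_mesh.finT by blast
      then show "finite ?T" using finT finite_subset[OF S] by auto
      show "K \<subseteq> cellset B" if "K \<in> ?T" for K using parent[OF that] division_ofD(2)[OF division] by blast
      show "K \<noteq> {}" "\<exists>a b. K = cbox a b" if "K \<in> ?T" for K using props[OF that] by blast+
      show "interior L \<inter> interior L' = {}" if L: "L \<in> ?T" "L' \<in> ?T" "L \<noteq> L'" for L L'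
      proof -
        obtain K where K: "K \<in> T" "L \<subseteq> K" "L = K \<and> K \<notin> S \<or> L \<in> subcells K \<and> K \<in> S" using parent[OF L(1)] by blast
        obtain K' where K': "K' \<in> T" "L' \<subseteq> K'" "L' = K' \<and> K' \<notin> S \<or> L' \<in> subcells K' \<and> K' \<in> S" using parent[OF L(2)] by blast
        show ?thesis
        proof (cases "K = K'")
          case False
          then have "interior K \<inter> interior K' = {}" using division_ofD(5)[OF division K(1) K'(1)] by simp
          then show ?thesis using interior_mono[OF K(2)] interior_mono[OF K'(2)] by blast
        next
          case True
          then have k: "L \<in> subcells K" "L' \<in> subcells K" "K \<in> S" using K(3) K'(3) L(3) by auto
          obtain C where C: "K = cellset C" "opencell C \<noteq> {}" using SE[OF k(3)] by blast
          show ?thesis using division_ofD(5)[OF regular_mesh.division[OF sub[OF C]] k(1,2) L(3)] .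
        qed
      qed
      have uK: "\<Union> (subcells K) = K" if "K \<in> S" for K
        using SE[OF that] sub regular_mesh.region by metis
      have "\<Union> ?T = \<Union> (T - S) \<union> (\<Union>K\<in>S. \<Union> (subcells K))" by blast
      also have "(\<Union>K\<in>S. \<Union> (subcells K)) = (\<Union>K\<in>S. K)" by (rule SUP_cong[OF refl uK])
      also have "\<Union> (T - S) \<union> (\<Union>K\<in>S. K) = \<Union> T" using S by blast
      finally show "\<Union> ?T = cellset B" using region by simp
    qed
  qed
  have sk: "skeleton (subcells K) = frontier K \<union> (\<Union>d. \<Union>C\<in>{C. cellset C = K \<and> opencell C \<noteq> {}}. mid d C)" if "K \<in> S" for K
  proof -
    obtain C where C: "K = cellset C" "opencell C \<noteq> {}" using SE[OF \<open>K \<in> S\<close>] by blast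
    have "{C'. cellset C' = K \<and> opencell C' \<noteq> {}} = {C}" using cellset_injective[of _ C] C by blast
    then show ?thesis using subcells_skeleton[OF C(2)] C(1) by simp
  qed
  have "skeleton ?T = skeleton (T - S) \<union> (\<Union>K\<in>S. skeleton (subcells K))" by (auto simp: skeleton_def)
  also have "(\<Union>K\<in>S. skeleton (subcells K)) =
      (\<Union>K\<in>S. frontier K \<union> (\<Union>d. \<Union>C\<in>{C. cellset C = K \<and> opencell C \<noteq> {}}. mid d C))" by (rule SUP_cong[OF refl sk])
  also have "\<dots> = (\<Union>K\<in>S. frontier K) \<union> (\<Union>d. \<Union>C\<in>{C. cellset C \<in> S \<and> opencell C \<noteq> {}}. mid d C)" by blast
  also have "skeleton (T - S) \<union> ((\<Union>K\<in>S. frontier K) \<union> (\<Union>d. \<Union>C\<in>{C. cellset C \<in> S \<and> opencell C \<noteq> {}}. mid d C)) =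
     skeleton T \<union> (\<Union>d. \<Union>C\<in>{C. cellset C \<in> S \<and> opencell C \<noteq> {}}. mid d C)"
    unfolding skeleton_def using S by blast
  finally show "skeleton ?T = skeleton T \<union> (\<Union>d. \<Union>C\<in>{C. cellset C \<in> S \<and> opencell C \<noteq> {}}. mid d C)" .
qed

section \<open>Neighbouring cells\<close>

lemma nbr_neighbouring:
  assumes g: "gcell G K" "gcell G L" and n: "nbr d K L"
  shows "neighbouring (cellset K) (cellset L)"
proof -
  have *: "neighbouring (cellset K) (cellset L)" if g: "gcell G K" "gcell G L" and n: "lo (\<not> d) K = lo (\<not> d) L" "hi (\<not> d) K = hi (\<not> d) L" "hi d K = lo d L" for K L
  proof -
    define u where "u = pt d (hi d K) (lo (\<not> d) K)"
    define v where "v = pt d (hi d K) (hi (\<not> d) K)"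
    have al: "crd (\<not> \<not> d) u = crd (\<not> \<not> d) v" by (simp add: u_def v_def)
    have l: "lo d K < hi d K" "lo d L < hi d L" "lo (\<not> d) K < hi (\<not> d) K" using g gcell_less(3) by auto
    have "cellset K \<inter> cellset L = closed_segment u v"
      unfolding aligned_segment[OF al] using n l
      by (auto simp: cellset_iff[of _ _ d] u_def v_def closed_segment_eq_real_ivl)
    moreover have "u \<noteq> v" using l(3) crd_pt(2) unfolding u_def v_def by (metis less_irrefl)
    moreover have "cellset K \<noteq> cellset L"
    proof
      assume "cellset K = cellset L"
      moreover have "pt d (lo d K) (lo (\<not> d) K) \<in> cellset K" using l by (simp add: cellset_iff[of _ _ d])
      ultimately show False using l n by (simp add: cellset_iff[of _ _ d])
    qed
    ultimately show ?thesis unfolding neighbouring_def by blast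
  qed
  show ?thesis
  proof (cases "hi d K = lo d L")
    case True
    then show ?thesis using *[OF g] n by (auto simp: nbr_def)
  next
    case False
    then have "neighbouring (cellset L) (cellset K)" using *[OF g(2,1)] n by (auto simp: nbr_def)
    then show ?thesis by (auto simp: neighbouring_def Int_commute)
  qed
qed

text \<open>Two cells of one grid that meet in a proper segment share a side: the midpoint of the common segment is in the
interior of a side of each, which fixes the interval of the grid along it.\<close>

lemma neighbouring_nbr:
  assumes g: "gcell G K" "gcell G L" and n: "neighbouring (cellset K) (cellset L)"
  shows "\<exists>d. nbr d K L"
proof -
  obtain u v where uv: "u \<noteq> v" "cellset K \<inter> cellset L = closed_segment u v" and KL: "K \<noteq> L" using n by (auto simp: neighbouring_def)
  have uK: "u \<in> cellset K" "v \<in> cellset K" "u \<in> cellset L" "v \<in> cellset L" using uv(2) ends_in_segment by blast+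
  obtain d where d: "crd (\<not> d) u \<noteq> crd (\<not> d) v" using uv(1) point_eqI[of True u v] by (metis (full_types))
  let ?m = "(crd (\<not> d) u + crd (\<not> d) v) / 2"
  have b: "lo (\<not> d) K \<le> crd (\<not> d) u" "crd (\<not> d) u \<le> hi (\<not> d) K" "lo (\<not> d) K \<le> crd (\<not> d) v" "crd (\<not> d) v \<le> hi (\<not> d) K"
     "lo (\<not> d) L \<le> crd (\<not> d) u" "crd (\<not> d) u \<le> hi (\<not> d) L" "lo (\<not> d) L \<le> crd (\<not> d) v" "crd (\<not> d) v \<le> hi (\<not> d) L"
    using uK unfolding cellset_iff[of _ _ d] by blast+
  have aux: "l < (x + y) / 2 \<and> (x + y) / 2 < h" if "l \<le> x" "x \<le> h" "l \<le> y" "y \<le> h" "x \<noteq> y" for l h x y :: real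
    using that by auto
  have mK: "lo (\<not> d) K < ?m" "?m < hi (\<not> d) K" "lo (\<not> d) L \<le> ?m" "?m \<le> hi (\<not> d) L"
    using aux[OF b(1-4) d] aux[OF b(5-8) d] by (auto simp: less_imp_le)
  have e: "lo (\<not> d) L = lo (\<not> d) K" "hi (\<not> d) L = hi (\<not> d) K" using gcell_unique[OF g mK] by auto
  have ne: "\<not> (lo d L = lo d K \<and> hi d L = hi d K)" using KL e cell_eqI2 by metis
  have ud: "lo d K \<le> crd d u" "crd d u \<le> hi d K" "lo d L \<le> crd d u" "crd d u \<le> hi d L" using uK by (auto simp: cellset_iff[of _ _ d])
  have "crd d u = lo d K \<or> crd d u = hi d K"
    using gcell_unique[OF g _ _ ud(3,4)] ne ud by (metis order_le_imp_less_or_eq)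
  moreover have "crd d u = lo d L \<or> crd d u = hi d L"
    using gcell_unique[OF g(2,1) _ _ ud(1,2)] ne ud by (metis order_le_imp_less_or_eq)
  moreover have c: "consecutive (G d) (lo d K) (hi d K)" "consecutive (G d) (lo d L) (hi d L)" using g by (auto simp: gcell_def)
  ultimately have "hi d K = lo d L \<or> hi d L = lo d K"
    using ne consecutive_same_end by metis
  then have "nbr d K L" using e by (auto simp: nbr_def)
  then show ?thesis by blast
qed

section \<open>Classical hierarchical meshes\<close>

text \<open>\<open>A k\<close> are the cells subdivided at level \<open>k\<close>, and \<open>G k\<close> is the grid of
this level.\<close>

locale classical =
  fixes X Y :: "real set" and n :: nat and S :: "nat \<Rightarrow> mesh"
  assumes ref: "refinement X Y n S"
begin

definition T0 where "T0 = tensor_mesh X Y"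
abbreviation "G0 \<equiv> axes X Y"
abbreviation "Lv k \<equiv> level_cells T0 S k"
abbreviation "T k \<equiv> level_mesh T0 S k"

fun G :: "nat \<Rightarrow> bool \<Rightarrow> real set" where
  "G 0 d = axes X Y d" | "G (Suc k) d = refine (G k d)"

definition A :: "nat \<Rightarrow> cell set" where "A k = {C. cellset C \<in> S k \<and> opencell C \<noteq> {}}"

lemma grid0: "grid G0"
  using ref by unfold_locales (auto simp: axes_def refinement_def)

sublocale g: grid G0 by (rule grid0)

lemma SL: "k < n \<Longrightarrow> S k \<subseteq> Lv k" using ref by (auto simp: refinement_def T0_def)

lemma finG: "finite (G k d)"
  by (induction k) (use g.fin finite_refine in auto)

lemma G_mono: "G k d \<subseteq> G (Suc k) d" using refine_sub by auto

lemma LT: "Lv k \<subseteq> T k"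
  by (induction k) auto

lemma G_range: "s \<in> G k d \<Longrightarrow> Min (G0 d) \<le> s \<and> s \<le> Max (G0 d)"
proof (induction k arbitrary: s)
  case 0
  then show ?case using g.minmax(4,5) by auto
next
  case (Suc k)
  show ?case
  proof (cases "s \<in> G k d")
    case False
    then obtain a b where ab: "consecutive (G k d) a b" "s = (a + b) / 2" using Suc.prems by (auto simp: refine_def)
    then have "a \<in> G k d" "b \<in> G k d" by (auto simp: consecutive_def)
    then show ?thesis using Suc.IH[of a] Suc.IH[of b] ab(2) by auto
  qed (use Suc.IH in auto)
qed

lemma level_gcell: "k \<le> n \<Longrightarrow> K \<in> Lv k \<Longrightarrow> \<exists>C. K = cellset C \<and> gcell (G k) C"
proof (induction k arbitrary: K)
  case 0
  have "G 0 = G0" by (rule ext) simp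
  then show ?case using 0 by (auto simp: T0_def tensor_mesh_gcell)
next
  case (Suc k)
  then obtain N where N: "N \<in> S k" "K \<in> subcells N" by auto
  have "N \<in> Lv k" using SL[of k] N Suc.prems by auto
  then obtain C where C: "N = cellset C" "gcell (G k) C" using Suc.IH[of N] Suc.prems(1) Suc_leD by blast
  have "lo d C < hi d C" for d using gcell_less(3)[OF C(2)] .
  then have "pt True (md True C) (md False C) \<in> opencell C"
    by (auto simp: opencell_def all_bool_eq md_def) (simp_all add: pt_def crd_def field_simps)
  then have o: "opencell C \<noteq> {}" by blast
  obtain K' where K': "K = cellset K'" "gcell (halves C) K'" using N(2) unfolding C(1) subcells_gcell[OF o] by blast
  have "G (Suc k) = (\<lambda>d. refine (G k d))" by (rule ext) simp
  then have "gcell (G (Suc k)) K'" using subcell_gcell[OF C(2) K'(2)] by simp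
  then show ?case using K' by blast
qed

lemma A_gcell: assumes "k < n" "C \<in> A k" shows "gcell (G k) C"
proof -
  have C: "cellset C \<in> S k" "opencell C \<noteq> {}" using assms by (auto simp: A_def)
  have "cellset C \<in> Lv k" using C(1) SL[OF assms(1)] by blast
  then obtain C' where "cellset C = cellset C'" "gcell (G k) C'" using level_gcell[OF less_imp_le[OF assms(1)]] by blast
  then show ?thesis using cellset_injective[OF _ C(2)] by metis
qed

lemma A_image: assumes "k < n" shows "cellset ` A k = S k"
proof
  show "S k \<subseteq> cellset ` A k"
  proof
    fix K assume K: "K \<in> S k"
    then have "K \<in> Lv k" using SL[OF assms] by blast
    then obtain C where "K = cellset C" "gcell (G k) C" using level_gcell[OF less_imp_le[OF assms]] by blast
    then show "K \<in> cellset ` A k" using K gcell_nonempty by (auto simp: A_def)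
  qed
qed (auto simp: A_def)

lemma regular: "k \<le> n \<Longrightarrow> regular_mesh (T k) g.gbox"
proof (induction k)
  case 0
  then show ?case using g.grid_regular by (simp add: T0_def tensor_mesh_gcell)
next
  case (Suc k)
  then show ?case using refine_regular(1)[of "T k" g.gbox "S k"] SL[of k] LT[of k] by auto
qed

lemma skel_step: "k < n \<Longrightarrow> skeleton (T (Suc k)) = skeleton (T k) \<union> (\<Union>d. \<Union>C\<in>A k. mid d C)"
  using refine_regular(2)[OF regular, of k "S k"] SL[of k] LT[of k] by (auto simp: A_def)

lemma skel0: "skeleton (T 0) = grid_skeleton G0"
  using g.grid_skel by (simp add: T0_def tensor_mesh_gcell)

lemma skel_lines: "k \<le> n \<Longrightarrow> p \<in> skeleton (T k) \<Longrightarrow> \<exists>d. crd d p \<in> G k d"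
proof (induction k)
  case 0
  have "p \<in> grid_skeleton G0" using 0 skel0 by simp
  then show ?case by (auto simp: grid_skeleton_def)
next
  case (Suc k)
  show ?case
  proof (cases "p \<in> skeleton (T k)")
    case True
    then show ?thesis using Suc G_mono by fastforce
  next
    case False
    then obtain d C where C: "C \<in> A k" "p \<in> mid d C" using Suc.prems skel_step[of k] by auto
    have "consecutive (G k (\<not> d)) (lo (\<not> d) C) (hi (\<not> d) C)" using A_gcell[OF _ C(1)] Suc.prems by (auto simp: gcell_def)
    then have "crd (\<not> d) p \<in> G (Suc k) (\<not> d)" using C(2) by (auto simp: mid_crd md_def refine_def)
    then show ?thesis by blast
  qed
qed

lemma A_frontier: assumes "k < n" "C \<in> A k" shows "frontier (cellset C) \<subseteq> skeleton (T k)"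
  using assms SL[of k] LT[of k] by (auto simp: A_def skeleton_def)

lemma step:
  assumes k: "k < n"
  shows "skeleton_refinement (skeleton (T k)) (skeleton (T (Suc k))) (G k) (\<lambda>d. A k)"
proof
  interpret r: regular_mesh "T k" g.gbox using regular k by simp
  show "finite (G k d)" for d by (rule finG)
  show "closed (skeleton (T k))" using r.compact_Sk compact_imp_closed by blast
  show "\<exists>d. crd d p \<in> G k d" if "p \<in> skeleton (T k)" for p using skel_lines that k by simp
  show "\<exists>w\<in>eseg (skeleton (T k)) d v. w \<in> verts (skeleton (T k))" if "dir (skeleton (T k)) d v" for d v using r.has_vertex[OF that] .
  show "gcell (G k) K" if "K \<in> A k" for K using A_gcell[OF k that] .
  show "side d K \<subseteq> skeleton (T k)" if K: "K \<in> A k" for d K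
  proof
    fix p assume "p \<in> side d K"
    then have "p \<in> frontier (cellset K)" unfolding frontier_cellset using gcell_less(3)[OF A_gcell[OF k K]]
      by (auto simp: side_def cellset_iff[of _ _ d] opencell_iff[of _ _ d] less_imp_le)
    then show "p \<in> skeleton (T k)" using A_frontier[OF k K] by blast
  qed
  show "K \<in> A k" if "K \<in> A k" for K using that .
  show "skeleton (T (Suc k)) = skeleton (T k) \<union> (\<Union>d. \<Union> (mid d ` A k))" using skel_step[OF k] .
qed

lemma nested_A:
  assumes "Suc k < n" "C \<in> A (Suc k)"
  shows "\<exists>N\<in>A k. cellset C \<subseteq> cellset N"
proof -
  have "cellset C \<in> Lv (Suc k)" using assms SL[of "Suc k"] by (auto simp: A_def)
  then obtain N where N: "N \<in> S k" "cellset C \<in> subcells N" by auto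
  obtain N' where N': "N = cellset N'" "N' \<in> A k" using A_image[of k] N(1) assms(1) by (metis Suc_lessD imageE)
  have "opencell N' \<noteq> {}" using N'(2) by (simp add: A_def)
  then have "cellset C \<subseteq> cellset N'" using division_ofD(2)[OF regular_mesh.division[OF subcells_regular]] N(2) N'(1) by blast
  then show ?thesis using N' by blast
qed

lemma sequence:
  assumes c: "(card X = 2 \<longrightarrow> card Y = 3) \<and> (card Y = 2 \<longrightarrow> card X = 3)"
  shows "\<exists>d0. skeleton_sequence n (\<lambda>k. skeleton (T k)) G (\<lambda>k d. A k) G0 d0"
proof -
  have c2: "2 \<le> card X" "2 \<le> card Y" using ref by (auto simp: refinement_def)
  \<comment> \<open>the direction with the required three coordinates; if X has only two elements, Y has three\<close>
  define d0 where "d0 \<longleftrightarrow> card X \<ge> 3"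
  have c3: "card (G0 d0) \<ge> 3" "card (G0 (\<not> d0)) \<ge> 3 \<or> card (G0 d0) = 3"
    using c c2 unfolding d0_def axes_def by auto
  have "skeleton_sequence n (\<lambda>k. skeleton (T k)) G (\<lambda>k d. A k) G0 d0"
    by (rule skeleton_sequence.intro[OF step nested_A grid0 skel0 c3])
  then show ?thesis by blast
qed

text \<open>A neighbour in the grid of the level remains a cell of the next mesh if and only if it is not subdivided.\<close>

lemma isolated_count: assumes k: "k < n"
  shows "card (isolated_cells (S k) (Lv k) (T (Suc k))) = card (skeleton_refinement.isolated (\<lambda>d. A k))"
proof -
  interpret s: skeleton_refinement "skeleton (T k)" "skeleton (T (Suc k))" "G k" "\<lambda>d. A k" using step[OF k] .
  interpret r: regular_mesh "T (Suc k)" g.gbox by (rule regular) (use k in simp)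
  have not_next: "cellset C \<notin> T (Suc k)" if C: "C \<in> A k" for C
  proof
    assume "cellset C \<in> T (Suc k)"
    from r.opencell_Sk[OF this] have "opencell C \<inter> mid True C = {}" using s.mid_sub[OF C, of True] by blast
    moreover have "pt True (md True C) (md (\<not> True) C) \<in> opencell C \<inter> mid True C"
      using gcell_less[OF s.cells[OF C], of True] gcell_less[OF s.cells[OF C], of False] crd_pt[of True]
      by (simp add: opencell_iff[of _ _ True] mid_crd)
    ultimately show False by blast
  qed
  have "isolated_cells (S k) (Lv k) (T (Suc k)) = cellset ` s.isolated"
  proof (intro set_eqI iffI)
    fix K assume K: "K \<in> isolated_cells (S k) (Lv k) (T (Suc k))"
    then have "K \<in> S k" by (simp add: isolated_cells_def)
    then obtain C where C: "K = cellset C" "C \<in> A k" using A_image[OF k] by blast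
    have "\<not> nbr d C C'" if C': "C' \<in> A k" for d C'
    proof
      assume "nbr d C C'"
      then have "neighbouring K (cellset C')" using nbr_neighbouring s.cells C C' by blast
      moreover have "cellset C' \<in> Lv k" using C' SL[OF k] by (auto simp: A_def)
      ultimately show False using K not_next[OF C'] by (auto simp: isolated_cells_def)
    qed
    then show "K \<in> cellset ` s.isolated" using C by (auto simp: s.isolated_def)
  next
    fix K assume "K \<in> cellset ` s.isolated"
    then obtain C where C: "K = cellset C" "C \<in> A k" "\<And>d C'. C' \<in> A k \<Longrightarrow> \<not> nbr d C C'" by (auto simp: s.isolated_def)
    have "N \<in> T (Suc k)" if N: "N \<in> Lv k" "neighbouring K N" for N
    proof -
      obtain C' where C': "N = cellset C'" "gcell (G k) C'" using level_gcell[OF less_imp_le[OF k] N(1)] by blast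
      obtain d where "nbr d C C'" using neighbouring_nbr[OF s.cells[OF C(2)] C'(2)] N(2) C(1) C'(1) by blast
      then have "C' \<notin> A k" using C(3) by blast
      then have "N \<notin> S k" using C' gcell_nonempty by (auto simp: A_def)
      then show ?thesis using N(1) LT[of k] by auto
    qed
    then show "K \<in> isolated_cells (S k) (Lv k) (T (Suc k))" using C by (auto simp: isolated_cells_def A_def)
  qed
  moreover have "opencell C \<noteq> {}" if "C \<in> s.isolated" for C
  proof -
    have "C \<in> A k" using that by (simp add: s.isolated_def)
    then show ?thesis by (simp add: A_def)
  qed
  then have "inj_on cellset s.isolated" using cellset_injective inj_onI[of s.isolated cellset] by metis
  ultimately show ?thesis by (simp add: card_image)
qed

end

section \<open>Extended meshes\<close>

context regular_mesh begin

text \<open>Let \<open>C'\<close> be the cell of the mesh whose interior contains a given point of \<open>opencell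
C\<close>. Both open cells are connected and neither meets the boundary of the other, so they are equal.\<close>

lemma cell_determined:
  assumes C: "opencell C \<noteq> {}" "cellset C \<subseteq> cellset B" "frontier (cellset C) \<subseteq> Sk" "opencell C \<inter> Sk = {}"
  shows "cellset C \<in> T"
proof -
  obtain p where p: "p \<in> opencell C" using C(1) by blast
  then have "p \<in> cellset B" "p \<notin> Sk" using C opencell_cellset by blast+
  then obtain C' where C': "cellset C' \<in> T" "p \<in> opencell C'" using not_Sk by blast
  have conn: "connected (opencell K)" for K by (cases K) (simp add: cellset_cbox convex_connected)
  have sub: "opencell K \<subseteq> opencell K'" if "p \<in> opencell K" "p \<in> opencell K'" "opencell K \<inter> frontier (cellset K') = {}" for K K'
  proof (rule ccontr)
    assume "\<not> ?thesis"
    then have "opencell K - cellset K' \<noteq> {}" using that(3) frontier_cellset[of K'] by blast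
    moreover have "opencell K \<inter> cellset K' \<noteq> {}" using that(1,2) opencell_cellset by blast
    ultimately show False using connected_Int_frontier[OF conn] that(3) by blast
  qed
  have f: "frontier (cellset C') \<subseteq> Sk" using C' by (auto simp: skeleton_def)
  have "opencell C \<subseteq> opencell C'" using sub[OF p C'(2)] f C(4) by blast
  moreover have "opencell C' \<subseteq> opencell C" using sub[OF C'(2) p] opencell_Sk[OF C'(1)] C(3) by blast
  ultimately have "cellset C = cellset C'" using closure_opencell[of C] closure_opencell[of C'] p C'(2) by (metis empty_iff order_antisym)
  then show ?thesis using C' by simp
qed

end

lemma crd_affine: "crd d (u + t *\<^sub>R (v - u)) = crd d u + t * (crd d v - crd d u)"
  by (cases d) (simp_all add: crd_def)

locale extended = classical X Y n S for X Y n S +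
  fixes xs ys :: "real list" and D :: "nat \<Rightarrow> mesh"
  assumes ext: "\<And>k. k \<le> n \<Longrightarrow> extension_of xs ys (level_mesh (tensor_mesh X Y) S k) (D k)"
begin

abbreviation "Z \<equiv> axes (set xs) (set ys)"
definition z where "z d i = (if d then xs ! i else ys ! i)"
text \<open>The original region is \<open>[z True 2, z True 3] \<times> [z False 2, z False 3]\<close>; \<open>clampv
d\<close> projects a coordinate to it. A point \<open>p\<close> is on an arm of direction \<open>d\<close> if
its projection \<open>cl d p\<close> along direction \<open>d\<close> lies on a segment of this direction of
the original mesh.\<close>

definition clampv where "clampv d s = max (z d 2) (min (z d 3) s)"
definition cl where "cl d p = pt d (clampv d (crd d p)) (crd (\<not> d) p)"

lemma outer: "outer_grid xs ys (\<Union>(T k))" if "k \<le> n"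
  using ext[OF that] by (simp add: extension_of_def Let_def T0_def)

lemma z_less: "i < j \<Longrightarrow> j < 6 \<Longrightarrow> z d i < z d j"
  using outer[of 0] by (auto simp: outer_grid_def z_def sorted_wrt_iff_nth_less)

lemma z_le: "i \<le> j \<Longrightarrow> j < 6 \<Longrightarrow> z d i \<le> z d j"
  using z_less[of i j d] by (cases "i = j") auto

lemma Z_nth: "s \<in> Z d \<longleftrightarrow> (\<exists>i<6. s = z d i)"
  using outer[of 0] by (auto simp: outer_grid_def z_def axes_def in_set_conv_nth)

lemma z_Z: "i < 6 \<Longrightarrow> z d i \<in> Z d" using Z_nth by blast

lemma Z_outside:
  assumes "s \<in> Z d"
  shows "s \<le> z d 2 \<or> z d 3 \<le> s" "z d 0 \<le> s" "s \<le> z d 5"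
proof -
  obtain i where i: "i < 6" "s = z d i" using assms Z_nth by blast
  have "i \<le> 2 \<or> 3 \<le> i" by auto
  then show "s \<le> z d 2 \<or> z d 3 \<le> s" using z_le[of i 2 d] z_le[of 3 i d] i by auto
  show "z d 0 \<le> s" "s \<le> z d 5" using z_le[of 0 i d] z_le[of i 5 d] i by auto
qed

lemma card_Z: "card (Z d) = 6"
  using outer[of 0] by (auto simp: outer_grid_def axes_def strict_sorted_iff distinct_card)

lemma finite_Z: "finite (Z d)"
  by (simp add: axes_def)

sublocale m: grid Z
  by unfold_locales (simp_all add: card_Z finite_Z)

lemma Z_minmax: "Min (Z d) = z d 0" "Max (Z d) = z d 5"
  using Z_outside(2,3) z_Z m.fin by (auto intro!: Min_eqI Max_eqI)

lemma gbox0: "lo d g.gbox = z d 2" "hi d g.gbox = z d 3"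
proof -
  have "cellset g.gbox = cellset ((xs ! 2, ys ! 2), (xs ! 3, ys ! 3))"
    using outer[of 0] regular_mesh.region[OF regular[of 0]] by (simp add: outer_grid_def cellset_cbox)
  then have "g.gbox = ((xs ! 2, ys ! 2), (xs ! 3, ys ! 3))" using cellset_injective g.gbox_nonempty by blast
  then show "lo d g.gbox = z d 2" "hi d g.gbox = z d 3" by (auto simp: lo_def hi_def crd_def z_def)
qed

lemma G_in: "s \<in> G k d \<Longrightarrow> z d 2 \<le> s \<and> s \<le> z d 3"
  using G_range[of s k d] g.gbox gbox0 by metis

lemma z23: "z d 2 < z d 3" "z d 0 < z d 2" "z d 3 < z d 5" using z_less by auto

lemma regionM: "p \<in> cellset m.gbox \<longleftrightarrow> (\<forall>d. z d 0 \<le> crd d p \<and> crd d p \<le> z d 5)"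
  by (simp add: cellset_def m.gbox Z_minmax)

lemma region0: "p \<in> cellset g.gbox \<longleftrightarrow> (\<forall>d. z d 2 \<le> crd d p \<and> crd d p \<le> z d 3)"
  by (simp add: cellset_def gbox0)

lemma region_sub: "cellset g.gbox \<subseteq> cellset m.gbox"
  using z23 unfolding subset_iff region0 regionM by (meson less_imp_le order_trans)

lemma tensorM: "tensor_mesh (set xs) (set ys) = cellset ` {K. gcell Z K}" by (rule tensor_mesh_gcell)

lemma unionM: "\<Union>(tensor_mesh (set xs) (set ys)) = cellset m.gbox"
  unfolding tensorM using regular_mesh.region[OF m.grid_regular] .

lemma regular_D: assumes "k \<le> n" shows "regular_mesh (D k) m.gbox"
proof -
  have e: "regular_Tmesh (D k)" "\<Union>(D k) = cellset m.gbox"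
    using ext[OF assms] unionM by (auto simp: extension_of_def Let_def)
  obtain a b where ab: "D k division_of cbox a b" using e(1) by (auto simp: regular_Tmesh_def)
  then have "cbox a b = cellset m.gbox" using division_ofD(6)[OF ab] e(2) by simp
  then show ?thesis using ab e(1) m.gbox_nonempty by unfold_locales (auto simp: regular_Tmesh_def)
qed

lemma skeleton_D: assumes "k \<le> n"
  shows "skeleton (D k) = grid_skeleton Z \<union> skeleton (T k) \<union> extended_segments (T k) (cellset m.gbox)"
  using ext[OF assms] unionM m.grid_skel tensorM by (simp add: extension_of_def Let_def T0_def)

text \<open>The segments of the original mesh together with their prolongations, described by projection. It replaces
\<open>extended_segments\<close>, which refers to edges (\<open>extended_sub\<close>, \<open>Ext_sub\<close>).\<close>

definition Ext where "Ext k = {p \<in> cellset m.gbox. \<exists>d. dir (skeleton (T k)) d (cl d p)}"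

lemma clampv: "z d 2 \<le> clampv d s" "clampv d s \<le> z d 3" "z d 2 \<le> s \<Longrightarrow> s \<le> z d 3 \<Longrightarrow> clampv d s = s"
   "s \<le> z d 2 \<Longrightarrow> clampv d s = z d 2" "z d 3 \<le> s \<Longrightarrow> clampv d s = z d 3" "s \<le> t \<Longrightarrow> clampv d s \<le> clampv d t"
  using z23(1)[of d] by (auto simp: clampv_def)

lemma crd_cl [simp]: "crd d (cl d p) = clampv d (crd d p)" "crd (\<not> d) (cl d p) = crd (\<not> d) p"
  by (simp_all add: cl_def)

lemma cl_inside: "z d 2 \<le> crd d p \<Longrightarrow> crd d p \<le> z d 3 \<Longrightarrow> cl d p = p"
  using clampv(3)[of d "crd d p"] by (simp add: cl_def)

lemma in_grid_skeletonM: "p \<in> cellset m.gbox \<Longrightarrow> crd d p \<in> Z d \<Longrightarrow> p \<in> grid_skeleton Z"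
  by (auto simp: m.in_skeleton cellset_def m.gbox)

lemma extended_sub:
  assumes k: "k \<le> n"
  shows "extended_segments (T k) (cellset m.gbox) \<subseteq> grid_skeleton Z \<union> Ext k"
proof
  interpret r: regular_mesh "T k" g.gbox using regular k by simp
  fix p assume p: "p \<in> extended_segments (T k) (cellset m.gbox)"
  then obtain u v t where uv: "p = u + t *\<^sub>R (v - u)" "closed_segment u v \<in> edges (T k)" "v \<in> frontier (\<Union>(T k))" "1 \<le> t"
    and pM: "p \<in> cellset m.gbox" by (auto simp: extended_segments_def)
  obtain d where "closed_segment u v \<in> r.aedges d" using uv(2) r.edges_aedges by (metis (full_types) UnE)
  then obtain u' v' where e: "closed_segment u v = closed_segment u' v'" "u' \<noteq> v'" "v' \<in> eseg r.Sk d u'" unfolding r.aedges_iff by blast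
  have "{u, v} = {u', v'}" using e(1) by (simp add: closed_segment_eq)
  then have ev: "u \<in> eseg r.Sk d v" "u \<noteq> v"
    using e by (auto simp: doubleton_eq_iff eseg_def closed_segment_commute)
  then have al: "crd (\<not> d) u = crd (\<not> d) v" and dv: "dir r.Sk d v" by (auto simp: eseg_def dir_def)
  have uB: "u \<in> cellset g.gbox" using ev(1) r.Sk_region by (auto simp: eseg_def)
  have vB: "v \<in> cellset g.gbox" "v \<notin> opencell g.gbox" using uv(3) r.interior_region by auto
  have ne: "crd d u \<noteq> crd d v" using ev(2) al point_eqI by metis
  have pl: "crd (\<not> d) p = crd (\<not> d) v" "crd d p = crd d u + t * (crd d v - crd d u)" using al unfolding uv(1) crd_affine by simp_all
  show "p \<in> grid_skeleton Z \<union> Ext k"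
  proof (cases "crd d v \<in> {z d 2, z d 3}")
    case False
    then have "crd (\<not> d) v \<in> {z (\<not> d) 2, z (\<not> d) 3}" using vB unfolding cellset_iff[of _ _ d] opencell_iff[of _ _ d] gbox0 by auto
    then have "crd (\<not> d) p \<in> Z (\<not> d)" using z_Z pl(1) by auto
    then show ?thesis using in_grid_skeletonM pM by blast
  next
    case True
    have t1: "(t - 1) * (crd d v - crd d u) \<ge> 0 \<longleftrightarrow> t = 1 \<or> crd d v \<ge> crd d u" using uv(4) by (auto simp: zero_le_mult_iff)
    have pe: "crd d p = crd d v + (t - 1) * (crd d v - crd d u)" unfolding pl(2) by (simp add: algebra_simps)
    have "clampv d (crd d p) = crd d v"
    proof (cases "crd d u < crd d v")
      case lt: True
      have "crd d v = z d 3" using True lt uB unfolding cellset_iff[of _ _ d] gbox0 by auto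
      moreover have "(t - 1) * (crd d v - crd d u) \<ge> 0" using lt uv(4) by simp
      ultimately show ?thesis using clampv(5)[of d "crd d p"] pe by simp
    next
      case False
      then have gt: "crd d v < crd d u" using ne by simp
      have "crd d v = z d 2" using True gt uB unfolding cellset_iff[of _ _ d] gbox0 by auto
      moreover have "(t - 1) * (crd d v - crd d u) \<le> 0" using gt uv(4) by (simp add: mult_nonneg_nonpos)
      ultimately show ?thesis using clampv(4)[of "crd d p" d] pe by simp
    qed
    then have "cl d p = v" using pl(1) by (intro point_eqI[of d]) auto
    then show ?thesis using dv pM by (auto simp: Ext_def)
  qed
qed

lemma Ext_sub:
  assumes k: "k \<le> n"
  shows "Ext k \<subseteq> skeleton (T k) \<union> extended_segments (T k) (cellset m.gbox)"
proof
  interpret r: regular_mesh "T k" g.gbox using regular k by simp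
  fix p assume "p \<in> Ext k"
  then obtain d where pM: "p \<in> cellset m.gbox" and d: "dir r.Sk d (cl d p)" by (auto simp: Ext_def)
  define v where "v = cl d p"
  have vS: "v \<in> r.Sk" using d dir_self(1) by (simp add: v_def)
  show "p \<in> skeleton (T k) \<union> extended_segments (T k) (cellset m.gbox)"
  proof (cases "p = v")
    case False
    have neq: "crd d p \<noteq> clampv d (crd d p)" using False point_eqI[of d p v] by (auto simp: v_def)
    then have side: "crd d p < z d 2 \<and> crd d v = z d 2 \<or> z d 3 < crd d p \<and> crd d v = z d 3"
      using clampv(3,5)[of d "crd d p"] clampv(4)[of "crd d p" d] unfolding v_def crd_cl by linarith
    define \<sigma> where "\<sigma> = (if crd d p < z d 2 then 1 else -1 :: real)"
    have \<sigma>: "\<sigma> \<in> signs" "- \<sigma> \<in> signs" by (auto simp: \<sigma>_def)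
    have "\<not> germ r.Sk d (- \<sigma>) v"
      using r.germ_inside[of d "- \<sigma>" v] side z23(1)[of d] \<sigma> gbox0[of d] by (auto simp: \<sigma>_def)
    then have vv: "v \<in> verts r.Sk" and "germ r.Sk d \<sigma> v"
      using r.end_vertex[OF vS \<sigma>(2)] d dir_germ[OF vS, of d] by (auto simp: v_def \<sigma>_def split: if_splits)
    then obtain w where w: "r.adj d \<sigma> v w" using r.adj_exists \<sigma>(1) by blast
    have "closed_segment v w \<in> r.aedges d" using r.adj_edge[OF vv w] .
    then have e: "closed_segment w v \<in> edges (T k)" using r.edges_aedges by (cases d) (auto simp: closed_segment_commute)
    have fr: "v \<in> frontier (\<Union>(T k))"
      using vS r.Sk_region side r.interior_region(2) by (auto simp: opencell_iff[of _ _ d] gbox0)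
    have wv: "\<sigma> * (crd d w - crd d v) > 0" "crd (\<not> d) w = crd (\<not> d) v" using w by (auto simp: r.adj_def eseg_def)
    define t where "t = (crd d p - crd d w) / (crd d v - crd d w)"
    have "t \<ge> 1" using wv(1) side z23(1)[of d] unfolding t_def \<sigma>_def by (auto simp: divide_simps split: if_splits)
    moreover have "p = w + t *\<^sub>R (v - w)"
    proof (rule point_eqI[of d])
      show "crd d p = crd d (w + t *\<^sub>R (v - w))" unfolding crd_affine t_def using wv(1) by auto
      show "crd (\<not> d) p = crd (\<not> d) (w + t *\<^sub>R (v - w))" unfolding crd_affine using wv(2) by (simp add: v_def)
    qed
    ultimately show ?thesis using e fr pM unfolding extended_segments_def by blast
  qed (use vS in auto)
qed

lemma skeleton_D_clamped: "k \<le> n \<Longrightarrow> skeleton (D k) = grid_skeleton Z \<union> skeleton (T k) \<union> Ext k"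
  using skeleton_D extended_sub Ext_sub by blast

text \<open>In the extension the grid of a level also has the lines of the outer mesh. No such line passes through the
interior of the original region, so the cells there are the same.\<close>

definition GE where "GE k d = G k d \<union> Z d"

text \<open>The cells of the extended grid that are cut in direction \<open>d\<close> at level \<open>k\<close>: the
subdivided cells, and those in the arms of subdivided cells at the boundary of the original region. In the
definition, an arm cell is one whose projection to the region is a side of the subdivided cell
\<open>K\<close>; a cell in the region is equal to \<open>K\<close>.\<close>

definition cuts :: "nat \<Rightarrow> bool \<Rightarrow> cell set" where
  "cuts k d = {L. gcell (GE k) L \<and> (\<exists>K\<in>A k. lo (\<not> d) L = lo (\<not> d) K \<and> hi (\<not> d) L = hi (\<not> d) K \<and>
     lo d K \<le> clampv d (lo d L) \<and> clampv d (hi d L) \<le> hi d K)}"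

lemma finGE: "finite (GE k d)" using finG m.fin by (simp add: GE_def)

lemma consecutive_GE: assumes "consecutive (G k d) a b" shows "consecutive (GE k d) a b"
proof -
  have ab: "a \<in> G k d" "b \<in> G k d" "a < b" "G k d \<inter> {a<..<b} = {}" using assms by (auto simp: consecutive_def)
  have "s \<notin> {a<..<b}" if "s \<in> Z d" for s using Z_outside(1)[OF that] G_in[OF ab(1)] G_in[OF ab(2)] by auto
  then show ?thesis using ab by (auto simp: consecutive_def GE_def)
qed

lemma A_GE: "k < n \<Longrightarrow> K \<in> A k \<Longrightarrow> gcell (GE k) K"
  using A_gcell consecutive_GE unfolding gcell_def by blast

lemma A_in: assumes "k < n" "K \<in> A k" shows "z d 2 \<le> lo d K" "hi d K \<le> z d 3" "lo d K < hi d K"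
  using A_gcell[OF assms] G_in[of "lo d K" k d] G_in[of "hi d K" k d] by (auto simp: gcell_def consecutive_def)

lemma A_cuts: assumes k: "k < n" and K: "K \<in> A k" shows "K \<in> cuts k d"
proof -
  have "clampv d (lo d K) = lo d K" "clampv d (hi d K) = hi d K" using A_in[OF k K, of d] by (auto intro!: clampv(3))
  then show ?thesis unfolding cuts_def using A_GE[OF k K] K by auto
qed

lemma z_GE: "i < 6 \<Longrightarrow> z d i \<in> GE k d" using z_Z by (simp add: GE_def)

lemma GE_gap:
  assumes "gcell (GE k) L"
  shows "hi d L \<le> z d 2 \<or> z d 2 \<le> lo d L \<and> hi d L \<le> z d 3 \<or> z d 3 \<le> lo d L"
  using gcell_gap[OF assms z_GE[of 2 d k]] gcell_gap[OF assms z_GE[of 3 d k]] gcell_less(3)[OF assms, of d] z23(1)[of d] by linarith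

lemma GE_arm:
  assumes "gcell (GE k) L" "hi d L \<le> z d 2 \<or> z d 3 \<le> lo d L"
  shows "lo d L \<in> Z d" "hi d L \<in> Z d"
proof -
  have l: "lo d L \<in> GE k d" "hi d L \<in> GE k d" "lo d L < hi d L" using assms(1) by (auto simp: gcell_def consecutive_def)
  have "s \<in> Z d" if s: "s \<in> GE k d" "s \<le> z d 2 \<or> z d 3 \<le> s" for s
  proof (cases "s \<in> Z d")
    case False
    then have "s \<in> G k d" using s by (simp add: GE_def)
    then have "s = z d 2 \<or> s = z d 3" using G_in[of s k d] s(2) by auto
    then show ?thesis using z_Z by auto
  qed
  then show "lo d L \<in> Z d" "hi d L \<in> Z d" using l assms(2) by auto
qed

lemma cuts_cases: assumes k: "k < n" and L: "L \<in> cuts k d"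
  obtains K where "K \<in> A k" "lo (\<not> d) L = lo (\<not> d) K" "hi (\<not> d) L = hi (\<not> d) K"
    "L = K \<or> hi d L \<le> z d 2 \<and> lo d K = z d 2 \<or> z d 3 \<le> lo d L \<and> hi d K = z d 3"
proof -
  obtain K where K: "K \<in> A k" "lo (\<not> d) L = lo (\<not> d) K" "hi (\<not> d) L = hi (\<not> d) K"
    "lo d K \<le> clampv d (lo d L)" "clampv d (hi d L) \<le> hi d K" and g: "gcell (GE k) L" using L by (auto simp: cuts_def)
  have "L = K \<or> hi d L \<le> z d 2 \<and> lo d K = z d 2 \<or> z d 3 \<le> lo d L \<and> hi d K = z d 3"
    using GE_gap[OF g, of d]
  proof (elim disjE)
    assume h: "hi d L \<le> z d 2"
    then have "clampv d (lo d L) = z d 2" using gcell_less(3)[OF g, of d] by (intro clampv(4)) simp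
    then show ?thesis using h K(4) A_in(1)[OF k K(1), of d] by simp
  next
    assume h: "z d 3 \<le> lo d L"
    then have "clampv d (hi d L) = z d 3" using gcell_less(3)[OF g, of d] by (intro clampv(5)) simp
    then show ?thesis using h K(5) A_in(2)[OF k K(1), of d] by simp
  next
    assume h: "z d 2 \<le> lo d L \<and> hi d L \<le> z d 3"
    then have "clampv d (lo d L) = lo d L" "clampv d (hi d L) = hi d L" using gcell_less(3)[OF g, of d] by (auto intro!: clampv(3))
    then have "lo d K \<le> md d L" "md d L \<le> hi d K" using K(4,5) gcell_less(1,2)[OF g, of d] by auto
    then have "lo d K = lo d L \<and> hi d K = hi d L"
      using gcell_unique[OF g A_GE[OF k K(1)] gcell_less(1)[OF g] gcell_less(2)[OF g]] by blast
    then show ?thesis using K(2,3) cell_eqI2[of d L K] by simp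
  qed
  then show ?thesis using that K by blast
qed

lemma arm_cuts:
  assumes k: "k < n" and K: "K \<in> A k" and g: "gcell (GE k) L" "lo (\<not> d) L = lo (\<not> d) K" "hi (\<not> d) L = hi (\<not> d) K"
  and a: "hi d L \<le> z d 2 \<and> lo d K = z d 2 \<or> z d 3 \<le> lo d L \<and> hi d K = z d 3"
  shows "L \<in> cuts k d"
proof -
  have l: "lo d L < hi d L" using gcell_less(3)[OF g(1)] .
  have K': "lo d K < hi d K" "z d 2 \<le> lo d K" "hi d K \<le> z d 3" using A_in[OF k K] by auto
  have "lo d K \<le> clampv d (lo d L) \<and> clampv d (hi d L) \<le> hi d K" using a
  proof
    assume h: "hi d L \<le> z d 2 \<and> lo d K = z d 2"
    then have "clampv d (lo d L) = z d 2" "clampv d (hi d L) = z d 2" using l by (auto intro!: clampv(4))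
    then show ?thesis using h K' by simp
  next
    assume h: "z d 3 \<le> lo d L \<and> hi d K = z d 3"
    then have "clampv d (lo d L) = z d 3" "clampv d (hi d L) = z d 3" using l by (auto intro!: clampv(5))
    then show ?thesis using h K' by simp
  qed
  then show ?thesis unfolding cuts_def using g K by blast
qed

lemma GE_region: assumes "gcell (GE k) L" "p \<in> cellset L" shows "p \<in> cellset m.gbox"
proof -
  have "z d 0 \<le> s \<and> s \<le> z d 5" if "s \<in> GE k d" for s d
    using that Z_outside(2,3)[of s d] G_in[of s k d] z23[of d] by (auto simp: GE_def)
  then have "z d 0 \<le> lo d L" "hi d L \<le> z d 5" for d using assms(1) by (auto simp: gcell_def consecutive_def)
  moreover have "lo d L \<le> crd d p \<and> crd d p \<le> hi d L" for d using assms(2) by (simp add: cellset_def)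
  ultimately show ?thesis unfolding regionM by (meson order_trans)
qed

lemma mids_cuts:
  assumes k: "k < n"
  shows "(\<Union>d. \<Union>L\<in>cuts k d. mid d L) = {p \<in> cellset m.gbox. \<exists>d. \<exists>K\<in>A k. cl d p \<in> mid d K}"
proof (intro set_eqI iffI)
  fix p assume "p \<in> (\<Union>d. \<Union>L\<in>cuts k d. mid d L)"
  then obtain d L where L: "L \<in> cuts k d" "p \<in> mid d L" by blast
  then obtain K where K: "K \<in> A k" "lo (\<not> d) L = lo (\<not> d) K" "hi (\<not> d) L = hi (\<not> d) K"
    "lo d K \<le> clampv d (lo d L)" "clampv d (hi d L) \<le> hi d K" and g: "gcell (GE k) L" by (auto simp: cuts_def)
  have "p \<in> cellset m.gbox" using GE_region[OF g] mid_cellset[OF g] L(2) by blast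
  moreover have "cl d p \<in> mid d K"
    using L(2) K clampv(6)[of "lo d L" "crd d p" d] clampv(6)[of "crd d p" "hi d L" d] by (auto simp: mid_crd md_def)
  ultimately show "p \<in> {p \<in> cellset m.gbox. \<exists>d. \<exists>K\<in>A k. cl d p \<in> mid d K}" using K(1) by blast
next
  fix p assume "p \<in> {p \<in> cellset m.gbox. \<exists>d. \<exists>K\<in>A k. cl d p \<in> mid d K}"
  then obtain d K where p: "p \<in> cellset m.gbox" and K: "K \<in> A k" "cl d p \<in> mid d K" by blast
  have c: "crd (\<not> d) p = md (\<not> d) K" "lo d K \<le> clampv d (crd d p)" "clampv d (crd d p) \<le> hi d K" using K(2) by (auto simp: mid_crd)
  have pr: "z d 0 \<le> crd d p" "crd d p \<le> z d 5" using p regionM by auto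
  have K': "lo d K < hi d K" "z d 2 \<le> lo d K" "hi d K \<le> z d 3" using A_in[OF k K(1)] by auto
  have cK: "consecutive (GE k (\<not> d)) (lo (\<not> d) K) (hi (\<not> d) K)" using A_GE[OF k K(1)] by (auto simp: gcell_def)
  have arm: "\<exists>L\<in>cuts k d. p \<in> mid d L" if ab: "consecutive (GE k d) a b" "a \<le> crd d p" "crd d p \<le> b"
    and side: "b \<le> z d 2 \<and> lo d K = z d 2 \<or> z d 3 \<le> a \<and> hi d K = z d 3" for a b
  proof -
    define L :: cell where "L = (pt d a (lo (\<not> d) K), pt d b (hi (\<not> d) K))"
    have L: "lo d L = a" "hi d L = b" "lo (\<not> d) L = lo (\<not> d) K" "hi (\<not> d) L = hi (\<not> d) K" by (simp_all add: L_def lo_def hi_def)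
    have "gcell (GE k) L" unfolding gcell_def bool_quantifiers(1)[of _ d] using L ab(1) cK by simp
    then have "L \<in> cuts k d" using arm_cuts[OF k K(1), of L d] L side by simp
    moreover have "p \<in> mid d L" using L ab c(1) by (simp add: mid_crd md_def)
    ultimately show ?thesis by blast
  qed
  consider "crd d p < z d 2" | "z d 3 < crd d p" | "z d 2 \<le> crd d p" "crd d p \<le> z d 3" by linarith
  then have "\<exists>L\<in>cuts k d. p \<in> mid d L"
  proof cases
    case 1
    obtain a b where ab: "consecutive (GE k d) a b" "a \<le> crd d p" "crd d p \<le> b"
      using gap_exists[OF finGE[of k d] z_GE[of 0] z_GE[of 5] pr] z_less[of 0 5 d] by auto
    have "z d 2 \<notin> {a<..<b}" using ab(1) z_GE[of 2 d k] by (auto simp: consecutive_def)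
    then have "b \<le> z d 2" using 1 ab(2) by auto
    moreover have "lo d K = z d 2" using c(2) clampv(4)[of "crd d p" d] 1 K' by simp
    ultimately show ?thesis using arm[OF ab] by blast
  next
    case 2
    obtain a b where ab: "consecutive (GE k d) a b" "a \<le> crd d p" "crd d p \<le> b"
      using gap_exists[OF finGE[of k d] z_GE[of 0] z_GE[of 5] pr] z_less[of 0 5 d] by auto
    have "z d 3 \<notin> {a<..<b}" using ab(1) z_GE[of 3 d k] by (auto simp: consecutive_def)
    then have "z d 3 \<le> a" using 2 ab(3) by auto
    moreover have "hi d K = z d 3" using c(3) clampv(5)[of d "crd d p"] 2 K' by simp
    ultimately show ?thesis using arm[OF ab] by blast
  next
    case 3
    then have "p \<in> mid d K" using K(2) cl_inside by simp
    then show ?thesis using A_cuts[OF k K(1)] by blast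
  qed
  then show "p \<in> (\<Union>d. \<Union>L\<in>cuts k d. mid d L)" by blast
qed

lemma skeleton_D_step:
  assumes k: "k < n"
  shows "skeleton (D (Suc k)) = skeleton (D k) \<union> (\<Union>d. \<Union>L\<in>cuts k d. mid d L)"
proof -
  interpret s: skeleton_refinement "skeleton (T k)" "skeleton (T (Suc k))" "G k" "\<lambda>d. A k" using step[OF k] .
  have E: "Ext (Suc k) = Ext k \<union> {p \<in> cellset m.gbox. \<exists>d. \<exists>K\<in>A k. cl d p \<in> mid d K}"
    unfolding Ext_def s.dir' by blast
  have M: "(\<Union>d. \<Union>K\<in>A k. mid d K) \<subseteq> (\<Union>d. \<Union>L\<in>cuts k d. mid d L)" using A_cuts[OF k] by blast
  have k1: "Suc k \<le> n" "k \<le> n" using k by auto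
  show ?thesis unfolding skeleton_D_clamped[OF k1(1)] skeleton_D_clamped[OF k1(2)] E skel_step[OF k] mids_cuts[OF k, symmetric] using M by blast
qed

lemma lines_D: assumes k: "k < n" and p: "p \<in> skeleton (D k)" shows "\<exists>d. crd d p \<in> GE k d"
proof -
  interpret s: skeleton_refinement "skeleton (T k)" "skeleton (T (Suc k))" "G k" "\<lambda>d. A k" using step[OF k] .
  have "p \<in> grid_skeleton Z \<or> p \<in> skeleton (T k) \<or> p \<in> Ext k" using p skeleton_D_clamped[of k] k by auto
  then show ?thesis
  proof (elim disjE)
    assume "p \<in> Ext k"
    then obtain d where "dir (skeleton (T k)) d (cl d p)" by (auto simp: Ext_def)
    from s.dir_level[OF this] show ?thesis by (auto simp: GE_def)
  qed (auto simp: m.in_skeleton GE_def dest!: s.lines)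
qed

lemma cuts_frontier:
  assumes k: "k < n" and L: "L \<in> cuts k d"
  shows "side d L \<subseteq> skeleton (D k)" "side (\<not> d) L \<subseteq> skeleton (D k)"
proof -
  have g: "gcell (GE k) L" using L by (simp add: cuts_def)
  interpret s: skeleton_refinement "skeleton (T k)" "skeleton (T (Suc k))" "G k" "\<lambda>d. A k" using step[OF k] .
  obtain K where K: "K \<in> A k" "lo (\<not> d) L = lo (\<not> d) K" "hi (\<not> d) L = hi (\<not> d) K"
    "L = K \<or> hi d L \<le> z d 2 \<and> lo d K = z d 2 \<or> z d 3 \<le> lo d L \<and> hi d K = z d 3" using cuts_cases[OF k L] .
  have Tk: "skeleton (T k) \<subseteq> skeleton (D k)" "grid_skeleton Z \<subseteq> skeleton (D k)" "Ext k \<subseteq> skeleton (D k)" using skeleton_D_clamped[of k] k by auto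
  have c: "side d' L \<subseteq> cellset L" for d' using gcell_less(3)[OF g] by (auto simp: side_def cellset_iff[of _ _ d'] less_imp_le)
  have "side d L \<subseteq> skeleton (D k) \<and> side (\<not> d) L \<subseteq> skeleton (D k)"
  proof (cases "L = K")
    case True
    then show ?thesis using s.sides[OF K(1)] Tk by blast
  next
    case False
    then have arm: "hi d L \<le> z d 2 \<and> lo d K = z d 2 \<or> z d 3 \<le> lo d L \<and> hi d K = z d 3" using K(4) by blast
    have "side d L \<subseteq> skeleton (D k)"
    proof
      fix p assume p: "p \<in> side d L"
      then have "crd d p \<in> Z d" using GE_arm[OF g, of d] arm by (auto simp: side_def)
      then show "p \<in> skeleton (D k)" using in_grid_skeletonM GE_region[OF g] c p Tk(2) by blast
    qed
    moreover have "side (\<not> d) L \<subseteq> skeleton (D k)"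
    proof
      fix p assume p: "p \<in> side (\<not> d) L"
      then have pc: "crd (\<not> d) p \<in> {lo (\<not> d) K, hi (\<not> d) K}" "lo d L \<le> crd d p" "crd d p \<le> hi d L"
        using K(2,3) by (auto simp: side_def)
      have Kl: "lo d K < hi d K" "lo (\<not> d) K < hi (\<not> d) K" using A_in(3)[OF k K(1)] by auto
      have cp: "clampv d (crd d p) \<in> {lo d K, hi d K}"
        using arm pc clampv(4)[of "crd d p" d] clampv(5)[of d "crd d p"] by auto
      define w where "w = pt d (if clampv d (crd d p) = lo d K then hi d K else lo d K) (crd (\<not> d) p)"
      have al: "crd (\<not> d) (cl d p) = crd (\<not> d) w" by (simp add: w_def)
      have "closed_segment (cl d p) w \<subseteq> side (\<not> d) K"
        unfolding aligned_segment[OF al] using pc(1) cp Kl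
        by (auto simp: side_def w_def closed_segment_eq_real_ivl split: if_splits)
      then have "w \<in> eseg (skeleton (T k)) d (cl d p)" using s.sides[OF K(1), of "\<not> d"] al by (auto simp: eseg_def)
      moreover have "crd d w \<noteq> crd d (cl d p)" using cp Kl by (auto simp: w_def)
      ultimately have "dir (skeleton (T k)) d (cl d p)" unfolding dir_def by metis
      moreover have "p \<in> cellset m.gbox" using GE_region[OF g] c p by blast
      ultimately have "p \<in> Ext k" by (auto simp: Ext_def)
      then show "p \<in> skeleton (D k)" using Tk by blast
    qed
    ultimately show ?thesis by blast
  qed
  then show "side d L \<subseteq> skeleton (D k)" "side (\<not> d) L \<subseteq> skeleton (D k)" by auto
qed

text \<open>An arm consists of consecutive cells from the subdivided cell to the outer boundary: towards the region, each
arm cell is followed by another cell of the arm or by the subdivided cell. Only subdivided cells can be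
without neighbour.\<close>

lemma cuts_lonely:
  assumes k: "k < n" and L: "L \<in> cuts k d" and n: "\<And>L'. L' \<in> cuts k d \<Longrightarrow> \<not> nbr d L L'"
  shows "L \<in> cuts k (\<not> d)"
proof -
  have g: "gcell (GE k) L" using L by (simp add: cuts_def)
  obtain K where K: "K \<in> A k" "lo (\<not> d) L = lo (\<not> d) K" "hi (\<not> d) L = hi (\<not> d) K"
    "L = K \<or> hi d L \<le> z d 2 \<and> lo d K = z d 2 \<or> z d 3 \<le> lo d L \<and> hi d K = z d 3" using cuts_cases[OF k L] .
  have cL: "consecutive (GE k d) (lo d L) (hi d L)" "consecutive (GE k (\<not> d)) (lo (\<not> d) L) (hi (\<not> d) L)" using g by (auto simp: gcell_def)
  have new: False if ab: "consecutive (GE k d) a b" and s: "b \<le> z d 2 \<and> lo d K = z d 2 \<or> z d 3 \<le> a \<and> hi d K = z d 3"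
    and adj: "hi d L = a \<or> b = lo d L" for a b
  proof -
    define L' :: cell where "L' = (pt d a (lo (\<not> d) K), pt d b (hi (\<not> d) K))"
    have L': "lo d L' = a" "hi d L' = b" "lo (\<not> d) L' = lo (\<not> d) K" "hi (\<not> d) L' = hi (\<not> d) K" by (simp_all add: L'_def lo_def hi_def)
    have "gcell (GE k) L'" unfolding gcell_def bool_quantifiers(1)[of _ d] using L' ab cL K(2,3) by simp
    then have "L' \<in> cuts k d" using arm_cuts[OF k K(1), of L' d] L' s by simp
    moreover have "nbr d L L'" using L' K(2,3) adj by (auto simp: nbr_def)
    ultimately show False using n by blast
  qed
  have "L = K"
  proof (rule ccontr)
    assume "L \<noteq> K"
    then have arm: "hi d L \<le> z d 2 \<and> lo d K = z d 2 \<or> z d 3 \<le> lo d L \<and> hi d K = z d 3" using K(4) by blast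
    have notK: "\<not> nbr d L K" using n A_cuts[OF k K(1)] by blast
    show False using arm
    proof
      assume h: "hi d L \<le> z d 2 \<and> lo d K = z d 2"
      then have "hi d L < z d 2" using notK K(2,3) by (auto simp: nbr_def less_le)
      moreover have "hi d L \<in> GE k d" using cL by (auto simp: consecutive_def)
      ultimately obtain c where "consecutive (GE k d) (hi d L) c" "c \<le> z d 2" using next_gap[OF finGE _ z_GE[of 2 d k], of "hi d L"] by auto
      then show False using new[of "hi d L" c] h by blast
    next
      assume h: "z d 3 \<le> lo d L \<and> hi d K = z d 3"
      then have "z d 3 < lo d L" using notK K(2,3) by (auto simp: nbr_def less_le)
      moreover have "lo d L \<in> GE k d" using cL by (auto simp: consecutive_def)
      ultimately obtain c where "consecutive (GE k d) c (lo d L)" "z d 3 \<le> c" using previous_gap[OF finGE _ z_GE[of 3 d k], of "lo d L"] by auto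
      then show False using new[of c "lo d L"] h by blast
    qed
  qed
  then show ?thesis using A_cuts[OF k K(1)] by simp
qed

lemma step_extended:
  assumes k: "k < n"
  shows "skeleton_refinement (skeleton (D k)) (skeleton (D (Suc k))) (GE k) (cuts k)"
proof
  interpret r: regular_mesh "D k" m.gbox by (rule regular_D) (use k in simp)
  show "finite (GE k d)" for d by (rule finGE)
  show "closed (skeleton (D k))" using r.compact_Sk compact_imp_closed by blast
  show "\<exists>d. crd d p \<in> GE k d" if "p \<in> skeleton (D k)" for p using lines_D[OF k that] .
  show "\<exists>w\<in>eseg (skeleton (D k)) d v. w \<in> verts (skeleton (D k))" if "dir (skeleton (D k)) d v" for d v using r.has_vertex[OF that] .
  show "gcell (GE k) K" if "K \<in> cuts k d" for K d using that by (simp add: cuts_def)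
  show "side d K \<subseteq> skeleton (D k)" if K: "K \<in> cuts k d" for d K using cuts_frontier(1)[OF k K] .
  show "K \<in> cuts k (\<not> d)" if "K \<in> cuts k d" "\<And>L. L \<in> cuts k d \<Longrightarrow> \<not> nbr d K L" for K d using cuts_lonely[OF k that] .
  show "skeleton (D (Suc k)) = skeleton (D k) \<union> (\<Union>d. \<Union> (mid d ` cuts k d))" using skeleton_D_step[OF k] .
qed

lemma nested_extended:
  assumes k: "Suc k < n" and L: "L \<in> cuts (Suc k) d"
  shows "\<exists>N\<in>cuts k d. cellset L \<subseteq> cellset N"
proof -
  have k': "k < n" using k by simp
  have g: "gcell (GE (Suc k)) L" using L by (simp add: cuts_def)
  obtain K where K: "K \<in> A (Suc k)" "lo (\<not> d) L = lo (\<not> d) K" "hi (\<not> d) L = hi (\<not> d) K"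
    "L = K \<or> hi d L \<le> z d 2 \<and> lo d K = z d 2 \<or> z d 3 \<le> lo d L \<and> hi d K = z d 3" using cuts_cases[OF k L] .
  obtain N0 where N0: "N0 \<in> A k" "cellset K \<subseteq> cellset N0" using nested_A[OF k K(1)] by blast
  have Kl: "lo d' K < hi d' K" for d' using A_in(3)[OF k K(1)] .
  have N0l: "z d' 2 \<le> lo d' N0" "hi d' N0 \<le> z d' 3" for d' using A_in[OF k' N0(1)] by auto
  have "fst K \<in> cellset K" "snd K \<in> cellset K" using Kl by (auto simp: cellset_def lo_def hi_def less_imp_le)
  then have "fst K \<in> cellset N0" "snd K \<in> cellset N0" using N0(2) by auto
  then have KN: "lo d' N0 \<le> lo d' K" "hi d' K \<le> hi d' N0" for d' by (auto simp: cellset_def lo_def hi_def)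
  show ?thesis
  proof (cases "L = K")
    case True
    then show ?thesis using N0 A_cuts[OF k' N0(1)] by blast
  next
    case False
    then have arm: "hi d L \<le> z d 2 \<and> lo d K = z d 2 \<or> z d 3 \<le> lo d L \<and> hi d K = z d 3" using K(4) by blast
    have LZ: "lo d L \<in> Z d" "hi d L \<in> Z d" using GE_arm[OF g, of d] arm by auto
    have "GE k d \<subseteq> GE (Suc k) d" using G_mono by (auto simp: GE_def)
    then have cL: "consecutive (GE k d) (lo d L) (hi d L)" using g LZ by (auto simp: gcell_def consecutive_def GE_def)
    define N :: cell where "N = (pt d (lo d L) (lo (\<not> d) N0), pt d (hi d L) (hi (\<not> d) N0))"
    have N: "lo d N = lo d L" "hi d N = hi d L" "lo (\<not> d) N = lo (\<not> d) N0" "hi (\<not> d) N = hi (\<not> d) N0" by (simp_all add: N_def lo_def hi_def)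
    have "gcell (GE k) N0" using A_GE[OF k' N0(1)] .
    then have gN: "gcell (GE k) N" unfolding gcell_def bool_quantifiers(1)[of _ d] using N cL by simp
    have "hi d N \<le> z d 2 \<and> lo d N0 = z d 2 \<or> z d 3 \<le> lo d N \<and> hi d N0 = z d 3"
      using arm N KN[of d] N0l[of d] by auto
    then have "N \<in> cuts k d" using arm_cuts[OF k' N0(1) gN N(3,4)] by blast
    moreover have "cellset L \<subseteq> cellset N"
      using N K(2,3) KN[of "\<not> d"] by (auto simp: cellset_iff[of _ _ d])
    ultimately show ?thesis by blast
  qed
qed

text \<open>The extension of a grid is the grid with the outer lines added, since all its lines are prolonged. It has at
least six lines in each direction.\<close>

lemma base_extended: "grid (GE 0)" "skeleton (D 0) = grid_skeleton (GE 0)" "card (GE 0 d) \<ge> 3"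
proof -
  have c: "card (GE 0 d) \<ge> 6" for d
    using card_mono[OF finGE, of "Z d" 0 d] card_Z[of d] by (simp add: GE_def)
  show "card (GE 0 d) \<ge> 3" using c[of d] by simp
  show gr: "grid (GE 0)" using c finGE by unfold_locales (auto intro: order_trans[of 2 6])
  have mm: "Min (GE 0 d) = z d 0" "Max (GE 0 d) = z d 5" for d
  proof -
    have "z d 0 \<le> s \<and> s \<le> z d 5" if "s \<in> GE 0 d" for s
      using that Z_outside(2,3)[of s d] G_in[of s 0 d] z23[of d] by (auto simp: GE_def)
    then show "Min (GE 0 d) = z d 0" "Max (GE 0 d) = z d 5" using finGE z_GE by (auto intro!: Min_eqI Max_eqI)
  qed
  have in0: "p \<in> grid_skeleton (GE 0) \<longleftrightarrow> p \<in> cellset m.gbox \<and> (\<exists>d. crd d p \<in> GE 0 d)" for p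
    by (simp add: grid_skeleton_def mm regionM)
  show "skeleton (D 0) = grid_skeleton (GE 0)"
  proof (intro set_eqI iffI)
    fix p assume "p \<in> skeleton (D 0)"
    then have "p \<in> grid_skeleton Z \<or> p \<in> grid_skeleton G0 \<or> p \<in> Ext 0" using skeleton_D_clamped[of 0] skel0 by auto
    then show "p \<in> grid_skeleton (GE 0)"
    proof (elim disjE)
      assume p: "p \<in> grid_skeleton Z"
      then show ?thesis unfolding in0 by (auto simp: m.in_skeleton cellset_def m.gbox GE_def)
    next
      assume p: "p \<in> grid_skeleton G0"
      then have "p \<in> cellset g.gbox" by (auto simp: g.in_skeleton cellset_def g.gbox)
      then show ?thesis using p region_sub unfolding in0 by (auto simp: g.in_skeleton GE_def)
    next
      assume "p \<in> Ext 0"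
      then obtain d where "p \<in> cellset m.gbox" "dir (grid_skeleton G0) d (cl d p)" using skel0 by (auto simp: Ext_def)
      then show ?thesis unfolding in0 by (auto simp: g.dir_grid GE_def)
    qed
  next
    fix p assume "p \<in> grid_skeleton (GE 0)"
    then obtain d where p: "p \<in> cellset m.gbox" "crd d p \<in> GE 0 d" unfolding in0 by blast
    have sk: "skeleton (D 0) = grid_skeleton Z \<union> grid_skeleton G0 \<union> Ext 0" using skeleton_D_clamped[of 0] skel0 by simp
    show "p \<in> skeleton (D 0)"
    proof (cases "crd d p \<in> Z d")
      case True
      then show ?thesis using in_grid_skeletonM p(1) sk by blast
    next
      case False
      then have c: "crd d p \<in> G0 d" using p(2) by (simp add: GE_def)
      have "z d 2 \<le> crd d p \<and> crd d p \<le> z d 3" using G_in[of "crd d p" 0 d] c by simp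
      then have "cl (\<not> d) p \<in> cellset g.gbox" using clampv(1,2)[of "\<not> d"] crd_cl[of "\<not> d" p] gbox0 by (simp add: cellset_iff[of _ _ d])
      moreover have "crd d (cl (\<not> d) p) \<in> G0 d" using c crd_cl(2)[of "\<not> d" p] by simp
      ultimately have "cl (\<not> d) p \<in> grid_skeleton G0" unfolding g.in_skeleton cellset_def g.gbox by blast
      then have "dir (grid_skeleton G0) (\<not> d) (cl (\<not> d) p)" using c crd_cl(2)[of "\<not> d" p] unfolding g.dir_grid by simp
      then have "dir (skeleton (T 0)) (\<not> d) (cl (\<not> d) p)" using skel0 by metis
      then have "p \<in> Ext 0" using p(1) unfolding Ext_def by blast
      then show ?thesis using sk by blast
    qed
  qed
qed

lemma sequence_extended: "skeleton_sequence n (\<lambda>k. skeleton (D k)) GE cuts (GE 0) True"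
  by (rule skeleton_sequence.intro[OF step_extended nested_extended base_extended(1,2)]) (use base_extended(3) in auto)

text \<open>The neighbours outside the original region of a subdivided cell are crossed by its arms. So an isolated cell
does not touch the boundary of the original region, and its neighbours are cells of the original level.\<close>

lemma isolated_count_extended: assumes k: "k < n"
  shows "card (isolated_cells (S k) (Lv k \<union> (D k - T k)) (D (Suc k))) = card (skeleton_refinement.isolated (cuts k))"
proof -
  interpret s: skeleton_refinement "skeleton (D k)" "skeleton (D (Suc k))" "GE k" "cuts k" using step_extended[OF k] .
  interpret c: skeleton_refinement "skeleton (T k)" "skeleton (T (Suc k))" "G k" "\<lambda>d. A k" using step[OF k] .
  interpret r: regular_mesh "D k" m.gbox by (rule regular_D) (use k in simp)
  interpret r': regular_mesh "D (Suc k)" m.gbox by (rule regular_D) (use k in simp)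
  interpret t: regular_mesh "T k" g.gbox by (rule regular) (use k in simp)
  interpret t': regular_mesh "T (Suc k)" g.gbox by (rule regular) (use k in simp)
  have sk: "skeleton (D k) = grid_skeleton Z \<union> skeleton (T k) \<union> Ext k"
    "skeleton (D (Suc k)) = grid_skeleton Z \<union> skeleton (T (Suc k)) \<union> Ext (Suc k)" using skeleton_D_clamped k by auto
  have not_next: "cellset C \<notin> D (Suc k)" if C: "C \<in> cuts k d" for C d
  proof
    assume "cellset C \<in> D (Suc k)"
    from r'.opencell_Sk[OF this] have "opencell C \<inter> mid d C = {}" using s.mid_sub[OF C] by blast
    moreover have "pt d (md d C) (md (\<not> d) C) \<in> opencell C \<inter> mid d C"
      using gcell_less[OF s.cells[OF C]] by (simp add: opencell_iff[of _ _ d] mid_crd less_imp_le)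
    ultimately show False by blast
  qed
  have open_GE: "opencell C \<inter> skeleton (D k) = {}" if C: "gcell (GE k) C" for C
  proof (rule ccontr)
    assume "\<not> ?thesis"
    then obtain p where p: "p \<in> opencell C" "p \<in> skeleton (D k)" by blast
    obtain d where "crd d p \<in> GE k d" using lines_D[OF k p(2)] by blast
    then show False using gcell_gap[OF C, of "crd d p" d] p(1) by (auto simp: opencell_def less_imp_le) (metis less_irrefl)+
  qed
  have cell_D: "cellset C \<in> D k" if C: "C \<in> cuts k d" for C d
  proof (rule r.cell_determined)
    have g: "gcell (GE k) C" using s.cells[OF C] .
    show "opencell C \<noteq> {}" using gcell_nonempty[OF g] .
    show "cellset C \<subseteq> cellset m.gbox" using GE_region[OF g] by blast
    show "opencell C \<inter> skeleton (D k) = {}" using open_GE[OF g] .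
    show "frontier (cellset C) \<subseteq> skeleton (D k)"
    proof
      fix p assume "p \<in> frontier (cellset C)"
      then have "p \<in> side d C \<union> side (\<not> d) C" unfolding frontier_cellset
        by (auto simp: side_def cellset_iff[of _ _ d] opencell_iff[of _ _ d])
      then show "p \<in> skeleton (D k)" using cuts_frontier[OF k C] by blast
    qed
  qed
  have frontier0: "frontier (cellset g.gbox) \<subseteq> skeleton (T k)" using t.frontier_Sk .
  have inner: "p \<in> skeleton (T j)" if "p \<in> cellset g.gbox" "p \<in> grid_skeleton Z \<union> skeleton (T j) \<union> Ext j" "j = k \<or> j = Suc k" for p j
    using that(2)
  proof (elim UnE)
    assume "p \<in> grid_skeleton Z"
    then obtain d where "crd d p \<in> Z d" by (auto simp: m.in_skeleton)
    then have "p \<notin> opencell g.gbox" using Z_outside(1)[of "crd d p" d] gbox0 by (auto simp: opencell_iff[of _ _ d])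
    then show ?thesis using that(1,3) t.frontier_Sk t'.frontier_Sk frontier_cellset[of g.gbox] by auto
  next
    assume "p \<in> Ext j"
    then obtain d where "dir (skeleton (T j)) d (cl d p)" by (auto simp: Ext_def)
    then show ?thesis using dir_self(1) cl_inside[of d p] that(1) by (auto simp: region0)
  qed
  have cuts_both: "C \<in> A k" if C: "C \<in> cuts k True" "C \<in> cuts k False" for C
  proof -
    obtain K where K: "K \<in> A k" "lo (\<not> True) C = lo (\<not> True) K" "hi (\<not> True) C = hi (\<not> True) K"
      "C = K \<or> hi True C \<le> z True 2 \<and> lo True K = z True 2 \<or> z True 3 \<le> lo True C \<and> hi True K = z True 3" using cuts_cases[OF k C(1)] .
    obtain K' where K': "K' \<in> A k" "lo (\<not> False) C = lo (\<not> False) K'" "hi (\<not> False) C = hi (\<not> False) K'" using cuts_cases[OF k C(2)] by metis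
    have "z True 2 \<le> lo True C" "hi True C \<le> z True 3" "lo True C < hi True C" using A_in[OF k K'(1), of True] K'(2,3) by auto
    then have "C = K" using K(4) by auto
    then show ?thesis using K(1) by simp
  qed
  have "isolated_cells (S k) (Lv k \<union> (D k - T k)) (D (Suc k)) = cellset ` s.isolated"
  proof (intro set_eqI iffI)
    fix K assume K: "K \<in> isolated_cells (S k) (Lv k \<union> (D k - T k)) (D (Suc k))"
    then have "K \<in> S k" by (simp add: isolated_cells_def)
    then obtain C where C: "K = cellset C" "C \<in> A k" using A_image[OF k] by blast
    have "\<not> nbr d C C'" if C': "C' \<in> cuts k d" for d C'
    proof
      assume nb: "nbr d C C'"
      then have ne: "neighbouring K (cellset C')" using nbr_neighbouring[OF A_GE[OF k C(2)] s.cells[OF C']] C(1) by blast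
      have "cellset C' \<in> Lv k \<union> (D k - T k)"
      proof (cases "C' \<in> A k")
        case True
        then show ?thesis using SL[OF k] by (auto simp: A_def)
      next
        case False
        obtain K1 where K1: "K1 \<in> A k"
          "C' = K1 \<or> hi d C' \<le> z d 2 \<and> lo d K1 = z d 2 \<or> z d 3 \<le> lo d C' \<and> hi d K1 = z d 3" using cuts_cases[OF k C'] by metis
        then have arm: "hi d C' \<le> z d 2 \<or> z d 3 \<le> lo d C'" using False by blast
        have "cellset C' \<notin> T k"
        proof
          assume "cellset C' \<in> T k"
          then have "cellset C' \<subseteq> cellset g.gbox" using t.region by blast
          moreover have "pt d (md d C') (md (\<not> d) C') \<in> cellset C'"
            using gcell_less[OF s.cells[OF C']] by (simp add: cellset_iff[of _ _ d] less_imp_le)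
          ultimately have "pt d (md d C') (md (\<not> d) C') \<in> cellset g.gbox" by blast
          then show False using arm gcell_less[OF s.cells[OF C'], of d] gbox0 by (simp add: cellset_iff[of _ _ d])
        qed
        then show ?thesis using cell_D[OF C'] by blast
      qed
      then show False using K ne not_next[OF C'] by (auto simp: isolated_cells_def)
    qed
    then show "K \<in> cellset ` s.isolated" using C A_cuts[OF k C(2)] by (auto simp: s.isolated_def)
  next
    fix K assume "K \<in> cellset ` s.isolated"
    then obtain C where C: "K = cellset C" "C \<in> cuts k True" "C \<in> cuts k False" "\<And>d C'. C' \<in> cuts k d \<Longrightarrow> \<not> nbr d C C'" by (auto simp: s.isolated_def)
    have CA: "C \<in> A k" using cuts_both C by blast
    have "N \<in> D (Suc k)" if N: "N \<in> Lv k \<union> (D k - T k)" "neighbouring K N" for N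
      using N(1)
    proof
      assume NL: "N \<in> Lv k"
      obtain C' where C': "N = cellset C'" "gcell (G k) C'" using level_gcell[OF less_imp_le[OF k] NL] by blast
      obtain d where "nbr d C C'" using neighbouring_nbr[OF A_gcell[OF k CA] C'(2)] N(2) C(1) C'(1) by blast
      then have "C' \<notin> A k" using C(4) A_cuts[OF k] by blast
      then have "N \<notin> S k" using C' gcell_nonempty by (auto simp: A_def)
      then have NT: "cellset C' \<in> T (Suc k)" using NL LT[of k] C'(1) by auto
      have sub: "cellset C' \<subseteq> cellset g.gbox" using t'.region NT by blast
      have "cellset C' \<in> D (Suc k)"
      proof (rule r'.cell_determined)
        show "opencell C' \<noteq> {}" using gcell_nonempty[OF C'(2)] .
        show "cellset C' \<subseteq> cellset m.gbox" using sub region_sub by blast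
        show "frontier (cellset C') \<subseteq> skeleton (D (Suc k))" using NT sk(2) unfolding skeleton_def[of "T (Suc k)"] by blast
        show "opencell C' \<inter> skeleton (D (Suc k)) = {}"
          using inner[of _ "Suc k"] t'.opencell_Sk[OF NT] sub opencell_cellset[of C'] sk(2) by blast
      qed
      then show ?thesis using C' by simp
    next
      assume ND: "N \<in> D k - T k"
      obtain C' where C': "N = cellset C'" "opencell C' \<noteq> {}" "cellset C' \<subseteq> cellset m.gbox" using r.cellE[of N] ND by blast
      have NDk: "cellset C' \<in> D k" using ND C'(1) by simp
      have l: "lo d C' < hi d C'" for d using opencell_nonempty[OF C'(2)] .
      have gap: "hi d C' \<le> z d 2 \<or> z d 2 \<le> lo d C' \<and> hi d C' \<le> z d 3 \<or> z d 3 \<le> lo d C'" for d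
      proof -
        have "\<not> (lo d C' < s \<and> s < hi d C')" if s: "s \<in> Z d" for s
        proof
          assume a: "lo d C' < s \<and> s < hi d C'"
          have p: "pt d s (md (\<not> d) C') \<in> opencell C'" using a l[of "\<not> d"] by (simp add: opencell_iff[of _ _ d] md_def field_simps)
          then have "pt d s (md (\<not> d) C') \<in> cellset m.gbox" using C'(3) opencell_cellset by blast
          then have "pt d s (md (\<not> d) C') \<in> grid_skeleton Z" using in_grid_skeletonM[of _ d] s by simp
          then show False using p r.opencell_Sk[OF NDk] sk(1) by blast
        qed
        from this[OF z_Z[of 2 d]] this[OF z_Z[of 3 d]] show ?thesis using l[of d] z23(1)[of d] by linarith
      qed
      have "\<not> cellset C' \<subseteq> cellset g.gbox"
      proof
        assume sub: "cellset C' \<subseteq> cellset g.gbox"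
        have "cellset C' \<in> T k"
        proof (rule t.cell_determined[OF C'(2) sub])
          have "frontier (cellset C') \<subseteq> skeleton (D k)" using NDk by (auto simp: skeleton_def)
          moreover have "frontier (cellset C') \<subseteq> cellset C'" unfolding frontier_cellset by blast
          ultimately show "frontier (cellset C') \<subseteq> skeleton (T k)" using inner[of _ k] sub sk(1) by blast
          show "opencell C' \<inter> skeleton (T k) = {}" using r.opencell_Sk[OF NDk] sk(1) by blast
        qed
        then show False using ND C'(1) by simp
      qed
      then obtain d where d: "hi d C' \<le> z d 2 \<or> z d 3 \<le> lo d C'"
      proof (rule contrapos_np)
        assume "\<not> thesis"
        then have "\<not> (hi d C' \<le> z d 2 \<or> z d 3 \<le> lo d C')" for d using that by blast
        then have "z d 2 \<le> lo d C'" "hi d C' \<le> z d 3" for d using gap[of d] by auto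
        moreover have "lo d C' \<le> crd d p \<and> crd d p \<le> hi d C'" if "p \<in> cellset C'" for p d
          using that by (simp add: cellset_def)
        ultimately have "p \<in> cellset g.gbox" if "p \<in> cellset C'" for p
          unfolding region0 using that by (meson order_trans)
        then show "cellset C' \<subseteq> cellset g.gbox" by blast
      qed
      obtain u where "u \<in> K \<inter> N" using N(2) unfolding neighbouring_def by (metis ends_in_segment(1))
      then have u: "lo d C \<le> crd d u" "crd d u \<le> hi d C" "lo d C' \<le> crd d u" "crd d u \<le> hi d C'"
        using C(1) C'(1) by (auto simp: cellset_iff[of _ _ d])
      have Cz: "z d 2 \<le> lo d C" "hi d C \<le> z d 3" using A_in[OF k CA] by auto
      have cC: "consecutive (GE k (\<not> d)) (lo (\<not> d) C) (hi (\<not> d) C)" using A_GE[OF k CA] by (auto simp: gcell_def)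
      have new: False if ab: "consecutive (GE k d) a b" and s: "b = z d 2 \<and> lo d C = z d 2 \<or> a = z d 3 \<and> hi d C = z d 3" for a b
      proof -
        define M :: cell where "M = (pt d a (lo (\<not> d) C), pt d b (hi (\<not> d) C))"
        have M: "lo d M = a" "hi d M = b" "lo (\<not> d) M = lo (\<not> d) C" "hi (\<not> d) M = hi (\<not> d) C" by (simp_all add: M_def lo_def hi_def)
        have "gcell (GE k) M" unfolding gcell_def bool_quantifiers(1)[of _ d] using M ab cC by simp
        then have "M \<in> cuts k d" using arm_cuts[OF k CA, of M d] M s by auto
        moreover have "nbr d C M" using M s by (auto simp: nbr_def)
        ultimately show False using C(4) by blast
      qed
      have False using d
      proof
        assume "hi d C' \<le> z d 2"
        then have e: "lo d C = z d 2" using u Cz by linarith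
        obtain c where "consecutive (GE k d) c (z d 2)" using previous_gap[OF finGE z_GE[of 2] z_GE[of 0] z23(2)] by auto
        then show False using new e by blast
      next
        assume "z d 3 \<le> lo d C'"
        then have e: "hi d C = z d 3" using u Cz by linarith
        obtain c where "consecutive (GE k d) (z d 3) c" using next_gap[OF finGE z_GE[of 3] z_GE[of 5] z23(3)] by auto
        then show False using new e by blast
      qed
      then show ?thesis ..
    qed
    then show "K \<in> isolated_cells (S k) (Lv k \<union> (D k - T k)) (D (Suc k))" using C CA by (auto simp: isolated_cells_def A_def)
  qed
  moreover have "opencell C \<noteq> {}" if "C \<in> s.isolated" for C
  proof -
    have "C \<in> cuts k True" using that by (simp add: s.isolated_def)
    then show ?thesis using gcell_nonempty s.cells by blast
  qed
  then have "inj_on cellset s.isolated" using cellset_injective inj_onI[of s.isolated cellset] by metis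
  ultimately show ?thesis by (simp add: card_image)
qed

end

section \<open>The dimension formula\<close>

text \<open>With \<open>L = E + 4\<close> l-edges, the dimension is \<open>|V| - 3 L + 9 + s\<close> and \<open>|V| =
|V\<^sup>+| + 2 L - 4\<close>.\<close>

lemma dimension_formula:
  assumes seq: "skeleton_sequence n Sk G A G0 d0" and reg: "regular_mesh T B" and Sk: "Sk n = skeleton T"
    and s: "s = (\<Sum>k<n. card (skeleton_refinement.isolated (A k)))"
  shows "(\<exists>B. finite B \<and> B \<subseteq> Sbar T \<and> Sbar T \<subseteq> fun_space.span B) \<and>
         int (fun_space.dim (Sbar T)) = int (card (crossing_vertices T)) - int (card (interior_l_edges T)) + int (s + 1)"
proof -
  interpret q: skeleton_sequence n Sk G A G0 d0 by (rule seq)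
  interpret r: regular_mesh T B by (rule reg)
  obtain B' where B': "finite B'" "\<not> fun_space.dependent B'" "fun_space.span B' = r.Z"
    "int (card B') = int (card r.P) - 3 * (int (card (ledges r.Sk True)) + card (ledges r.Sk False)) + 9 + s"
    using q.moment_free_dim unfolding Sk s by auto
  show ?thesis using r.Sbar_dim[OF B'(1-3)] B'(4) r.vertex_count r.l_edge_count by auto
qed

theorem theorem5p12:
  fixes X Y :: "real set" and T :: mesh and s \<delta> :: nat
  assumes "(classical_hierarchical_Tmesh X Y T s \<and>
              (card X = 2 \<longrightarrow> card Y = 3) \<and> (card Y = 2 \<longrightarrow> card X = 3)) \<or>
           extended_hierarchical_Tmesh X Y T s"
    and "\<delta> = s + 1"
  shows "(\<exists>B. finite B \<and> B \<subseteq> Sbar T \<and> Sbar T \<subseteq> fun_space.span B) \<and>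
         int (fun_space.dim (Sbar T)) =
           int (card (crossing_vertices T)) - int (card (interior_l_edges T)) + int \<delta>"
  using assms(1)
proof
  assume a: "classical_hierarchical_Tmesh X Y T s \<and>
              (card X = 2 \<longrightarrow> card Y = 3) \<and> (card Y = 2 \<longrightarrow> card X = 3)"
  then obtain n S where S: "refinement X Y n S" "T = level_mesh (tensor_mesh X Y) S n"
    "s = (\<Sum>k<n. card (isolated_cells (S k) (level_cells (tensor_mesh X Y) S k) (level_mesh (tensor_mesh X Y) S (Suc k))))"
    by (auto simp: classical_hierarchical_Tmesh_def Let_def)
  interpret c: classical X Y n S by unfold_locales (rule S(1))
  obtain d0 where d0: "skeleton_sequence n (\<lambda>k. skeleton (c.T k)) c.G (\<lambda>k d. c.A k) c.G0 d0" using c.sequence a by blast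
  have "s = (\<Sum>k<n. card (skeleton_refinement.isolated (\<lambda>d. c.A k)))"
    unfolding S(3) using c.isolated_count unfolding c.T0_def by (intro sum.cong) auto
  from dimension_formula[OF d0 c.regular[OF order_refl] refl this]
  show ?thesis using assms(2) S(2) unfolding c.T0_def by simp
next
  assume "extended_hierarchical_Tmesh X Y T s"
  then obtain n S xs ys D where S: "refinement X Y n S" "\<forall>k\<le>n. extension_of xs ys (level_mesh (tensor_mesh X Y) S k) (D k)" "T = D n"
    "s = (\<Sum>k<n. card (isolated_cells (S k)
               (level_cells (tensor_mesh X Y) S k \<union> (D k - level_mesh (tensor_mesh X Y) S k)) (D (Suc k))))"
    unfolding extended_hierarchical_Tmesh_def Let_def by blast
  interpret e: extended X Y n S xs ys D by unfold_locales (use S(1,2) in auto)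
  have "s = (\<Sum>k<n. card (skeleton_refinement.isolated (e.cuts k)))"
    unfolding S(4) using e.isolated_count_extended unfolding e.T0_def by (intro sum.cong) auto
  from dimension_formula[OF e.sequence_extended e.regular_D[OF order_refl] refl this]
  show ?thesis using assms(2) S(3) by simp
qed

end
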